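(* Assume the following hypothesis (GRHR): every non-trivial zero $\rho$ (i.e. $0<\Re\rho<1$) of every Dirichlet $L$-function with $\Im\rho\ne0$ satisfies $\Re\rho=1/2$. Let $N\ge 2$, $0<\xi\le 1/2$, and let $\chi$ be a Dirichlet character modulo a positive integer $q$. For real $\alpha$ put $z=1/N-2\pi i\alpha$ and \[\widetilde{S}(\alpha,\chi)=\sum_{n=1}^\infty\chi(n)\Lambda(n)e^{-n/N}e(n\alpha).\] Then \[\int_{-\xi}^{\xi}\left|\widetilde{S}(\alpha,\chi)-\frac{E(\chi)}{z}+\sum_\beta\frac{\Gamma(\beta)}{z^\beta}\right|^2d\alpha\ll N\xi(\log qN)^2,\] where $\beta$ runs over all real non-trivial zeros of $L(s,\chi)$ with $\beta\ge 1/2$.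
   Context: $\Lambda$ is the von Mangoldt function, $e(x)=\exp(2\pi i x)$. $E(\chi)=1$ if $\chi$ is principal and $E(\chi)=0$ otherwise. A zero is non-trivial if its real part lies in $(0,1)$. Powers $z^{w}$ are taken with the principal branch (note $\Re z>0$). *)

theory Defs
  imports "HOL-Complex_Analysis.Complex_Analysis" "HOL-Number_Theory.Number_Theory"
begin

definition dirichlet_character :: "nat \<Rightarrow> (nat \<Rightarrow> complex) \<Rightarrow> bool" where
  "dirichlet_character q chi \<longleftrightarrow>
     q > 0 \<and> chi 1 = 1 \<and>
     (\<forall>m n. chi (m * n) = chi m * chi n) \<and>
     (\<forall>n. chi (n + q) = chi n) \<and>
     (\<forall>n. chi n = 0 \<longleftrightarrow> \<not> coprime n q)"

definition principal_character :: "nat \<Rightarrow> (nat \<Rightarrow> complex) \<Rightarrow> bool" where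
  "principal_character q chi \<longleftrightarrow> (\<forall>n. chi n = (if coprime n q then 1 else 0))"

definition E_char :: "nat \<Rightarrow> (nat \<Rightarrow> complex) \<Rightarrow> complex" where
  "E_char q chi = (if principal_character q chi then 1 else 0)"

text \<open>
  The analytic continuation of the Dirichlet series. For principal \<open>chi\<close> there is a simple
  pole at 1, where the (irrelevant) value is fixed to be 0, so that the continuation is unique
  as a total function.
\<close>

definition is_dirichlet_L :: "nat \<Rightarrow> (nat \<Rightarrow> complex) \<Rightarrow> (complex \<Rightarrow> complex) \<Rightarrow> bool" where
  "is_dirichlet_L q chi f \<longleftrightarrow>
     f holomorphic_on (if principal_character q chi then - {1} else UNIV) \<and>
     (principal_character q chi \<longrightarrow> f 1 = 0) \<and>
     (\<forall>s. Re s > 1 \<longrightarrow> f s = (\<Sum>n. chi (Suc n) / of_nat (Suc n) powr s))"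

definition dirichlet_L :: "nat \<Rightarrow> (nat \<Rightarrow> complex) \<Rightarrow> complex \<Rightarrow> complex" where
  "dirichlet_L q chi = (THE f. is_dirichlet_L q chi f)"

lemma is_dirichlet_L_unique:
  assumes f: "is_dirichlet_L q chi f" and g: "is_dirichlet_L q chi g"
  shows "f = g"
proof
  fix z
  define D :: "complex set" where "D = (if principal_character q chi then - {1} else UNIV)"
  have hf: "f holomorphic_on D" and hg: "g holomorphic_on D"
    using f g by (simp_all add: is_dirichlet_L_def D_def)
  have opD: "open D" by (auto simp: D_def)
  have "connected (- {1 :: complex})" by (rule connected_punctured_universe) simp
  hence conD: "connected D" by (simp add: D_def convex_connected)
  have sub: "{s. Re s > 1} \<subseteq> D" by (auto simp: D_def)
  show "f z = g z"
  proof (cases "z \<in> D")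
    case True
    show ?thesis
    proof (rule analytic_continuation_open[of "{s. Re s > 1}" D f g])
      show "open {s. Re s > 1}" by (rule open_halfspace_Re_gt)
      have "(2::complex) \<in> {s. Re s > 1}" by simp
      thus "{s. Re s > 1} \<noteq> {}" by blast
      show "f w = g w" if "w \<in> {s. Re s > 1}" for w
        using f g that by (simp add: is_dirichlet_L_def)
    qed (use hf hg opD conD sub True in auto)
  next
    case False
    hence "z = 1" "principal_character q chi" by (auto simp: D_def split: if_splits)
    thus ?thesis using f g by (simp add: is_dirichlet_L_def)
  qed
qed

lemma dirichlet_L_eqI: "is_dirichlet_L q chi f \<Longrightarrow> dirichlet_L q chi = f"
  unfolding dirichlet_L_def using is_dirichlet_L_unique by (intro the_equality) auto

definition nontrivial_zero :: "nat \<Rightarrow> (nat \<Rightarrow> complex) \<Rightarrow> complex \<Rightarrow> bool" where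
  "nontrivial_zero q chi \<rho> \<longleftrightarrow> 0 < Re \<rho> \<and> Re \<rho> < 1 \<and> dirichlet_L q chi \<rho> = 0"

definition GRHR :: bool where
  "GRHR \<longleftrightarrow> (\<forall>q chi \<rho>. dirichlet_character q chi \<and> nontrivial_zero q chi \<rho> \<and> Im \<rho> \<noteq> 0 \<longrightarrow> Re \<rho> = 1 / 2)"

definition S_tilde :: "real \<Rightarrow> (nat \<Rightarrow> complex) \<Rightarrow> real \<Rightarrow> complex" where
  "S_tilde N chi \<alpha> =
     (\<Sum>n. chi (Suc n) * mangoldt (Suc n) * of_real (exp (- real (Suc n) / N)) *
           exp (2 * of_real pi * \<i> * of_real (real (Suc n) * \<alpha>)))"

definition z_of :: "real \<Rightarrow> real \<Rightarrow> complex" where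
  "z_of N \<alpha> = 1 / of_real N - 2 * of_real pi * \<i> * of_real \<alpha>"

text \<open>
  As usual for sums over zeros, each zero is counted with multiplicity, which is its order
  \<open>zorder\<close>.
\<close>

definition real_zero_sum :: "nat \<Rightarrow> (nat \<Rightarrow> complex) \<Rightarrow> complex \<Rightarrow> complex" where
  "real_zero_sum q chi z =
     (\<Sum>\<beta> | nontrivial_zero q chi (of_real \<beta>) \<and> \<beta> \<ge> 1 / 2.
        of_int (zorder (dirichlet_L q chi) (of_real \<beta>)) * (Gamma (of_real \<beta>) / z powr of_real \<beta>))"

end

theory Submission
 imports Defs "HOL-Real_Asymp.Real_Asymp"
begin

text \<open>
  Moving the line of integration in the Cahen--Mellin integral of \<open>L'/L\<close> to some \<open>Re s = c < 1/2\<close> expresses the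
  function \<open>\<Phi>\<close> inside the norm as a sum of \<open>\<Gamma>(\<rho>) z powr -\<rho>\<close> over the zeros other than the \<open>\<beta>\<close>, plus the integral
  over that line. The abscissa \<open>c\<close> is chosen by averaging so that it keeps away from the real zeros.

  On the vertical line \<open>Re z = 1/N\<close> the factors \<open>z powr -\<rho>\<close> are not orthogonal, but on a ray \<open>z = x (1 + \<i> v)\<close> one has
  \<open>x powr -\<rho> = x powr (-1/2) exp (-\<i> \<gamma> ln x)\<close>, and a smooth average over \<open>x \<asymp> 1/N\<close> makes distinct ordinates almost
  orthogonal. Schur's test and the bound \<open>O(log q(\<bar>t\<bar> + 2))\<close> for the number of zeros with \<open>\<bar>\<gamma> - t\<bar> \<le> 1\<close> then bound the
  mean square of \<open>\<Phi>\<close> on each ray. Integrating over \<open>v\<close> gives the mean square over a rectangle around the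
  segment, and since \<open>\<Phi>\<close> is holomorphic, its value at a point is dominated by its mean square over a square
  of side \<open>1/N\<close>, which leads from the rectangle back to the segment.
\<close>

section \<open>Gamma bounds and the Cahen--Mellin integral\<close>

text \<open>\<open>GRHR\<close> leaves the real zeros free, and this shapes the contour. Nonreal
  zeros of positive real part lie on Re s = 1/2, so on Re s = c with 1/4 \<le> c \<le> 3/8 only real
  zeros \<beta> can spoil the bound L'/L = O(log). Because |c + it - \<beta>|^2 \<ge> |c - \<beta>|
  |t|, it is enough that |c - \<beta>|^(-1/2) is bounded on average over the \<beta>, and some c
  achieves this. Real zeros between c and 1/2 do not occur in the statement and must be absorbed
  into the error. The two logarithms are two uses of the local zero count: once for the row sums of
  the kernel, once for the zeros that matter on the ray through 1 + iv, those with |\<gamma>| up to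
  about |1 + iv|. The factor 1 / |1 + iv| from the squared kernel cancels the number of these zeros,
  so every ray costs the same up to logarithms. On the way back to the segment, the squares about
  its points overlap. For \<xi> > 1/N the overlap is counted by Fubini, for \<xi> \<le> 1/N the
  length of the segment alone is used; either way the smaller of \<xi> and 1/N meets the height of
  the rectangle, which is of the order of the larger.\<close>

lemma Gamma_abs_ratio_mono:
 fixes a b t :: real
 assumes "0 < a" "a \<le> b"
 shows "cmod (Gamma (Complex a t)) * Gamma b \<le> cmod (Gamma (Complex b t)) * Gamma a"
proof (rule LIMSEQ_le)
 show "(\<lambda>n. cmod (Gamma_series (Complex a t) n) * Gamma_series b n) \<longlonglongrightarrow> cmod (Gamma (Complex a t)) * Gamma b"
  by (intro tendsto_intros Gamma_series_LIMSEQ)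
 show "(\<lambda>n. cmod (Gamma_series (Complex b t) n) * Gamma_series a n) \<longlonglongrightarrow> cmod (Gamma (Complex b t)) * Gamma a"
  by (intro tendsto_intros Gamma_series_LIMSEQ)
 \<comment> \<open>In Euler's product the claim holds factor by factor: |c + k + it| / (c + k) =
   sqrt (1 + t^2 / (c + k)^2) decreases in c, and these factors stand in the denominators. The
   modulus of what is left depends on the real part only and cancels.\<close>
 have ineq: "cmod (Complex b t + of_nat k) * (a + real k) \<le> cmod (Complex a t + of_nat k) * (b + real k)" for k
 proof (rule power2_le_imp_le)
  have "(a + real k)^2 \<le> (b + real k)^2" using assms by (intro power_mono) auto
  hence "t^2 * (a + real k)^2 \<le> t^2 * (b + real k)^2" by (intro mult_left_mono) auto
  thus "(cmod (Complex b t + of_nat k) * (a + real k))^2 \<le> (cmod (Complex a t + of_nat k) * (b + real k))^2"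
   unfolding power_mult_distrib cmod_power2 by (simp add: algebra_simps)
 qed (use assms in auto)
 have "cmod (Gamma_series (Complex a t) n) * Gamma_series b n \<le> cmod (Gamma_series (Complex b t) n) * Gamma_series a n"
  if "n \<ge> 1" for n
 proof -
  have pos: "pochhammer a (Suc n) > 0" "pochhammer b (Suc n) > 0"
   using assms by (auto intro!: pochhammer_pos)
  have nz: "cmod (pochhammer (Complex c t) (Suc n)) > 0" if "c > 0" for c
  proof -
   have "pochhammer (Complex c t) (Suc n) \<noteq> 0"
    using that unfolding pochhammer_eq_0_iff by (auto simp: complex_eq_iff[of _ "- _"])
   thus ?thesis by simp
  qed
  have key: "cmod (pochhammer (Complex b t) (Suc n)) * pochhammer a (Suc n)
    \<le> cmod (pochhammer (Complex a t) (Suc n)) * pochhammer b (Suc n)"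
   unfolding pochhammer_prod prod_norm[symmetric] prod.distrib[symmetric]
   using assms by (intro prod_mono conjI ineq) auto
  have e: "cmod (exp (Complex c t * of_real (ln (real n)))) = exp (c * ln (real n))" for c
   by simp
  have "cmod (Gamma_series (Complex a t) n) * Gamma_series b n =
    (fact n)^2 * exp (a * ln (real n)) * exp (b * ln (real n)) /
    (cmod (pochhammer (Complex a t) (Suc n)) * pochhammer b (Suc n))"
   unfolding Gamma_series_def norm_divide norm_mult e by (simp add: power2_eq_square)
  also have "\<dots> \<le> (fact n)^2 * exp (a * ln (real n)) * exp (b * ln (real n)) /
    (cmod (pochhammer (Complex b t) (Suc n)) * pochhammer a (Suc n))"
   using key assms by (intro divide_left_mono mult_pos_pos pos nz) auto
  also have "\<dots> = cmod (Gamma_series (Complex b t) n) * Gamma_series a n"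
   unfolding Gamma_series_def norm_divide norm_mult e by (simp add: power2_eq_square)
  finally show ?thesis .
 qed
 thus "\<exists>N. \<forall>n\<ge>N. cmod (Gamma_series (Complex a t) n) * Gamma_series b n \<le> cmod (Gamma_series (Complex b t) n) * Gamma_series a n"
  by blast
qed

lemma Gamma_half_bound: "cmod (Gamma (Complex (1/2) t)) \<le> sqrt (2 * pi) * exp (- pi * \<bar>t\<bar> / 2)"
proof (rule power2_le_imp_le)
 have e: "1 - Complex (1/2) t = cnj (Complex (1/2) t)" by (simp add: complex_eq_iff)
 have "Gamma (Complex (1/2) t) * Gamma (1 - Complex (1/2) t) = pi / sin (pi * Complex (1/2) t)"
  by (rule Gamma_reflection_complex)
 hence "Gamma (Complex (1/2) t) * cnj (Gamma (Complex (1/2) t)) = pi / sin (pi * Complex (1/2) t)"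
  by (simp add: e cnj_Gamma)
 hence "complex_of_real ((cmod (Gamma (Complex (1/2) t)))^2) = pi / sin (pi * Complex (1/2) t)"
  by (simp only: complex_norm_square)
 moreover have "sin (pi * Complex (1/2) t) = of_real (cosh (pi * t))"
 proof -
  have "complex_of_real pi * Complex (1/2) t = of_real (pi/2) + \<i> * of_real (pi * t)"
   by (simp add: complex_eq_iff)
  hence "sin (complex_of_real pi * Complex (1/2) t) = cos (\<i> * complex_of_real (pi*t))"
   by (simp add: sin_add sin_of_real cos_of_real)
  also have "\<dots> = cosh (complex_of_real (pi*t))" by (simp only: cosh_conv_cos)
  also have "\<dots> = of_real (cosh (pi * t))" by (simp add: cosh_def scaleR_conv_of_real flip: exp_of_real)
  finally show ?thesis .
 qed
 ultimately have "complex_of_real ((cmod (Gamma (Complex (1/2) t)))^2) = complex_of_real (pi / cosh (pi * t))" by simp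
 hence "(cmod (Gamma (Complex (1/2) t)))^2 = pi / cosh (pi * t)" using of_real_eq_iff by blast
 also have "cosh (pi * t) \<ge> exp (pi * \<bar>t\<bar>) / 2"
  by (cases "t \<ge> 0") (auto simp: cosh_def)
 hence "pi / cosh (pi * t) \<le> pi / (exp (pi * \<bar>t\<bar>) / 2)"
  by (intro divide_left_mono) (auto intro!: mult_pos_pos)
 also have "\<dots> = (sqrt (2 * pi) * exp (- pi * \<bar>t\<bar> / 2))^2"
  by (simp add: power_mult_distrib exp_minus field_simps flip: exp_of_nat_mult exp_add)
 finally show "(cmod (Gamma (Complex (1/2) t)))^2 \<le> \<dots>" .
qed simp

lemma Re_pos_notin_nonpos_Ints: "Re s > 0 ==> s \<notin> \<int>\<^sub>\<le>\<^sub>0"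
 by (auto elim!: nonpos_Ints_cases)

lemma Gamma_strip_bounds:
 "\<exists>C>0. (\<forall>\<sigma> t. 1/4 \<le> \<sigma> --> \<sigma> \<le> 1/2 --> cmod (Gamma (Complex \<sigma> t)) \<le> C * exp (- pi * \<bar>t\<bar> / 2)) \<and>
     (\<forall>\<sigma> t. 1/4 \<le> \<sigma> --> \<sigma> \<le> 3/2 --> cmod (Gamma (Complex \<sigma> t)) \<le> C * (1 + \<bar>t\<bar>) * exp (- pi * \<bar>t\<bar> / 2))"
proof -
 have "continuous_on {1/4..3/2} (Gamma :: real => real)"
  by (intro continuous_on_Gamma) (auto elim!: nonpos_Ints_cases)
 hence "bounded (Gamma ` {1/4..3/2::real})" by (intro compact_imp_bounded compact_continuous_image) auto
 then obtain B where B: "B > 0" "\<And>x::real. 1/4 \<le> x ==> x \<le> 3/2 ==> \<bar>Gamma x\<bar> \<le> B"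
  unfolding bounded_pos by auto
 define g1 g2 where "g1 = Gamma (1/2::real)" and "g2 = Gamma (3/2::real)"
 have gp: "g1 > 0" "g2 > 0" by (auto simp: g1_def g2_def Gamma_real_pos)
 define C where "C = max (B * sqrt (2*pi) / g1) (B * sqrt (2*pi) / g2)"
 have C0: "C > 0" using B(1) gp by (auto simp: C_def less_max_iff_disj)
 have 1: "cmod (Gamma (Complex \<sigma> t)) \<le> C * exp (- pi * \<bar>t\<bar> / 2)" if "1/4 \<le> \<sigma>" "\<sigma> \<le> 1/2" for \<sigma> t
 proof -
  have "cmod (Gamma (Complex \<sigma> t)) * g1 \<le> cmod (Gamma (Complex (1/2) t)) * Gamma \<sigma>"
   unfolding g1_def using that by (intro Gamma_abs_ratio_mono) auto
  also have "\<dots> \<le> (sqrt (2 * pi) * exp (- pi * \<bar>t\<bar> / 2)) * B"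
   using B(2)[of \<sigma>] that by (intro mult_mono Gamma_half_bound) auto
  finally have "cmod (Gamma (Complex \<sigma> t)) \<le> (B * sqrt (2*pi) / g1) * exp (- pi * \<bar>t\<bar> / 2)"
   using gp by (simp add: field_simps)
  also have "\<dots> \<le> C * exp (- pi * \<bar>t\<bar> / 2)" by (intro mult_right_mono) (auto simp: C_def)
  finally show ?thesis .
 qed
 have 2: "cmod (Gamma (Complex \<sigma> t)) \<le> C * (1 + \<bar>t\<bar>) * exp (- pi * \<bar>t\<bar> / 2)" if "1/4 \<le> \<sigma>" "\<sigma> \<le> 3/2" for \<sigma> t
 proof -
  have "Gamma (Complex (3/2) t) = Complex (1/2) t * Gamma (Complex (1/2) t)"
   using Gamma_plus1[of "Complex (1/2) t"] Re_pos_notin_nonpos_Ints[of "Complex (1/2) t"]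
   by (simp add: plus_complex.code one_complex.code)
  hence "cmod (Gamma (Complex (3/2) t)) = cmod (Complex (1/2) t) * cmod (Gamma (Complex (1/2) t))"
   by (simp add: norm_mult)
  also have "\<dots> \<le> (1 + \<bar>t\<bar>) * (sqrt (2 * pi) * exp (- pi * \<bar>t\<bar> / 2))"
   using cmod_le[of "Complex (1/2) t"] by (intro mult_mono Gamma_half_bound) auto
  finally have g3: "cmod (Gamma (Complex (3/2) t)) \<le> \<dots>" .
  have "cmod (Gamma (Complex \<sigma> t)) * g2 \<le> cmod (Gamma (Complex (3/2) t)) * Gamma \<sigma>"
   unfolding g2_def using that by (intro Gamma_abs_ratio_mono) auto
  also have "\<dots> \<le> ((1 + \<bar>t\<bar>) * (sqrt (2 * pi) * exp (- pi * \<bar>t\<bar> / 2))) * B"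
   using B(2)[of \<sigma>] that by (intro mult_mono g3) auto
  finally have "cmod (Gamma (Complex \<sigma> t)) \<le> (B * sqrt (2*pi) / g2) * ((1 + \<bar>t\<bar>) * exp (- pi * \<bar>t\<bar> / 2))"
   using gp by (simp add: field_simps)
  also have "\<dots> \<le> C * ((1 + \<bar>t\<bar>) * exp (- pi * \<bar>t\<bar> / 2))" by (intro mult_right_mono) (auto simp: C_def)
  finally show ?thesis by (simp add: mult.assoc)
 qed
 show ?thesis using C0 1 2 by blast
qed

text \<open>This is sin x \<le> x at x = pi/2 - |Arg z|. It measures how far the growth exp (t Arg
  z) of z^(-s) stays below the decay exp (- pi |t| / 2) of Gamma.\<close>

lemma Arg_bound:
 assumes "Re z > 0"
 shows "\<bar>Arg z\<bar> + Re z / cmod z \<le> pi / 2"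
proof -
 have nz: "z \<noteq> 0" using assms by auto
 have lt: "\<bar>Arg z\<bar> < pi/2" using assms Re_Ln_pos_lt[OF nz] Arg_eq_Im_Ln[OF nz] by simp
 have "Re z = cmod z * cos (Arg z)" using Arg_eq[OF nz]
  by (metis Re_rcis rcis_cmod_Arg)
 hence "Re z / cmod z = cos (\<bar>Arg z\<bar>)" using nz by (simp add: abs_if)
 also have "\<dots> = sin (pi/2 - \<bar>Arg z\<bar>)" by (simp add: cos_sin_eq)
 also have "\<dots> \<le> pi/2 - \<bar>Arg z\<bar>" using lt by (intro sin_x_le_x) auto
 finally show ?thesis by linarith
qed

text \<open>What survives of Gamma's decay after multiplication by z^(-s) is an exponential on the
  scale |z| / Re z. On the ray through 1 + iv this scale is |1 + iv|, so only zeros up to that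
  height matter.\<close>

lemma norm_powr_minus_bound:
 assumes "Re z > 0"
 shows "cmod (z powr (- s)) * exp (- pi * \<bar>Im s\<bar> / 2) \<le> cmod z powr (- Re s) * exp (- (Re z / cmod z) * \<bar>Im s\<bar>)"
proof -
 have "\<bar>Im s\<bar> * (\<bar>Arg z\<bar> + Re z / cmod z) \<le> \<bar>Im s\<bar> * (pi / 2)"
  by (intro mult_left_mono Arg_bound assms) auto
 moreover have "Im s * Arg z \<le> \<bar>Im s\<bar> * \<bar>Arg z\<bar>" by (metis abs_ge_self abs_mult)
 ultimately have "Im s * Arg z - pi * \<bar>Im s\<bar> / 2 \<le> - (Re z / cmod z) * \<bar>Im s\<bar>"
  by (simp add: algebra_simps)
 hence "exp (Im s * Arg z) * exp (- pi * \<bar>Im s\<bar> / 2) \<le> exp (- (Re z / cmod z) * \<bar>Im s\<bar>)"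
  by (simp flip: exp_add)
 hence "cmod z powr (- Re s) * (exp (Im s * Arg z) * exp (- pi * \<bar>Im s\<bar> / 2)) \<le> cmod z powr (- Re s) * exp (- (Re z / cmod z) * \<bar>Im s\<bar>)"
  by (intro mult_left_mono) auto
 thus ?thesis by (simp add: norm_powr_complex mult.assoc)
qed

section \<open>Shifting vertical lines of integration\<close>

lemma rectpath_contour_integral_bound:
 assumes ab: "a < b" "T > 0"
  and cont: "continuous_on (path_image (rectpath (Complex a (-T)) (Complex b T))) f"
  and B: "\<And>x. x \<in> {a..b} ==> cmod (f (Complex x T)) \<le> B \<and> cmod (f (Complex x (-T))) \<le> B"
 shows "cmod (contour_integral (rectpath (Complex a (-T)) (Complex b T)) f -
      \<i> * (integral {-T..T} (\<lambda>t. f (Complex b t)) - integral {-T..T} (\<lambda>t. f (Complex a t)))) \<le> 2 * (b - a) * B"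
proof -
 let ?a1 = "Complex a (-T)" and ?a2 = "Complex b (-T)" and ?a3 = "Complex b T" and ?a4 = "Complex a T"
 have rp: "rectpath ?a1 ?a3 = linepath ?a1 ?a2 +++ linepath ?a2 ?a3 +++ linepath ?a3 ?a4 +++ linepath ?a4 ?a1"
  by (simp add: rectpath_def Let_def)
 have im: "path_image (rectpath ?a1 ?a3) = closed_segment ?a1 ?a2 \<union> closed_segment ?a2 ?a3 \<union> closed_segment ?a3 ?a4 \<union> closed_segment ?a4 ?a1"
  unfolding rp by (simp add: path_image_join Un_assoc)
 have c1: "continuous_on (closed_segment ?a1 ?a2) f" and c2: "continuous_on (closed_segment ?a2 ?a3) f"
  and c3: "continuous_on (closed_segment ?a3 ?a4) f" and c4: "continuous_on (closed_segment ?a4 ?a1) f"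
  using cont unfolding im by (auto elim!: continuous_on_subset)
 note ci = contour_integrable_continuous_linepath[OF c1] contour_integrable_continuous_linepath[OF c2]
  contour_integrable_continuous_linepath[OF c3] contour_integrable_continuous_linepath[OF c4]
 have tot: "contour_integral (rectpath ?a1 ?a3) f = contour_integral (linepath ?a1 ?a2) f + contour_integral (linepath ?a2 ?a3) f
   + contour_integral (linepath ?a3 ?a4) f + contour_integral (linepath ?a4 ?a1) f"
  unfolding rp using ci by (simp add: contour_integrable_joinI add.assoc)
 have B0: "0 \<le> B" using B[of a] ab norm_ge_zero order_trans by (metis atLeastAtMost_iff less_imp_le order_refl)
 have h1: "cmod (contour_integral (linepath ?a1 ?a2) f) \<le> B * cmod (?a2 - ?a1)"
  by (rule contour_integral_bound_linepath[OF ci(1) B0]) (use ab B in \<open>auto simp: closed_segment_same_Im complex_eq_iff elim!: \<close>, metis B atLeastAtMost_iff closed_segment_eq_real_ivl1 complex.exhaust_sel less_imp_le)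
 have h3: "cmod (contour_integral (linepath ?a3 ?a4) f) \<le> B * cmod (?a4 - ?a3)"
  by (rule contour_integral_bound_linepath[OF ci(3) B0]) (use ab B in \<open>auto simp: closed_segment_same_Im complex_eq_iff elim!: \<close>, metis B atLeastAtMost_iff closed_segment_eq_real_ivl closed_segment_commute complex.exhaust_sel less_imp_le)
 have d: "cmod (?a2 - ?a1) = b - a" "cmod (?a4 - ?a3) = b - a" using ab by (auto simp: cmod_def)
 have v: "contour_integral (linepath (Complex c (-T)) (Complex c T)) f = \<i> * integral {-T..T} (\<lambda>t. f (Complex c t))"
  if "continuous_on (closed_segment (Complex c (-T)) (Complex c T)) f" for c
 proof -
  have "(f has_contour_integral contour_integral (linepath (Complex c (-T)) (Complex c T)) f) (linepath (Complex c (-T)) (Complex c T))"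
   by (intro has_contour_integral_integral contour_integrable_continuous_linepath that)
  hence "((\<lambda>t. f (Complex c t)) has_integral - \<i> * contour_integral (linepath (Complex c (-T)) (Complex c T)) f) {-T..T}"
   by (subst (asm) has_contour_integral_linepath_same_Re_iff[of _ c _ "-T" T]) (use ab in auto)
  hence "integral {-T..T} (\<lambda>t. f (Complex c t)) = - \<i> * contour_integral (linepath (Complex c (-T)) (Complex c T)) f"
   by (rule integral_unique)
  thus ?thesis by simp
 qed
 have v4: "contour_integral (linepath ?a4 ?a1) f = - (\<i> * integral {-T..T} (\<lambda>t. f (Complex a t)))"
  using v[of a] c4 contour_integral_reverse_linepath[OF c4] by (simp add: closed_segment_commute)
 have "contour_integral (rectpath ?a1 ?a3) f - \<i> * (integral {-T..T} (\<lambda>t. f (Complex b t)) - integral {-T..T} (\<lambda>t. f (Complex a t)))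
   = contour_integral (linepath ?a1 ?a2) f + contour_integral (linepath ?a3 ?a4) f"
  unfolding tot v[OF c2] v4 by (simp add: algebra_simps)
 also have "cmod \<dots> \<le> B * (b - a) + B * (b - a)"
  using h1 h3 unfolding d by (intro norm_triangle_le add_mono) auto
 finally show ?thesis by (simp add: algebra_simps)
qed

lemma integrable_exp_abs:
 fixes a :: real
 assumes "a > 0"
 shows "integrable lborel (\<lambda>t. exp (- a * \<bar>t\<bar>))" "integral\<^sup>L lborel (\<lambda>t. exp (- a * \<bar>t\<bar>)) = 2 / a"
proof -
 have 1: "((\<lambda>t. exp (- a * \<bar>t\<bar>)) has_integral 1 / a) {0..}"
  using has_integral_exp_minus_to_infinity[OF assms, of 0]
  by (rule has_integral_eq_rhs[OF has_integral_eq, rotated]) auto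
 have m: "(\<lambda>t. exp (- a * \<bar>t\<bar>)) \<in> borel_measurable borel" by measurable
 have "(\<lambda>t. exp (- a * \<bar>t\<bar>)) absolutely_integrable_on {0..}"
  using 1 by (intro nonnegative_absolutely_integrable_1) (auto simp: has_integral_integrable)
 hence "integrable lebesgue (\<lambda>t. indicator {0..} t *\<^sub>R exp (- a * \<bar>t\<bar>))"
  by (simp add: set_integrable_def)
 hence int0: "integrable lborel (\<lambda>t. indicator {0..} t *\<^sub>R exp (- a * \<bar>t\<bar>))"
  using m by (subst (asm) integrable_completion) auto
 have "integral\<^sup>L lborel (\<lambda>t. indicator {0..} t *\<^sub>R exp (- a * \<bar>t\<bar>)) = 1 / a"
 proof -
  have "((\<lambda>t. if t \<in> {0..} then exp (- a * \<bar>t\<bar>) else 0) has_integral 1 / a) UNIV"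
   using 1 by (subst has_integral_restrict_UNIV)
  moreover have "(\<lambda>t. indicator {0..} t *\<^sub>R exp (- a * \<bar>t\<bar>)) = (\<lambda>t. if t \<in> {0..} then exp (- a * \<bar>t\<bar>) else 0)"
   by (auto simp: indicator_def)
  ultimately show ?thesis
   using has_integral_integral_lborel[OF int0] has_integral_unique by metis
 qed
 hence "has_bochner_integral lborel (\<lambda>t. indicator {0..} t *\<^sub>R exp (- a * \<bar>t\<bar>)) (1 / a)"
  using int0 by (simp only: has_bochner_integral_iff)
 from has_bochner_integral_even_function[OF this]
 have "has_bochner_integral lborel (\<lambda>t. exp (- a * \<bar>t\<bar>)) (2 *\<^sub>R (1 / a))"
  by simp
 thus "integrable lborel (\<lambda>t. exp (- a * \<bar>t\<bar>))" "integral\<^sup>L lborel (\<lambda>t. exp (- a * \<bar>t\<bar>)) = 2 / a"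
  by (auto simp: has_bochner_integral_iff)
qed

lemma integrable_lborel_dominated:
 fixes f :: "real => complex"
 assumes "continuous_on UNIV f" "integrable lborel g" "\<And>t. cmod (f t) \<le> g t"
 shows "integrable lborel f"
proof (rule Bochner_Integration.integrable_bound[OF assms(2)])
 show "f \<in> borel_measurable lborel"
  using borel_measurable_continuous_onI[OF assms(1)] by simp
 show "AE x in lborel. norm (f x) \<le> norm (g x)"
  using assms(3) by (intro AE_I2) (metis abs_ge_self order_trans real_norm_def)
qed

lemma symmetric_integral_tendsto:
 fixes f :: "real => complex" and T :: "nat => real"
 assumes "integrable lborel f" "filterlim T at_top sequentially"
 shows "(\<lambda>k. integral {-T k..T k} f) \<longlonglongrightarrow> integral\<^sup>L lborel f"
proof -
 have "(\<lambda>k. integral\<^sup>L lborel (\<lambda>x. indicator {-T k..T k} x *\<^sub>R f x)) \<longlonglongrightarrow> integral\<^sup>L lborel f"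
 proof (rule integral_dominated_convergence[where w = "\<lambda>x. norm (f x)"])
  show "f \<in> borel_measurable lborel" using assms(1) by (rule borel_measurable_integrable)
  then show "(\<lambda>x. indicator {-T k..T k} x *\<^sub>R f x) \<in> borel_measurable lborel" for k by measurable
  show "integrable lborel (\<lambda>x. norm (f x))" using assms(1) by simp
  show "AE x in lborel. (\<lambda>k. indicator {- T k..T k} x *\<^sub>R f x) \<longlonglongrightarrow> f x"
  proof (rule AE_I2, rule tendsto_eventually)
   fix x
   have "eventually (\<lambda>k. T k \<ge> \<bar>x\<bar>) sequentially"
    using assms(2) by (simp add: filterlim_at_top)
   thus "\<forall>\<^sub>F k in sequentially. indicator {- T k..T k} x *\<^sub>R f x = f x"
    by eventually_elim (auto simp: indicator_def abs_le_iff)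
  qed
  show "AE x in lborel. norm (indicator {- T k..T k} x *\<^sub>R f x) \<le> norm (f x)" for k
   by (rule AE_I2) (auto simp: indicator_def)
 qed
 moreover have "integral\<^sup>L lborel (\<lambda>x. indicator {-T k..T k} x *\<^sub>R f x) = integral {-T k..T k} f" for k
 proof -
  have "set_integrable lborel {-T k..T k} f"
   using assms(1) by (simp add: set_integrable_def integrable_mult_indicator)
  thus ?thesis using set_borel_integral_eq_integral(2) unfolding set_lebesgue_integral_def by blast
 qed
 ultimately show ?thesis by simp
qed

lemma line_integral_shift:
 fixes f :: "complex => complex"
 assumes ab: "a < b"
  and int: "integrable lborel (\<lambda>t. f (Complex a t))" "integrable lborel (\<lambda>t. f (Complex b t))"
  and rect: "\<And>k. continuous_on (path_image (rectpath (Complex a (- T k)) (Complex b (T k)))) f"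
   "\<And>k. contour_integral (rectpath (Complex a (- T k)) (Complex b (T k))) f = I k"
  and lim: "I \<longlonglongrightarrow> I0"
  and T: "filterlim T at_top sequentially" "\<And>k. T k > (0::real)"
  and B: "\<And>k x. x \<in> {a..b} ==> cmod (f (Complex x (T k))) \<le> B k \<and> cmod (f (Complex x (- T k))) \<le> B k" "B \<longlonglongrightarrow> 0"
 shows "integral\<^sup>L lborel (\<lambda>t. f (Complex b t)) - integral\<^sup>L lborel (\<lambda>t. f (Complex a t)) = - \<i> * I0"
proof -
 let ?V = "\<lambda>c k. integral {-T k..T k} (\<lambda>t. f (Complex c t))"
 have "(\<lambda>k. I k - \<i> * (?V b k - ?V a k)) \<longlonglongrightarrow> 0"
 proof (rule Lim_null_comparison)
  show "\<forall>\<^sub>F k in sequentially. norm (I k - \<i> * (?V b k - ?V a k)) \<le> 2 * (b - a) * B k"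
   using rectpath_contour_integral_bound[OF ab T(2) rect(1) B(1)] unfolding rect(2) by (intro always_eventually) blast
  show "(\<lambda>k. 2 * (b - a) * B k) \<longlonglongrightarrow> 0" using tendsto_mult_left[OF B(2), of "2 * (b - a)"] by simp
 qed
 moreover have "(\<lambda>k. I k - \<i> * (?V b k - ?V a k)) \<longlonglongrightarrow> I0 - \<i> * (integral\<^sup>L lborel (\<lambda>t. f (Complex b t)) - integral\<^sup>L lborel (\<lambda>t. f (Complex a t)))"
  by (intro tendsto_intros lim symmetric_integral_tendsto int T)
 ultimately have "I0 - \<i> * (integral\<^sup>L lborel (\<lambda>t. f (Complex b t)) - integral\<^sup>L lborel (\<lambda>t. f (Complex a t))) = 0"
  using LIMSEQ_unique by blast
 hence "I0 = \<i> * (integral\<^sup>L lborel (\<lambda>t. f (Complex b t)) - integral\<^sup>L lborel (\<lambda>t. f (Complex a t)))"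
  by (rule eq_iff_diff_eq_0[THEN iffD2])
 hence "- \<i> * I0 = (- \<i> * \<i>) * (integral\<^sup>L lborel (\<lambda>t. f (Complex b t)) - integral\<^sup>L lborel (\<lambda>t. f (Complex a t)))"
  by (simp only: mult.assoc)
 moreover have "- \<i> * \<i> = 1" by simp
 ultimately show ?thesis by (simp only: mult_1_left)
qed

section \<open>The Cahen-Mellin integral\<close>

lemma half_line_notin_nonpos_Ints: "Complex (1/2 - real K) t \<notin> \<int>\<^sub>\<le>\<^sub>0"
proof
 assume "Complex (1/2 - real K) t \<in> \<int>\<^sub>\<le>\<^sub>0"
 then obtain n where "Complex (1/2 - real K) t = of_int n" by (auto elim!: nonpos_Ints_cases)
 hence "Re (Complex (1/2 - real K) t) = of_int n" by simp
 hence "real_of_int (2 * n) = real_of_int (1 - 2 * int K)" by simp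
 hence "2 * n = 1 - 2 * int K" using of_int_eq_iff by blast
 thus False by presburger
qed

text \<open>Each step of Gamma (s + 1) = s Gamma s to the left divides by |s| \<ge> |Re s|, and the
  |Re s| multiply up to the Pochhammer symbol. This factorial growth sends the shifted Mellin
  integrals to 0.\<close>

lemma Gamma_left_bound:
 "cmod (Gamma (Complex (1/2 - real K) t)) \<le> cmod (Gamma (Complex (1/2) t)) / pochhammer (1/2) K"
proof (induction K)
 case (Suc K)
 define s where "s = Complex (1/2 - real (Suc K)) t"
 have sn: "s \<notin> \<int>\<^sub>\<le>\<^sub>0" unfolding s_def by (rule half_line_notin_nonpos_Ints)
 have "cmod (Gamma (s + 1)) = cmod s * cmod (Gamma s)"
  by (simp add: Gamma_plus1[OF sn] norm_mult)
 moreover have "cmod s \<ge> 1/2 + real K" using abs_Re_le_cmod[of s] by (simp add: s_def)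
 moreover have "s + 1 = Complex (1/2 - real K) t" by (simp add: s_def complex_eq_iff)
 ultimately have "(1/2 + real K) * cmod (Gamma s) \<le> cmod (Gamma (Complex (1/2 - real K) t))"
  by (simp add: mult_right_mono)
 also note Suc.IH
 finally have "(1/2 + real K) * cmod (Gamma s) \<le> cmod (Gamma (Complex (1/2) t)) / pochhammer (1/2) K" .
 hence "cmod (Gamma s) \<le> cmod (Gamma (Complex (1/2) t)) / pochhammer (1/2) K / (1/2 + real K)"
  by (subst pos_le_divide_eq) (auto simp: mult.commute)
 thus ?case unfolding s_def[symmetric] pochhammer_Suc by simp
qed simp

text \<open>For |t| \<ge> 1 every factor s in Gamma (s + 1) = s Gamma s has modulus at least 1. The
  horizontal sides of rectangles far to the left thus inherit the bound of the strip from 1/4 to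
  3/2.\<close>

lemma Gamma_right_shift_bound:
 assumes "\<bar>t\<bar> \<ge> 1"
 shows "cmod (Gamma (Complex x t)) \<le> cmod (Gamma (Complex (x + real n) t))"
proof (induction n)
 case (Suc n)
 define s where "s = Complex (x + real n) t"
 have sn: "s \<notin> \<int>\<^sub>\<le>\<^sub>0"
 proof
  assume "s \<in> \<int>\<^sub>\<le>\<^sub>0"
  then obtain n where "s = of_int n" by (auto elim!: nonpos_Ints_cases)
  hence "Im s = 0" by simp
  thus False using assms by (simp add: s_def)
 qed
 have "Complex (x + real (Suc n)) t = s + 1" by (simp add: s_def complex_eq_iff)
 hence "cmod (Gamma (Complex (x + real (Suc n)) t)) = cmod s * cmod (Gamma s)"
  by (simp add: Gamma_plus1[OF sn] norm_mult)
 moreover have "cmod s \<ge> 1" using abs_Im_le_cmod[of s] assms by (simp add: s_def)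
 hence "1 * cmod (Gamma s) \<le> cmod s * cmod (Gamma s)" by (intro mult_right_mono) auto
 ultimately show ?case using Suc.IH by (simp add: s_def)
qed simp

lemma Mellin_integrand_holomorphic:
 assumes "Re w > 0"
 shows "(\<lambda>s. Gamma s * w powr (- s)) holomorphic_on - \<int>\<^sub>\<le>\<^sub>0"
 using assms by (intro holomorphic_intros) auto

lemma Mellin_line_integrable:
 assumes w: "Re w > 0"
 defines "V \<equiv> \<lambda>K. integral\<^sup>L lborel (\<lambda>t. Gamma (Complex (1/2 - real K) t) * w powr (- Complex (1/2 - real K) t))"
 shows "integrable lborel (\<lambda>t. Gamma (Complex (1/2 - real K) t) * w powr (- Complex (1/2 - real K) t))"
  and "cmod (V K) \<le> sqrt (2 * pi) * (2 / (Re w / cmod w)) * cmod w powr (real K - 1/2) / pochhammer (1/2) K"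
proof -
 define \<eta> where "\<eta> = Re w / cmod w"
 have "w \<noteq> 0" using w by auto
 hence \<eta>: "\<eta> > 0" using w by (simp add: \<eta>_def)
 define c where "c = sqrt (2 * pi) * cmod w powr (real K - 1/2) / pochhammer (1/2) K"
 have bd: "cmod (Gamma (Complex (1/2 - real K) t) * w powr (- Complex (1/2 - real K) t)) \<le> c * exp (- \<eta> * \<bar>t\<bar>)" for t
 proof -
  have "cmod (Gamma (Complex (1/2 - real K) t)) \<le> (sqrt (2 * pi) * exp (- pi * \<bar>t\<bar> / 2)) / pochhammer (1/2) K"
   by (rule order_trans[OF Gamma_left_bound], intro divide_right_mono Gamma_half_bound)
     (auto intro!: less_imp_le pochhammer_pos)
  hence "cmod (Gamma (Complex (1/2 - real K) t) * w powr (- Complex (1/2 - real K) t))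
    \<le> (sqrt (2 * pi) * exp (- pi * \<bar>t\<bar> / 2)) / pochhammer (1/2) K * cmod (w powr (- Complex (1/2 - real K) t))"
   unfolding norm_mult by (intro mult_right_mono) auto
  also have "\<dots> = sqrt (2 * pi) / pochhammer (1/2) K * (cmod (w powr (- Complex (1/2 - real K) t)) * exp (- pi * \<bar>Im (Complex (1/2 - real K) t)\<bar> / 2))"
   by simp
  also have "\<dots> \<le> sqrt (2 * pi) / pochhammer (1/2) K * (cmod w powr (- Re (Complex (1/2 - real K) t)) * exp (- (Re w / cmod w) * \<bar>Im (Complex (1/2 - real K) t)\<bar>))"
   by (intro mult_left_mono norm_powr_minus_bound w divide_nonneg_pos pochhammer_pos) auto
  also have "\<dots> = c * exp (- \<eta> * \<bar>t\<bar>)" by (simp add: c_def \<eta>_def)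
  finally show ?thesis .
 qed
 have ie: "integrable lborel (\<lambda>t. c * exp (- \<eta> * \<bar>t\<bar>))" using integrable_exp_abs(1)[OF \<eta>] by simp
 have "continuous_on UNIV (\<lambda>t. Complex (1/2 - real K) t)"
  by (simp add: Complex_eq) (intro continuous_intros)
 moreover have "range (\<lambda>t. Complex (1/2 - real K) t) \<subseteq> - \<int>\<^sub>\<le>\<^sub>0"
  using half_line_notin_nonpos_Ints by auto
 ultimately have cont: "continuous_on UNIV (\<lambda>t. Gamma (Complex (1/2 - real K) t) * w powr (- Complex (1/2 - real K) t))"
  using continuous_on_compose2[OF holomorphic_on_imp_continuous_on[OF Mellin_integrand_holomorphic[OF w]]] by blast
 show int: "integrable lborel (\<lambda>t. Gamma (Complex (1/2 - real K) t) * w powr (- Complex (1/2 - real K) t))"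
  by (rule integrable_lborel_dominated[OF cont ie bd])
 have "cmod (V K) \<le> integral\<^sup>L lborel (\<lambda>t. c * exp (- \<eta> * \<bar>t\<bar>))"
  unfolding V_def
  by (rule order_trans[OF integral_norm_bound], intro integral_mono integrable_norm int ie bd)
 also have "\<dots> = c * (2 / \<eta>)" using integrable_exp_abs[OF \<eta>] by simp
 also have "\<dots> = sqrt (2 * pi) * (2 / \<eta>) * cmod w powr (real K - 1/2) / pochhammer (1/2) K"
  unfolding c_def by (simp add: mult_ac)
 finally show "cmod (V K) \<le> sqrt (2 * pi) * (2 / (Re w / cmod w)) * cmod w powr (real K - 1/2) / pochhammer (1/2) K"
  unfolding \<eta>_def .
qed

lemma line_in_rectpath:
 assumes "a < b" "T > 0" "z \<in> path_image (rectpath (Complex a (-T)) (Complex b T))"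
 shows "a \<le> Re z" "Re z \<le> b" "\<bar>Im z\<bar> \<le> T" "Re z = a \<or> Re z = b \<or> \<bar>Im z\<bar> = T"
 using assms by (auto simp: path_image_rectpath_cbox_minus_box in_cbox_complex_iff in_box_complex_iff not_less)

lemma Mellin_horizontal_bound:
 assumes w: "Re w > 0"
 shows "\<exists>B. B \<longlonglongrightarrow> 0 \<and> (\<forall>k::nat. \<forall>x\<in>{1/2 - real K..3/2 - real K}.
   cmod (Gamma (Complex x (real k + 1)) * w powr (- Complex x (real k + 1))) \<le> B k \<and>
   cmod (Gamma (Complex x (- (real k + 1))) * w powr (- Complex x (- (real k + 1)))) \<le> B k)"
proof -
 obtain C where C: "C > 0" "\<And>\<sigma> t. 1/4 \<le> \<sigma> ==> \<sigma> \<le> 3/2 ==> cmod (Gamma (Complex \<sigma> t)) \<le> C * (1 + \<bar>t\<bar>) * exp (- pi * \<bar>t\<bar> / 2)"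
  using Gamma_strip_bounds by blast
 define \<eta> where "\<eta> = Re w / cmod w"
 have w0: "cmod w > 0" using w by auto
 hence \<eta>: "\<eta> > 0" using w by (simp add: \<eta>_def)
 \<comment> \<open>\<open>W\<close> majorizes \<open>cmod w powr (- x)\<close> over the whole strip;
   which of its two terms does so depends on whether |w| \<ge> 1.\<close>
 define W where "W = cmod w powr (real K - 1/2) + cmod w powr (real K - 3/2)"
 define B where "B = (\<lambda>k::nat. C * W * ((real k + 2) * exp (- \<eta> * (real k + 1))))"
 have "(\<lambda>k::nat. (real k + 2) * exp (- \<eta> * (real k + 1))) \<longlonglongrightarrow> 0"
  using \<eta> by real_asymp
 hence lim: "B \<longlonglongrightarrow> 0" unfolding B_def by (rule tendsto_mult_right_zero)
 have key: "cmod (Gamma (Complex x t) * w powr (- Complex x t)) \<le> B k"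
  if x: "x \<in> {1/2 - real K..3/2 - real K}" and t: "\<bar>t\<bar> = real k + 1" for x t k
 proof -
  have "cmod (Gamma (Complex x t)) \<le> cmod (Gamma (Complex (x + real K) t))"
   using t by (intro Gamma_right_shift_bound) auto
  also have "\<dots> \<le> C * (1 + \<bar>t\<bar>) * exp (- pi * \<bar>t\<bar> / 2)" using x by (intro C(2)) auto
  finally have "cmod (Gamma (Complex x t) * w powr (- Complex x t)) \<le>
    C * (1 + \<bar>t\<bar>) * exp (- pi * \<bar>t\<bar> / 2) * cmod (w powr (- Complex x t))"
   unfolding norm_mult by (intro mult_right_mono) auto
  also have "\<dots> = C * (1 + \<bar>t\<bar>) * (cmod (w powr (- Complex x t)) * exp (- pi * \<bar>Im (Complex x t)\<bar> / 2))"
   by simp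
  also have "\<dots> \<le> C * (1 + \<bar>t\<bar>) * (cmod w powr (- Re (Complex x t)) * exp (- (Re w / cmod w) * \<bar>Im (Complex x t)\<bar>))"
   using C(1) by (intro mult_left_mono norm_powr_minus_bound w) auto
  also have "\<dots> = C * (1 + \<bar>t\<bar>) * (cmod w powr (- x) * exp (- \<eta> * \<bar>t\<bar>))" by (simp add: \<eta>_def)
  also have "cmod w powr (- x) \<le> W"
  proof (cases "cmod w \<ge> 1")
   case True
   hence "cmod w powr (- x) \<le> cmod w powr (real K - 1/2)" using x by (intro powr_mono) auto
   thus ?thesis by (simp add: W_def add_increasing2)
  next
   case False
   hence "cmod w powr (- x) \<le> cmod w powr (real K - 3/2)" using x w0 by (intro powr_mono') auto
   thus ?thesis by (simp add: W_def add_increasing)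
  qed
  hence "C * (1 + \<bar>t\<bar>) * (cmod w powr (- x) * exp (- \<eta> * \<bar>t\<bar>)) \<le> C * (1 + \<bar>t\<bar>) * (W * exp (- \<eta> * \<bar>t\<bar>))"
   using C(1) by (intro mult_left_mono mult_right_mono) auto
  also have "\<dots> = B k" by (simp add: B_def t)
  finally show ?thesis .
 qed
 show ?thesis by (intro exI[of _ B] conjI lim allI ballI key) auto
qed

lemma Mellin_shift_step:
 fixes w :: complex
 assumes w: "Re w > 0"
 defines "V \<equiv> \<lambda>K. integral\<^sup>L lborel (\<lambda>t. Gamma (Complex (1/2 - real K) t) * w powr (- Complex (1/2 - real K) t))"
 shows "V K - V (Suc K) = 2 * pi * ((- w) ^ K / fact K)"
proof -
 define f where "f = (\<lambda>s. Gamma s * w powr (- s))"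
 obtain B where B: "B \<longlonglongrightarrow> 0" "\<And>k x. x \<in> {1/2 - real (Suc K)..3/2 - real (Suc K)} ==>
   cmod (f (Complex x (real k + 1))) \<le> B k \<and> cmod (f (Complex x (- (real k + 1)))) \<le> B k"
  using Mellin_horizontal_bound[OF w, of "Suc K"] unfolding f_def by blast
 define a b where "a = 1/2 - real (Suc K)" and "b = 1/2 - real K"
 have ab: "a < b" by (simp add: a_def b_def)
 define S where "S = {s. Re s > - real K - 1} \<inter> {s. Re s < - real K + 1}"
 \<comment> \<open>The pole is cleared by hand: Gamma s = Gamma (s + K + 1) / pochhammer s (K + 1),
   and moving the last factor s + K to the other side leaves \<open>h\<close>, which is holomorphic
   near -K. Cauchy's integral formula then replaces the residue theorem.\<close>
 define h where "h = (\<lambda>s. Gamma (s + of_nat K + 1) / pochhammer s K * w powr (- s))"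
 have S: "convex S" "open S" unfolding S_def
  by (auto intro!: convex_Int convex_halfspace_Re_gt convex_halfspace_Re_lt open_Int open_halfspace_Re_gt open_halfspace_Re_lt)
 have w0: "w \<noteq> 0" using w by auto
 have pnz: "pochhammer s K \<noteq> 0" if "s \<in> S" for s
  using that by (auto simp: pochhammer_eq_0_iff S_def)
 have holh: "h holomorphic_on S" unfolding h_def using w0 pnz
  by (intro holomorphic_intros) (auto simp: S_def elim!: nonpos_Ints_cases simp: complex_eq_iff)
 have img: "path_image (rectpath (Complex a (- (real k + 1))) (Complex b (real k + 1))) \<subseteq> S - {- of_nat K}" for k
 proof
  fix z assume "z \<in> path_image (rectpath (Complex a (- (real k + 1))) (Complex b (real k + 1)))"
  note line_in_rectpath[OF ab _ this]
  thus "z \<in> S - {- of_nat K}" by (auto simp: S_def a_def b_def)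
 qed
 have feq: "f s = h s / (s - (- of_nat K))" if "s \<in> S - {- of_nat K}" for s
 proof -
  have sn: "s \<notin> \<int>\<^sub>\<le>\<^sub>0"
  proof
   assume "s \<in> \<int>\<^sub>\<le>\<^sub>0"
   then obtain n where n: "s = - of_nat n" by (auto elim!: nonpos_Ints_cases')
   hence "- real n > - real K - 1" "- real n < - real K + 1" using that by (auto simp: S_def)
   hence "n = K" by linarith
   thus False using that n by simp
  qed
  have "pochhammer s (Suc K) = Gamma (s + of_nat (Suc K)) / Gamma s" by (rule pochhammer_Gamma[OF sn])
  hence G: "Gamma (s + of_nat K + 1) = Gamma s * (pochhammer s K * (s - (- of_nat K)))"
   using Gamma_eq_zero_iff[of s] sn by (simp add: pochhammer_Suc field_simps)
  have "s - (- of_nat K) \<noteq> 0" using that by (auto simp: add_eq_0_iff)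
  thus ?thesis unfolding f_def h_def G using pnz[of s] that by simp
 qed
 have ci: "contour_integral (rectpath (Complex a (- (real k + 1))) (Complex b (real k + 1))) f = 2 * pi * \<i> * h (- of_nat K)" for k
 proof -
  let ?g = "rectpath (Complex a (- (real k + 1))) (Complex b (real k + 1))"
  have "((\<lambda>s. h s / (s - (- of_nat K))) has_contour_integral (2 * pi * \<i> * winding_number ?g (- of_nat K) * h (- of_nat K))) ?g"
  proof (rule Cauchy_integral_formula_convex_simple[OF S(1) holh])
   show "- of_nat K \<in> interior S" using S(2) by (simp add: interior_open) (simp add: S_def)
  qed (use img in auto)
  moreover have "winding_number ?g (- of_nat K) = 1"
   by (rule winding_number_rectpath) (auto simp: in_box_complex_iff a_def b_def)
  moreover have "contour_integral ?g f = contour_integral ?g (\<lambda>s. h s / (s - (- of_nat K)))"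
   using img[of k] by (intro contour_integral_eq feq) auto
  ultimately show ?thesis by (simp add: contour_integral_unique)
 qed
 have cont: "continuous_on (path_image (rectpath (Complex a (- (real k + 1))) (Complex b (real k + 1)))) f" for k
 proof -
  have "continuous_on (S - {- of_nat K}) (\<lambda>s. h s / (s - (- of_nat K)))"
   using holomorphic_on_imp_continuous_on[OF holh]
   by (intro continuous_intros) (auto elim: continuous_on_subset simp: add_eq_0_iff)
  hence "continuous_on (S - {- of_nat K}) f" using feq by (subst continuous_on_cong[OF refl feq]) auto
  thus ?thesis using img continuous_on_subset by blast
 qed
 have "integral\<^sup>L lborel (\<lambda>t. f (Complex b t)) - integral\<^sup>L lborel (\<lambda>t. f (Complex a t)) = - \<i> * (2 * pi * \<i> * h (- of_nat K))"
 proof (rule line_integral_shift[OF ab _ _ cont ci tendsto_const])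
  show "integrable lborel (\<lambda>t. f (Complex a t))" "integrable lborel (\<lambda>t. f (Complex b t))"
   unfolding f_def a_def b_def by (intro Mellin_line_integrable w)+
  show "filterlim (\<lambda>k. real k + 1) at_top sequentially" by real_asymp
  show "B \<longlonglongrightarrow> 0" by fact
  show "cmod (f (Complex x (real k + 1))) \<le> B k \<and> cmod (f (Complex x (- (real k + 1)))) \<le> B k" if "x \<in> {a..b}" for k x
   using B(2)[of x k] that by (simp add: a_def b_def)
 qed auto
 moreover have "h (- of_nat K) = (- w) ^ K / fact K"
 proof -
  have "w powr of_nat K = w ^ K" using w0 by (simp add: powr_nat')
  moreover have "inverse ((- 1 :: complex) ^ K) = (- 1) ^ K" by (simp add: power_inverse flip: power_inverse)
  ultimately show ?thesis
   unfolding h_def pochhammer_same power_minus[of w] by (simp add: divide_inverse mult_ac)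
 qed
 moreover have "- \<i> * (2 * pi * \<i> * x) = 2 * pi * x" for x :: complex by (simp add: algebra_simps)
 ultimately have "integral\<^sup>L lborel (\<lambda>t. f (Complex b t)) - integral\<^sup>L lborel (\<lambda>t. f (Complex a t)) = 2 * pi * ((- w) ^ K / fact K)"
  by metis
 thus ?thesis unfolding V_def f_def a_def b_def .
qed

theorem Cahen_Mellin:
 fixes w :: complex
 assumes w: "Re w > 0"
 shows "integrable lborel (\<lambda>t. Gamma (Complex (3/2) t) * w powr (- Complex (3/2) t))" (is "integrable _ ?F")
  and "integral\<^sup>L lborel (\<lambda>t. Gamma (Complex (3/2) t) * w powr (- Complex (3/2) t)) = 2 * pi * exp (- w)"
proof -
 define f where "f = (\<lambda>s. Gamma s * w powr (- s))"
 define V where "V = (\<lambda>K. integral\<^sup>L lborel (\<lambda>t. Gamma (Complex (1/2 - real K) t) * w powr (- Complex (1/2 - real K) t)))"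
 have w0: "cmod w > 0" using w by auto
 have "V 0 = 2 * pi * (\<Sum>k<K. (- w) ^ k / fact k) + V K" for K
 proof (induction K)
  case (Suc K)
  thus ?case using Mellin_shift_step[OF w, of K] by (simp add: V_def algebra_simps)
 qed simp
 hence "(\<lambda>K. V 0) = (\<lambda>K. 2 * pi * (\<Sum>k<K. (- w) ^ k / fact k) + V K)" by (intro ext)
 moreover have "(\<lambda>K. 2 * pi * (\<Sum>k<K. (- w) ^ k / fact k) + V K) \<longlonglongrightarrow> 2 * pi * exp (- w) + 0"
 proof (intro tendsto_intros)
  have "(\<lambda>k. (- w) ^ k /\<^sub>R fact k) sums exp (- w)" by (rule exp_converges)
  thus "(\<lambda>K. \<Sum>k<K. (- w) ^ k / fact k) \<longlonglongrightarrow> exp (- w)"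
   by (simp add: sums_def scaleR_conv_of_real divide_inverse mult.commute)
  define c where "c = sqrt (2 * pi) * (2 / (Re w / cmod w)) * cmod w powr (- 1/2)"
  have c0: "c \<ge> 0" unfolding c_def using w by (intro mult_nonneg_nonneg) auto
  have bd: "norm (V K) \<le> 2 * c * cmod w * (cmod w ^ (K - 1) /\<^sub>R fact (K - 1))" if K1: "K \<ge> 1" for K
  proof -
   obtain j where K: "K = Suc j" using K1 by (cases K) auto
   \<comment> \<open>The product (1/2)(3/2)...(K - 1/2) is compared with (1/2) 1 2 ... (K - 1). This
     costs one index: the bound for \<open>V K\<close> is the term K - 1 of an exponential
     series.\<close>
   have poch: "pochhammer (1/2) K \<ge> (fact j / 2 :: real)"
   proof -
    have "(\<Prod>i=0..<j. 1 + real i) \<le> (\<Prod>i=0..<j. 1/2 + 1 + real i)" by (intro prod_mono) auto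
    hence "fact j \<le> pochhammer (1/2 + 1 :: real) j"
     unfolding pochhammer_prod pochhammer_fact by (simp only: add.assoc)
    hence "fact j / 2 \<le> 1/2 * pochhammer (1/2 + 1 :: real) j" by linarith
    thus ?thesis unfolding K pochhammer_rec .
   qed
   have "norm (V K) \<le> sqrt (2 * pi) * (2 / (Re w / cmod w)) * cmod w powr (real K - 1/2) / pochhammer (1/2) K"
    unfolding V_def by (rule Mellin_line_integrable(2)[OF w])
   also have "cmod w powr (real K - 1/2) = cmod w powr (- 1/2) * cmod w ^ K"
    using powr_add[of "cmod w" "- 1/2" "real K"] powr_realpow[OF w0, of K] by simp
   also have "sqrt (2 * pi) * (2 / (Re w / cmod w)) * (cmod w powr (- 1/2) * cmod w ^ K) / pochhammer (1/2) K = c * cmod w ^ K / pochhammer (1/2) K"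
    unfolding c_def by (simp only: mult.assoc)
   also have "\<dots> \<le> c * cmod w ^ K / (fact j / 2)"
    using poch c0 by (intro divide_left_mono mult_nonneg_nonneg mult_pos_pos pochhammer_pos) auto
   also have "\<dots> = 2 * c * cmod w * (cmod w ^ (K - 1) /\<^sub>R fact (K - 1))"
    by (simp add: K field_simps)
   finally show ?thesis .
  qed
  have "(\<lambda>k. cmod w ^ k /\<^sub>R fact k) \<longlonglongrightarrow> 0"
   by (rule summable_LIMSEQ_zero[OF summable_exp_generic])
  hence "(\<lambda>k. cmod w ^ (Suc k - 1) /\<^sub>R fact (Suc k - 1)) \<longlonglongrightarrow> 0" by simp
  hence "(\<lambda>k. cmod w ^ (k - 1) /\<^sub>R fact (k - 1)) \<longlonglongrightarrow> 0" by (rule LIMSEQ_imp_Suc)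
  hence "(\<lambda>k. 2 * c * cmod w * (cmod w ^ (k - 1) /\<^sub>R fact (k - 1))) \<longlonglongrightarrow> 0" by (rule tendsto_mult_right_zero)
  moreover have "\<forall>\<^sub>F K in sequentially. norm (V K) \<le> 2 * c * cmod w * (cmod w ^ (K - 1) /\<^sub>R fact (K - 1))"
   using bd by (intro eventually_sequentiallyI[of 1]) blast
  ultimately show "V \<longlonglongrightarrow> 0" by (intro Lim_null_comparison[of V])
 qed
 ultimately have "(\<lambda>K::nat. V 0) \<longlonglongrightarrow> 2 * pi * exp (- w)" by simp
 hence V0: "V 0 = 2 * pi * exp (- w)" by (simp add: LIMSEQ_const_iff)
 have hol: "f holomorphic_on {s. Re s > 0}" unfolding f_def
  by (rule holomorphic_on_subset[OF Mellin_integrand_holomorphic[OF w]]) (auto dest: Re_pos_notin_nonpos_Ints)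
 have Ccont: "continuous_on A (\<lambda>t. Complex c t)" for A c
  by (simp add: Complex_eq) (intro continuous_intros)
 have cont: "continuous_on UNIV (\<lambda>t. f (Complex (3/2) t))"
  by (rule continuous_on_compose2[OF holomorphic_on_imp_continuous_on[OF hol] Ccont]) auto
 obtain C where C: "C > 0" "\<And>\<sigma> t. 1/4 \<le> \<sigma> ==> \<sigma> \<le> 3/2 ==> cmod (Gamma (Complex \<sigma> t)) \<le> C * (1 + \<bar>t\<bar>) * exp (- pi * \<bar>t\<bar> / 2)"
  using Gamma_strip_bounds by blast
 define \<eta> where "\<eta> = Re w / cmod w"
 have \<eta>: "\<eta> > 0" using w w0 by (simp add: \<eta>_def)
 have int: "integrable lborel (\<lambda>t. f (Complex (3/2) t))"
 proof (rule integrable_lborel_dominated[OF cont])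
  define c where "c = C * (1 + 2 / \<eta>) * cmod w powr (- 3/2)"
  show "integrable lborel (\<lambda>t. c * exp (- (\<eta> / 2) * \<bar>t\<bar>))" using integrable_exp_abs(1)[of "\<eta>/2"] \<eta> by simp
  fix t
  have "cmod (f (Complex (3/2) t)) \<le> C * (1 + \<bar>t\<bar>) * exp (- pi * \<bar>t\<bar> / 2) * cmod (w powr (- Complex (3/2) t))"
   unfolding f_def norm_mult by (intro mult_right_mono C(2)) auto
  also have "\<dots> = C * (1 + \<bar>t\<bar>) * (cmod (w powr (- Complex (3/2) t)) * exp (- pi * \<bar>Im (Complex (3/2) t)\<bar> / 2))"
   by simp
  also have "\<dots> \<le> C * (1 + \<bar>t\<bar>) * (cmod w powr (- Re (Complex (3/2) t)) * exp (- (Re w / cmod w) * \<bar>Im (Complex (3/2) t)\<bar>))"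
   using C(1) by (intro mult_left_mono norm_powr_minus_bound w) auto
  also have "\<dots> = C * cmod w powr (- 3/2) * ((1 + \<bar>t\<bar>) * exp (- (\<eta>/2) * \<bar>t\<bar>) * exp (- (\<eta>/2) * \<bar>t\<bar>))"
   by (simp add: \<eta>_def mult_ac flip: exp_add)
  also have "(1 + \<bar>t\<bar>) * exp (- (\<eta>/2) * \<bar>t\<bar>) \<le> 1 + 2 / \<eta>"
  proof -
   have "1 + \<bar>t\<bar> \<le> (1 + 2 / \<eta>) * (1 + (\<eta>/2) * \<bar>t\<bar>)" using \<eta> by (simp add: field_simps)
   also have "\<dots> \<le> (1 + 2 / \<eta>) * exp ((\<eta>/2) * \<bar>t\<bar>)"
    using \<eta> by (intro mult_left_mono exp_ge_add_one_self) auto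
   finally have "(1 + \<bar>t\<bar>) * exp (- (\<eta>/2) * \<bar>t\<bar>) \<le> (1 + 2 / \<eta>) * exp ((\<eta>/2) * \<bar>t\<bar>) * exp (- (\<eta>/2) * \<bar>t\<bar>)"
    by (intro mult_right_mono) auto
   thus ?thesis by (simp add: mult.assoc flip: exp_add)
  qed
  hence "C * cmod w powr (- 3/2) * ((1 + \<bar>t\<bar>) * exp (- (\<eta>/2) * \<bar>t\<bar>) * exp (- (\<eta>/2) * \<bar>t\<bar>))
    \<le> C * cmod w powr (- 3/2) * ((1 + 2 / \<eta>) * exp (- (\<eta>/2) * \<bar>t\<bar>))"
   using C(1) by (intro mult_left_mono mult_right_mono) auto
  finally show "cmod (f (Complex (3/2) t)) \<le> c * exp (- (\<eta> / 2) * \<bar>t\<bar>)" by (simp add: c_def mult_ac)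
 qed
 thus "integrable lborel ?F" by (simp add: f_def)
 obtain B where B: "B \<longlonglongrightarrow> 0" "\<And>k x. x \<in> {1/2 - real 0..3/2 - real 0} ==>
   cmod (f (Complex x (real k + 1))) \<le> B k \<and> cmod (f (Complex x (- (real k + 1)))) \<le> B k"
  using Mellin_horizontal_bound[OF w, of 0] unfolding f_def by blast
 have img: "path_image (rectpath (Complex (1/2) (- (real k + 1))) (Complex (3/2) (real k + 1))) \<subseteq> {s. Re s > 0}" for k
 proof
  fix z assume "z \<in> path_image (rectpath (Complex (1/2) (- (real k + 1))) (Complex (3/2) (real k + 1)))"
  from line_in_rectpath(1)[OF _ _ this] show "z \<in> {s. Re s > 0}" by simp
 qed
 have "integral\<^sup>L lborel (\<lambda>t. f (Complex (3/2) t)) - integral\<^sup>L lborel (\<lambda>t. f (Complex (1/2) t)) = - \<i> * 0"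
 proof (rule line_integral_shift[where T = "\<lambda>k. real k + 1" and I = "\<lambda>_. 0" and B = B])
  show "integrable lborel (\<lambda>t. f (Complex (1/2) t))"
   using Mellin_line_integrable(1)[OF w, of 0] by (simp add: f_def)
  show "continuous_on (path_image (rectpath (Complex (1/2) (- (real k + 1))) (Complex (3/2) (real k + 1)))) f" for k
   by (rule holomorphic_on_imp_continuous_on[OF holomorphic_on_subset[OF hol img]])
  show "contour_integral (rectpath (Complex (1/2) (- (real k + 1))) (Complex (3/2) (real k + 1))) f = 0" for k
   using img by (intro contour_integral_unique Cauchy_theorem_convex_simple[OF hol convex_halfspace_Re_gt]) auto
  show "filterlim (\<lambda>k. real k + 1) at_top sequentially" by real_asymp
  show "cmod (f (Complex x (real k + 1))) \<le> B k \<and> cmod (f (Complex x (- (real k + 1)))) \<le> B k" if "x \<in> {1/2..3/2}" for k x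
   using B(2)[of x k] that by simp
 qed (use int B in auto)
 thus "integral\<^sup>L lborel ?F = 2 * pi * exp (- w)"
  using V0 by (simp add: V_def f_def)
qed

section \<open>Analytic continuation of Dirichlet L-functions\<close>

text \<open>A q-periodic function on [1, \<infinity>) is encoded by its pieces: \<open>g n u\<close>
  is its value at n + 1 + u. Each piece is continuous on the closed unit interval, which admits
  jumps at the integers, as a summatory function has them.\<close>

definition mean_zero_periodic :: "nat => (nat => real => complex) => bool" where
 "mean_zero_periodic q g \<longleftrightarrow> q > 0 \<and> (\<forall>n. continuous_on {0..1} (g n)) \<and> (\<forall>n u. g (n + q) u = g n u) \<and>
   (\<Sum>n<q. integral {0..1} (g n)) = 0"

text \<open>The integral of g(x) x^(-s-1) over x \<ge> 1, cut at the integers.\<close>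

definition periodic_Mellin :: "(nat => real => complex) => complex => complex" where
 "periodic_Mellin g s = (\<Sum>n. integral {0..1} (\<lambda>u. g n u * of_real (real (Suc n) + u) powr (- s - 1)))"

lemma periodic_mod:
 fixes g :: "nat => 'a"
 assumes "\<And>n. g (n + q) = g n"
 shows "g n = g (n mod q)"
proof -
 have "g (m + k * q) = g m" for m k
 proof (induction k)
  case (Suc k)
  have "g (m + Suc k * q) = g ((m + k * q) + q)" by (simp add: algebra_simps)
  thus ?case using assms Suc by simp
 qed simp
 from this[of "n mod q" "n div q"] show ?thesis by simp
qed

lemma mean_zero_periodic_bounded:
 assumes "mean_zero_periodic q g"
 shows "\<exists>G\<ge>0. \<forall>n. \<forall>u\<in>{0..1}. cmod (g n u) \<le> G"
proof -
 have "\<exists>G. \<forall>u\<in>{0..1}. cmod (g n u) \<le> G" for n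
 proof -
  have "bounded (g n ` {0..1})"
   using assms by (intro compact_imp_bounded compact_continuous_image) (auto simp: mean_zero_periodic_def)
  thus ?thesis by (auto simp: bounded_iff)
 qed
 then obtain G where G: "\<And>n u. u \<in> {0..1} ==> cmod (g n u) \<le> G n" by metis
 have q: "q > 0" using assms by (simp add: mean_zero_periodic_def)
 have "cmod (g n u) \<le> (\<Sum>k<q. \<bar>G k\<bar>)" if "u \<in> {0..1}" for n u
 proof -
  have "g n = g (n mod q)" using assms by (intro periodic_mod) (auto simp: mean_zero_periodic_def)
  hence "cmod (g n u) \<le> \<bar>G (n mod q)\<bar>" using G[OF that, of "n mod q"] by simp
  also have "\<dots> \<le> (\<Sum>k<q. \<bar>G k\<bar>)" using q by (intro member_le_sum) auto
  finally show ?thesis .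
 qed
 thus ?thesis by (intro exI[of _ "\<Sum>k<q. \<bar>G k\<bar>"]) (auto intro: sum_nonneg)
qed

lemma shift_powr_continuous: "continuous_on {0..1} (\<lambda>u. complex_of_real (real (Suc n) + u) powr c)"
proof -
 have "complex_of_real (real (Suc n) + u) \<noteq> 0" if "u \<in> {0..1}" for u
  using that unfolding of_real_eq_0_iff by auto
 thus ?thesis by (intro continuous_on_powr_complex continuous_intros) auto
qed

lemma shift_powr_deriv:
 assumes "u \<in> {0..1}"
 shows "((\<lambda>u. complex_of_real (real (Suc n) + u) powr c) has_vector_derivative
      c * complex_of_real (real (Suc n) + u) powr (c - 1)) (at u within {0..1})"
proof -
 have "((\<lambda>w. (of_nat (Suc n) + w) powr c) has_field_derivative c * (of_nat (Suc n) + of_real u) powr (c - 1)) (at (of_real u))"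
  using assms by (auto intro!: derivative_eq_intros simp: complex_nonpos_Reals_iff)
 from has_vector_derivative_real_field[OF this, of "{0..1}"] show ?thesis by simp
qed

lemma norm_shift_powr_le:
 assumes "u \<in> {0..1}" "Re c \<le> 0"
 shows "cmod (complex_of_real (real (Suc n) + u) powr c) \<le> real (Suc n) powr Re c"
 using assms by (subst norm_powr_real_powr) (auto intro!: powr_mono2')

lemma periodic_Mellin_term_bound:
 assumes "continuous_on {0..1} (g n)" "\<And>u. u \<in> {0..1} ==> cmod (g n u) \<le> G" "Re s \<ge> -1"
 shows "cmod (integral {0..1} (\<lambda>u. g n u * of_real (real (Suc n) + u) powr (- s - 1))) \<le> G * real (Suc n) powr (- Re s - 1)"
proof -
 have "cmod (integral {0..1} (\<lambda>u. g n u * of_real (real (Suc n) + u) powr (- s - 1))) \<le> (G * real (Suc n) powr (- Re s - 1)) * (1 - 0)"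
 proof (rule integral_bound)
  show "continuous_on {0..1} (\<lambda>u. g n u * of_real (real (Suc n) + u) powr (- s - 1))"
   by (intro continuous_on_mult assms(1) shift_powr_continuous)
  fix u :: real assume u: "u \<in> {0..1}"
  have "cmod (g n u) * cmod (complex_of_real (real (Suc n) + u) powr (- s - 1)) \<le> G * real (Suc n) powr Re (- s - 1)"
   using assms(3) order_trans[OF norm_ge_zero assms(2)[OF u]]
   by (intro mult_mono assms(2) u norm_shift_powr_le) auto
  thus "cmod (g n u * of_real (real (Suc n) + u) powr (- s - 1)) \<le> G * real (Suc n) powr (- Re s - 1)"
   by (simp add: norm_mult)
 qed auto
 thus ?thesis by simp
qed

lemma summable_Suc_powr: "x < -1 ==> summable (\<lambda>n. real (Suc n) powr x)"
 using summable_real_powr_iff[of x] summable_Suc_iff[of "\<lambda>n. real n powr x"] by simp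

lemma periodic_Mellin_summable:
 assumes "mean_zero_periodic q g" "Re s > 0"
 shows "summable (\<lambda>n. integral {0..1} (\<lambda>u. g n u * of_real (real (Suc n) + u) powr (- s - 1)))"
proof -
 obtain G where G: "\<And>n u. u \<in> {0..1} ==> cmod (g n u) \<le> G" using mean_zero_periodic_bounded[OF assms(1)] by blast
 show ?thesis
 proof (rule summable_comparison_test')
  show "summable (\<lambda>n. G * real (Suc n) powr (- Re s - 1))" using assms(2) by (intro summable_mult summable_Suc_powr) auto
  show "norm (integral {0..1} (\<lambda>u. g n u * of_real (real (Suc n) + u) powr (- s - 1))) \<le> G * real (Suc n) powr (- Re s - 1)" for n
   using assms by (intro periodic_Mellin_term_bound G) (auto simp: mean_zero_periodic_def)
 qed
qed

lemma periodic_Mellin_bound: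
 assumes "mean_zero_periodic q g" "\<And>n u. u \<in> {0..1} ==> cmod (g n u) \<le> G" "Re s \<ge> 1/16"
 shows "cmod (periodic_Mellin g s) \<le> G * (\<Sum>n. real (Suc n) powr (- 17/16))"
proof -
 have G0: "G \<ge> 0" using order_trans[OF norm_ge_zero assms(2)[of 0 0]] by simp
 have "cmod (periodic_Mellin g s) \<le> (\<Sum>n. G * real (Suc n) powr (- 17/16))"
  unfolding periodic_Mellin_def
 proof (rule norm_suminf_le)
  show "summable (\<lambda>n. G * real (Suc n) powr (- 17/16))" by (intro summable_mult summable_Suc_powr) auto
  fix n
  have "cmod (integral {0..1} (\<lambda>u. g n u * of_real (real (Suc n) + u) powr (- s - 1))) \<le> G * real (Suc n) powr (- Re s - 1)"
   using assms by (intro periodic_Mellin_term_bound) (auto simp: mean_zero_periodic_def)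
  also have "\<dots> \<le> G * real (Suc n) powr (- 17/16)" using G0 assms(3) by (intro mult_left_mono powr_mono) auto
  finally show "cmod (integral {0..1} (\<lambda>u. g n u * of_real (real (Suc n) + u) powr (- s - 1))) \<le> G * real (Suc n) powr (- 17/16)" .
 qed
 also have "\<dots> = G * (\<Sum>n. real (Suc n) powr (- 17/16))" by (intro suminf_mult summable_Suc_powr) auto
 finally show ?thesis .
qed

lemma periodic_Mellin_holomorphic:
 assumes g: "mean_zero_periodic q g"
 shows "periodic_Mellin g holomorphic_on {s. Re s > 0}"
proof (rule holomorphic_uniform_sequence)
 let ?t = "\<lambda>n s. integral {0..1} (\<lambda>u. g n u * of_real (real (Suc n) + u) powr (- s - 1))"
 show "open {s. Re s > 0}" by (rule open_halfspace_Re_gt)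
 have gc: "continuous_on {0..1} (g n)" for n using g by (simp add: mean_zero_periodic_def)
 have th: "?t n holomorphic_on {s. Re s > 0}" for n
 proof -
  have "(\<lambda>s. integral (cbox 0 1) (\<lambda>u. g n u * of_real (real (Suc n) + u) powr (- s - 1))) holomorphic_on {s. Re s > 0}"
  proof (rule leibniz_rule_holomorphic[where fx = "\<lambda>s u. - (g n u * (of_real (real (Suc n) + u) powr (- s - 1) * Ln (of_real (real (Suc n) + u))))"])
   fix s u assume su: "s \<in> {s. Re s > 0}" "u \<in> cbox 0 (1::real)"
   have nz: "complex_of_real (real (Suc n) + u) \<noteq> 0" using su by (simp only: of_real_eq_0_iff) auto
   show "((\<lambda>s. g n u * complex_of_real (real (Suc n) + u) powr (- s - 1)) has_field_derivative
     - (g n u * (of_real (real (Suc n) + u) powr (- s - 1) * Ln (of_real (real (Suc n) + u))))) (at s within {s. Re s > 0})"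
    unfolding powr_def using nz by (auto intro!: derivative_eq_intros)
  next
   show "(\<lambda>u. g n u * complex_of_real (real (Suc n) + u) powr (- s - 1)) integrable_on cbox 0 1" for s
    using continuous_on_mult[OF gc shift_powr_continuous] by (intro integrable_continuous) simp
  next
   have nz: "complex_of_real (real (Suc n) + u) \<notin> \<real>\<^sub>\<le>\<^sub>0" if "u \<in> {0..1}" for u
    using that by (auto simp: complex_nonpos_Reals_iff)
   hence nz': "complex_of_real (real (Suc n) + u) \<noteq> 0" if "u \<in> {0..1}" for u
    using that unfolding of_real_eq_0_iff by auto
   have gs: "continuous_on ({s. 0 < Re s} \<times> cbox 0 1) (\<lambda>x. g n (snd x))"
    by (rule continuous_on_compose2[OF gc]) (auto intro!: continuous_intros)
   show "continuous_on ({s. Re s > 0} \<times> cbox 0 1) (\<lambda>(s, u). - (g n u * (of_real (real (Suc n) + u) powr (- s - 1) * Ln (of_real (real (Suc n) + u)))))"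
    unfolding case_prod_beta
    by (intro continuous_on_minus continuous_on_mult gs continuous_on_powr_complex continuous_on_Ln' continuous_intros)
      (use nz nz' in \<open>auto simp: mem_Times_iff simp del: of_real_add of_nat_Suc\<close>)
  next
   show "convex {s. Re s > 0}" by (rule convex_halfspace_Re_gt)
  qed
  thus ?thesis by simp
 qed
 show "(\<lambda>s. \<Sum>n<N. ?t n s) holomorphic_on {s. Re s > 0}" for N
  by (intro holomorphic_on_sum th)
 fix s assume s: "s \<in> {s. Re s > 0}"
 obtain G where G: "G \<ge> 0" "\<And>n u. u \<in> {0..1} ==> cmod (g n u) \<le> G" using mean_zero_periodic_bounded[OF g] by blast
 define d where "d = Re s / 2"
 have sub: "Re z \<ge> d" if "z \<in> cball s d" for z
 proof -
  have "\<bar>Re (s - z)\<bar> \<le> d" using that abs_Re_le_cmod[of "s - z"] by (simp add: dist_norm)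
  hence "Re s - Re z \<le> Re s / 2" unfolding d_def using abs_le_D1 by fastforce
  thus ?thesis by (simp add: d_def)
 qed
 have d: "d > 0" using s by (simp add: d_def)
 have "uniform_limit (cball s d) (\<lambda>N s. \<Sum>n<N. ?t n s) (\<lambda>s. \<Sum>n. ?t n s) sequentially"
 proof (rule Weierstrass_m_test)
  show "summable (\<lambda>n. G * real (Suc n) powr (- d - 1))" using d by (intro summable_mult summable_Suc_powr) auto
  fix n z assume z: "z \<in> cball s d"
  have "norm (?t n z) \<le> G * real (Suc n) powr (- Re z - 1)"
   using sub[OF z] d by (intro periodic_Mellin_term_bound gc G) auto
  also have "\<dots> \<le> G * real (Suc n) powr (- d - 1)" using sub[OF z] G(1) by (intro mult_left_mono powr_mono) auto
  finally show "norm (?t n z) \<le> G * real (Suc n) powr (- d - 1)" .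
 qed
 moreover have "cball s d \<subseteq> {s. Re s > 0}" using sub d by force
 ultimately show "\<exists>d>0. cball s d \<subseteq> {s. Re s > 0} \<and> uniform_limit (cball s d) (\<lambda>N s. \<Sum>n<N. ?t n s) (periodic_Mellin g) sequentially"
  using d unfolding periodic_Mellin_def by blast
qed

text \<open>Mean value zero makes an antiderivative periodic again, and its free constant
  \<open>K\<close> is chosen so that it has mean value zero too. The procedure can therefore be
  repeated, and each round gains a vertical strip of width 1.\<close>

lemma periodic_Mellin_by_parts:
 assumes g: "mean_zero_periodic q g"
 obtains K P where "mean_zero_periodic q P" "\<And>s. Re s > 0 ==> periodic_Mellin g s = - K + (s + 1) * periodic_Mellin P (s + 1)"
proof -
 have q: "q > 0" and gc: "continuous_on {0..1} (g n)" and gper: "g (n + q) = g n"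
  and gmz: "(\<Sum>n<q. integral {0..1} (g n)) = 0" for n
  using g by (auto simp: mean_zero_periodic_def)
 define P0 where "P0 = (\<lambda>n u. (\<Sum>k<n. integral {0..1} (g k)) + integral {0..u} (g n))"
 define K where "K = - (\<Sum>n<q. integral {0..1} (P0 n)) / of_nat q"
 define P where "P = (\<lambda>n u. P0 n u + K)"
 have P0c: "continuous_on {0..1} (P0 n)" for n unfolding P0_def
  by (intro continuous_intros indefinite_integral_continuous_1 integrable_continuous_interval gc)
 hence Pc: "continuous_on {0..1} (P n)" for n unfolding P_def by (intro continuous_intros)
 have "(\<Sum>k<n+q. integral {0..1} (g k)) = (\<Sum>k<n. integral {0..1} (g k))" for n
 proof (induction n)
  case 0 thus ?case using gmz by simp
 next
  case (Suc n) thus ?case by (simp add: gper)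
 qed
 hence Pper: "P (n + q) u = P n u" for n u by (simp add: P_def P0_def gper)
 have "(\<Sum>n<q. integral {0..1} (P n)) = (\<Sum>n<q. integral {0..1} (P0 n) + K)"
  unfolding P_def by (intro sum.cong refl) (simp add: integral_add integrable_continuous_interval P0c)
 also have "\<dots> = 0" using q unfolding sum.distrib by (simp add: K_def)
 finally have Pm: "mean_zero_periodic q P" using q Pc Pper by (simp add: mean_zero_periodic_def)
 have Pd: "(P n has_vector_derivative g n u) (at u within {0..1})" if "u \<in> {0..1}" for n u
  unfolding P_def P0_def
  by (rule has_vector_derivative_eq_rhs, rule derivative_intros, rule derivative_intros, rule derivative_intros,
    rule integral_has_vector_derivative[OF gc that], rule derivative_intros) simp
 have join: "P n 1 = P (Suc n) 0" and P00: "P 0 0 = K" for n by (simp_all add: P_def P0_def)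
 obtain G where G: "G \<ge> 0" "\<And>n u. u \<in> {0..1} ==> cmod (P n u) \<le> G" using mean_zero_periodic_bounded[OF Pm] by blast
 have "periodic_Mellin g s = - K + (s + 1) * periodic_Mellin P (s + 1)" if s: "Re s > 0" for s
 proof -
  define a where "a = (\<lambda>n. P n 0 * complex_of_real (real (Suc n)) powr (- s - 1))"
  have parts: "integral {0..1} (\<lambda>u. g n u * of_real (real (Suc n) + u) powr (- s - 1)) =
    (a (Suc n) - a n) + (s + 1) * integral {0..1} (\<lambda>u. P n u * of_real (real (Suc n) + u) powr (- (s + 1) - 1))" for n
  proof -
   let ?x = "\<lambda>u. complex_of_real (real (Suc n) + u)"
   have "((\<lambda>u. P n u * ((- s - 1) * ?x u powr (- s - 1 - 1)) + g n u * ?x u powr (- s - 1)) has_integral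
     (P n 1 * ?x 1 powr (- s - 1) - P n 0 * ?x 0 powr (- s - 1))) {0..1}"
    by (intro fundamental_theorem_of_calculus has_vector_derivative_mult Pd shift_powr_deriv) auto
   hence 1: "integral {0..1} (\<lambda>u. P n u * ((- s - 1) * ?x u powr (- s - 1 - 1)) + g n u * ?x u powr (- s - 1)) = a (Suc n) - a n"
    unfolding a_def join by (intro integral_unique) (simp add: add_ac)
   have i1: "(\<lambda>u. P n u * ((- s - 1) * ?x u powr (- s - 1 - 1))) integrable_on {0..1}"
    by (intro integrable_continuous_interval continuous_on_mult Pc shift_powr_continuous continuous_on_const)
   have i2: "(\<lambda>u. g n u * ?x u powr (- s - 1)) integrable_on {0..1}"
    by (intro integrable_continuous_interval continuous_on_mult gc shift_powr_continuous)
   have "integral {0..1} (\<lambda>u. P n u * ((- s - 1) * ?x u powr (- s - 1 - 1))) =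
     integral {0..1} (\<lambda>u. (- (s + 1)) * (P n u * ?x u powr (- (s + 1) - 1)))"
    by (intro integral_cong) (simp add: algebra_simps)
   also have "\<dots> = - (s + 1) * integral {0..1} (\<lambda>u. P n u * ?x u powr (- (s + 1) - 1))"
    by (simp only: integral_mult_right)
   finally have 2: "integral {0..1} (\<lambda>u. P n u * ((- s - 1) * ?x u powr (- s - 1 - 1))) =
     - (s + 1) * integral {0..1} (\<lambda>u. P n u * ?x u powr (- (s + 1) - 1))" .
   have gen: "- (s + 1) * J + I = D ==> I = D + (s + 1) * J" for I J D by (auto simp: algebra_simps)
   from 1 show ?thesis unfolding integral_add[OF i1 i2] 2 by (rule gen)
  qed
  \<comment> \<open>The pieces of \<open>P\<close> join continuously, so the boundary terms
    telescope and only the value \<open>K\<close> of \<open>P\<close> at x = 1 survives.\<close>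
  have alim: "a \<longlonglongrightarrow> 0"
  proof (rule Lim_null_comparison)
   show "\<forall>\<^sub>F n in sequentially. norm (a n) \<le> G * real (Suc n) powr (- Re s - 1)"
   proof (rule always_eventually, rule allI)
    fix n
    have "norm (a n) = cmod (P n 0) * cmod (complex_of_real (real (Suc n) + 0) powr (- s - 1))" by (simp add: a_def norm_mult)
    also have "\<dots> \<le> G * real (Suc n) powr (Re (- s - 1))" using s G by (intro mult_mono G norm_shift_powr_le) auto
    finally show "norm (a n) \<le> G * real (Suc n) powr (- Re s - 1)" by simp
   qed
   show "(\<lambda>n. G * real (Suc n) powr (- Re s - 1)) \<longlonglongrightarrow> 0"
    using s by (intro summable_LIMSEQ_zero summable_mult summable_Suc_powr) auto
  qed
  have "(\<lambda>n. a (Suc n) - a n) sums (0 - a 0)" by (rule telescope_sums[OF alim])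
  moreover have "(\<lambda>n. (s + 1) * integral {0..1} (\<lambda>u. P n u * of_real (real (Suc n) + u) powr (- (s + 1) - 1))) sums ((s + 1) * periodic_Mellin P (s + 1))"
   unfolding periodic_Mellin_def using s by (intro sums_mult summable_sums periodic_Mellin_summable[OF Pm]) auto
  ultimately have "(\<lambda>n. integral {0..1} (\<lambda>u. g n u * of_real (real (Suc n) + u) powr (- s - 1))) sums ((0 - a 0) + (s + 1) * periodic_Mellin P (s + 1))"
   unfolding parts by (rule sums_add)
  hence "periodic_Mellin g s = (0 - a 0) + (s + 1) * periodic_Mellin P (s + 1)"
   unfolding periodic_Mellin_def by (rule sums_unique[symmetric])
  moreover have "a 0 = K" by (simp add: a_def P00)
  ultimately show ?thesis by simp
 qed
 with Pm show ?thesis using that by blast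
qed

lemma periodic_Mellin_continuation_halfplane:
 assumes "mean_zero_periodic q g"
 shows "\<exists>f. f holomorphic_on {s. Re s > - real k} \<and> (\<forall>s. Re s > 0 --> f s = periodic_Mellin g s)"
 using assms
proof (induction k arbitrary: g)
 case 0
 thus ?case using periodic_Mellin_holomorphic by (intro exI[of _ "periodic_Mellin g"]) auto
next
 case (Suc k)
 obtain K P where P: "mean_zero_periodic q P" "\<And>s. Re s > 0 ==> periodic_Mellin g s = - K + (s + 1) * periodic_Mellin P (s + 1)"
  using periodic_Mellin_by_parts[OF Suc.prems] by blast
 obtain f where f: "f holomorphic_on {s. Re s > - real k}" "\<And>s. Re s > 0 ==> f s = periodic_Mellin P s"
  using Suc.IH[OF P(1)] by blast
 have "(f \<circ> (\<lambda>s. s + 1)) holomorphic_on {s. Re s > - real (Suc k)}"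
  by (rule holomorphic_on_compose_gen[OF _ f(1)]) (auto intro!: holomorphic_intros)
 hence "(\<lambda>s. - K + (s + 1) * f (s + 1)) holomorphic_on {s. Re s > - real (Suc k)}"
  by (intro holomorphic_intros) (simp add: o_def)
 moreover have "\<forall>s. Re s > 0 --> - K + (s + 1) * f (s + 1) = periodic_Mellin g s"
  using P(2) f(2) by simp
 ultimately show ?case by (intro exI[of _ "\<lambda>s. - K + (s + 1) * f (s + 1)"]) blast
qed

lemma periodic_Mellin_continuation:
 assumes "mean_zero_periodic q g"
 shows "\<exists>F. F holomorphic_on UNIV \<and> (\<forall>s. Re s > 0 --> F s = periodic_Mellin g s)"
proof -
 have "\<forall>k. \<exists>f. f holomorphic_on {s. Re s > - real k} \<and> (\<forall>s. Re s > 0 --> f s = periodic_Mellin g s)"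
  using periodic_Mellin_continuation_halfplane[OF assms] by blast
 from choice[OF this] obtain f where "\<forall>k. f k holomorphic_on {s. Re s > - real k} \<and> (\<forall>s. Re s > 0 --> f k s = periodic_Mellin g s)"
  by blast
 hence f: "\<And>k. f k holomorphic_on {s. Re s > - real k}" "\<And>k s. Re s > 0 ==> f k s = periodic_Mellin g s"
  by blast+
 have agree: "f k s = f m s" if "Re s > - real k" "Re s > - real m" for k m s
 proof (rule analytic_continuation_open[of "{s. Re s > 0}" "{s. Re s > - real (min k m)}" "f k" "f m"])
  show "open {s. Re s > 0}" "open {s. Re s > - real (min k m)}" by (rule open_halfspace_Re_gt)+
  show "connected {s. Re s > - real (min k m)}" by (intro convex_connected convex_halfspace_Re_gt)
  show "{s. Re s > 0} \<noteq> {}" by (auto intro!: exI[of _ 1])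
  show "f k holomorphic_on {s. Re s > - real (min k m)}" by (rule holomorphic_on_subset[OF f(1)]) auto
  show "f m holomorphic_on {s. Re s > - real (min k m)}" by (rule holomorphic_on_subset[OF f(1)]) auto
  show "s \<in> {s. Re s > - real (min k m)}" using that by (auto simp: min_def)
 qed (use f in auto)
 \<comment> \<open>Some half-plane that contains s; by the identity theorem the choice does not
   influence the value.\<close>
 define idx where "idx = (\<lambda>s. nat \<lceil>- Re s\<rceil> + 1)"
 have idx: "Re s > - real (idx s)" for s unfolding idx_def by linarith
 define F where "F = (\<lambda>s. f (idx s) s)"
 have eq: "F s = f k s" if "Re s > - real k" for s k
  unfolding F_def by (rule agree[OF idx that])
 have "F field_differentiable at s" for s
 proof -
  have "F holomorphic_on {z. Re z > - real (idx s)}"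
   using holomorphic_cong[OF refl, of "{z. Re z > - real (idx s)}" F "f (idx s)"] f(1) eq by blast
  thus ?thesis using idx[of s] by (intro holomorphic_on_imp_differentiable_at[OF _ open_halfspace_Re_gt]) auto
 qed
 hence "F holomorphic_on UNIV" by (simp add: holomorphic_on_def)
 moreover have "F s = periodic_Mellin g s" if "Re s > 0" for s using eq[of 0 s] f(2)[of s 0] that by simp
 ultimately show ?thesis by blast
qed

section \<open>Dirichlet characters and their L-functions\<close>

lemma character_norm_1:
 assumes "dirichlet_character q chi" "coprime n q"
 shows "cmod (chi n) = 1"
proof -
 have q: "q > 0" and c1: "chi 1 = 1" and cm: "\<And>m n. chi (m * n) = chi m * chi n" and cp: "\<And>n. chi (n + q) = chi n"
  using assms by (auto simp: dirichlet_character_def)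
 have pw: "chi (n ^ k) = chi n ^ k" for k by (induction k) (use c1 cm in auto)
 have "[n ^ totient q = 1] (mod q)" by (rule euler_theorem[OF assms(2)])
 hence "chi (n ^ totient q) = chi 1"
  using periodic_mod[of chi q "n ^ totient q"] periodic_mod[of chi q 1] cp by (simp add: cong_def)
 hence "chi n ^ totient q = 1" using c1 by (simp add: pw)
 hence "cmod (chi n) ^ totient q = 1 ^ totient q" by (metis norm_one norm_power power_one)
 moreover have "totient q > 0" using q by simp
 ultimately show "cmod (chi n) = 1" using power_eq_imp_eq_base[of "cmod (chi n)" "totient q" 1] by simp
qed

lemma dirichlet_character_norm_le:
 assumes "dirichlet_character q chi"
 shows "cmod (chi n) \<le> 1"
proof (cases "coprime n q")
 case True
 thus ?thesis using character_norm_1[OF assms] by simp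
next
 case False
 hence "chi n = 0" using assms unfolding dirichlet_character_def by blast
 thus ?thesis by simp
qed

text \<open>Multiplication by some a coprime to q with \<open>chi a\<close> \<noteq> 1 permutes the
  residues and multiplies the sum by \<open>chi a\<close>.\<close>

lemma character_sum_period:
 assumes chi: "dirichlet_character q chi" and np: "\<not> principal_character q chi"
 shows "(\<Sum>k<q. chi (Suc k)) = 0"
proof -
 have q: "q > 0" and c1: "chi 1 = 1" and cm: "\<And>m n. chi (m * n) = chi m * chi n" and cp: "\<And>n. chi (n + q) = chi n"
  and c0: "\<And>n. chi n = 0 \<longleftrightarrow> \<not> coprime n q"
  using chi by (auto simp: dirichlet_character_def)
 have md: "chi n = chi (n mod q)" for n by (rule periodic_mod[of chi q, OF cp])
 obtain a where "chi a \<noteq> (if coprime a q then 1 else 0)" using np unfolding principal_character_def by blast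
 hence a: "coprime a q" "chi a \<noteq> 1" using c0[of a] by (auto split: if_splits)
 have shift: "(\<Sum>k<q. chi (Suc k)) = (\<Sum>k<q. chi k)"
  using sum.lessThan_Suc_shift[of chi q] sum.lessThan_Suc[of chi q] cp[of 0] by simp
 have inj: "inj_on (\<lambda>k. (a * k) mod q) {..<q}"
 proof (rule inj_onI)
  fix x y assume xy: "x \<in> {..<q}" "y \<in> {..<q}" "(a * x) mod q = (a * y) mod q"
  hence "[a * x = a * y] (mod q)" by (simp add: cong_def)
  hence "[x = y] (mod q)" using a(1) cong_mult_lcancel_nat by blast
  thus "x = y" using xy by (simp add: cong_def)
 qed
 have "(\<lambda>k. (a * k) mod q) ` {..<q} \<subseteq> {..<q}" using q by auto
 hence bij: "bij_betw (\<lambda>k. (a * k) mod q) {..<q} {..<q}"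
  using inj by (simp add: bij_betw_def endo_inj_surj)
 have "(\<Sum>k<q. chi k) = (\<Sum>k<q. chi ((a * k) mod q))"
  by (rule sum.reindex_bij_betw[OF bij, symmetric])
 also have "\<dots> = (\<Sum>k<q. chi a * chi k)" by (intro sum.cong refl) (metis md cm)
 also have "\<dots> = chi a * (\<Sum>k<q. chi k)" by (simp add: sum_distrib_left)
 finally have "(chi a - 1) * (\<Sum>k<q. chi k) = 0" by (simp add: algebra_simps)
 thus ?thesis using a(2) shift by simp
qed

text \<open>
 The summatory function of \<open>chi\<close> is linear with slope \<open>char_mean q chi\<close> up to a periodic function,
 whose mean value is split off as the constant \<open>m\<close> of \<open>dirichlet_series_decomposition\<close>.
\<close>

definition char_mean :: "nat => (nat => complex) => complex" where
 "char_mean q chi = (\<Sum>k<q. chi (Suc k)) / of_nat q"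

text \<open>Abel summation writes the series as s times the Mellin integral of the summatory
  function. Its linear part integrates to the pole at 1, its constant part to \<open>m\<close>, and
  the periodic rest to an integral that converges for Re s > 0. The bounds are linear in q, and
  through them the modulus enters the zero counts.\<close>

lemma dirichlet_series_decomposition:
 assumes chi: "dirichlet_character q chi"
 defines "kap \<equiv> char_mean q chi"
 shows "\<exists>m g. mean_zero_periodic q g \<and> (\<forall>n. \<forall>u\<in>{0..1}. cmod (g n u) \<le> 8 * real q) \<and> cmod m \<le> 4 * real q \<and>
  (\<forall>n. \<forall>u\<in>{0..1}. (\<Sum>k\<le>n. chi (Suc k)) = g n u + kap * of_real (real (Suc n) + u) + m) \<and>
  (\<forall>s. Re s > 1 --> (\<lambda>n. chi (Suc n) / of_nat (Suc n) powr s) sums (s * periodic_Mellin g s + kap * s / (s - 1) + m))"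
proof -
 have q: "q > 0" and cp: "\<And>n. chi (n + q) = chi n" using chi by (auto simp: dirichlet_character_def)
 have c1: "cmod (chi n) \<le> 1" for n by (rule dirichlet_character_norm_le[OF chi])
 define A where "A = (\<lambda>n. \<Sum>k\<le>n. chi (Suc k))"
 have Aq: "A (n + q) = A n + kap * of_nat q" for n
 proof (induction n)
  case 0
  have "A (0 + q) = (\<Sum>k<Suc q. chi (Suc k))" by (simp add: A_def lessThan_Suc_atMost)
  also have "\<dots> = (\<Sum>k<q. chi (Suc k)) + chi (Suc 0)" using cp[of "Suc 0"] by simp
  finally show ?case using q by (simp add: A_def kap_def char_mean_def)
 next
  case (Suc n)
  thus ?case using cp[of "Suc (Suc n)"] by (simp add: A_def)
 qed
 have Ab: "cmod (A n) \<le> real (Suc n)" for n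
  unfolding A_def by (rule order_trans[OF norm_sum]) (use sum_bounded_above[of "{..n}" "\<lambda>k. cmod (chi (Suc k))" 1] c1 in simp)
 have kb: "cmod kap \<le> 1"
 proof -
  have "cmod (\<Sum>k<q. chi (Suc k)) \<le> real q"
   by (rule order_trans[OF norm_sum]) (use sum_bounded_above[of "{..<q}" "\<lambda>k. cmod (chi (Suc k))" 1] c1 in simp)
  thus ?thesis using q by (simp add: kap_def char_mean_def norm_divide)
 qed
 define h where "h = (\<lambda>n u. A n - kap * of_real (real (Suc n) + u))"
 have hper: "h (n + q) u = h n u" for n u by (simp add: h_def Aq algebra_simps)
 have hc: "continuous_on {0..1} (h n)" for n unfolding h_def by (intro continuous_intros)
 have hb: "cmod (h n u) \<le> 4 * real q" if u: "u \<in> {0..1}" for n u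
 proof -
  have "h n = h (n mod q)" using periodic_mod[of h q n] hper by blast
  hence "cmod (h n u) \<le> cmod (A (n mod q)) + cmod (kap * of_real (real (Suc (n mod q)) + u))"
   by (simp add: h_def norm_triangle_ineq4)
  also have "cmod (A (n mod q)) \<le> real q" using Ab[of "n mod q"] mod_less_divisor[OF q, of n] by linarith
  also have "cmod (kap * of_real (real (Suc (n mod q)) + u)) \<le> 1 * (real q + 1)"
   unfolding norm_mult norm_of_real using u kb mod_less_divisor[OF q, of n] by (intro mult_mono) auto
  finally show ?thesis using q by simp
 qed
 define m where "m = (\<Sum>n<q. integral {0..1} (h n)) / of_nat q"
 have mb: "cmod m \<le> 4 * real q"
 proof -
  have "cmod (integral {0..1} (h n)) \<le> 4 * real q * (1 - 0)" for n by (rule integral_bound[OF _ hc hb]) auto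
  hence "cmod (\<Sum>n<q. integral {0..1} (h n)) \<le> (\<Sum>n<q. 4 * real q)" by (intro sum_norm_le) simp
  thus ?thesis using q by (simp add: m_def norm_divide field_simps)
 qed
 define g where "g = (\<lambda>n u. h n u - m)"
 have gc: "continuous_on {0..1} (g n)" for n unfolding g_def by (intro continuous_intros hc)
 have gper: "g (n + q) u = g n u" for n u by (simp add: g_def hper)
 have "(\<Sum>n<q. integral {0..1} (g n)) = (\<Sum>n<q. integral {0..1} (h n) - m)"
  unfolding g_def by (intro sum.cong refl) (simp add: integral_diff integrable_continuous_interval hc)
 hence gm: "mean_zero_periodic q g" using q gc gper by (simp add: mean_zero_periodic_def sum_subtractf m_def)
 have gb: "cmod (g n u) \<le> 8 * real q" if "u \<in> {0..1}" for n u
  using hb[OF that, of n] mb norm_triangle_ineq4[of "h n u" m] by (simp add: g_def)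
 have Aeq: "A n = g n u + kap * of_real (real (Suc n) + u) + m" for n u by (simp add: g_def h_def)
 have "(\<lambda>n. chi (Suc n) / of_nat (Suc n) powr s) sums (s * periodic_Mellin g s + kap * s / (s - 1) + m)" if s: "Re s > 1" for s
 proof -
  define p where "p = (\<lambda>c n. complex_of_real (real (Suc n)) powr c)"
  have s0: "s \<noteq> 0" "s - 1 \<noteq> 0" using s by auto
  have FTC: "integral {0..1} (\<lambda>u. complex_of_real (real (Suc n) + u) powr (c - 1)) = (p c (Suc n) - p c n) / c" if "c \<noteq> 0" for c n
  proof -
   have "((\<lambda>u. c * complex_of_real (real (Suc n) + u) powr (c - 1)) has_integral
     (complex_of_real (real (Suc n) + 1) powr c - complex_of_real (real (Suc n) + 0) powr c)) {0..1}"
    by (intro fundamental_theorem_of_calculus shift_powr_deriv) auto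
   hence "integral {0..1} (\<lambda>u. c * complex_of_real (real (Suc n) + u) powr (c - 1)) = p c (Suc n) - p c n"
    unfolding p_def by (intro integral_unique) (simp add: add_ac)
   thus ?thesis using that by (simp add: field_simps)
  qed
  have plim: "p c \<longlonglongrightarrow> 0" if "Re c < 0" for c
  proof (rule tendsto_norm_zero_cancel)
   have "(\<lambda>n. real (Suc n) powr Re c) \<longlonglongrightarrow> 0" using that by real_asymp
   moreover have "norm (p c n) = real (Suc n) powr Re c" for n unfolding p_def by (subst norm_powr_real_powr) auto
   ultimately show "(\<lambda>n. norm (p c n)) \<longlonglongrightarrow> 0" by simp
  qed
  have trm: "A n * (p (- s) n - p (- s) (Suc n)) =
    s * integral {0..1} (\<lambda>u. g n u * of_real (real (Suc n) + u) powr (- s - 1)) +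
    (kap * s / (s - 1) * (p (1 - s) n - p (1 - s) (Suc n)) + m * (p (- s) n - p (- s) (Suc n)))" for n
  proof -
   let ?x = "\<lambda>u. complex_of_real (real (Suc n) + u)"
   have e: "A n * ?x u powr (- s - 1) = g n u * ?x u powr (- s - 1) + (kap * ?x u powr ((1 - s) - 1) + m * ?x u powr (- s - 1))" if "u \<in> {0..1}" for u
   proof -
    have nz: "?x u \<noteq> 0" using that unfolding of_real_eq_0_iff by auto
    have "?x u powr ((1 - s) - 1) = ?x u powr (- s - 1 + 1)" by simp
    also have "\<dots> = ?x u powr (- s - 1) * ?x u" using nz by (simp only: powr_add powr_to_1 if_False)
    finally show ?thesis by (simp only: Aeq[of n u] ring_distribs mult_ac add_ac)
   qed
   have ig: "(\<lambda>u. g n u * ?x u powr (- s - 1)) integrable_on {0..1}"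
    "(\<lambda>u. kap * ?x u powr ((1 - s) - 1)) integrable_on {0..1}" "(\<lambda>u. m * ?x u powr (- s - 1)) integrable_on {0..1}"
    by (intro integrable_continuous_interval continuous_on_mult gc shift_powr_continuous continuous_on_const)+
   have "A n * ((p (- s) (Suc n) - p (- s) n) / (- s)) = A n * integral {0..1} (\<lambda>u. ?x u powr (- s - 1))"
    using FTC[of "- s" n] s0 by simp
   also have "\<dots> = integral {0..1} (\<lambda>u. A n * ?x u powr (- s - 1))" by (simp only: integral_mult_right)
   also have "\<dots> = integral {0..1} (\<lambda>u. g n u * ?x u powr (- s - 1) + (kap * ?x u powr ((1 - s) - 1) + m * ?x u powr (- s - 1)))"
    by (intro integral_cong e)
   also have "\<dots> = integral {0..1} (\<lambda>u. g n u * ?x u powr (- s - 1)) + (kap * ((p (1 - s) (Suc n) - p (1 - s) n) / (1 - s)) + m * ((p (- s) (Suc n) - p (- s) n) / (- s)))"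
   proof -
    have "1 - s \<noteq> 0" "- s \<noteq> 0" using s0 by auto
    note F = FTC[OF this(1), of n] FTC[OF this(2), of n]
    show ?thesis by (simp only: integral_add ig integrable_add integral_mult_right F)
   qed
   finally have "s * (A n * ((p (- s) (Suc n) - p (- s) n) / (- s))) = s * (integral {0..1} (\<lambda>u. g n u * ?x u powr (- s - 1)) + (kap * ((p (1 - s) (Suc n) - p (1 - s) n) / (1 - s)) + m * ((p (- s) (Suc n) - p (- s) n) / (- s))))"
    by simp
   moreover have "s * (A n * ((p (- s) (Suc n) - p (- s) n) / (- s))) = A n * (p (- s) n - p (- s) (Suc n))"
    using s0 by (simp add: field_simps)
   moreover have "s * (m * ((p (- s) (Suc n) - p (- s) n) / (- s))) = m * (p (- s) n - p (- s) (Suc n))"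
    using s0 by (simp add: field_simps)
   moreover have "s * (kap * ((p (1 - s) (Suc n) - p (1 - s) n) / (1 - s))) = kap * s / (s - 1) * (p (1 - s) n - p (1 - s) (Suc n))"
   proof -
    have "(p (1 - s) (Suc n) - p (1 - s) n) / (1 - s) = (p (1 - s) n - p (1 - s) (Suc n)) / (s - 1)"
     by (metis minus_diff_eq minus_divide_divide)
    thus ?thesis by simp
   qed
   ultimately show ?thesis by (simp only: distrib_left)
  qed
  have "(\<lambda>n. s * integral {0..1} (\<lambda>u. g n u * of_real (real (Suc n) + u) powr (- s - 1)) +
    (kap * s / (s - 1) * (p (1 - s) n - p (1 - s) (Suc n)) + m * (p (- s) n - p (- s) (Suc n))))
    sums (s * periodic_Mellin g s + (kap * s / (s - 1) * (p (1 - s) 0 - 0) + m * (p (- s) 0 - 0)))"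
   unfolding periodic_Mellin_def
   using s by (intro sums_add sums_mult summable_sums periodic_Mellin_summable[OF gm] telescope_sums' plim) auto
  hence S: "(\<lambda>n. A n * (p (- s) n - p (- s) (Suc n))) sums (s * periodic_Mellin g s + kap * s / (s - 1) + m)"
   unfolding trm by (simp add: p_def add.assoc)
  \<comment> \<open>Partial summation with the weights (n + 1)^(-s). The boundary term pairs the sum
    of the first N values with the weight of N + 1.\<close>
  have abel: "(\<Sum>n<N. chi (Suc n) * p (- s) n) = (\<Sum>n<N. A n * (p (- s) n - p (- s) (Suc n))) + (if N = 0 then 0 else A (N - 1) * p (- s) N)" for N
  proof (induction N)
   case (Suc N)
   have "A N = (if N = 0 then 0 else A (N - 1)) + chi (Suc N)" by (cases N) (auto simp: A_def)
   thus ?case using Suc.IH by (cases "N = 0") (simp_all add: algebra_simps)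
  qed simp
  have "(\<lambda>N. if N = 0 then 0 else A (N - 1) * p (- s) N) \<longlonglongrightarrow> 0"
  proof (rule Lim_null_comparison)
   show "\<forall>\<^sub>F N in sequentially. norm (if N = 0 then 0 else A (N - 1) * p (- s) N) \<le> real (Suc N) powr (1 - Re s)"
   proof (rule always_eventually, rule allI)
    fix N
    show "norm (if N = 0 then 0 else A (N - 1) * p (- s) N) \<le> real (Suc N) powr (1 - Re s)"
    proof (cases "N = 0")
     case False
     have "norm (A (N - 1) * p (- s) N) \<le> real (Suc N) * real (Suc N) powr (- Re s)"
      unfolding norm_mult p_def using Ab[of "N - 1"] False
      by (intro mult_mono) (auto simp: norm_powr_real_powr simp del: of_real_of_nat_eq of_nat_Suc)
     also have "\<dots> = real (Suc N) powr (1 - Re s)" by (simp add: powr_diff powr_minus field_simps)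
     finally show ?thesis using False by simp
    qed simp
   qed
   show "(\<lambda>N. real (Suc N) powr (1 - Re s)) \<longlonglongrightarrow> 0" using s by real_asymp
  qed
  with S have "(\<lambda>N. (\<Sum>n<N. A n * (p (- s) n - p (- s) (Suc n))) + (if N = 0 then 0 else A (N - 1) * p (- s) N))
    \<longlonglongrightarrow> (s * periodic_Mellin g s + kap * s / (s - 1) + m) + 0"
   unfolding sums_def by (intro tendsto_add) auto
  hence "(\<lambda>n. chi (Suc n) * p (- s) n) sums (s * periodic_Mellin g s + kap * s / (s - 1) + m)"
   unfolding sums_def abel by simp
  thus ?thesis by (simp add: p_def powr_minus_divide)
 qed
 with gm gb mb Aeq[unfolded A_def] show ?thesis
  by (intro exI[of _ m] exI[of _ g] conjI allI ballI impI)
qed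

lemma char_mean_eq_0_iff:
 assumes chi: "dirichlet_character q chi"
 shows "char_mean q chi = 0 \<longleftrightarrow> \<not> principal_character q chi"
proof (cases "principal_character q chi")
 case True
 have q: "q > 0" using chi by (simp add: dirichlet_character_def)
 have "(\<Sum>k<q. Re (chi (Suc k))) \<ge> Re (chi (Suc 0))"
  using q True by (intro member_le_sum) (auto simp: principal_character_def)
 moreover have "Re (chi (Suc 0)) = 1" using True by (simp add: principal_character_def)
 ultimately have "(\<Sum>k<q. chi (Suc k)) \<noteq> 0"
  by (auto simp flip: Re_sum)
 thus ?thesis using q True by (simp add: char_mean_def)
next
 case False
 thus ?thesis using character_sum_period[OF chi] by (simp add: char_mean_def)
qed

text \<open>At s = 1 the quotient by s - 1 is a division by 0 with value 0. This agrees with the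
  intended meaning for nonprincipal characters, for which \<open>char_mean\<close> vanishes.\<close>

definition L_data :: "nat => (nat => complex) => complex => (nat => real => complex) => bool" where
 "L_data q chi m g \<longleftrightarrow> mean_zero_periodic q g \<and> (\<forall>n. \<forall>u\<in>{0..1}. cmod (g n u) \<le> 8 * real q) \<and> cmod m \<le> 4 * real q \<and>
  (\<forall>n. \<forall>u\<in>{0..1}. (\<Sum>k\<le>n. chi (Suc k)) = g n u + char_mean q chi * of_real (real (Suc n) + u) + m) \<and>
  (\<forall>s. Re s > 0 --> (s \<noteq> 1 \<or> \<not> principal_character q chi) -->
    dirichlet_L q chi s = s * periodic_Mellin g s + char_mean q chi * s / (s - 1) + m)"

lemma L_dataD:
 assumes "L_data q chi m g"
 shows "mean_zero_periodic q g" "\<And>n u. u \<in> {0..1} ==> cmod (g n u) \<le> 8 * real q" "cmod m \<le> 4 * real q"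
  "\<And>n u. u \<in> {0..1} ==> (\<Sum>k\<le>n. chi (Suc k)) = g n u + char_mean q chi * of_real (real (Suc n) + u) + m"
  "\<And>s. Re s > 0 ==> s \<noteq> 1 \<or> \<not> principal_character q chi ==>
    dirichlet_L q chi s = s * periodic_Mellin g s + char_mean q chi * s / (s - 1) + m"
 using assms unfolding L_data_def by blast+

lemma dirichlet_L_formula:
 assumes chi: "dirichlet_character q chi"
 shows is_dirichlet_L_dirichlet_L: "is_dirichlet_L q chi (dirichlet_L q chi)"
  and ex_L_data: "\<exists>m g. L_data q chi m g"
proof -
 let ?k = "char_mean q chi"
 obtain m g where mg0: "mean_zero_periodic q g \<and> (\<forall>n. \<forall>u\<in>{0..1}. cmod (g n u) \<le> 8 * real q) \<and> cmod m \<le> 4 * real q \<and>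
  (\<forall>n. \<forall>u\<in>{0..1}. (\<Sum>k\<le>n. chi (Suc k)) = g n u + ?k * of_real (real (Suc n) + u) + m) \<and>
  (\<forall>s. Re s > 1 --> (\<lambda>n. chi (Suc n) / of_nat (Suc n) powr s) sums (s * periodic_Mellin g s + ?k * s / (s - 1) + m))"
  using dirichlet_series_decomposition[OF chi] by (elim exE)
 hence mg: "mean_zero_periodic q g"
  "\<And>s. Re s > 1 ==> (\<lambda>n. chi (Suc n) / of_nat (Suc n) powr s) sums (s * periodic_Mellin g s + ?k * s / (s - 1) + m)"
  by blast+
 obtain F where F: "F holomorphic_on UNIV" "\<And>s. Re s > 0 ==> F s = periodic_Mellin g s"
  using periodic_Mellin_continuation[OF mg(1)] by blast
 have k0: "?k = 0" if "\<not> principal_character q chi" using char_mean_eq_0_iff[OF chi] that by blast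
 define L where "L = (\<lambda>s. if s = 1 \<and> principal_character q chi then 0 else s * F s + ?k * s / (s - 1) + m)"
 have Lh: "L holomorphic_on (if principal_character q chi then - {1} else UNIV)"
 proof (cases "principal_character q chi")
  case True
  have "(\<lambda>s. s * F s + ?k * s / (s - 1) + m) holomorphic_on - {1}"
   by (intro holomorphic_intros holomorphic_on_subset[OF F(1)]) auto
  hence "L holomorphic_on - {1}" by (rule holomorphic_transform) (auto simp: L_def)
  thus ?thesis using True by simp
 next
  case False
  have "(\<lambda>s. s * F s + m) holomorphic_on UNIV" by (intro holomorphic_intros F(1))
  hence "L holomorphic_on UNIV" by (rule holomorphic_transform) (use False k0 in \<open>auto simp: L_def\<close>)
  thus ?thesis using False by simp
 qed
 have "L s = (\<Sum>n. chi (Suc n) / of_nat (Suc n) powr s)" if s: "Re s > 1" for s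
 proof -
  have "s \<noteq> 1" using s by auto
  hence "L s = s * periodic_Mellin g s + ?k * s / (s - 1) + m" using F(2)[of s] s by (simp add: L_def)
  thus ?thesis using sums_unique[OF mg(2)[OF s]] by simp
 qed
 hence isL: "is_dirichlet_L q chi L" using Lh by (simp add: is_dirichlet_L_def) (simp add: L_def)
 have Leq: "dirichlet_L q chi = L" by (rule dirichlet_L_eqI[OF isL])
 show "is_dirichlet_L q chi (dirichlet_L q chi)" using isL Leq by simp
 have "dirichlet_L q chi s = s * periodic_Mellin g s + ?k * s / (s - 1) + m"
   if "Re s > 0" "s \<noteq> 1 \<or> \<not> principal_character q chi" for s
  using F(2)[of s] that by (auto simp: Leq L_def)
 hence "L_data q chi m g" using mg0 unfolding L_data_def by blast
 thus "\<exists>m g. L_data q chi m g" by blast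
qed

text \<open>The value at 1 is the residue of L there, which makes the function entire; away from s =
  1 it has the same zeros as L. Zeros are counted for this function, so that the pole of a principal
  character does not interfere.\<close>

definition Lreg :: "nat => (nat => complex) => complex => complex" where
 "Lreg q chi s = (if principal_character q chi then if s = 1 then char_mean q chi else (s - 1) * dirichlet_L q chi s
   else dirichlet_L q chi s)"

lemma Lreg_holomorphic:
 assumes chi: "dirichlet_character q chi"
 shows "Lreg q chi holomorphic_on UNIV"
proof (cases "principal_character q chi")
 case True
 obtain m g where "L_data q chi m g" using ex_L_data[OF chi] by blast
 note mg = L_dataD[OF this]
 have "(\<lambda>s. (s - 1) * (s * periodic_Mellin g s + m) + char_mean q chi * s) holomorphic_on {s. Re s > 0}"
  by (intro holomorphic_intros periodic_Mellin_holomorphic[OF mg(1)])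
 hence h1: "Lreg q chi holomorphic_on {s. Re s > 0}"
  by (rule holomorphic_transform) (use True mg(5) in \<open>auto simp: Lreg_def field_simps\<close>)
 have "dirichlet_L q chi holomorphic_on - {1}" using is_dirichlet_L_dirichlet_L[OF chi] True by (simp add: is_dirichlet_L_def)
 hence "(\<lambda>s. (s - 1) * dirichlet_L q chi s) holomorphic_on - {1}" by (intro holomorphic_intros)
 hence h2: "Lreg q chi holomorphic_on - {1}" by (rule holomorphic_transform) (use True in \<open>auto simp: Lreg_def\<close>)
 have "Lreg q chi holomorphic_on {s. Re s > 0} \<union> - {1}"
  by (intro holomorphic_on_Un h1 h2 open_halfspace_Re_gt) auto
 moreover have "{s. Re s > 0} \<union> - {1} = UNIV" by auto
 ultimately show ?thesis by simp
next
 case False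
 have "is_dirichlet_L q chi (dirichlet_L q chi)" by (rule is_dirichlet_L_dirichlet_L[OF chi])
 hence "dirichlet_L q chi holomorphic_on UNIV" using False by (simp add: is_dirichlet_L_def)
 thus ?thesis by (rule holomorphic_transform) (use False in \<open>auto simp: Lreg_def\<close>)
qed

text \<open>Down to Re s = 1/16 the Mellin integrals have a convergent majorant with exponent 17/16.
  This abscissa is the left edge of the largest disc about 2 + it that the zero count uses, the one
  of radius 31/16.\<close>

lemma Lreg_growth:
 "\<exists>C>0. \<forall>q chi s. dirichlet_character q chi --> Re s \<ge> 1/16 --> cmod (Lreg q chi s) \<le> C * real q * (1 + cmod s)^2"
proof -
 define C0 where "C0 = (\<Sum>n. real (Suc n) powr (- 17/16))"
 have C0: "C0 \<ge> 0" unfolding C0_def by (intro suminf_nonneg summable_Suc_powr) auto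
 have "cmod (Lreg q chi s) \<le> (8 * C0 + 5) * real q * (1 + cmod s)^2" if chi: "dirichlet_character q chi" and s: "Re s \<ge> 1/16" for q chi s
 proof -
  obtain m g where "L_data q chi m g" using ex_L_data[OF chi] by blast
  note mg = L_dataD[OF this]
  have q: "real q \<ge> 1" using chi by (auto simp: dirichlet_character_def)
  define W where "W = s * periodic_Mellin g s + m"
  have "cmod (periodic_Mellin g s) \<le> 8 * real q * C0" unfolding C0_def by (rule periodic_Mellin_bound[OF mg(1,2) s])
  hence "cmod W \<le> cmod s * (8 * real q * C0) + 4 * real q"
   unfolding W_def by (intro order_trans[OF norm_triangle_ineq] add_mono mg) (simp add: norm_mult mult_left_mono)
  also have "\<dots> \<le> (1 + cmod s) * (8 * real q * C0 + 4 * real q)"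
   using C0 q by (simp add: algebra_simps)
  finally have W: "cmod W \<le> (1 + cmod s) * ((8 * C0 + 4) * real q)" by (simp add: algebra_simps)
  show ?thesis
  proof (cases "principal_character q chi")
   case False
   hence "Lreg q chi s = W" using mg(5)[of s] s char_mean_eq_0_iff[OF chi] by (simp add: Lreg_def W_def)
   also have "cmod W \<le> (1 + cmod s) * ((8 * C0 + 5) * real q)" using W q C0
    by (rule_tac order_trans[OF W]) (intro mult_left_mono mult_right_mono, auto)
   also have "\<dots> \<le> (1 + cmod s)^2 * ((8 * C0 + 5) * real q)"
    using C0 q by (intro mult_right_mono self_le_power) auto
   finally show ?thesis by (simp add: mult_ac)
  next
   case True
   have kb: "cmod (char_mean q chi) \<le> real q"
   proof -
    have "cmod (\<Sum>k<q. chi (Suc k)) \<le> real q"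
     by (rule order_trans[OF norm_sum]) (use sum_bounded_above[of "{..<q}" "\<lambda>k. cmod (chi (Suc k))" 1] dirichlet_character_norm_le[OF chi] in simp)
    hence "cmod (char_mean q chi) \<le> 1" using q by (simp add: char_mean_def norm_divide)
    thus ?thesis using q by linarith
   qed
   have "Lreg q chi s = (s - 1) * W + char_mean q chi * s"
    using mg(5)[of s] s True by (auto simp: Lreg_def W_def field_simps)
   also have "cmod \<dots> \<le> (1 + cmod s) * ((1 + cmod s) * ((8 * C0 + 4) * real q)) + real q * (1 + cmod s)^2"
   proof (intro order_trans[OF norm_triangle_ineq] add_mono)
    show "cmod ((s - 1) * W) \<le> (1 + cmod s) * ((1 + cmod s) * ((8 * C0 + 4) * real q))"
     unfolding norm_mult using W norm_triangle_ineq4[of s 1] C0 q by (intro mult_mono) auto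
    have "cmod s \<le> (1 + cmod s)^2" by (simp add: power2_eq_square algebra_simps)
    thus "cmod (char_mean q chi * s) \<le> real q * (1 + cmod s)^2"
     unfolding norm_mult using kb by (intro mult_mono) auto
   qed
   also have "\<dots> = (8 * C0 + 5) * real q * (1 + cmod s)^2" by (simp add: power2_eq_square algebra_simps)
   finally show ?thesis .
  qed
 qed
 thus ?thesis using C0 by (intro exI[of _ "8 * C0 + 5"]) auto
qed

text \<open>Abel summation at s = 1 with the summatory function left intact and weights 1/(n+1) -
  1/(n+2). In this form the value can be compared with a Lambert series.\<close>

lemma dirichlet_L_1_sums:
 assumes chi: "dirichlet_character q chi" and np: "\<not> principal_character q chi"
 shows "(\<lambda>n. (\<Sum>k\<le>n. chi (Suc k)) * of_real (1 / real (Suc n) - 1 / real (Suc (Suc n)))) sums dirichlet_L q chi 1"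
  and "cmod (\<Sum>k\<le>n. chi (Suc k)) \<le> 12 * real q"
proof -
  obtain m g where "L_data q chi m g" using ex_L_data[OF chi] by blast
  note mg = L_dataD[OF this]
 have k0: "char_mean q chi = 0" using char_mean_eq_0_iff[OF chi] np by blast
 define A where "A = (\<lambda>n. \<Sum>k\<le>n. chi (Suc k))"
 have A: "A n = g n u + m" if "u \<in> {0..1}" for n u using mg(4)[OF that] k0 by (simp add: A_def)
 show "cmod (\<Sum>k\<le>n. chi (Suc k)) \<le> 12 * real q"
  using A[of 0 n] mg(2)[of 0 n] mg(3) norm_triangle_ineq[of "g n 0" m] by (simp add: A_def)
 have gc: "continuous_on {0..1} (g n)" for n using mg(1) by (simp add: mean_zero_periodic_def)
 let ?d = "\<lambda>n. of_real (1 / real (Suc n) - 1 / real (Suc (Suc n))) :: complex"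
 have i2: "integral {0..1} (\<lambda>u. complex_of_real (real (Suc n) + u) powr (- 1 - 1)) = ?d n" for n
 proof -
  have "((\<lambda>u. (- 1) * complex_of_real (real (Suc n) + u) powr (- 1 - 1)) has_integral
     (complex_of_real (real (Suc n) + 1) powr (- 1) - complex_of_real (real (Suc n) + 0) powr (- 1))) {0..1}"
   by (intro fundamental_theorem_of_calculus shift_powr_deriv) auto
  hence "((\<lambda>u. (- 1) * ((- 1) * complex_of_real (real (Suc n) + u) powr (- 1 - 1))) has_integral
     (- 1) * (complex_of_real (real (Suc n) + 1) powr (- 1) - complex_of_real (real (Suc n) + 0) powr (- 1))) {0..1}"
   by (rule has_integral_mult_right)
  hence "integral {0..1} (\<lambda>u. complex_of_real (real (Suc n) + u) powr (- 1 - 1)) =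
     (- 1) * (complex_of_real (real (Suc n) + 1) powr (- 1) - complex_of_real (real (Suc n) + 0) powr (- 1))"
   by (intro integral_unique) simp
  thus ?thesis by (simp add: powr_minus_divide add_ac)
 qed
 have eq: "A n * ?d n = integral {0..1} (\<lambda>u. g n u * of_real (real (Suc n) + u) powr (- 1 - 1)) + m * ?d n" for n
 proof -
  have ig: "(\<lambda>u. g n u * complex_of_real (real (Suc n) + u) powr (- 1 - 1)) integrable_on {0..1}"
   "(\<lambda>u. m * complex_of_real (real (Suc n) + u) powr (- 1 - 1)) integrable_on {0..1}"
   by (intro integrable_continuous_interval continuous_on_mult gc shift_powr_continuous continuous_on_const)+
  have "A n * ?d n = integral {0..1} (\<lambda>u. A n * complex_of_real (real (Suc n) + u) powr (- 1 - 1))"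
   by (simp only: i2 integral_mult_right)
  also have "\<dots> = integral {0..1} (\<lambda>u. g n u * complex_of_real (real (Suc n) + u) powr (- 1 - 1) + m * complex_of_real (real (Suc n) + u) powr (- 1 - 1))"
   by (intro integral_cong) (simp add: A distrib_right)
  also have "\<dots> = integral {0..1} (\<lambda>u. g n u * complex_of_real (real (Suc n) + u) powr (- 1 - 1)) + m * ?d n"
   by (simp only: integral_add ig i2 integral_mult_right)
  finally show ?thesis .
 qed
 have "(\<lambda>n. 1 / real (Suc n) - 1 / real (Suc (Suc n))) sums (1 / real (Suc 0) - 0)"
  by (rule telescope_sums'[of "\<lambda>n. 1 / real (Suc n)"]) real_asymp
 hence "(\<lambda>n. ?d n) sums of_real (1 / real (Suc 0) - 0)" by (rule sums_of_real)
 hence "(\<lambda>n. integral {0..1} (\<lambda>u. g n u * of_real (real (Suc n) + u) powr (- 1 - 1)) + m * ?d n) sums (periodic_Mellin g 1 + m * of_real (1 / real (Suc 0) - 0))"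
  unfolding periodic_Mellin_def by (intro sums_add sums_mult summable_sums periodic_Mellin_summable[OF mg(1)]) auto
 hence "(\<lambda>n. A n * ?d n) sums (periodic_Mellin g 1 + m)" unfolding eq by simp
 moreover have "dirichlet_L q chi 1 = periodic_Mellin g 1 + m" using mg(5)[of 1] np k0 by simp
 ultimately show "(\<lambda>n. (\<Sum>k\<le>n. chi (Suc k)) * ?d n) sums dirichlet_L q chi 1" by (simp add: A_def)
qed

section \<open>Logarithmic derivatives and non-vanishing on the line Re s = 1\<close>

lemma has_sum_Suc:
 fixes f :: "nat => complex"
 assumes "summable (\<lambda>n. norm (f (Suc n)))"
 shows "(f has_sum (\<Sum>n. f (Suc n))) {0<..}" "(\<lambda>n. norm (f n)) summable_on {0<..}"
proof -
 have "(\<lambda>n. f (Suc n)) sums (\<Sum>n. f (Suc n))" by (rule summable_sums[OF summable_norm_cancel[OF assms]])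
 hence "((\<lambda>n. f (Suc n)) has_sum (\<Sum>n. f (Suc n))) UNIV" by (rule norm_summable_imp_has_sum[OF assms])
 hence "((f \<circ> Suc) has_sum (\<Sum>n. f (Suc n))) UNIV" by (simp add: o_def)
 thus "(f has_sum (\<Sum>n. f (Suc n))) {0<..}" using has_sum_reindex[of Suc UNIV f] by (simp add: greaterThan_0)
 have "(\<lambda>n. norm (f (Suc n))) summable_on UNIV"
  by (rule norm_summable_imp_summable_on) (use assms in simp)
 hence "((\<lambda>n. norm (f n)) \<circ> Suc) summable_on UNIV" by (simp add: o_def)
 thus "(\<lambda>n. norm (f n)) summable_on {0<..}" using summable_on_reindex[of Suc UNIV "\<lambda>n. norm (f n)"] by (simp add: greaterThan_0)
qed

text \<open>A pair (d, k) is recorded as its product m together with d; the fibre over m is the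
  finite set of divisors of m.\<close>

lemma infsum_divisors:
 fixes F :: "nat \<times> nat => complex"
 assumes "F summable_on {0<..} \<times> {0<..}"
 shows "(\<lambda>m. \<Sum>d | d dvd m. F (d, m div d)) summable_on {0<..}"
  and "infsum F ({0<..} \<times> {0<..}) = (\<Sum>\<^sub>\<infinity>m\<in>{0<..}. \<Sum>d | d dvd m. F (d, m div d))"
proof -
 let ?S = "Sigma {0<..} (\<lambda>m. {d. d dvd m})" and ?T = "{0<..} \<times> {0<..} :: (nat \<times> nat) set"
 let ?h = "\<lambda>(m, d). F (d, m div d)"
 have fin: "finite {d. d dvd m}" if "m \<in> {0<..}" for m :: nat using that by auto
 have "F summable_on ?T \<longleftrightarrow> ?h summable_on ?S"
  by (rule summable_on_reindex_bij_witness[where j = "\<lambda>(d, k). (d * k, d)" and i = "\<lambda>(m, d). (d, m div d)"])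
    (auto intro!: Nat.gr0I elim!: dvdE)
 hence sS: "?h summable_on ?S" using assms by simp
 have "infsum F ?T = infsum ?h ?S"
  by (rule infsum_reindex_bij_witness[where j = "\<lambda>(d, k). (d * k, d)" and i = "\<lambda>(m, d). (d, m div d)"])
    (auto intro!: Nat.gr0I elim!: dvdE)
 also have "\<dots> = (\<Sum>\<^sub>\<infinity>m\<in>{0<..}. \<Sum>\<^sub>\<infinity>d\<in>{d. d dvd m}. ?h (m, d))"
  by (rule infsum_Sigma_banach[OF sS, symmetric])
 also have "\<dots> = (\<Sum>\<^sub>\<infinity>m\<in>{0<..}. \<Sum>d | d dvd m. F (d, m div d))"
  by (intro infsum_cong) (simp add: infsum_finite fin)
 finally show "infsum F ?T = (\<Sum>\<^sub>\<infinity>m\<in>{0<..}. \<Sum>d | d dvd m. F (d, m div d))" .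
 have "(\<lambda>m. \<Sum>\<^sub>\<infinity>d\<in>{d. d dvd m}. ?h (m, d)) summable_on {0<..}"
  by (rule summable_on_Sigma_banach) (use sS in \<open>simp add: case_prod_beta\<close>)
 thus "(\<lambda>m. \<Sum>d | d dvd m. F (d, m div d)) summable_on {0<..}"
  by (subst summable_on_cong[of _ _ "\<lambda>m. \<Sum>\<^sub>\<infinity>d\<in>{d. d dvd m}. ?h (m, d)"]) (auto simp: infsum_finite fin)
qed

lemma product_Dirichlet_convolution:
 fixes f g :: "nat => complex"
 assumes f: "summable (\<lambda>n. norm (f (Suc n)))" and g: "summable (\<lambda>n. norm (g (Suc n)))"
 shows "(\<Sum>n. f (Suc n)) * (\<Sum>n. g (Suc n)) = (\<Sum>\<^sub>\<infinity>m\<in>{0<..}. \<Sum>d | d dvd m. f d * g (m div d))"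
proof -
 let ?A = "{0<..} :: nat set"
 let ?F = "\<lambda>(x, y). f x * g y"
 note fs = has_sum_Suc[OF f] and gs = has_sum_Suc[OF g]
 have "(\<lambda>z. norm (?F z)) summable_on ?A \<times> ?A"
  unfolding Infinite_Sum.abs_summable_on_Sigma_iff
 proof (intro conjI ballI)
  fix x show "(\<lambda>y. norm (?F (x, y))) summable_on ?A"
   using summable_on_cmult_right[OF gs(2), of "norm (f x)"] by (simp add: norm_mult)
 next
  have "(\<lambda>x. \<Sum>\<^sub>\<infinity>y\<in>?A. norm (?F (x, y))) = (\<lambda>x. norm (f x) * (\<Sum>\<^sub>\<infinity>y\<in>?A. norm (g y)))"
   by (simp add: norm_mult infsum_cmult_right')
  moreover have "(\<lambda>x. norm (f x) * (\<Sum>\<^sub>\<infinity>y\<in>?A. norm (g y))) summable_on ?A"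
   by (rule summable_on_cmult_left[OF fs(2)])
  ultimately show "(\<lambda>x. norm (\<Sum>\<^sub>\<infinity>y\<in>?A. norm (?F (x, y)))) summable_on ?A"
   by (simp add: abs_mult infsum_nonneg)
 qed
 hence F: "?F summable_on ?A \<times> ?A" by (rule abs_summable_summable)
 have "(\<Sum>n. f (Suc n)) * (\<Sum>n. g (Suc n)) = infsum f ?A * infsum g ?A"
  using fs(1) gs(1) by (simp add: infsumI)
 also have "\<dots> = (\<Sum>\<^sub>\<infinity>x\<in>?A. \<Sum>\<^sub>\<infinity>y\<in>?A. ?F (x, y))"
  by (simp add: infsum_cmult_right' infsum_cmult_left')
 also have "\<dots> = infsum ?F (?A \<times> ?A)" by (rule infsum_Sigma_banach[OF F])
 also have "\<dots> = (\<Sum>\<^sub>\<infinity>m\<in>?A. \<Sum>d | d dvd m. f d * g (m div d))"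
  using infsum_divisors(2)[OF F] by simp
 finally show ?thesis .
qed

lemma mangoldt_le_ln: "n > 0 ==> mangoldt n \<le> ln (real n)"
proof -
 assume n: "n > 0"
 have "mangoldt n \<le> (\<Sum>d | d dvd n. mangoldt d :: real)"
  using n by (intro member_le_sum mangoldt_nonneg) auto
 also have "\<dots> = ln (real n)" using mangoldt_sum[of n, where 'a = real] n by simp
 finally show ?thesis .
qed

lemma summable_ln_powr:
 assumes "x > 1"
 shows "summable (\<lambda>n. ln (real (Suc n)) * real (Suc n) powr - x)"
proof (rule summable_comparison_test')
 define a where "a = (x - 1) / 2"
 have a: "a > 0" using assms by (simp add: a_def)
 show "summable (\<lambda>n. 1 / a * real (Suc n) powr (a - x))"
  using assms by (intro summable_mult summable_Suc_powr) (simp add: a_def field_simps)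
 fix n :: nat
 have "ln (real (Suc n)) * real (Suc n) powr - x \<le> (real (Suc n) powr a / a) * real (Suc n) powr - x"
  using a by (intro mult_right_mono ln_powr_bound) auto
 also have "\<dots> = 1 / a * real (Suc n) powr (a - x)" by (simp add: powr_diff powr_minus field_simps)
 finally show "norm (ln (real (Suc n)) * real (Suc n) powr - x) \<le> 1 / a * real (Suc n) powr (a - x)" by simp
qed

lemma norm_nat_powr: "cmod (of_nat (Suc n) powr s) = real (Suc n) powr Re s"
 by (subst norm_powr_real_powr) auto

definition Lambda_term :: "(nat => complex) => complex => nat => complex" where
 "Lambda_term chi s n = chi n * mangoldt n / of_nat n powr s"

definition Lambda_series :: "(nat => complex) => complex => complex" where
 "Lambda_series chi s = (\<Sum>n. Lambda_term chi s (Suc n))"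

context
 fixes q :: nat and chi :: "nat => complex"
 assumes chi: "dirichlet_character q chi"
begin

lemma Lambda_term_norm_le: "cmod (Lambda_term chi s (Suc n)) \<le> ln (real (Suc n)) * real (Suc n) powr - Re s"
proof -
 have "cmod (Lambda_term chi s (Suc n)) = cmod (chi (Suc n)) * mangoldt (Suc n) * real (Suc n) powr - Re s"
  unfolding Lambda_term_def norm_divide norm_mult norm_nat_powr by (simp add: powr_minus_divide)
 also have "\<dots> \<le> 1 * ln (real (Suc n)) * real (Suc n) powr - Re s"
  by (intro mult_right_mono mult_mono dirichlet_character_norm_le[OF chi] mangoldt_le_ln mangoldt_nonneg) auto
 finally show ?thesis by simp
qed

lemma Lambda_series_abs_summable: "Re s > 1 ==> summable (\<lambda>n. norm (Lambda_term chi s (Suc n)))"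
 using Lambda_term_norm_le by (intro summable_comparison_test'[OF summable_ln_powr[of "Re s"]]) auto

lemma char_term_norm_le: "cmod (chi (Suc n) / of_nat (Suc n) powr s) \<le> real (Suc n) powr - Re s"
proof -
 have "cmod (chi (Suc n) / of_nat (Suc n) powr s) = cmod (chi (Suc n)) * real (Suc n) powr - Re s"
  unfolding norm_divide norm_nat_powr by (simp add: powr_minus_divide)
 also have "\<dots> \<le> 1 * real (Suc n) powr - Re s" by (intro mult_right_mono dirichlet_character_norm_le[OF chi]) auto
 finally show ?thesis by simp
qed

lemma dirichlet_L_eq_suminf: "Re s > 1 ==> dirichlet_L q chi s = (\<Sum>n. chi (Suc n) / of_nat (Suc n) powr s)"
 using is_dirichlet_L_dirichlet_L[OF chi] by (simp add: is_dirichlet_L_def)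

lemma char_term_abs_summable: "Re s > 1 ==> summable (\<lambda>n. norm (chi (Suc n) / of_nat (Suc n) powr s))"
 using char_term_norm_le by (intro summable_comparison_test'[OF summable_Suc_powr[of "- Re s"]]) auto

lemma dirichlet_L_deriv_sums:
 assumes s: "Re s > 1"
 shows "(\<lambda>n. - (chi (Suc n) * ln (real (Suc n)) / of_nat (Suc n) powr s)) sums deriv (dirichlet_L q chi) s"
proof -
 define x where "x = (1 + Re s) / 2"
 have x: "x > 1" "Re s > x" using s by (auto simp: x_def)
 let ?A = "{z. Re z > x}"
 have ul: "uniform_limit ?A (\<lambda>N z. \<Sum>n<N. chi (Suc n) / of_nat (Suc n) powr z) (\<lambda>z. \<Sum>n. chi (Suc n) / of_nat (Suc n) powr z) sequentially"
 proof (rule Weierstrass_m_test)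
  show "summable (\<lambda>n. real (Suc n) powr - x)" using x by (intro summable_Suc_powr) auto
  fix n z assume z: "z \<in> ?A"
  have "cmod (chi (Suc n) / of_nat (Suc n) powr z) \<le> real (Suc n) powr - Re z" by (rule char_term_norm_le)
  also have "\<dots> \<le> real (Suc n) powr - x" using z by (intro powr_mono) auto
  finally show "cmod (chi (Suc n) / of_nat (Suc n) powr z) \<le> real (Suc n) powr - x" .
 qed
 have "(\<lambda>N. deriv (\<lambda>z. \<Sum>n<N. chi (Suc n) / of_nat (Suc n) powr z) s) \<longlonglongrightarrow> deriv (\<lambda>z. \<Sum>n. chi (Suc n) / of_nat (Suc n) powr z) s"
  by (rule deriv_complex_uniform_limit[OF ul])
    (use x in \<open>auto intro!: always_eventually holomorphic_intros open_halfspace_Re_gt\<close>)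
 moreover have "deriv (\<lambda>z. \<Sum>n<N. chi (Suc n) / of_nat (Suc n) powr z) s = (\<Sum>n<N. - (chi (Suc n) * ln (real (Suc n)) / of_nat (Suc n) powr s))" for N
 proof (rule DERIV_imp_deriv, rule DERIV_sum)
  fix n
  have l: "Ln (of_nat (Suc n)) = complex_of_real (ln (real (Suc n)))"
   using Ln_of_real[of "real (Suc n)"] by simp
  have "((\<lambda>z. chi (Suc n) / of_nat (Suc n) powr z) has_field_derivative
     - (chi (Suc n) * (Ln (of_nat (Suc n)) / of_nat (Suc n) powr s))) (at s)"
   unfolding powr_def by (auto intro!: derivative_eq_intros simp: field_simps power2_eq_square)
  thus "((\<lambda>z. chi (Suc n) / of_nat (Suc n) powr z) has_field_derivative - (chi (Suc n) * ln (real (Suc n)) / of_nat (Suc n) powr s)) (at s)"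
   unfolding l by simp
 qed
 moreover have "deriv (dirichlet_L q chi) s = deriv (\<lambda>z. \<Sum>n. chi (Suc n) / of_nat (Suc n) powr z) s"
 proof (rule deriv_cong_ev[OF _ refl])
  have "eventually (\<lambda>z. z \<in> ?A) (nhds s)" using x by (intro eventually_nhds_in_open open_halfspace_Re_gt) auto
  thus "\<forall>\<^sub>F z in nhds s. dirichlet_L q chi z = (\<Sum>n. chi (Suc n) / of_nat (Suc n) powr z)"
  proof eventually_elim
   case (elim z)
   thus ?case using x by (intro dirichlet_L_eq_suminf) auto
  qed
 qed
 ultimately show ?thesis unfolding sums_def by simp
qed

text \<open>The convolution of \<open>mangoldt\<close> with 1 is the logarithm, and the completely
  multiplicative \<open>chi\<close> can be carried along. The identity is a product and not a
  quotient because the non-vanishing of L is deduced from it.\<close>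

lemma deriv_dirichlet_L:
 assumes s: "Re s > 1"
 shows "deriv (dirichlet_L q chi) s = - (Lambda_series chi s * dirichlet_L q chi s)"
proof -
 define b where "b = (\<lambda>n. chi n * ln (real n) / of_nat n powr s)"
 have cm: "chi (m * n) = chi m * chi n" for m n using chi by (simp add: dirichlet_character_def)
 have bs: "summable (\<lambda>n. norm (b (Suc n)))"
 proof (rule summable_comparison_test'[OF summable_ln_powr[of "Re s"]])
  show "Re s > 1" by fact
  fix n
  have "norm (b (Suc n)) = cmod (chi (Suc n) / of_nat (Suc n) powr s) * ln (real (Suc n))"
   unfolding b_def norm_divide norm_mult norm_of_real by simp
  also have "\<dots> \<le> real (Suc n) powr - Re s * ln (real (Suc n))" by (intro mult_right_mono char_term_norm_le) auto
  finally show "norm (norm (b (Suc n))) \<le> ln (real (Suc n)) * real (Suc n) powr - Re s" by (simp add: mult.commute)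
 qed
 have "Lambda_series chi s * dirichlet_L q chi s =
   (\<Sum>\<^sub>\<infinity>m\<in>{0<..}. \<Sum>d | d dvd m. Lambda_term chi s d * (chi (m div d) / of_nat (m div d) powr s))"
  unfolding Lambda_series_def dirichlet_L_eq_suminf[OF s]
  by (rule product_Dirichlet_convolution[where g = "\<lambda>n. chi n / of_nat n powr s"]) (use s Lambda_series_abs_summable char_term_abs_summable in auto)
 also have "\<dots> = (\<Sum>\<^sub>\<infinity>m\<in>{0<..}. b m)"
 proof (rule infsum_cong)
  fix m :: nat assume m: "m \<in> {0<..}"
  have "(\<Sum>d | d dvd m. Lambda_term chi s d * (chi (m div d) / of_nat (m div d) powr s)) = (\<Sum>d | d dvd m. chi m / of_nat m powr s * mangoldt d)"
  proof (intro sum.cong refl)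
   fix d assume "d \<in> {d. d dvd m}"
   then obtain k where k: "m = d * k" by auto
   hence dk: "d > 0" "k > 0" using m by auto
   have "of_nat m powr s = complex_of_real (real d) powr s * complex_of_real (real k) powr s"
    using dk by (simp add: k powr_times_real)
   thus "Lambda_term chi s d * (chi (m div d) / of_nat (m div d) powr s) = chi m / of_nat m powr s * mangoldt d"
    using dk by (simp add: Lambda_term_def k cm)
  qed
  also have "\<dots> = chi m / of_nat m powr s * (\<Sum>d | d dvd m. mangoldt d)" by (simp only: sum_distrib_left)
  also have "(\<Sum>d | d dvd m. mangoldt d) = complex_of_real (ln (real m))" using m by (intro mangoldt_sum) auto
  finally show "(\<Sum>d | d dvd m. Lambda_term chi s d * (chi (m div d) / of_nat (m div d) powr s)) = b m" by (simp add: b_def)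
 qed
 also have "\<dots> = (\<Sum>n. b (Suc n))" using has_sum_Suc(1)[OF bs] by (rule infsumI)
 finally have "(\<Sum>n. b (Suc n)) = Lambda_series chi s * dirichlet_L q chi s" by simp
 moreover have "(\<lambda>n. - b (Suc n)) sums deriv (dirichlet_L q chi) s"
  using dirichlet_L_deriv_sums[OF s] by (simp add: b_def)
 hence "(\<lambda>n. b (Suc n)) sums - deriv (dirichlet_L q chi) s" using sums_minus by fastforce
 ultimately show ?thesis using sums_unique[of "\<lambda>n. b (Suc n)" "- deriv (dirichlet_L q chi) s"]
  by (metis minus_equation_iff)
qed

lemma Lambda_series_holomorphic: "Lambda_series chi holomorphic_on {s. Re s > 1}"
proof (rule holomorphic_uniform_sequence[OF open_halfspace_Re_gt])
 show "(\<lambda>s. \<Sum>n<N. Lambda_term chi s (Suc n)) holomorphic_on {s. Re s > 1}" for N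
  unfolding Lambda_term_def by (intro holomorphic_intros) auto
 fix s assume s: "s \<in> {s. Re s > 1}"
 define d where "d = (Re s - 1) / 2"
 define x where "x = 1 + d"
 have d: "d > 0" "x > 1" using s by (auto simp: d_def x_def)
 have sub: "Re z \<ge> x" if "z \<in> cball s d" for z
 proof -
  have "Re (s - z) \<le> d" using that abs_Re_le_cmod[of "s - z"] by (simp add: dist_norm)
  thus ?thesis by (simp add: x_def d_def field_simps)
 qed
 have "uniform_limit (cball s d) (\<lambda>N z. \<Sum>n<N. Lambda_term chi z (Suc n)) (\<lambda>z. \<Sum>n. Lambda_term chi z (Suc n)) sequentially"
 proof (rule Weierstrass_m_test)
  show "summable (\<lambda>n. ln (real (Suc n)) * real (Suc n) powr - x)" using d by (intro summable_ln_powr)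
  fix n z assume z: "z \<in> cball s d"
  have "cmod (Lambda_term chi z (Suc n)) \<le> ln (real (Suc n)) * real (Suc n) powr - Re z" by (rule Lambda_term_norm_le)
  also have "\<dots> \<le> ln (real (Suc n)) * real (Suc n) powr - x" using sub[OF z] by (intro mult_left_mono powr_mono) auto
  finally show "cmod (Lambda_term chi z (Suc n)) \<le> ln (real (Suc n)) * real (Suc n) powr - x" .
 qed
 moreover have "cball s d \<subseteq> {s. Re s > 1}" using sub d by force
 ultimately show "\<exists>d>0. cball s d \<subseteq> {s. Re s > 1} \<and> uniform_limit (cball s d) (\<lambda>N z. \<Sum>n<N. Lambda_term chi z (Suc n)) (Lambda_series chi) sequentially"
  unfolding Lambda_series_def[abs_def] using d(1) by blast
qed

lemma dirichlet_L_lower_bound: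
 assumes s: "Re s = 2"
 shows "cmod (dirichlet_L q chi s) \<ge> 1/4"
proof -
 define a where "a = (\<lambda>n. chi (Suc n) / of_nat (Suc n) powr s)"
 have as: "summable (\<lambda>n. norm (a n))" unfolding a_def using s by (intro char_term_abs_summable) auto
 have an: "norm (a n) \<le> 1 / real (Suc n) ^ 2" for n
  using char_term_norm_le[of n s] s unfolding a_def by (simp add: powr_minus_divide powr_numeral del: of_nat_Suc)
 have "dirichlet_L q chi s = (\<Sum>n. a n)" unfolding a_def using s by (intro dirichlet_L_eq_suminf) auto
 also have "\<dots> = (\<Sum>n. a (n + 2)) + (\<Sum>n<2. a n)" by (rule suminf_split_initial_segment[OF summable_norm_cancel[OF as]])
 finally have L: "dirichlet_L q chi s = (\<Sum>n. a (n + 2)) + a 1 + a 0" by (simp add: numeral_2_eq_2 lessThan_Suc)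
 have a0: "a 0 = 1" using chi by (simp add: a_def dirichlet_character_def)
 have a1: "norm (a 1) \<le> 1/4" using an[of 1] by simp
 \<comment> \<open>The terms from n = 3 on sum to at most 1/2 by comparison with a telescoping
   series, and the term n = 2 is at most 1/4. This leaves 1/4 of the first term 1.\<close>
 have tel: "(\<lambda>n. 1 / real (n + 2) - 1 / real (Suc n + 2)) sums (1 / real (0 + 2) - 0)"
  by (rule telescope_sums') real_asymp
 have "norm (\<Sum>n. a (n + 2)) \<le> (\<Sum>n. 1 / real (n + 2) - 1 / real (Suc n + 2))"
 proof (rule norm_suminf_le)
  show "summable (\<lambda>n. 1 / real (n + 2) - 1 / real (Suc n + 2))" using tel by (rule sums_summable)
  fix n
  have "norm (a (n + 2)) \<le> 1 / real (Suc (n + 2)) ^ 2" by (rule an)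
  also have "\<dots> \<le> 1 / (real (n + 2) * real (Suc n + 2))"
   by (intro divide_left_mono) (auto simp: power2_eq_square)
  also have "\<dots> = 1 / real (n + 2) - 1 / real (Suc n + 2)" by (simp add: field_simps)
  finally show "norm (a (n + 2)) \<le> 1 / real (n + 2) - 1 / real (Suc n + 2)" .
 qed
 also have "\<dots> = 1/2" using sums_unique[OF tel] by simp
 finally have "norm ((\<Sum>n. a (n + 2)) + a 1) \<le> 1/2 + 1/4" using a1 by (intro order_trans[OF norm_triangle_ineq]) simp
 moreover have "norm (1 :: complex) \<le> norm (dirichlet_L q chi s) + norm ((\<Sum>n. a (n + 2)) + a 1)"
  using norm_triangle_ineq4[of "dirichlet_L q chi s" "(\<Sum>n. a (n + 2)) + a 1"] by (simp add: L a0)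
 ultimately show ?thesis by simp
qed

text \<open>If E is a primitive of \<open>Lambda_series chi\<close>, then L exp E has derivative 0.
  Being nonzero at 2, this constant is nonzero, without recourse to an Euler product.\<close>

lemma dirichlet_L_nonzero_gt_1:
 assumes s: "Re s > 1"
 shows "dirichlet_L q chi s \<noteq> 0"
proof -
 let ?S = "{s. Re s > 1}"
 obtain E where E: "\<And>z. z \<in> ?S ==> (E has_field_derivative Lambda_series chi z) (at z within ?S)"
  using holomorphic_convex_primitive'[OF convex_halfspace_Re_gt open_halfspace_Re_gt Lambda_series_holomorphic] by blast
 have Ld: "(dirichlet_L q chi has_field_derivative - (Lambda_series chi z * dirichlet_L q chi z)) (at z within ?S)" if z: "z \<in> ?S" for z
 proof -
  have "dirichlet_L q chi holomorphic_on ?S"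
   using is_dirichlet_L_dirichlet_L[OF chi] unfolding is_dirichlet_L_def
   by (auto split: if_splits elim!: holomorphic_on_subset)
  hence "(dirichlet_L q chi has_field_derivative deriv (dirichlet_L q chi) z) (at z)"
   using z by (intro holomorphic_derivI[OF _ open_halfspace_Re_gt]) auto
  thus ?thesis using deriv_dirichlet_L[of z] z by (simp add: has_field_derivative_at_within)
 qed
 have "((\<lambda>z. dirichlet_L q chi z * exp (E z)) has_field_derivative 0) (at z within ?S)" if z: "z \<in> ?S" for z
  by (rule derivative_eq_intros Ld[OF z] E[OF z] refl)+ (simp add: algebra_simps)
 then obtain c where c: "\<And>z. z \<in> ?S ==> dirichlet_L q chi z * exp (E z) = c"
  using has_field_derivative_zero_constant[OF convex_halfspace_Re_gt, of 1 "\<lambda>z. dirichlet_L q chi z * exp (E z)"] by blast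
 have "dirichlet_L q chi 2 \<noteq> 0" using dirichlet_L_lower_bound[of 2] by auto
 hence "c \<noteq> 0" using c[of 2] by auto
 thus ?thesis using c[of s] s by auto
qed

lemma Lreg_eq:
 "s \<noteq> 1 \<or> \<not> principal_character q chi ==> Lreg q chi s = (if principal_character q chi then s - 1 else 1) * dirichlet_L q chi s"
 by (auto simp: Lreg_def)

lemma Lreg_1_principal: "principal_character q chi ==> Lreg q chi 1 \<noteq> 0"
 using char_mean_eq_0_iff[OF chi] by (simp add: Lreg_def)

lemma logderiv_Lreg:
 assumes s: "s \<noteq> 1 \<or> \<not> principal_character q chi" and nz: "dirichlet_L q chi s \<noteq> 0"
 shows "deriv (Lreg q chi) s / Lreg q chi s = deriv (dirichlet_L q chi) s / dirichlet_L q chi s + (if principal_character q chi then 1 / (s - 1) else 0)"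
proof (cases "principal_character q chi")
 case True
 hence s1: "s \<noteq> 1" using s by auto
 have "dirichlet_L q chi holomorphic_on - {1}"
  using is_dirichlet_L_dirichlet_L[OF chi] True by (simp add: is_dirichlet_L_def)
 hence d: "(dirichlet_L q chi has_field_derivative deriv (dirichlet_L q chi) s) (at s)"
  using s1 by (intro holomorphic_derivI[of _ "- {1}"]) auto
 have "deriv (Lreg q chi) s = deriv (\<lambda>s. (s - 1) * dirichlet_L q chi s) s"
 proof (rule deriv_cong_ev[OF _ refl])
  have "eventually (\<lambda>z. z \<in> - {1}) (nhds s)" using s1 by (intro eventually_nhds_in_open) auto
  thus "\<forall>\<^sub>F x in nhds s. Lreg q chi x = (x - 1) * dirichlet_L q chi x"
   by eventually_elim (use True in \<open>auto simp: Lreg_def\<close>)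
 qed
 also have "\<dots> = dirichlet_L q chi s + (s - 1) * deriv (dirichlet_L q chi) s"
  by (rule DERIV_imp_deriv) (auto intro!: derivative_eq_intros d)
 finally show ?thesis using True s1 nz by (simp add: Lreg_def field_simps)
next
 case False
 hence "Lreg q chi = dirichlet_L q chi" by (intro ext) (simp add: Lreg_def)
 thus ?thesis using False by simp
qed

lemma Lambda_series_eq_logderiv:
 assumes "Re s > 1"
 shows "Lambda_series chi s = - (deriv (dirichlet_L q chi) s / dirichlet_L q chi s)"
 using deriv_dirichlet_L[OF assms] dirichlet_L_nonzero_gt_1[OF assms] by simp

lemma Lreg_nonzero_gt_1: "Re s > 1 ==> Lreg q chi s \<noteq> 0"
 using dirichlet_L_nonzero_gt_1[of s] by (subst Lreg_eq) auto

end

lemma logderiv_local: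
 fixes f :: "complex => complex"
 assumes f: "f holomorphic_on S" "open S" "connected S" "z \<in> S" "w0 \<in> S" "f w0 \<noteq> 0"
 shows "\<exists>r g n. r > 0 \<and> ball z r \<subseteq> S \<and> g holomorphic_on ball z r \<and> (\<forall>w\<in>ball z r. g w \<noteq> 0) \<and> (n = 0 \<longleftrightarrow> f z \<noteq> 0) \<and>
  zorder f z = int n \<and> (\<forall>w\<in>ball z r - {z}. f w \<noteq> 0 \<and> deriv f w / f w = of_nat n / (w - z) + deriv g w / g w)"
proof -
 define n where "n = nat (zorder f z)"
 define g where "g = zor_poly f z"
 have "\<exists>w\<in>S. f w \<noteq> 0" using f by blast
 from zorder_exist_zero[OF f(1-4) this] obtain r where r: "if f z = 0 then 0 < zorder f z else zorder f z = 0" "r > 0" "cball z r \<subseteq> S"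
  "g holomorphic_on cball z r" "\<And>w. w \<in> cball z r ==> f w = g w * (w - z) ^ n" "\<And>w. w \<in> cball z r ==> g w \<noteq> 0"
  unfolding g_def n_def by blast
 have gh: "g holomorphic_on ball z r" using r(4) by (rule holomorphic_on_subset) auto
 have ld: "f w \<noteq> 0 \<and> deriv f w / f w = of_nat n / (w - z) + deriv g w / g w" if w: "w \<in> ball z r - {z}" for w
 proof -
  have gd: "(g has_field_derivative deriv g w) (at w)" using w by (intro holomorphic_derivI[OF gh]) auto
  have "deriv f w = deriv (\<lambda>w. g w * (w - z) ^ n) w"
  proof (rule deriv_cong_ev[OF _ refl])
   have "eventually (\<lambda>w. w \<in> ball z r) (nhds w)" using w by (intro eventually_nhds_in_open) auto
   thus "\<forall>\<^sub>F x in nhds w. f x = g x * (x - z) ^ n" by eventually_elim (use r(5) in auto)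
  qed
  also have "\<dots> = deriv g w * (w - z) ^ n + g w * (of_nat n * (w - z) ^ (n - 1))"
   by (rule DERIV_imp_deriv) (auto intro!: derivative_eq_intros gd)
  finally have d: "deriv f w = deriv g w * (w - z) ^ n + g w * (of_nat n * (w - z) ^ (n - 1))" .
  have fw: "f w = g w * (w - z) ^ n" "g w \<noteq> 0" using r(5,6)[of w] w by auto
  have nz: "w - z \<noteq> 0" using w by auto
  have "deriv f w / f w = deriv g w / g w + of_nat n * (w - z) ^ (n - 1) / (w - z) ^ n"
   unfolding d fw(1) using fw(2) nz by (simp add: field_simps)
  also have "of_nat n * (w - z) ^ (n - 1) / (w - z) ^ n = of_nat n / (w - z)"
   using nz by (cases n) auto
  finally show ?thesis using fw nz by simp
 qed
 have n1: "n = 0 \<longleftrightarrow> f z \<noteq> 0" "zorder f z = int n" using r(1) by (auto simp: n_def split: if_splits)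
 have "ball z r \<subseteq> S" "\<forall>w\<in>ball z r. g w \<noteq> 0" using r(3,6) by auto
 thus ?thesis using r(2) gh n1 ld
  by (intro exI[of _ r] exI[of _ g] exI[of _ n] conjI ballI) auto
qed

text \<open>At 1 + i \<tau> the function -L'/L has residue (order of the pole of L) - (order of its
  zero), and multiplication by h on the way from the right reads off this number. The order
  \<open>n\<close> belongs to \<open>Lreg\<close>; the pole is accounted for separately.\<close>

lemma Lambda_series_limit:
 assumes chi: "dirichlet_character q chi"
 obtains n :: nat where "n = 0 \<longleftrightarrow> Lreg q chi (Complex 1 \<tau>) \<noteq> 0"
  "((\<lambda>h. of_real h * Lambda_series chi (Complex (1 + h) \<tau>)) \<longlongrightarrow> (if principal_character q chi \<and> \<tau> = 0 then 1 else 0) - of_nat n) (at_right 0)"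
proof -
 let ?R = "Lreg q chi" and ?z = "Complex 1 \<tau>"
 have hol: "?R holomorphic_on UNIV" by (rule Lreg_holomorphic[OF chi])
 have nz2: "?R 2 \<noteq> 0" by (rule Lreg_nonzero_gt_1[OF chi]) simp
 obtain r g n where rg: "r > 0" "g holomorphic_on ball ?z r" "\<And>w. w \<in> ball ?z r ==> g w \<noteq> 0" "n = 0 \<longleftrightarrow> ?R ?z \<noteq> 0"
  "\<And>w. w \<in> ball ?z r - {?z} ==> ?R w \<noteq> 0 \<and> deriv ?R w / ?R w = of_nat n / (w - ?z) + deriv g w / g w"
  using logderiv_local[OF hol open_UNIV connected_UNIV UNIV_I UNIV_I nz2, of ?z] by (elim exE conjE) (rule that, auto)
 let ?p = "\<lambda>h. if principal_character q chi then complex_of_real h / Complex h \<tau> else 0"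
 have C: "Complex (1 + h) \<tau> = ?z + of_real h" for h by (simp add: complex_eq_iff)
 have ev: "\<forall>\<^sub>F h in at_right 0. ?p h - of_nat n - of_real h * (deriv g (?z + of_real h) / g (?z + of_real h)) = of_real h * Lambda_series chi (Complex (1 + h) \<tau>)"
  using eventually_at_right_real[OF rg(1)]
 proof eventually_elim
  case (elim h)
  have w: "?z + of_real h \<in> ball ?z r - {?z}" using elim by (auto simp: dist_norm)
  have Re: "Re (?z + of_real h) > 1" using elim by simp
  have ne: "?z + of_real h \<noteq> 1" using Re by (metis less_irrefl one_complex.sel(1))
  have ld: "deriv ?R (?z + of_real h) / ?R (?z + of_real h) = deriv (dirichlet_L q chi) (?z + of_real h) / dirichlet_L q chi (?z + of_real h) + (if principal_character q chi then 1 / (?z + of_real h - 1) else 0)"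
   by (rule logderiv_Lreg[OF chi]) (use ne dirichlet_L_nonzero_gt_1[OF chi Re] in auto)
  have e: "?z + of_real h - 1 = Complex h \<tau>" by (simp add: complex_eq_iff)
  have "Lambda_series chi (Complex (1 + h) \<tau>) = (if principal_character q chi then 1 / Complex h \<tau> else 0) - deriv ?R (?z + of_real h) / ?R (?z + of_real h)"
   unfolding C Lambda_series_eq_logderiv[OF chi Re] ld e by simp
  also have "deriv ?R (?z + of_real h) / ?R (?z + of_real h) = of_nat n / of_real h + deriv g (?z + of_real h) / g (?z + of_real h)"
   using rg(5)[OF w] by simp
  finally show ?case using elim by (simp add: field_simps)
 qed
 have "((\<lambda>h. ?p h - of_nat n - of_real h * (deriv g (?z + of_real h) / g (?z + of_real h))) \<longlongrightarrow>
   (if principal_character q chi \<and> \<tau> = 0 then 1 else 0) - of_nat n - of_real 0 * (deriv g (?z + of_real 0) / g (?z + of_real 0))) (at_right 0)"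
 proof (intro tendsto_intros)
  have ev0: "eventually (\<lambda>h. h > 0) (at_right (0::real))" by (simp add: eventually_at_right_less)
  show "(?p \<longlongrightarrow> (if principal_character q chi \<and> \<tau> = 0 then 1 else 0)) (at_right 0)"
  proof (cases "principal_character q chi \<and> \<tau> = 0")
   case True
   have "\<forall>\<^sub>F h in at_right 0. ?p h = 1" using ev0
    by eventually_elim (use True in \<open>auto simp: complex_eq_iff Complex_eq\<close>)
   thus ?thesis using True by (simp add: tendsto_eventually)
  next
   case False
   have "((\<lambda>h. complex_of_real h / (of_real h + \<i> * of_real \<tau>)) \<longlongrightarrow> of_real 0 / (of_real 0 + \<i> * of_real \<tau>)) (at_right 0)" if "\<tau> \<noteq> 0"
    using that by (intro tendsto_intros) auto
   hence "\<tau> \<noteq> 0 ==> ((\<lambda>h. complex_of_real h / Complex h \<tau>) \<longlongrightarrow> 0) (at_right 0)" by (simp add: Complex_eq)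
   thus ?thesis using False by (cases "principal_character q chi") auto
  qed
  have gc: "continuous_on (ball ?z r) g" "continuous_on (ball ?z r) (deriv g)"
   using rg(2) by (auto intro!: holomorphic_on_imp_continuous_on holomorphic_deriv)
  have zb: "?z \<in> ball ?z r" using rg(1) by simp
  have lim: "((\<lambda>h. ?z + complex_of_real h) \<longlongrightarrow> ?z) (at_right 0)" by (auto intro!: tendsto_eq_intros)
  have "isCont g ?z" "isCont (deriv g) ?z" using gc zb by (auto simp: continuous_on_eq_continuous_at)
  thus "((\<lambda>h. g (?z + of_real h)) \<longlongrightarrow> g (?z + of_real 0)) (at_right 0)" "((\<lambda>h. deriv g (?z + of_real h)) \<longlongrightarrow> deriv g (?z + of_real 0)) (at_right 0)"
   using isCont_tendsto_compose[OF _ lim] by auto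
  show "g (?z + of_real 0) \<noteq> 0" using rg(3)[OF zb] by simp
 qed
 hence "((\<lambda>h. of_real h * Lambda_series chi (Complex (1 + h) \<tau>)) \<longlongrightarrow> (if principal_character q chi \<and> \<tau> = 0 then 1 else 0) - of_nat n) (at_right 0)"
  by (subst (asm) tendsto_cong[OF ev]) simp
 with rg(4) show ?thesis by (rule that)
qed

section \<open>The 3-4-1 inequality\<close>

lemma character_power2:
 assumes "dirichlet_character q chi"
 shows "dirichlet_character q (\<lambda>n. chi n ^ 2)" "dirichlet_character q (\<lambda>n. if coprime n q then 1 else 0)"
proof -
 show "dirichlet_character q (\<lambda>n. chi n ^ 2)"
  using assms by (simp add: dirichlet_character_def power_mult_distrib)
 have 1: "coprime (m * n) q \<longleftrightarrow> coprime m q \<and> coprime n q" for m n by (rule coprime_mult_left_iff)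
 have 2: "coprime (n + q) q \<longleftrightarrow> coprime n q" for n by (simp only: coprime_iff_gcd_eq_1 gcd_add1)
 have q: "q > 0" using assms by (simp add: dirichlet_character_def)
 show "dirichlet_character q (\<lambda>n. if coprime n q then 1 else 0)"
  unfolding dirichlet_character_def 1 2 using q by simp
qed

text \<open>For |w| = 1 one has 3 + 4 Re w + Re w^2 = 2 (1 + Re w)^2 \<ge> 0, applied termwise to w
  = chi(n) n^(-i \<tau>).\<close>

lemma three_four_one:
 assumes chi: "dirichlet_character q chi" and s: "\<sigma> > 1"
 shows "3 * Re (Lambda_series (\<lambda>n. if coprime n q then 1 else (0::complex)) (Complex \<sigma> 0)) + 4 * Re (Lambda_series chi (Complex \<sigma> \<tau>))
   + Re (Lambda_series (\<lambda>n. chi n ^ 2) (Complex \<sigma> (2 * \<tau>))) \<ge> 0"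
proof -
 let ?c0 = "\<lambda>n. if coprime n q then 1 else 0 :: complex" and ?c2 = "\<lambda>n. chi n ^ 2"
 note ch = character_power2[OF chi]
 have sm: "(\<lambda>n. Lambda_term psi s (Suc n)) sums Lambda_series psi s" if "dirichlet_character q psi" "Re s > 1" for psi s
  unfolding Lambda_series_def by (rule summable_sums[OF summable_norm_cancel[OF Lambda_series_abs_summable[OF that]]])
 have "(\<lambda>n. 3 * Lambda_term ?c0 (Complex \<sigma> 0) (Suc n) + 4 * Lambda_term chi (Complex \<sigma> \<tau>) (Suc n) + Lambda_term ?c2 (Complex \<sigma> (2 * \<tau>)) (Suc n))
  sums (3 * Lambda_series ?c0 (Complex \<sigma> 0) + 4 * Lambda_series chi (Complex \<sigma> \<tau>) + Lambda_series ?c2 (Complex \<sigma> (2 * \<tau>)))"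
  by (intro sums_add sums_mult sm ch chi) (use s in auto)
 hence S: "(\<lambda>n. Re (3 * Lambda_term ?c0 (Complex \<sigma> 0) (Suc n) + 4 * Lambda_term chi (Complex \<sigma> \<tau>) (Suc n) + Lambda_term ?c2 (Complex \<sigma> (2 * \<tau>)) (Suc n)))
  sums Re (3 * Lambda_series ?c0 (Complex \<sigma> 0) + 4 * Lambda_series chi (Complex \<sigma> \<tau>) + Lambda_series ?c2 (Complex \<sigma> (2 * \<tau>)))"
  by (rule sums_Re)
 have pos: "Re (3 * Lambda_term ?c0 (Complex \<sigma> 0) (Suc n) + 4 * Lambda_term chi (Complex \<sigma> \<tau>) (Suc n) + Lambda_term ?c2 (Complex \<sigma> (2 * \<tau>)) (Suc n)) \<ge> 0" for n
 proof (cases "coprime (Suc n) q")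
  case False
  hence "chi (Suc n) = 0" using chi by (simp add: dirichlet_character_def)
  thus ?thesis using False by (simp add: Lambda_term_def)
 next
  case True
  define N where "N = complex_of_nat (Suc n)"
  define w where "w = chi (Suc n) / N powr Complex 0 \<tau>"
  have Cs: "Complex a b = Complex a 0 + Complex 0 b" for a b by (simp add: complex_eq_iff)
  have n2: "N powr Complex 0 (2 * \<tau>) = (N powr Complex 0 \<tau>)^2"
  proof -
   have "Complex 0 (2 * \<tau>) = Complex 0 \<tau> + Complex 0 \<tau>" by (simp add: complex_eq_iff)
   thus ?thesis by (simp only: powr_add power2_eq_square)
  qed
  have wn: "cmod w = 1"
   unfolding w_def N_def norm_divide norm_nat_powr using character_norm_1[OF chi True] by simp
  define m where "m = (mangoldt (Suc n) :: real) * real (Suc n) powr - \<sigma>"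
  have m0: "m \<ge> 0" unfolding m_def by (intro mult_nonneg_nonneg mangoldt_nonneg) auto
  have Npow: "N powr Complex \<sigma> 0 = of_real (real (Suc n) powr \<sigma>)"
  proof -
   have "Complex \<sigma> 0 = of_real \<sigma>" by (simp add: complex_of_real_def)
   thus ?thesis unfolding N_def using powr_of_real[of "real (Suc n)" \<sigma>] by (simp del: of_nat_Suc)
  qed
  have m': "mangoldt (Suc n) / N powr Complex \<sigma> 0 = complex_of_real m"
   unfolding Npow m_def by (simp add: powr_minus_divide del: of_nat_Suc)
  have "Lambda_term chi (Complex \<sigma> \<tau>) (Suc n) = (chi (Suc n) / N powr Complex 0 \<tau>) * (mangoldt (Suc n) / N powr Complex \<sigma> 0)"
   unfolding Lambda_term_def N_def[symmetric] Cs[of \<sigma> \<tau>] powr_add by (simp add: field_simps)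
  hence t1: "Lambda_term chi (Complex \<sigma> \<tau>) (Suc n) = w * of_real m" unfolding m' w_def .
  have "Lambda_term ?c2 (Complex \<sigma> (2 * \<tau>)) (Suc n) = (chi (Suc n) / N powr Complex 0 \<tau>)^2 * (mangoldt (Suc n) / N powr Complex \<sigma> 0)"
   unfolding Lambda_term_def N_def[symmetric] Cs[of \<sigma> "2 * \<tau>"] powr_add n2 by (simp add: field_simps power_divide)
  hence t2: "Lambda_term ?c2 (Complex \<sigma> (2 * \<tau>)) (Suc n) = w^2 * of_real m" unfolding m' w_def .
  have t0: "Lambda_term ?c0 (Complex \<sigma> 0) (Suc n) = of_real m"
   using True m' by (simp add: Lambda_term_def N_def)
  have w2: "(Re w)^2 + (Im w)^2 = 1" using wn by (simp add: cmod_def)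
  have "Re (3 * Lambda_term ?c0 (Complex \<sigma> 0) (Suc n) + 4 * Lambda_term chi (Complex \<sigma> \<tau>) (Suc n) + Lambda_term ?c2 (Complex \<sigma> (2 * \<tau>)) (Suc n))
   = (3 + 4 * Re w + ((Re w)^2 - (Im w)^2)) * m"
   unfolding t0 t1 t2 by (simp add: power2_eq_square algebra_simps)
  also have "3 + 4 * Re w + ((Re w)^2 - (Im w)^2) = 2 * (1 + Re w)^2"
   using w2 by (simp add: power2_eq_square algebra_simps)
  finally show ?thesis using m0 by simp
 qed
 have "Re (3 * Lambda_series ?c0 (Complex \<sigma> 0) + 4 * Lambda_series chi (Complex \<sigma> \<tau>) + Lambda_series ?c2 (Complex \<sigma> (2 * \<tau>))) \<ge> 0"
  using sums_unique[OF S] suminf_nonneg[OF sums_summable[OF S]] pos by simp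
 thus ?thesis by simp
qed

text \<open>Multiplying the inequality by h = \<sigma> - 1 and letting h tend to 0 gives 3 - 4 n1 +
  e - n2 \<ge> 0, where e = 1 if \<tau> = 0 and the square of \<open>chi\<close> is principal, and e
  = 0 otherwise. A zero means n1 \<ge> 1, so only e = 1 remains; that case is beyond this
  method.\<close>

lemma Lreg_zero_on_1_line:
 assumes chi: "dirichlet_character q chi" and z: "Lreg q chi (Complex 1 \<tau>) = 0"
 shows "\<tau> = 0 \<and> principal_character q (\<lambda>n. chi n ^ 2) \<and> \<not> principal_character q chi"
proof -
 let ?c0 = "\<lambda>n. if coprime n q then 1 else 0 :: complex" and ?c2 = "\<lambda>n. chi n ^ 2"
 note ch = character_power2[OF chi]
 have p0: "principal_character q ?c0" by (simp add: principal_character_def)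
 have one: "Complex 1 0 = 1" by (simp add: complex_eq_iff)
 obtain n0 where n0: "n0 = 0 \<longleftrightarrow> Lreg q ?c0 (Complex 1 0) \<noteq> 0"
  "((\<lambda>h. of_real h * Lambda_series ?c0 (Complex (1 + h) 0)) \<longlongrightarrow> (if principal_character q ?c0 \<and> 0 = (0::real) then 1 else 0) - of_nat n0) (at_right 0)"
  by (rule Lambda_series_limit[OF ch(2), of 0])
 have n00: "n0 = 0" using n0(1) Lreg_1_principal[OF ch(2) p0] one by simp
 obtain n1 where n1: "n1 = 0 \<longleftrightarrow> Lreg q chi (Complex 1 \<tau>) \<noteq> 0"
  "((\<lambda>h. of_real h * Lambda_series chi (Complex (1 + h) \<tau>)) \<longlongrightarrow> (if principal_character q chi \<and> \<tau> = 0 then 1 else 0) - of_nat n1) (at_right 0)"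
  by (rule Lambda_series_limit[OF chi, of \<tau>])
 have n10: "n1 \<ge> 1" using n1(1) z by (cases n1) auto
 obtain n2 where n2: "((\<lambda>h. of_real h * Lambda_series ?c2 (Complex (1 + h) (2 * \<tau>))) \<longlongrightarrow> (if principal_character q ?c2 \<and> 2 * \<tau> = 0 then 1 else 0) - of_nat n2) (at_right 0)"
  by (rule Lambda_series_limit[OF ch(1), of "2 * \<tau>"])
 let ?L = "3 * Re ((if principal_character q ?c0 \<and> 0 = (0::real) then 1 else 0) - of_nat n0) + 4 * Re ((if principal_character q chi \<and> \<tau> = 0 then 1 else 0) - of_nat n1)
   + Re ((if principal_character q ?c2 \<and> 2 * \<tau> = 0 then 1 else 0) - of_nat n2)"
 have "((\<lambda>h. 3 * Re (of_real h * Lambda_series ?c0 (Complex (1 + h) 0)) + 4 * Re (of_real h * Lambda_series chi (Complex (1 + h) \<tau>))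
   + Re (of_real h * Lambda_series ?c2 (Complex (1 + h) (2 * \<tau>)))) \<longlongrightarrow> ?L) (at_right 0)"
  by (intro tendsto_intros n0(2) n1(2) n2)
 moreover have "\<forall>\<^sub>F h in at_right 0. 3 * Re (of_real h * Lambda_series ?c0 (Complex (1 + h) 0)) + 4 * Re (of_real h * Lambda_series chi (Complex (1 + h) \<tau>))
   + Re (of_real h * Lambda_series ?c2 (Complex (1 + h) (2 * \<tau>))) \<ge> 0"
  using eventually_at_right_less[of "0::real"]
 proof eventually_elim
  case (elim h)
  have "0 \<le> h * (3 * Re (Lambda_series ?c0 (Complex (1 + h) 0)) + 4 * Re (Lambda_series chi (Complex (1 + h) \<tau>)) + Re (Lambda_series ?c2 (Complex (1 + h) (2 * \<tau>))))"
   using elim three_four_one[OF chi, of "1 + h" \<tau>] by (intro mult_nonneg_nonneg) auto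
  thus ?case by (simp add: algebra_simps)
 qed
 ultimately have L: "?L \<ge> 0" by (rule tendsto_lowerbound) simp
 have npt: "\<not> (principal_character q chi \<and> \<tau> = 0)"
  using Lreg_1_principal[OF chi] z one by auto
 have n1r: "real n1 \<ge> 1" using n10 by simp
 from L have "3 - 4 * real n1 + (if principal_character q ?c2 \<and> \<tau> = 0 then 1 else 0) - real n2 \<ge> 0"
  using n00 npt p0 by (simp split: if_splits)
 hence "principal_character q ?c2 \<and> \<tau> = 0" using n1r by (auto split: if_splits)
 thus ?thesis using npt by blast
qed

section \<open>Real characters at s = 1\<close>

lemma sum_divisors_prime_power:
 fixes f :: "nat => real" and p m k :: nat
 assumes p: "prime p" and m: "m > 0" "\<not> p dvd m" and mult: "\<And>a b. f (a * b) = f a * f b" "f 1 = 1"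
 shows "(\<Sum>d | d dvd p ^ k * m. f d) = (\<Sum>i\<le>k. f p ^ i) * (\<Sum>d | d dvd m. f d)"
proof -
 have bij: "bij_betw (\<lambda>(i, d). p ^ i * d) ({..k} \<times> {d. d dvd m}) {d. d dvd p ^ k * m}"
  unfolding bij_betw_def
 proof
  show "inj_on (\<lambda>(i, d). p ^ i * d) ({..k} \<times> {d. d dvd m})"
  proof (rule inj_onI, clarify)
   fix i d j e assume h: "d dvd m" "e dvd m" "p ^ i * d = p ^ j * e"
   have nd: "\<not> p dvd d" "\<not> p dvd e" "d \<noteq> 0" "e \<noteq> 0" using h m by (auto dest: dvd_trans)
   have "multiplicity p (p ^ n * c) = n" if "\<not> p dvd c" "c \<noteq> 0" for n c
    using that p by (simp add: multiplicity_times_same prime_elem_multiplicity_mult_distrib not_dvd_imp_multiplicity_0)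
   hence "i = j" using h(3) nd by metis
   thus "i = j \<and> d = e" using h(3) p by auto
  qed
  show "(\<lambda>(i, d). p ^ i * d) ` ({..k} \<times> {d. d dvd m}) = {d. d dvd p ^ k * m}"
  proof (intro equalityI subsetI)
   fix x assume "x \<in> {d. d dvd p ^ k * m}"
   then obtain b c where bc: "x = b * c" "b dvd p ^ k" "c dvd m" using division_decomp[of x "p ^ k" m] by auto
   then obtain i where "i \<le> k" "b = p ^ i" using divides_primepow_nat[OF p] by auto
   thus "x \<in> (\<lambda>(i, d). p ^ i * d) ` ({..k} \<times> {d. d dvd m})" using bc by auto
  qed (auto intro!: mult_dvd_mono le_imp_power_dvd)
 qed
 have pw: "f (p ^ i) = f p ^ i" for i by (induction i) (use mult in auto)
 have "(\<Sum>d | d dvd p ^ k * m. f d) = (\<Sum>(i, d)\<in>{..k} \<times> {d. d dvd m}. f (p ^ i * d))"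
  using sum.reindex_bij_betw[OF bij, of f, symmetric] by (simp add: case_prod_beta)
 also have "\<dots> = (\<Sum>i\<le>k. \<Sum>d | d dvd m. f p ^ i * f d)"
  by (simp add: sum.cartesian_product mult pw)
 also have "\<dots> = (\<Sum>i\<le>k. f p ^ i) * (\<Sum>d | d dvd m. f d)" by (simp only: sum_product)
 finally show ?thesis .
qed

lemma geometric_sign_sum:
 assumes "x \<in> {-1, 0, 1 :: real}"
 shows "(\<Sum>i\<le>k. x ^ i) \<ge> 0" "even k ==> (\<Sum>i\<le>k. x ^ i) \<ge> 1"
proof -
 consider "x = -1" | "x = 0" | "x = 1" using assms by auto
 hence "(\<Sum>i\<le>k. x ^ i) \<ge> 0 \<and> (even k --> (\<Sum>i\<le>k. x ^ i) \<ge> 1)"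
 proof cases
  case 1
  have "(\<Sum>i\<le>k. (-1) ^ i) = (if even k then 1 else 0 :: real)" by (induction k) auto
  thus ?thesis using 1 by simp
 qed (auto simp: power_0_left)
 thus "(\<Sum>i\<le>k. x ^ i) \<ge> 0" "even k ==> (\<Sum>i\<le>k. x ^ i) \<ge> 1" by auto
qed

lemma nat_prime_peel:
 fixes n :: nat
 assumes "n > 1"
 obtains p k m where "prime p" "n = p ^ k * m" "\<not> p dvd m" "m > 0" "m < n"
proof -
 obtain p where p: "prime p" "p dvd n" using prime_factor_nat[of n] assms by auto
 have "n \<noteq> 0" "\<not> is_unit p" using assms p by auto
 then obtain m where m: "n = p ^ multiplicity p n * m" "\<not> p dvd m"
  by (rule multiplicity_decompose')
 have k: "multiplicity p n > 0" using p assms by (simp add: prime_multiplicity_gt_zero_iff)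
 have m0: "m > 0" using m(1) assms by (cases "m = 0") auto
 have "p ^ multiplicity p n > 1" by (rule one_less_power[OF prime_gt_1_nat[OF p(1)] k])
 hence "1 * m < p ^ multiplicity p n * m" using m0 by (intro mult_strict_right_mono) auto
 hence "m < n" using m(1) by simp
 thus ?thesis by (rule that[OF p(1) m m0])
qed

text \<open>The divisor sum is multiplicative. At a prime power it is a geometric sum of ratio 1, 0
  or -1, which is never negative and is at least 1 when the exponent is even.\<close>

lemma sum_divisors_sign_character:
 fixes f :: "nat => real"
 assumes mult: "\<And>a b. f (a * b) = f a * f b" "f 1 = 1" and sgn: "\<And>a. f a \<in> {-1, 0, 1}"
 shows "n > 0 ==> (\<Sum>d | d dvd n. f d) \<ge> 0" "n > 0 ==> (\<Sum>d | d dvd n^2. f d) \<ge> 1"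
proof -
 have one: "(\<Sum>d | d dvd (1::nat). f d) = 1" using mult(2) by simp
 show "(\<Sum>d | d dvd n. f d) \<ge> 0" if "n > 0" using that
 proof (induction n rule: less_induct)
  case (less n)
  show ?case
  proof (cases "n = 1")
   case True thus ?thesis using one by simp
  next
   case False
   hence "n > 1" using less.prems by simp
   then obtain p k m where pk: "prime p" "n = p ^ k * m" "\<not> p dvd m" "m > 0" "m < n" by (rule nat_prime_peel)
   have "(\<Sum>d | d dvd n. f d) = (\<Sum>i\<le>k. f p ^ i) * (\<Sum>d | d dvd m. f d)"
    unfolding pk(2) by (rule sum_divisors_prime_power[OF pk(1,4,3) mult])
   thus ?thesis using less.IH[OF pk(5,4)] geometric_sign_sum(1)[OF sgn[of p], of k] by simp
  qed
 qed
 show "(\<Sum>d | d dvd n^2. f d) \<ge> 1" if "n > 0" using that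
 proof (induction n rule: less_induct)
  case (less n)
  show ?case
  proof (cases "n = 1")
   case True thus ?thesis using one by simp
  next
   case False
   hence "n > 1" using less.prems by simp
   then obtain p k m where pk: "prime p" "n = p ^ k * m" "\<not> p dvd m" "m > 0" "m < n" by (rule nat_prime_peel)
   have e: "n^2 = p ^ (2 * k) * m^2" by (simp add: pk(2) power_mult_distrib power_mult mult.commute)
   have nd: "\<not> p dvd m^2" using pk(1,3) prime_dvd_power by blast
   have "(\<Sum>d | d dvd n^2. f d) = (\<Sum>i\<le>2 * k. f p ^ i) * (\<Sum>d | d dvd m^2. f d)"
    unfolding e by (rule sum_divisors_prime_power[OF pk(1) _ nd mult]) (use pk(4) in simp)
   moreover have "1 * 1 \<le> (\<Sum>i\<le>2 * k. f p ^ i) * (\<Sum>d | d dvd m^2. f d)"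
    using less.IH[OF pk(5,4)] geometric_sign_sum(2)[OF sgn[of p], of "2 * k"] by (intro mult_mono) auto
   ultimately show ?thesis by simp
  qed
 qed
qed

lemma exp_minus_inverse_bounds:
 fixes y :: real
 assumes "y > 0"
 shows "1 / y - 1 / (exp y - 1) \<le> 1" "y * exp (y / 2) \<le> exp y - 1"
proof -
 have ey: "exp y - 1 > 0" using assms by simp
 have "exp y * (1 - y) \<le> exp y * exp (- y)" using exp_ge_add_one_self[of "- y"] by (intro mult_left_mono) auto
 hence "exp y * (1 - y) \<le> 1" by (simp flip: exp_add)
 hence "(exp y - 1) - y \<le> y * (exp y - 1)" by (simp add: algebra_simps)
 thus "1 / y - 1 / (exp y - 1) \<le> 1" using assms ey by (simp add: field_simps)
 have "(\<lambda>x. exp (x/2) - exp (- (x/2)) - x) 0 \<le> (\<lambda>x. exp (x/2) - exp (- (x/2)) - x) y"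
 proof (rule DERIV_nonneg_imp_nondecreasing[where f = "\<lambda>x. exp (x/2) - exp (- (x/2)) - x" and a = 0 and b = y])
  fix x :: real
  have "((\<lambda>x. exp (x/2) - exp (- (x/2)) - x) has_real_derivative (exp (x/2) + exp (- (x/2))) / 2 - 1) (at x)"
   by (auto intro!: derivative_eq_intros simp: field_simps)
  moreover have "(exp (x/2) + exp (- (x/2))) / 2 - 1 \<ge> 0"
  proof -
   have "(1 + x/2) + (1 + - (x/2)) \<le> exp (x/2) + exp (- (x/2))" by (intro add_mono exp_ge_add_one_self)
   thus ?thesis by simp
  qed
  ultimately show "\<exists>z. ((\<lambda>x. exp (x/2) - exp (- (x/2)) - x) has_real_derivative z) (at x) \<and> 0 \<le> z" by blast
 qed (use assms in auto)
 hence "y \<le> exp (y/2) - exp (- (y/2))" by simp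
 hence "y * exp (y/2) \<le> (exp (y/2) - exp (- (y/2))) * exp (y/2)" by (intro mult_right_mono) auto
 also have "\<dots> = exp y - 1" by (simp add: left_diff_distrib flip: exp_add)
 finally show "y * exp (y / 2) \<le> exp y - 1" .
qed

text \<open>The derivative has the right sign because y \<le> 2 sinh (y/2). Monotonicity bounds the
  total variation of 1/x - 1/(e^x - 1) along t, 2t, 3t, ... by its value at t, which is at most
  1.\<close>

lemma inverse_minus_inverse_exp_antimono:
 fixes x y :: real
 assumes "0 < x" "x \<le> y"
 shows "1 / y - 1 / (exp y - 1) \<le> 1 / x - 1 / (exp x - 1)"
proof -
 have "(\<lambda>z. 1 / (exp z - 1) - 1 / z) x \<le> (\<lambda>z. 1 / (exp z - 1) - 1 / z) y"
 proof (rule DERIV_nonneg_imp_nondecreasing[where f = "\<lambda>z. 1 / (exp z - 1) - 1 / z", OF assms(2)])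
  fix z assume z: "x \<le> z" "z \<le> y"
  hence z0: "z > 0" "exp z - 1 > 0" using assms by auto
  have "((\<lambda>z. 1 / (exp z - 1) - 1 / z) has_real_derivative 1 / z^2 - exp z / (exp z - 1)^2) (at z)"
   using z0 by (auto intro!: derivative_eq_intros simp: power2_eq_square)
  moreover have "exp z / (exp z - 1)^2 \<le> 1 / z^2"
  proof -
   have "(z * exp (z / 2))^2 \<le> (exp z - 1)^2" using exp_minus_inverse_bounds(2)[OF z0(1)] z0 by (intro power_mono) auto
   hence "z^2 * exp z \<le> (exp z - 1)^2" by (simp add: power_mult_distrib flip: exp_double)
   thus ?thesis using z0 by (simp add: field_simps)
  qed
  ultimately show "\<exists>w. ((\<lambda>z. 1 / (exp z - 1) - 1 / z) has_real_derivative w) (at z) \<and> 0 \<le> w" by (metis diff_ge_0_iff_ge)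
 qed
 thus ?thesis by simp
qed

lemma summation_by_parts:
 fixes c p :: "nat => complex"
 shows "(\<Sum>n<N. c n * p n) = (\<Sum>n<N. (\<Sum>k\<le>n. c k) * (p n - p (Suc n))) + (\<Sum>k<N. c k) * p N"
proof (induction N)
 case (Suc N)
 have "(\<Sum>k\<le>N. c k) = (\<Sum>k<N. c k) + c N" by (simp flip: lessThan_Suc_atMost)
 thus ?case using Suc.IH by (simp add: algebra_simps)
qed simp

text \<open>
 The Lambert series \<open>\<Sum>n. chi n / (exp (n t) - 1) = \<Sum>m. r m exp (-m t)\<close> with \<open>r m = \<Sum>d dvd m. chi d\<close>
 stays bounded as \<open>t\<close> tends to 0 if \<open>L(1, chi)\<close> vanishes, but \<open>r\<close> is nonnegative and at least 1 on squares.
\<close>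

lemma dirichlet_L_1_nonzero_real:
 assumes chi: "dirichlet_character q chi" and np: "\<not> principal_character q chi" and sq: "principal_character q (\<lambda>n. chi n ^ 2)"
 shows "dirichlet_L q chi 1 \<noteq> 0"
proof
 assume L0: "dirichlet_L q chi 1 = 0"
 define f where "f = (\<lambda>n. Re (chi n))"
 have q: "q > 0" using chi by (simp add: dirichlet_character_def)
 have cv: "chi n \<in> {-1, 0, 1}" for n
 proof -
  have "chi n ^ 2 = 1 \<or> chi n ^ 2 = 0" using sq unfolding principal_character_def by metis
  thus ?thesis by (auto simp: power2_eq_1_iff)
 qed
 have cf: "chi n = of_real (f n)" for n using cv[of n] by (auto simp: f_def)
 have fv: "f n \<in> {-1, 0, 1}" for n using cv[of n] by (auto simp: f_def)
 have "chi (a * b) = chi a * chi b" "chi 1 = 1" for a b using chi by (auto simp: dirichlet_character_def)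
 hence "complex_of_real (f (a * b)) = complex_of_real (f a * f b)" "complex_of_real (f 1) = complex_of_real 1" for a b unfolding cf by simp_all
 hence fm: "f (a * b) = f a * f b" "f 1 = 1" for a b using of_real_eq_iff by blast+
 define r where "r = (\<lambda>m. \<Sum>d | d dvd m. f d)"
 have r0: "r m \<ge> 0" if "m > 0" for m unfolding r_def by (rule sum_divisors_sign_character(1)[OF fm fv that])
 have r1: "r (m^2) \<ge> 1" if "m > 0" for m unfolding r_def by (rule sum_divisors_sign_character(2)[OF fm fv that])
 \<comment> \<open>Write 1 / (e^(nt) - 1) as 1 / (nt) minus a remainder. The first part contributes
   L(1, chi) / t, which vanishes by assumption. The second pairs the summatory function, at most 12
   q, with the variation of \<open>h\<close>, at most 1.\<close>
 have main: "(\<Sum>m\<in>F. r m * exp (- (real m * t))) \<le> 12 * real q" if t: "t > 0" and F: "finite F" "F \<subseteq> {0<..}" for t F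
 proof -
  define A where "A = (\<lambda>n. \<Sum>k\<le>n. chi (Suc k))"
  define h where "h = (\<lambda>n. 1 / (real (Suc n) * t) - 1 / (exp (real (Suc n) * t) - 1))"
  define g where "g = (\<lambda>n. 1 / (exp (real (Suc n) * t) - 1))"
  note L1 = dirichlet_L_1_sums[OF chi np]
  have ha: "h (Suc n) \<le> h n" for n unfolding h_def
   using t by (intro inverse_minus_inverse_exp_antimono mult_right_mono) auto
  have hl: "h \<longlonglongrightarrow> 0" unfolding h_def using t by real_asymp
  have hs: "(\<lambda>n. h n - h (Suc n)) sums (h 0 - 0)" by (rule telescope_sums'[OF hl])
  have h0: "h 0 \<le> 1" unfolding h_def using exp_minus_inverse_bounds(1)[of t] t by simp
  have gd: "g n - g (Suc n) = (1 / t) * (1 / real (Suc n) - 1 / real (Suc (Suc n))) - (h n - h (Suc n))" for n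
   unfolding g_def h_def by (simp add: right_diff_distrib mult.commute del: of_nat_Suc)
  have An: "cmod (A n) \<le> 12 * real q" for n using L1(2) by (simp add: A_def)
  have sA: "summable (\<lambda>n. A n * of_real (h n - h (Suc n)))"
  proof (rule summable_comparison_test')
   show "summable (\<lambda>n. 12 * real q * (h n - h (Suc n)))" using hs by (intro summable_mult) (rule sums_summable)
   fix n show "norm (A n * of_real (h n - h (Suc n))) \<le> 12 * real q * (h n - h (Suc n))"
    unfolding norm_mult norm_of_real using ha[of n] An[of n] by (simp add: mult_right_mono)
  qed
  have nA: "norm (\<Sum>n. A n * of_real (h n - h (Suc n))) \<le> 12 * real q"
  proof -
   have "norm (\<Sum>n. A n * of_real (h n - h (Suc n))) \<le> (\<Sum>n. 12 * real q * (h n - h (Suc n)))"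
   proof (rule norm_suminf_le)
    fix n show "norm (A n * of_real (h n - h (Suc n))) \<le> 12 * real q * (h n - h (Suc n))"
     unfolding norm_mult norm_of_real using ha[of n] An[of n] by (simp add: mult_right_mono)
   qed (use hs in \<open>auto intro!: summable_mult dest: sums_summable\<close>)
   also have "\<dots> = 12 * real q * h 0" using sums_unique[OF sums_mult[OF hs, of "12 * real q"]] by simp
   also have "\<dots> \<le> 12 * real q * 1" using h0 by (intro mult_left_mono) auto
   finally show ?thesis by simp
  qed
  have s1: "(\<lambda>n. A n * of_real (g n - g (Suc n))) sums (of_real (1 / t) * 0 - (\<Sum>n. A n * of_real (h n - h (Suc n))))"
  proof -
   have "(\<lambda>n. of_real (1 / t) * (A n * of_real (1 / real (Suc n) - 1 / real (Suc (Suc n)))) - A n * of_real (h n - h (Suc n)))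
     sums (of_real (1 / t) * 0 - (\<Sum>n. A n * of_real (h n - h (Suc n))))"
    using L1(1) L0 by (intro sums_diff sums_mult summable_sums[OF sA]) (simp add: A_def)
   thus ?thesis unfolding gd of_real_diff of_real_mult by (simp add: algebra_simps)
  qed
  have gl: "(\<lambda>N. (\<Sum>k<N. chi (Suc k)) * of_real (g N)) \<longlonglongrightarrow> 0"
  proof (rule Lim_null_comparison)
   have "norm ((\<Sum>k<N. chi (Suc k)) * of_real (g N)) \<le> 12 * real q * g N" for N
   proof -
    have "norm (\<Sum>k<N. chi (Suc k)) \<le> 12 * real q"
     using An by (cases N) (auto simp: A_def lessThan_Suc_atMost)
    moreover have "g N \<ge> 0" using t by (simp add: g_def)
    ultimately show ?thesis unfolding norm_mult norm_of_real by (simp add: mult_right_mono)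
   qed
   thus "\<forall>\<^sub>F N in sequentially. norm ((\<Sum>k<N. chi (Suc k)) * of_real (g N)) \<le> 12 * real q * g N" by (intro always_eventually allI)
   have "g \<longlonglongrightarrow> 0" unfolding g_def using t by real_asymp
   thus "(\<lambda>N. 12 * real q * g N) \<longlonglongrightarrow> 0" by (rule tendsto_mult_right_zero)
  qed
  have "(\<lambda>N. \<Sum>n<N. chi (Suc n) * of_real (g n)) \<longlonglongrightarrow> (of_real (1 / t) * 0 - (\<Sum>n. A n * of_real (h n - h (Suc n)))) + 0"
  proof -
   have "(\<Sum>n<N. chi (Suc n) * of_real (g n)) = (\<Sum>n<N. A n * of_real (g n - g (Suc n))) + (\<Sum>k<N. chi (Suc k)) * of_real (g N)" for N
    by (subst summation_by_parts) (simp add: A_def)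
   thus ?thesis using tendsto_add[OF s1[unfolded sums_def] gl] by simp
  qed
  hence fs: "(\<lambda>n. chi (Suc n) * of_real (g n)) sums (- (\<Sum>n. A n * of_real (h n - h (Suc n))))"
   by (simp add: sums_def)
  \<comment> \<open>Summing this double series over k first gives the Lambert series, grouping it by
    m = d k gives the coefficients \<open>r m\<close>. The geometric bound \<open>gb\<close> yields
    absolute convergence, so both are the same number.\<close>
  let ?F = "\<lambda>(d, k). chi d * of_real (exp (- (real d * real k * t)))"
  define x where "x = exp (- t)"
  have x: "0 < x" "x < 1" using t by (auto simp: x_def)
  have gsum: "((\<lambda>k. exp (- (real d * real k * t))) has_sum g (d - 1)) {0<..}" if d: "d > 0" for d
  proof -
   define y where "y = exp (- (real d * t))"
   have y: "0 < y" "y < 1" using d t by (auto simp: y_def)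
   have yk: "exp (- (real d * real k * t)) = y ^ k" for k
    by (simp add: y_def mult_ac flip: exp_of_nat_mult)
   have "(\<lambda>k. y * y ^ k) sums (y * (1 / (1 - y)))" using y by (intro sums_mult geometric_sums) auto
   hence "(\<lambda>k. y ^ Suc k) sums (y / (1 - y))" by simp
   hence "((\<lambda>k. y ^ Suc k) has_sum (y / (1 - y))) UNIV"
    using y by (intro norm_summable_imp_has_sum) (auto dest: sums_summable simp: norm_mult norm_power)
   hence "((\<lambda>k. y ^ k) \<circ> Suc has_sum (y / (1 - y))) UNIV" by (simp add: o_def)
   hence "((\<lambda>k. y ^ k) has_sum (y / (1 - y))) {0<..}" using has_sum_reindex[of Suc UNIV "\<lambda>k. y ^ k"] by (simp add: greaterThan_0)
   moreover have "y / (1 - y) = g (d - 1)"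
    using d t y by (simp add: g_def y_def exp_minus field_simps)
   ultimately show ?thesis unfolding yk by simp
  qed
  have normF: "norm (?F (d, k)) \<le> exp (- (real d * real k * t))" for d k
   using fv[of d] by (auto simp: cf norm_mult)
  have gb: "g (d - 1) \<le> x ^ (d - 1) * g 0" if d: "d > 0" for d
  proof -
   have "exp (real (d - 1) * t) * (exp t - 1) \<le> exp (real d * t) - 1"
   proof -
    have "real d * t = real (d - 1) * t + t" using d by (simp add: of_nat_diff algebra_simps)
    hence "exp (real d * t) = exp (real (d - 1) * t) * exp t" by (simp add: exp_add)
    moreover have "exp (real (d - 1) * t) \<ge> 1" using t by simp
    ultimately show ?thesis by (simp add: algebra_simps)
   qed
   hence "1 / (exp (real d * t) - 1) \<le> 1 / (exp (real (d - 1) * t) * (exp t - 1))"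
    using t d by (intro divide_left_mono mult_pos_pos) auto
   also have "\<dots> = x ^ (d - 1) * (1 / (exp t - 1))"
    by (simp add: x_def exp_minus field_simps flip: exp_of_nat_mult)
   finally show ?thesis using d by (simp add: g_def)
  qed
  have g0: "g n \<ge> 0" for n using t by (simp add: g_def)
  have "(\<lambda>(d, k). exp (- (real d * real k * t))) summable_on {0<..} \<times> {0<..}"
  proof (rule summable_on_SigmaI[where g = "\<lambda>d. g (d - 1)"])
   show "((\<lambda>k. (\<lambda>(d, k). exp (- (real d * real k * t))) (d, k)) has_sum g (d - 1)) {0<..}" if "d \<in> {0<..}" for d
    using gsum[of d] that by simp
   have "summable (\<lambda>n. norm (x ^ n * g 0))" using x g0[of 0] by (simp add: summable_mult2 norm_mult norm_power)
   hence "(\<lambda>n. x ^ n * g 0) summable_on UNIV" by (rule norm_summable_imp_summable_on)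
   hence "((\<lambda>n. x ^ (n - 1) * g 0) \<circ> Suc) summable_on UNIV" by (simp add: o_def)
   hence "(\<lambda>n. x ^ (n - 1) * g 0) summable_on {0<..}" using summable_on_reindex[of Suc UNIV "\<lambda>n. x ^ (n - 1) * g 0"] by (simp add: greaterThan_0)
   thus "(\<lambda>d. g (d - 1)) summable_on {0<..}"
    by (rule summable_on_comparison_test) (use gb g0 in auto)
  qed auto
  hence "(\<lambda>z. norm (?F z)) summable_on {0<..} \<times> {0<..}"
   by (rule summable_on_comparison_test) (use normF in auto)
  hence Fs: "?F summable_on {0<..} \<times> {0<..}" by (rule abs_summable_summable)
  have gn: "summable (\<lambda>n. norm (chi (Suc n) * of_real (g n)))"
  proof (rule summable_comparison_test')
   show "summable (\<lambda>n. x ^ n * g 0)" using x by (intro summable_mult2 summable_geometric) auto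
   fix n show "norm (norm (chi (Suc n) * of_real (g n))) \<le> x ^ n * g 0"
    using gb[of "Suc n"] g0[of n] fv[of "Suc n"] g0[of 0] x by (auto simp: cf norm_mult)
  qed
  have "infsum ?F ({0<..} \<times> {0<..}) = (\<Sum>\<^sub>\<infinity>d\<in>{0<..}. \<Sum>\<^sub>\<infinity>k\<in>{0<..}. ?F (d, k))"
   by (rule infsum_Sigma_banach[OF Fs, symmetric])
  also have "\<dots> = (\<Sum>\<^sub>\<infinity>d\<in>{0<..}. chi d * of_real (g (d - 1)))"
  proof (rule infsum_cong)
   fix d :: nat assume d: "d \<in> {0<..}"
   have "((\<lambda>k. complex_of_real (exp (- (real d * real k * t)))) has_sum of_real (g (d - 1))) {0<..}"
    using gsum[of d] d by (simp only: has_sum_of_real_iff greaterThan_iff)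
   from infsumI[OF has_sum_cmult_right[OF this, of "chi d"]]
   show "(\<Sum>\<^sub>\<infinity>k\<in>{0<..}. ?F (d, k)) = chi d * of_real (g (d - 1))" by simp
  qed
  also have "\<dots> = (\<Sum>n. chi (Suc n) * of_real (g n))"
   using infsumI[OF has_sum_Suc(1)[of "\<lambda>d. chi d * of_real (g (d - 1))"]] gn by simp
  also have "\<dots> = - (\<Sum>n. A n * of_real (h n - h (Suc n)))" by (rule sums_unique[OF fs, symmetric])
  finally have I1: "infsum ?F ({0<..} \<times> {0<..}) = - (\<Sum>n. A n * of_real (h n - h (Suc n)))" .
  have rterm: "(\<Sum>d | d dvd m. ?F (d, m div d)) = of_real (r m * exp (- (real m * t)))" if m: "m > 0" for m
  proof -
   have "(\<Sum>d | d dvd m. ?F (d, m div d)) = (\<Sum>d | d dvd m. of_real (f d * exp (- (real m * t))))"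
   proof (intro sum.cong refl)
    fix d assume "d \<in> {d. d dvd m}"
    hence "real d * real (m div d) = real m" by (auto simp flip: of_nat_mult)
    thus "?F (d, m div d) = of_real (f d * exp (- (real m * t)))" by (simp add: cf)
   qed
   thus ?thesis by (simp add: r_def sum_distrib_right)
  qed
  have rs: "(\<lambda>m. complex_of_real (r m * exp (- (real m * t)))) summable_on {0<..}"
   using infsum_divisors(1)[OF Fs] rterm by (subst summable_on_cong[of _ _ "\<lambda>m. \<Sum>d | d dvd m. ?F (d, m div d)"]) auto
  hence rs': "(\<lambda>m. r m * exp (- (real m * t))) summable_on {0<..}"
   using summable_on_Re[OF rs] by simp
  have "infsum ?F ({0<..} \<times> {0<..}) = (\<Sum>\<^sub>\<infinity>m\<in>{0<..}. of_real (r m * exp (- (real m * t))))"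
   unfolding infsum_divisors(2)[OF Fs] by (intro infsum_cong rterm) auto
  also have "\<dots> = of_real (\<Sum>\<^sub>\<infinity>m\<in>{0<..}. r m * exp (- (real m * t)))"
   using infsumI[OF has_sum_of_real[OF has_sum_infsum[OF rs']]] by simp
  finally have I3: "infsum ?F ({0<..} \<times> {0<..}) = of_real (\<Sum>\<^sub>\<infinity>m\<in>{0<..}. r m * exp (- (real m * t)))" .
  have I2: "cmod (of_real (\<Sum>\<^sub>\<infinity>m\<in>{0<..}. r m * exp (- (real m * t)))) \<le> 12 * real q"
   unfolding I3[symmetric] I1 norm_minus_cancel by (rule nA)
  have "(\<Sum>m\<in>F. r m * exp (- (real m * t))) \<le> (\<Sum>\<^sub>\<infinity>m\<in>{0<..}. r m * exp (- (real m * t)))"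
   using F r0 by (intro finite_sum_le_infsum rs') auto
  also have "\<dots> \<le> 12 * real q" using I2 unfolding norm_of_real by (rule order_trans[OF abs_ge_self])
  finally show ?thesis .
 qed
 \<comment> \<open>At t = 1 / K^2 each of the squares 1, 4, ..., K^2 contributes at least 1/e, hence
   K / e \<le> 12 q. As e \<le> 3, the choice K = 40 q contradicts this: 40 / 3 > 12.\<close>
 define K where "K = 40 * q"
 have K: "K > 0" using q by (simp add: K_def)
 define F where "F = (\<lambda>m::nat. m^2) ` {1..K}"
 have inj: "inj_on (\<lambda>m::nat. m^2) {1..K}" by (auto simp: inj_on_def)
 have "real K * exp (-1) = (\<Sum>m\<in>{1..K}. exp (-1))" by simp
 also have "\<dots> \<le> (\<Sum>m\<in>{1..K}. r (m^2) * exp (- (real (m^2) * (1 / (real K)^2))))"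
 proof (rule sum_mono)
  fix m assume m: "m \<in> {1..K}"
  have "(real m)^2 \<le> (real K)^2" using m by (intro power_mono) auto
  hence "real (m^2) * (1 / (real K)^2) \<le> 1" using K by (simp add: field_simps)
  hence "1 * exp (-1) \<le> r (m^2) * exp (- (real (m^2) * (1 / (real K)^2)))"
   using r1[of m] m by (intro mult_mono) auto
  thus "exp (-1) \<le> r (m^2) * exp (- (real (m^2) * (1 / (real K)^2)))" by simp
 qed
 also have "\<dots> = (\<Sum>m\<in>F. r m * exp (- (real m * (1 / (real K)^2))))"
  unfolding F_def by (simp only: sum.reindex[OF inj] o_def)
 also have "\<dots> \<le> 12 * real q" using K by (intro main) (auto simp: F_def)
 finally have "40 * real q * exp (-1) \<le> 12 * real q" by (simp add: K_def)
 hence "40 * exp (-1) \<le> (12 :: real)" using q by simp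
 hence "40 \<le> 12 * exp (1::real)" by (simp add: exp_minus field_simps)
 moreover have "exp (1::real) \<le> 3" by (rule exp_le)
 ultimately show False by linarith
qed

theorem Lreg_nonzero_ge_1:
 assumes chi: "dirichlet_character q chi" and s: "Re s \<ge> 1"
 shows "Lreg q chi s \<noteq> 0"
proof (cases "Re s > 1")
 case True
 thus ?thesis by (rule Lreg_nonzero_gt_1[OF chi])
next
 case False
 hence sc: "s = Complex 1 (Im s)" using s by (simp add: complex_eq_iff)
 show ?thesis
 proof
  assume "Lreg q chi s = 0"
  hence "Lreg q chi (Complex 1 (Im s)) = 0" using sc by simp
  note * = Lreg_zero_on_1_line[OF chi this]
  hence "s = 1" using sc by (simp add: complex_eq_iff)
  hence "dirichlet_L q chi 1 = 0" using \<open>Lreg q chi s = 0\<close> * by (simp add: Lreg_def)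
  thus False using dirichlet_L_1_nonzero_real[OF chi] * by blast
 qed
qed

section \<open>Zeros and logarithmic derivatives of bounded entire functions\<close>

lemma factor_zero_entire:
 fixes g :: "complex => complex"
 assumes g: "g holomorphic_on UNIV" "g w0 \<noteq> 0"
 shows "\<exists>k h. h holomorphic_on UNIV \<and> h a \<noteq> 0 \<and> (\<forall>w. g w = (w - a) ^ k * h w)"
proof -
 define k where "k = nat (zorder g a)"
 have "\<exists>w\<in>UNIV. g w \<noteq> 0" using g by blast
 from zorder_exist_zero[OF g(1) open_UNIV connected_UNIV UNIV_I this, of a] obtain r where r: "r > 0"
  "zor_poly g a holomorphic_on cball a r" "\<And>w. w \<in> cball a r ==> g w = zor_poly g a w * (w - a) ^ k" "\<And>w. w \<in> cball a r ==> zor_poly g a w \<noteq> 0"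
  unfolding k_def by blast
 define h where "h = (\<lambda>w. if w = a then zor_poly g a a else g w / (w - a) ^ k)"
 have hz: "h w = zor_poly g a w" if "w \<in> ball a r" for w
  using r(3)[of w] that by (auto simp: h_def)
 have "zor_poly g a holomorphic_on ball a r" using r(2) by (rule holomorphic_on_subset) auto
 hence h1: "h holomorphic_on ball a r" by (rule holomorphic_transform) (use hz in auto)
 have "(\<lambda>w. g w / (w - a) ^ k) holomorphic_on - {a}"
  by (intro holomorphic_intros holomorphic_on_subset[OF g(1)]) auto
 hence h2: "h holomorphic_on - {a}" by (rule holomorphic_transform) (auto simp: h_def)
 have "h holomorphic_on ball a r \<union> - {a}" by (intro holomorphic_on_Un h1 h2) auto
 moreover have "ball a r \<union> - {a} = UNIV" using r(1) by auto
 ultimately have "h holomorphic_on UNIV" by simp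
 moreover have "h a \<noteq> 0" using r(1) r(4)[of a] by (simp add: h_def)
 moreover have "g w = (w - a) ^ k * h w" for w
  using r(3)[of a] r(1) by (cases "w = a") (auto simp: h_def)
 ultimately show ?thesis by blast
qed

lemma factor_zeros_entire:
 fixes f :: "complex => complex"
 assumes f: "f holomorphic_on UNIV" "f w0 \<noteq> 0" and Z: "finite Z"
 shows "\<exists>g. g holomorphic_on UNIV \<and> (\<forall>z\<in>Z. g z \<noteq> 0) \<and> (\<forall>w. f w = (\<Prod>z\<in>Z. (w - z) ^ nat (zorder f z)) * g w)"
 using Z
proof (induction Z)
 case empty
 thus ?case using f by (intro exI[of _ f]) auto
next
 case (insert a Z)
 obtain g where g: "g holomorphic_on UNIV" "\<And>z. z \<in> Z ==> g z \<noteq> 0" "\<And>w. f w = (\<Prod>z\<in>Z. (w - z) ^ nat (zorder f z)) * g w"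
  using insert.IH by blast
 have "g w0 \<noteq> 0" using g(3)[of w0] f(2) by auto
 then obtain k h where h: "h holomorphic_on UNIV" "h a \<noteq> 0" "\<And>w. g w = (w - a) ^ k * h w"
  using factor_zero_entire[OF g(1), of w0 a] by blast
 \<comment> \<open>The exponent found for the intermediate quotient \<open>g\<close> is the order of
   the original f, because the factors already split off do not vanish at a.\<close>
 have "zorder f a = int k"
 proof (rule zorder_eqI[OF open_UNIV UNIV_I])
  show "(\<lambda>w. (\<Prod>z\<in>Z. (w - z) ^ nat (zorder f z)) * h w) holomorphic_on UNIV" by (intro holomorphic_intros h(1))
  show "(\<Prod>z\<in>Z. (a - z) ^ nat (zorder f z)) * h a \<noteq> 0" using insert.hyps h(2) by auto
  show "f w = (\<Prod>z\<in>Z. (w - z) ^ nat (zorder f z)) * h w * (w - a) powi int k" if "w \<in> UNIV" "w \<noteq> a" for w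
   using g(3)[of w] h(3)[of w] by (simp add: power_int_def mult_ac)
 qed
 hence "f w = (\<Prod>z\<in>insert a Z. (w - z) ^ nat (zorder f z)) * h w" for w
  using insert.hyps g(3)[of w] h(3)[of w] by (simp add: mult_ac)
 moreover have "h z \<noteq> 0" if "z \<in> insert a Z" for z
  using that h(2,3) g(2)[of z] by auto
 ultimately show ?case using h(1) by (intro exI[of _ h]) blast
qed

lemma has_field_derivative_prod_power:
 fixes p :: "'a => complex => complex"
 assumes "finite Z" "\<And>z. z \<in> Z ==> (p z has_field_derivative p' z) (at w)" "\<And>z. z \<in> Z ==> p z w \<noteq> 0"
 shows "((\<lambda>w. \<Prod>z\<in>Z. p z w ^ n z) has_field_derivative (\<Prod>z\<in>Z. p z w ^ n z) * (\<Sum>z\<in>Z. of_nat (n z) * p' z / p z w)) (at w)"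
 using assms
proof (induction Z)
 case (insert a Z)
 define P where "P = (\<lambda>w. \<Prod>z\<in>Z. p z w ^ n z)"
 define S where "S = (\<Sum>z\<in>Z. of_nat (n z) * p' z / p z w)"
 have IH: "(P has_field_derivative P w * S) (at w)"
  unfolding P_def S_def using insert by simp
 have a: "(p a has_field_derivative p' a) (at w)" "p a w \<noteq> 0" using insert.prems by auto
 have "((\<lambda>w. p a w ^ n a * P w) has_field_derivative (of_nat (n a) * p a w ^ (n a - 1) * p' a) * P w + p a w ^ n a * (P w * S)) (at w)"
  by (auto intro!: derivative_eq_intros IH a)
 also have "of_nat (n a) * p a w ^ (n a - 1) * p' a = p a w ^ n a * (of_nat (n a) * p' a / p a w)"
  using a(2) by (cases "n a") auto
 also have "p a w ^ n a * (of_nat (n a) * p' a / p a w) * P w + p a w ^ n a * (P w * S) = (p a w ^ n a * P w) * (of_nat (n a) * p' a / p a w + S)"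
  by (simp add: algebra_simps)
 finally show ?case using insert.hyps by (simp add: P_def S_def)
qed simp

lemma Borel_Caratheodory_deriv:
 fixes h :: "complex => complex"
 assumes h: "h holomorphic_on ball s r1" "h s = 0" and Re: "\<And>w. w \<in> ball s r1 ==> Re (h w) \<le> M" and M: "M > 0"
  and r: "0 < r2" "r2 < r1" and w: "w \<in> cball s r2"
 shows "cmod (deriv h w) \<le> (8 * (r1 + r2) / (r1 - r2)^2) * M"
proof -
 \<comment> \<open>The customary h / (2 M - h) has modulus at most 1. With 4 M in place of 2 M the
   modulus is strictly less than 1, as the Schwarz lemma demands, at the price of a doubled
   constant.\<close>
 define \<phi> where "\<phi> = (\<lambda>u. h (s + of_real r1 * u) / (of_real (4 * M) - h (s + of_real r1 * u)))"
 have inb: "s + of_real r1 * u \<in> ball s r1" if "cmod u < 1" for u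
  using that r by (simp add: dist_norm norm_mult)
 have ne: "of_real (4 * M) - h z \<noteq> 0" and nl: "cmod (h z) < cmod (of_real (4 * M) - h z)" if "z \<in> ball s r1" for z
 proof -
  have a: "Re (h z) \<le> M" using Re[OF that] .
  have "(Re (h z))^2 < (4 * M - Re (h z))^2"
  proof -
   have "(4 * M - Re (h z))^2 - (Re (h z))^2 = 8 * M * (2 * M - Re (h z))" by (simp add: power2_eq_square algebra_simps)
   moreover have "8 * M * (2 * M - Re (h z)) > 0" using a M by (intro mult_pos_pos) auto
   ultimately show ?thesis by linarith
  qed
  hence "(cmod (h z))^2 < (cmod (of_real (4 * M) - h z))^2" by (simp add: cmod_power2)
  thus nl: "cmod (h z) < cmod (of_real (4 * M) - h z)" by (rule power2_less_imp_less) simp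
  thus "of_real (4 * M) - h z \<noteq> 0" by auto
 qed
 have hol: "\<phi> holomorphic_on ball 0 1"
 proof -
  have "(h \<circ> (\<lambda>u. s + of_real r1 * u)) holomorphic_on ball 0 1"
   by (rule holomorphic_on_compose_gen[OF _ h(1)]) (auto intro!: holomorphic_intros inb)
  hence "(\<lambda>u. h (s + of_real r1 * u)) holomorphic_on ball 0 1" by (simp add: o_def)
  thus ?thesis unfolding \<phi>_def using ne[OF inb] by (intro holomorphic_intros) auto
 qed
 have \<phi>0: "\<phi> 0 = 0" by (simp add: \<phi>_def h)
 have \<phi>1: "cmod (\<phi> u) < 1" if "cmod u < 1" for u
  unfolding \<phi>_def norm_divide using ne[OF inb[OF that]] nl[OF inb[OF that]] by (subst divide_less_eq_1_pos) auto
 have sch: "cmod (\<phi> u) \<le> cmod u" if "cmod u < 1" for u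
  using Schwarz_Lemma(1)[OF hol \<phi>0 \<phi>1 that] by simp
 \<comment> \<open>Half of the gap between r2 and r1 is spent on the bound for h itself, the other
   half on Cauchy's estimate for its derivative.\<close>
 define r' where "r' = (r1 + r2) / 2"
 have r': "r2 < r'" "r' < r1" "r' > 0" using r by (auto simp: r'_def)
 define B where "B = 4 * M * r' / (r1 - r')"
 have hb: "cmod (h z) \<le> B" if z: "z \<in> cball s r'" for z
 proof -
  define u where "u = (z - s) / of_real r1"
  have zu: "z = s + of_real r1 * u" using r by (simp add: u_def)
  have u: "cmod u \<le> r' / r1" using z r by (simp add: u_def norm_divide dist_norm norm_minus_commute divide_right_mono)
  have "r' / r1 < 1" using r' r by simp
  hence u1: "cmod u < 1" using u by linarith
  have p: "cmod (\<phi> u) \<le> r' / r1" using sch[OF u1] u by linarith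
  have n0: "of_real (4 * M) - h z \<noteq> 0" using ne[OF inb[OF u1]] zu by simp
  have "h z = \<phi> u * (of_real (4 * M) - h z)" using n0 by (simp add: \<phi>_def zu[symmetric])
  hence "cmod (h z) \<le> cmod (\<phi> u) * (4 * M + cmod (h z))"
   by (metis norm_mult norm_triangle_ineq4 norm_of_real abs_of_pos M mult_left_mono norm_ge_zero zero_less_mult_iff zero_less_numeral)
  also have "\<dots> \<le> r' / r1 * (4 * M + cmod (h z))" using p M by (intro mult_right_mono) auto
  finally have "cmod (h z) * r1 \<le> r' * (4 * M + cmod (h z))" using r by (simp add: field_simps)
  hence "cmod (h z) * (r1 - r') \<le> 4 * M * r'" by (simp add: algebra_simps)
  thus ?thesis using r' by (simp add: B_def field_simps)
 qed
 define d where "d = (r1 - r2) / 2"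
 have d: "d > 0" using r by (simp add: d_def)
 have sub: "cball w d \<subseteq> cball s r'"
 proof
  fix z assume "z \<in> cball w d"
  hence "dist s z \<le> r2 + d" using w dist_triangle[of s z w] by auto
  also have "r2 + d = r'" by (simp add: d_def r'_def field_simps)
  finally show "z \<in> cball s r'" by simp
 qed
 have hc: "h holomorphic_on cball w d" using h(1) by (rule holomorphic_on_subset) (use sub r' in auto)
 have "cmod ((deriv ^^ 1) h w) \<le> fact 1 * B / d ^ 1"
 proof (rule Cauchy_inequality)
  show "h holomorphic_on ball w d" using hc by (rule holomorphic_on_subset) auto
  show "continuous_on (cball w d) h" using hc by (rule holomorphic_on_imp_continuous_on)
  show "cmod (h x) \<le> B" if "cmod (w - x) = d" for x
   using sub that by (intro hb) (auto simp: dist_norm)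
 qed (use d in auto)
 also have "\<dots> = B / d" by simp
 also have "B / d = (8 * (r1 + r2) / (r1 - r2)^2) * M"
 proof -
  define e where "e = r1 - r2"
  have e: "e \<noteq> 0" "r1 - r' = e / 2" "d = e / 2" using r by (auto simp: e_def r'_def d_def field_simps)
  have "B = 4 * M * ((r1 + r2) / 2) / (e / 2)" unfolding B_def e(2) by (simp add: r'_def)
  thus ?thesis unfolding e(3) e_def[symmetric] using e(1) by (simp add: field_simps power2_eq_square)
 qed
 finally show ?thesis by simp
qed

text \<open>
 Dividing out the zeros by Blaschke factors keeps the bound on the large circle; what remains is
 free of zeros in the smaller disc, and its logarithm is controlled by Borel and Caratheodory.
\<close>

lemma Landau_local_zeros:
 fixes f :: "complex => complex"
 assumes f: "f holomorphic_on UNIV" "f s \<noteq> 0" and r: "0 < r2" "r2 < r1" "r1 < R" and M: "M > 0"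
  and bd: "\<And>w. w \<in> cball s R ==> cmod (f w) \<le> exp M * cmod (f s)"
 defines "Z \<equiv> {z \<in> cball s r1. f z = 0}"
 defines "n \<equiv> \<lambda>z. nat (zorder f z)"
 shows "finite Z" "real (\<Sum>z\<in>Z. n z) \<le> M / ln (R / r1)"
  "\<And>w. w \<in> cball s r2 ==> f w \<noteq> 0 ==> cmod (deriv f w / f w - (\<Sum>z\<in>Z. of_nat (n z) / (w - z)))
    \<le> (8 * (r1 + r2) / (r1 - r2)^2 + r1 / (R^2 - r1 * r2) / ln (R / r1)) * M"
proof -
 show finZ: "finite Z"
 proof (cases "f constant_on UNIV")
  case True
  hence "f z = f s" for z by (auto simp: constant_on_def)
  hence "f z \<noteq> 0" for z using f(2) by metis
  thus ?thesis unfolding Z_def by simp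
 next
  case False
  thus ?thesis unfolding Z_def
   by (intro holomorphic_compact_finite_zeros[OF f(1) open_UNIV connected_UNIV]) auto
 qed
 obtain g where g: "g holomorphic_on UNIV" "\<And>z. z \<in> Z ==> g z \<noteq> 0" "\<And>w. f w = (\<Prod>z\<in>Z. (w - z) ^ n z) * g w"
  using factor_zeros_entire[OF f finZ] unfolding n_def by blast
 \<comment> \<open>On the circle |w - s| = R one has |b z w| = |w - z|, while \<open>b z\<close>
   vanishes only at the mirror image of z in this circle. Replacing each factor w - z by
   \<open>b z w\<close> removes the zero and keeps the modulus on the circle.\<close>
 define b where "b = (\<lambda>z w. (of_real (R^2) - cnj (z - s) * (w - s)) / of_real R)"
 have R: "R > 0" using r by simp
 define G where "G = (\<lambda>w. (\<Prod>z\<in>Z. b z w ^ n z) * g w)"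
 have bh: "(\<lambda>w. \<Prod>z\<in>Z. b z w ^ n z) holomorphic_on UNIV" unfolding b_def using R by (intro holomorphic_intros) auto
 have Gh: "G holomorphic_on UNIV" unfolding G_def by (intro holomorphic_on_mult bh g(1))
 have zs: "cmod (z - s) \<le> r1" if "z \<in> Z" for z using that by (simp add: Z_def dist_norm norm_minus_commute)
 have bden: "cmod (of_real (R^2) - cnj (z - s) * (w - s)) \<ge> R^2 - r1 * \<rho>" if "z \<in> Z" "cmod (w - s) \<le> \<rho>" for z w \<rho>
 proof -
  have "cmod (cnj (z - s) * (w - s)) \<le> r1 * \<rho>"
   unfolding norm_mult complex_mod_cnj using zs[OF that(1)] that(2) r by (intro mult_mono) auto
  moreover have "cmod (of_real (R^2)) = R^2" by (simp only: norm_of_real abs_power2)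
  ultimately show ?thesis using norm_triangle_ineq2[of "of_real (R^2)" "cnj (z - s) * (w - s)"] by linarith
 qed
 have r1R: "r1 * \<rho> < R^2" if "\<rho> \<le> r1" "\<rho> > 0" for \<rho>
 proof -
  have "r1 * \<rho> \<le> r1 * r1" using that r by (intro mult_left_mono) auto
  also have "\<dots> < R * R" using r by (intro mult_strict_mono) auto
  finally show ?thesis by (simp add: power2_eq_square)
 qed
 have bnz: "b z w \<noteq> 0" if "z \<in> Z" "w \<in> ball s r1" for z w
 proof -
  have "cmod (w - s) \<le> r1" using that by (simp add: dist_norm norm_minus_commute)
  hence "cmod (of_real (R^2) - cnj (z - s) * (w - s)) > 0"
   using bden[OF that(1), of w r1] r1R[of r1] r by linarith
  thus ?thesis using R by (auto simp: b_def)
 qed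
 have circ: "cmod (G w) = cmod (f w)" if w: "w \<in> sphere s R" for w
 proof -
  have ws: "cmod (w - s) = R" using w by (simp add: dist_norm norm_minus_commute)
  have "cmod (b z w) = cmod (w - z)" for z
  proof -
   have "of_real (R^2) = (w - s) * cnj (w - s)" using complex_norm_square[of "w - s"] unfolding ws .
   hence "of_real (R^2) - cnj (z - s) * (w - s) = (w - s) * cnj (w - z)" by (simp add: algebra_simps)
   hence "cmod (of_real (R^2) - cnj (z - s) * (w - s)) = R * cmod (w - z)" by (simp only: norm_mult complex_mod_cnj ws)
   thus ?thesis using R unfolding b_def norm_divide norm_of_real by simp
  qed
  thus ?thesis by (simp add: G_def g(3) norm_mult norm_power prod_norm[symmetric])
 qed
 have Gb: "cmod (G w) \<le> exp M * cmod (f s)" if w: "w \<in> cball s R" for w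
 proof (rule maximum_modulus_frontier[of G "cball s R"])
  show "G holomorphic_on interior (cball s R)" using Gh by (rule holomorphic_on_subset) auto
  show "continuous_on (closure (cball s R)) G" using holomorphic_on_imp_continuous_on[OF Gh] by (rule continuous_on_subset) auto
  show "cmod (G z) \<le> exp M * cmod (f s)" if "z \<in> frontier (cball s R)" for z
   using that R circ[of z] bd[of z] by (auto simp: frontier_cball)
 qed (use w in auto)
 define N where "N = (\<Sum>z\<in>Z. n z)"
 \<comment> \<open>At the centre each exchanged factor grows by at least R / r1. Set against the
   maximum principle on the large circle, this is Jensen's bound for the number of zeros.\<close>
 have Gs: "cmod (G s) \<ge> (R / r1) ^ N * cmod (f s)"
 proof -
  have "(R / r1) ^ N * (\<Prod>z\<in>Z. cmod (s - z) ^ n z) = (\<Prod>z\<in>Z. (R / r1 * cmod (s - z)) ^ n z)"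
   unfolding N_def power_sum power_mult_distrib prod.distrib ..
  also have "\<dots> \<le> (\<Prod>z\<in>Z. R ^ n z)"
  proof (intro prod_mono conjI power_mono)
   fix z assume z: "z \<in> Z"
   have "cmod (s - z) \<le> r1" using zs[OF z] by (simp add: norm_minus_commute)
   hence "R / r1 * cmod (s - z) \<le> R / r1 * r1" using R r by (intro mult_left_mono) auto
   thus "R / r1 * cmod (s - z) \<le> R" using r by simp
   show "0 \<le> R / r1 * cmod (s - z)" using R r by simp
   thus "0 \<le> (R / r1 * cmod (s - z)) ^ n z" by simp
  qed
  finally have "(R / r1) ^ N * (\<Prod>z\<in>Z. cmod (s - z) ^ n z) * cmod (g s) \<le> (\<Prod>z\<in>Z. R ^ n z) * cmod (g s)"
   by (intro mult_right_mono) auto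
  moreover have "cmod (b z s) = R" for z using R by (simp add: b_def power2_eq_square)
  hence "cmod (G s) = (\<Prod>z\<in>Z. R ^ n z) * cmod (g s)" by (simp add: G_def norm_mult norm_power prod_norm[symmetric])
  moreover have "cmod (f s) = (\<Prod>z\<in>Z. cmod (s - z) ^ n z) * cmod (g s)" by (simp add: g(3) norm_mult norm_power prod_norm[symmetric])
  ultimately show ?thesis by (simp add: mult.assoc)
 qed
 have fs: "cmod (f s) > 0" using f(2) by simp
 have Rr: "R / r1 > 1" using r by simp
 have "(R / r1) ^ N * cmod (f s) \<le> exp M * cmod (f s)" using Gs Gb[of s] R by simp
 hence "(R / r1) ^ N \<le> exp M" using fs by simp
 hence "ln ((R / r1) ^ N) \<le> ln (exp M)" using Rr by (subst ln_le_cancel_iff) auto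
 hence "real N * ln (R / r1) \<le> M" using Rr by (simp add: ln_realpow)
 thus Nb: "real (\<Sum>z\<in>Z. n z) \<le> M / ln (R / r1)" using Rr by (simp add: N_def field_simps)
 have GsM: "cmod (G s) \<ge> cmod (f s)"
 proof -
  have "1 * cmod (f s) \<le> (R / r1) ^ N * cmod (f s)" using Rr by (intro mult_right_mono) auto
  thus ?thesis using Gs by simp
 qed
 have Gnz: "G w \<noteq> 0" if w: "w \<in> ball s r1" for w
 proof -
  have "g w \<noteq> 0"
  proof
   assume "g w = 0"
   hence "f w = 0" by (simp add: g(3))
   hence "w \<in> Z" using w by (auto simp: Z_def)
   thus False using g(2) \<open>g w = 0\<close> by blast
  qed
  moreover have "(\<Prod>z\<in>Z. b z w ^ n z) \<noteq> 0" using bnz[OF _ w] finZ by auto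
  ultimately show ?thesis by (simp add: G_def)
 qed
 \<comment> \<open>In this disc the zeros of f have been removed and those of the factors
   \<open>b\<close> lie outside, so the quotient has a logarithm; its real part is at most
   M.\<close>
 have Hh: "(\<lambda>w. G w / G s) holomorphic_on ball s r1"
  using Gnz[of s] r by (intro holomorphic_intros holomorphic_on_subset[OF Gh]) auto
 have sb: "s \<in> ball s r1" using r by simp
 obtain h0 where h0: "h0 holomorphic_on ball s r1" "\<And>w. w \<in> ball s r1 ==> exp (h0 w) = G w / G s"
  using holomorphic_logarithm_exists[OF convex_ball open_ball Hh _ sb] Gnz Gnz[OF sb] by (metis divide_eq_0_iff)
 define h where "h = (\<lambda>w. h0 w - h0 s)"
 have hh: "h holomorphic_on ball s r1" unfolding h_def by (intro holomorphic_intros h0(1))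
 have he: "exp (h w) = G w / G s" if "w \<in> ball s r1" for w
  using h0(2)[OF that] h0(2)[OF sb] Gnz[OF sb] by (simp add: h_def exp_diff)
 have hRe: "Re (h w) \<le> M" if w: "w \<in> ball s r1" for w
 proof -
  have "exp (Re (h w)) = cmod (G w) / cmod (G s)" using he[OF w] by (metis norm_divide norm_exp_eq_Re)
  also have "\<dots> \<le> (exp M * cmod (f s)) / cmod (f s)"
   using Gb[of w] w r GsM fs by (intro frac_le) auto
  finally show ?thesis using fs by simp
 qed
 fix w assume w: "w \<in> cball s r2" and fw: "f w \<noteq> 0"
 have wb: "w \<in> ball s r1" using w r by auto
 have hd: "cmod (deriv h w) \<le> (8 * (r1 + r2) / (r1 - r2)^2) * M"
  by (rule Borel_Caratheodory_deriv[OF hh _ hRe M r(1,2) w]) (simp add: h_def)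
 have hder: "(h has_field_derivative deriv h w) (at w)" by (rule holomorphic_derivI[OF hh open_ball wb])
 have Gder: "(G has_field_derivative G w * deriv h w) (at w)"
 proof -
  have "((\<lambda>w. G s * exp (h w)) has_field_derivative G s * (exp (h w) * deriv h w)) (at w)"
   by (auto intro!: derivative_eq_intros hder)
  hence "(G has_field_derivative G s * (exp (h w) * deriv h w)) (at w)"
   by (rule has_field_derivative_transform_within_open[OF _ open_ball wb]) (use he Gnz[OF sb] in auto)
  moreover have "G s * (exp (h w) * deriv h w) = G w * deriv h w" using he[OF wb] Gnz[OF sb] by simp
  ultimately show ?thesis by simp
 qed
 have gd: "(g has_field_derivative deriv g w) (at w)" by (rule holomorphic_derivI[OF g(1)]) auto
 have gw: "g w \<noteq> 0" using fw g(3)[of w] by auto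
 have wz: "w - z \<noteq> 0" if "z \<in> Z" for z using fw that by (auto simp: Z_def)
 define S1 where "S1 = (\<Sum>z\<in>Z. of_nat (n z) * 1 / (w - z))"
 define S2 where "S2 = (\<Sum>z\<in>Z. of_nat (n z) * (- cnj (z - s) / of_real R) / b z w)"
 have fder: "(f has_field_derivative f w * (S1 + deriv g w / g w)) (at w)"
 proof -
  have P: "((\<lambda>w. \<Prod>z\<in>Z. (w - z) ^ n z) has_field_derivative (\<Prod>z\<in>Z. (w - z) ^ n z) * S1) (at w)"
   unfolding S1_def by (rule has_field_derivative_prod_power[OF finZ, where p = "\<lambda>z w. w - z" and p' = "\<lambda>_. 1"])
    (use wz in \<open>auto intro!: derivative_eq_intros\<close>)
  have "((\<lambda>w. (\<Prod>z\<in>Z. (w - z) ^ n z) * g w) has_field_derivative ((\<Prod>z\<in>Z. (w - z) ^ n z) * S1) * g w + deriv g w * (\<Prod>z\<in>Z. (w - z) ^ n z)) (at w)"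
   by (rule DERIV_mult[OF P gd])
  moreover have "(\<lambda>w. (\<Prod>z\<in>Z. (w - z) ^ n z) * g w) = f" by (simp add: g(3) fun_eq_iff)
  moreover have "((\<Prod>z\<in>Z. (w - z) ^ n z) * S1) * g w + deriv g w * (\<Prod>z\<in>Z. (w - z) ^ n z) = f w * (S1 + deriv g w / g w)"
   unfolding g(3)[of w] using gw by (simp add: field_simps)
  ultimately show ?thesis by simp
 qed
 have "(G has_field_derivative G w * (S2 + deriv g w / g w)) (at w)"
 proof -
  have P: "((\<lambda>w. \<Prod>z\<in>Z. b z w ^ n z) has_field_derivative (\<Prod>z\<in>Z. b z w ^ n z) * S2) (at w)"
   unfolding S2_def
  proof (rule has_field_derivative_prod_power[OF finZ, where p = b])
   show "(b z has_field_derivative - cnj (z - s) / of_real R) (at w)" for z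
    unfolding b_def using R by (auto intro!: derivative_eq_intros simp: field_simps)
  qed (use bnz wb in auto)
  have "((\<lambda>w. (\<Prod>z\<in>Z. b z w ^ n z) * g w) has_field_derivative ((\<Prod>z\<in>Z. b z w ^ n z) * S2) * g w + deriv g w * (\<Prod>z\<in>Z. b z w ^ n z)) (at w)"
   by (rule DERIV_mult[OF P gd])
  moreover have "((\<Prod>z\<in>Z. b z w ^ n z) * S2) * g w + deriv g w * (\<Prod>z\<in>Z. b z w ^ n z) = G w * (S2 + deriv g w / g w)"
   unfolding G_def using gw by (simp add: field_simps)
  ultimately show ?thesis unfolding G_def by simp
 qed
 hence "G w * (S2 + deriv g w / g w) = G w * deriv h w" using Gder DERIV_unique by blast
 hence gl: "deriv g w / g w = deriv h w - S2" using Gnz[OF wb] unfolding mult_cancel_left by (simp add: algebra_simps)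
 have "deriv f w / f w - S1 = deriv h w - S2" using DERIV_imp_deriv[OF fder] fw gl by simp
 hence "cmod (deriv f w / f w - S1) \<le> cmod (deriv h w) + cmod S2" by (simp add: norm_triangle_ineq4)
 \<comment> \<open>The mirror images stay away from w, so each exchanged factor contributes a
   bounded amount to the logarithmic derivative, and their number is at most M / ln (R /
   r1).\<close>
 also have "cmod S2 \<le> (\<Sum>z\<in>Z. real (n z) * (r1 / (R^2 - r1 * r2)))"
  unfolding S2_def
 proof (intro order_trans[OF norm_sum] sum_mono)
  fix z assume z: "z \<in> Z"
  have ws: "cmod (w - s) \<le> r2" using w by (simp add: dist_norm norm_minus_commute)
  have dp: "R^2 - r1 * r2 > 0" using r1R[of r2] r by simp
  define D where "D = of_real (R^2) - cnj (z - s) * (w - s)"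
  have "cmod (of_nat (n z) * (- cnj (z - s) / of_real R) / b z w) = real (n z) * (cmod (z - s) / cmod D)"
   unfolding b_def D_def[symmetric] norm_mult norm_divide norm_minus_cancel complex_mod_cnj norm_of_real norm_of_nat
   using R by simp
  also have "\<dots> \<le> real (n z) * (r1 / (R^2 - r1 * r2))"
   using bden[OF z ws] zs[OF z] dp r unfolding D_def by (intro mult_left_mono frac_le) auto
  finally show "cmod (of_nat (n z) * (- cnj (z - s) / of_real R) / b z w) \<le> real (n z) * (r1 / (R^2 - r1 * r2))" .
 qed
 also have "(\<Sum>z\<in>Z. real (n z) * (r1 / (R^2 - r1 * r2))) = real N * (r1 / (R^2 - r1 * r2))"
  unfolding N_def of_nat_sum by (rule sum_distrib_right[symmetric])
 also have "\<dots> \<le> (M / ln (R / r1)) * (r1 / (R^2 - r1 * r2))"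
  using Nb r1R[of r2] r unfolding N_def by (intro mult_right_mono) auto
 finally have "cmod (deriv f w / f w - S1) \<le> (8 * (r1 + r2) / (r1 - r2)^2) * M + (M / ln (R / r1)) * (r1 / (R^2 - r1 * r2))"
  using hd by linarith
 also have "\<dots> = (8 * (r1 + r2) / (r1 - r2)^2 + r1 / (R^2 - r1 * r2) / ln (R / r1)) * M" by (simp only: distrib_right) (simp add: mult_ac)
 finally show "cmod (deriv f w / f w - (\<Sum>z\<in>Z. of_nat (n z) / (w - z)))
    \<le> (8 * (r1 + r2) / (r1 - r2)^2 + r1 / (R^2 - r1 * r2) / ln (R / r1)) * M"
  by (simp add: S1_def)
qed

section \<open>Zeros of Dirichlet L-functions\<close>

definition log_cond :: "nat => real => real" where
 "log_cond q t = ln (real q * (\<bar>t\<bar> + 2))"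

text \<open>The disc reaches to Re s = 1/8 and contains every zero on Re s = 1/2 whose ordinate is
  within 1 of t, because (3/2)^2 + 1 \<le> (15/8)^2.\<close>

definition zeros_near :: "nat => (nat => complex) => real => complex set" where
 "zeros_near q chi t = {z \<in> cball (Complex 2 t) (15/8). Lreg q chi z = 0}"

definition zmult :: "nat => (nat => complex) => complex => nat" where
 "zmult q chi z = nat (zorder (Lreg q chi) z)"

text \<open>A positive lower bound uniform in q and t lets additive constants be absorbed into
  multiples of \<open>log_cond\<close>.\<close>

lemma log_cond_ge: "q > 0 ==> log_cond q t \<ge> 1/2"
proof -
 assume q: "q > 0"
 have "1 * 2 \<le> real q * (\<bar>t\<bar> + 2)" using q by (intro mult_mono) auto
 hence "ln 2 \<le> log_cond q t" unfolding log_cond_def by (subst ln_le_cancel_iff) auto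
 thus ?thesis using ln2_ge_two_thirds by linarith
qed

lemma log_cond_mono: "q > 0 ==> \<bar>t\<bar> \<le> \<bar>u\<bar> ==> log_cond q t \<le> log_cond q u"
 unfolding log_cond_def by (subst ln_le_cancel_iff) (auto intro!: mult_left_mono mult_pos_pos)

lemma log_cond_le: "q > 0 ==> log_cond q t \<le> real q * (\<bar>t\<bar> + 2)"
 unfolding log_cond_def by (rule less_imp_le, rule ln_less_self) simp

lemma Lreg_ratio_bound:
 "\<exists>C>0. \<forall>q chi t w. dirichlet_character q chi --> w \<in> cball (Complex 2 t) (31/16) -->
   cmod (Lreg q chi w) \<le> exp (C * log_cond q t) * cmod (Lreg q chi (Complex 2 t))"
proof -
 obtain C1 where C1: "C1 > 0" "\<And>q chi s. dirichlet_character q chi ==> Re s \<ge> 1/16 ==> cmod (Lreg q chi s) \<le> C1 * real q * (1 + cmod s)^2"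
  using Lreg_growth by blast
 \<comment> \<open>The quotient of the two moduli is at most 9 C1 X^2 / (1/4) = 36 C1 X^2, where ln
   X = \<open>log_cond q t\<close>. The factor X^2 accounts for the summand 2, and 2 ln X \<ge> 1
   absorbs ln (36 C1 + 1).\<close>
 define C where "C = 2 + 2 * ln (36 * C1 + 1)"
 have C: "C > 0" using C1(1) by (simp add: C_def add_pos_nonneg)
 have "cmod (Lreg q chi w) \<le> exp (C * log_cond q t) * cmod (Lreg q chi (Complex 2 t))"
  if chi: "dirichlet_character q chi" and w: "w \<in> cball (Complex 2 t) (31/16)" for q chi t w
 proof -
  have q: "q > 0" using chi by (simp add: dirichlet_character_def)
  define X where "X = real q * (\<bar>t\<bar> + 2)"
  have X: "X > 0" "ln X = log_cond q t" using q by (auto simp: X_def log_cond_def)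
  have d: "cmod (w - Complex 2 t) \<le> 31/16" using w by (simp add: dist_norm norm_minus_commute)
  have "\<bar>Re (w - Complex 2 t)\<bar> \<le> 31/16" using abs_Re_le_cmod d by (rule order_trans)
  hence Re: "Re w \<ge> 1/16" by (auto simp: abs_if split: if_splits)
  have "cmod w \<le> cmod (w - Complex 2 t) + cmod (Complex 2 t)" using norm_triangle_ineq[of "w - Complex 2 t" "Complex 2 t"] by simp
  moreover have "cmod (Complex 2 t) \<le> 2 + \<bar>t\<bar>" using cmod_le[of "Complex 2 t"] by simp
  ultimately have "1 + cmod w \<le> 3 * (\<bar>t\<bar> + 2)" using d abs_ge_zero[of t] unfolding distrib_left by linarith
  hence "(1 + cmod w)^2 \<le> (3 * (\<bar>t\<bar> + 2))^2" by (intro power_mono) auto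
  hence "C1 * real q * (1 + cmod w)^2 \<le> C1 * real q * (3 * (\<bar>t\<bar> + 2))^2" using C1(1) by (intro mult_left_mono) auto
  also have "\<dots> = 9 * C1 * (real q * (\<bar>t\<bar> + 2)^2)" unfolding power_mult_distrib by simp
  also have "\<dots> \<le> 9 * C1 * X^2"
  proof -
   have "real q * 1 \<le> real q * real q" using q by (intro mult_left_mono) auto
   hence "real q * (\<bar>t\<bar> + 2)^2 \<le> (real q)^2 * (\<bar>t\<bar> + 2)^2" by (intro mult_right_mono) (auto simp: power2_eq_square)
   thus ?thesis using C1(1) by (intro mult_left_mono) (auto simp: X_def power_mult_distrib)
  qed
  finally have up: "cmod (Lreg q chi w) \<le> 9 * C1 * X^2" using C1(2)[OF chi Re] by linarith
  have low: "1/4 \<le> cmod (Lreg q chi (Complex 2 t))"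
  proof -
   have L: "1/4 \<le> cmod (dirichlet_L q chi (Complex 2 t))" by (rule dirichlet_L_lower_bound[OF chi]) simp
   have "Complex 2 t \<noteq> 1" by (simp add: complex_eq_iff)
   moreover have "1 \<le> cmod (Complex 2 t - 1)" using abs_Re_le_cmod[of "Complex 2 t - 1"] by simp
   hence "1 * cmod (dirichlet_L q chi (Complex 2 t)) \<le> cmod (Complex 2 t - 1) * cmod (dirichlet_L q chi (Complex 2 t))"
    by (intro mult_right_mono) auto
   ultimately show ?thesis using L by (simp add: Lreg_def norm_mult)
  qed
  have "36 * C1 * X^2 \<le> exp (C * ln X)"
  proof -
   have "ln (36 * C1 + 1) * 1 \<le> ln (36 * C1 + 1) * (2 * ln X)"
    using log_cond_ge[OF q, of t] C1(1) X(2) by (intro mult_left_mono) auto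
   hence "ln (36 * C1 + 1) + 2 * ln X \<le> C * ln X" by (simp add: C_def algebra_simps)
   hence "exp (ln (36 * C1 + 1) + 2 * ln X) \<le> exp (C * ln X)" by simp
   hence "(36 * C1 + 1) * X^2 \<le> exp (C * ln X)"
    using C1(1) X(1) exp_double[of "ln X"] by (simp add: exp_add)
   moreover have "36 * C1 * X^2 \<le> (36 * C1 + 1) * X^2" by (intro mult_right_mono) auto
   ultimately show ?thesis by linarith
  qed
  hence "9 * C1 * X^2 \<le> exp (C * ln X) * (1/4)" by simp
  also have "\<dots> \<le> exp (C * ln X) * cmod (Lreg q chi (Complex 2 t))" using low by (intro mult_left_mono) auto
  finally show ?thesis using up X(2) by simp
 qed
 thus ?thesis using C by blast
qed

text \<open>\<open>Landau_local_zeros\<close> with centre 2 + it and radii 7/4 < 15/8 < 31/16. The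
  smallest disc reaches to Re s = 1/4, the left end of the range for the line of integration; the
  largest stays in Re s \<ge> 1/16, where \<open>Lreg_growth\<close> applies.\<close>

lemma Lreg_local_zeros:
 "\<exists>C>0. \<forall>q chi t. dirichlet_character q chi -->
   finite (zeros_near q chi t) \<and> real (\<Sum>z\<in>zeros_near q chi t. zmult q chi z) \<le> C * log_cond q t \<and>
   (\<forall>w\<in>cball (Complex 2 t) (7/4). Lreg q chi w \<noteq> 0 -->
    cmod (deriv (Lreg q chi) w / Lreg q chi w - (\<Sum>z\<in>zeros_near q chi t. of_nat (zmult q chi z) / (w - z))) \<le> C * log_cond q t)"
proof -
 obtain C1 where C1: "C1 > 0" "\<And>q chi t w. dirichlet_character q chi ==> w \<in> cball (Complex 2 t) (31/16) ==>
   cmod (Lreg q chi w) \<le> exp (C1 * log_cond q t) * cmod (Lreg q chi (Complex 2 t))"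
  using Lreg_ratio_bound by blast
 define A where "A = 1 / ln ((31/16) / (15/8) :: real)"
 define B where "B = 8 * (15/8 + 7/4) / (15/8 - 7/4)^2 + (15/8) / ((31/16)^2 - 15/8 * (7/4)) / ln ((31/16) / (15/8) :: real)"
 have A0: "A > 0" by (simp add: A_def)
 show ?thesis
 proof (intro exI[of _ "C1 * (A + \<bar>B\<bar>)"] conjI allI impI)
  show "C1 * (A + \<bar>B\<bar>) > 0" using C1(1) A0 by (intro mult_pos_pos) auto
  fix q chi t assume chi: "dirichlet_character q chi"
  have q: "q > 0" using chi by (simp add: dirichlet_character_def)
  define M where "M = C1 * log_cond q t"
  have M: "M > 0" using C1(1) log_cond_ge[OF q, of t] by (simp add: M_def)
  have nz: "Lreg q chi (Complex 2 t) \<noteq> 0" by (rule Lreg_nonzero_gt_1[OF chi]) simp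
  note LL = Landau_local_zeros[OF Lreg_holomorphic[OF chi] nz, of "7/4" "15/8" "31/16" M, folded zeros_near_def zmult_def]
  have bd: "cmod (Lreg q chi w) \<le> exp M * cmod (Lreg q chi (Complex 2 t))" if "w \<in> cball (Complex 2 t) (31/16)" for w
   using C1(2)[OF chi that] by (simp add: M_def)
  show "finite (zeros_near q chi t)" by (rule LL(1)) (use M bd in auto)
  have "real (\<Sum>z\<in>zeros_near q chi t. zmult q chi z) \<le> M / ln ((31/16) / (15/8))" by (rule LL(2)) (use M bd in auto)
  also have "\<dots> = M * A" by (simp add: A_def)
  also have "\<dots> \<le> M * (A + \<bar>B\<bar>)" using M by (intro mult_left_mono) auto
  finally show "real (\<Sum>z\<in>zeros_near q chi t. zmult q chi z) \<le> C1 * (A + \<bar>B\<bar>) * log_cond q t" by (simp add: M_def mult_ac)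
  show "\<forall>w\<in>cball (Complex 2 t) (7/4). Lreg q chi w \<noteq> 0 -->
    cmod (deriv (Lreg q chi) w / Lreg q chi w - (\<Sum>z\<in>zeros_near q chi t. of_nat (zmult q chi z) / (w - z))) \<le> C1 * (A + \<bar>B\<bar>) * log_cond q t"
  proof (intro ballI impI)
   fix w assume w: "w \<in> cball (Complex 2 t) (7/4)" "Lreg q chi w \<noteq> 0"
   have "cmod (deriv (Lreg q chi) w / Lreg q chi w - (\<Sum>z\<in>zeros_near q chi t. of_nat (zmult q chi z) / (w - z))) \<le> B * M"
    unfolding B_def by (rule LL(3)) (use M bd w in auto)
   also have "\<dots> \<le> (A + \<bar>B\<bar>) * M" using M A0 by (intro mult_right_mono) auto
   finally show "cmod (deriv (Lreg q chi) w / Lreg q chi w - (\<Sum>z\<in>zeros_near q chi t. of_nat (zmult q chi z) / (w - z))) \<le> C1 * (A + \<bar>B\<bar>) * log_cond q t"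
    by (simp add: M_def mult_ac)
  qed
 qed
qed

lemma GRHR_Lreg_zero:
 assumes GRHR and chi: "dirichlet_character q chi" and z: "Lreg q chi z = 0" "Re z > 0"
 shows "Re z < 1" "Im z \<noteq> 0 ==> Re z = 1/2" "nontrivial_zero q chi z" "z \<noteq> 1"
proof -
 show lt: "Re z < 1" using Lreg_nonzero_ge_1[OF chi, of z] z by force
 thus z1: "z \<noteq> 1" by auto
 have "dirichlet_L q chi z = 0" using z z1 by (auto simp: Lreg_def split: if_splits)
 thus nz: "nontrivial_zero q chi z" using z lt by (simp add: nontrivial_zero_def)
 show "Re z = 1/2" if "Im z \<noteq> 0" using assms(1) chi nz that unfolding GRHR_def by blast
qed

lemma nontrivial_zero_iff:
 assumes chi: "dirichlet_character q chi"
 shows "nontrivial_zero q chi z \<longleftrightarrow> 0 < Re z \<and> Re z < 1 \<and> Lreg q chi z = 0"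
 by (auto simp: nontrivial_zero_def Lreg_def)

text \<open>\<open>Lreg\<close> and L differ at most by the factor s - 1, which does not vanish at
  z.\<close>

lemma zorder_dirichlet_L:
 assumes chi: "dirichlet_character q chi" and z: "nontrivial_zero q chi z"
 shows "zorder (dirichlet_L q chi) z = int (zmult q chi z)"
proof -
 have z1: "z \<noteq> 1" using z by (auto simp: nontrivial_zero_def)
 have nz2: "Lreg q chi 2 \<noteq> 0" by (rule Lreg_nonzero_gt_1[OF chi]) simp
 have "\<exists>w\<in>UNIV. Lreg q chi w \<noteq> 0" using nz2 by blast
 from zorder_exist_zero[OF Lreg_holomorphic[OF chi] open_UNIV connected_UNIV UNIV_I this, of z]
 obtain r where r: "r > 0" "zor_poly (Lreg q chi) z holomorphic_on cball z r"
  "\<And>w. w \<in> cball z r ==> Lreg q chi w = zor_poly (Lreg q chi) z w * (w - z) ^ zmult q chi z" "\<And>w. w \<in> cball z r ==> zor_poly (Lreg q chi) z w \<noteq> 0"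
  unfolding zmult_def by blast
 define g where "g = (\<lambda>w. zor_poly (Lreg q chi) z w / (if principal_character q chi then w - 1 else 1))"
 have "open (ball z r - {1})" by (intro open_Diff) auto
 moreover have "z \<in> ball z r - {1}" using r(1) z1 by auto
 moreover have "g holomorphic_on ball z r - {1}"
 proof -
  have 1: "zor_poly (Lreg q chi) z holomorphic_on ball z r - {1}" using r(2) by (rule holomorphic_on_subset) auto
  thus ?thesis unfolding g_def by (cases "principal_character q chi") (auto intro!: holomorphic_intros)
 qed
 moreover have "g z \<noteq> 0" using r(4)[of z] r(1) z1 by (auto simp: g_def)
 moreover have "dirichlet_L q chi w = g w * (w - z) powi int (zmult q chi z)" if "w \<in> ball z r - {1}" "w \<noteq> z" for w
  using r(3)[of w] that by (auto simp: g_def Lreg_def power_int_def field_simps split: if_splits)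
 ultimately show ?thesis by (rule zorder_eqI)
qed

text \<open>These are the zeros that \<open>GRHR\<close> leaves free; some may lie on or near the
  intended line of integration, or between it and 1/2. The cut at 1/8 comes from
  \<open>zeros_near\<close> and lies to the left of every line in use.\<close>

definition real_zeros :: "nat => (nat => complex) => complex set" where
 "real_zeros q chi = {z \<in> zeros_near q chi 0. Im z = 0}"

lemma real_zeros_iff: "z \<in> real_zeros q chi \<longleftrightarrow> Im z = 0 \<and> \<bar>Re z - 2\<bar> \<le> 15/8 \<and> Lreg q chi z = 0"
proof -
 have "Im z = 0 ==> cmod (Complex 2 0 - z) = \<bar>Re z - 2\<bar>" by (simp add: cmod_def power2_commute)
 thus ?thesis by (auto simp: real_zeros_def zeros_near_def dist_norm)
qed

definition logderiv_L :: "nat => (nat => complex) => complex => complex" where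
 "logderiv_L q chi s = deriv (Lreg q chi) s / Lreg q chi s - (if principal_character q chi then 1 / (s - 1) else 0)"

text \<open>Under \<open>GRHR\<close> a nonreal zero in the local disc has distance at least 1/2 -
  3/8 = 1/8 from s, so the local zero sum is O(log) apart from the real zeros, which are kept
  explicitly.\<close>

lemma logderiv_L_bound:
 assumes GRHR
 shows "\<exists>C>0. \<forall>q chi c t. dirichlet_character q chi --> 1/4 \<le> c --> c \<le> 3/8 --> Lreg q chi (Complex c t) \<noteq> 0 -->
  cmod (logderiv_L q chi (Complex c t)) \<le> C * log_cond q t + (\<Sum>z\<in>real_zeros q chi. real (zmult q chi z) / cmod (Complex c t - z))"
proof -
 obtain C where C: "C > 0" "\<And>q chi t. dirichlet_character q chi ==> finite (zeros_near q chi t)"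
   "\<And>q chi t. dirichlet_character q chi ==> real (\<Sum>z\<in>zeros_near q chi t. zmult q chi z) \<le> C * log_cond q t"
   "\<And>q chi t w. dirichlet_character q chi ==> w\<in>cball (Complex 2 t) (7/4) ==> Lreg q chi w \<noteq> 0 ==>
    cmod (deriv (Lreg q chi) w / Lreg q chi w - (\<Sum>z\<in>zeros_near q chi t. of_nat (zmult q chi z) / (w - z))) \<le> C * log_cond q t"
  using Lreg_local_zeros by blast
 have "cmod (logderiv_L q chi (Complex c t)) \<le> (9 * C + 4) * log_cond q t + (\<Sum>z\<in>real_zeros q chi. real (zmult q chi z) / cmod (Complex c t - z))"
  if chi: "dirichlet_character q chi" and c: "1/4 \<le> c" "c \<le> 3/8" and nz: "Lreg q chi (Complex c t) \<noteq> 0" for q chi c t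
 proof -
  let ?s = "Complex c t" and ?l = "log_cond q t"
  have q: "q > 0" using chi by (simp add: dirichlet_character_def)
  have l: "?l \<ge> 1/2" by (rule log_cond_ge[OF q])
  define Z where "Z = zeros_near q chi t"
  note finZ = C(2)[OF chi, of t, folded Z_def]
  have sb: "?s \<in> cball (Complex 2 t) (7/4)" using c by (simp add: dist_norm cmod_def)
  have fr: "finite (real_zeros q chi)" using C(2)[OF chi, of 0] by (simp add: real_zeros_def)
  have Zre: "Re z \<ge> 1/8" if "z \<in> Z" for z
  proof -
   have "cmod (Complex 2 t - z) \<le> 15/8" using that by (simp add: Z_def zeros_near_def dist_norm)
   hence "\<bar>Re (Complex 2 t - z)\<bar> \<le> 15/8" using abs_Re_le_cmod order_trans by blast
   thus ?thesis by (auto simp: abs_if split: if_splits)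
  qed
  have "cmod (\<Sum>z\<in>Z. of_nat (zmult q chi z) / (?s - z)) \<le> (\<Sum>z\<in>Z. real (zmult q chi z) / cmod (?s - z))"
   by (rule order_trans[OF norm_sum]) (simp add: norm_divide)
  also have "\<dots> = (\<Sum>z\<in>{z\<in>Z. Im z = 0}. real (zmult q chi z) / cmod (?s - z)) + (\<Sum>z\<in>{z\<in>Z. Im z \<noteq> 0}. real (zmult q chi z) / cmod (?s - z))"
   by (subst sum.union_disjoint[symmetric]) (auto simp: finZ intro!: sum.cong)
  also have "(\<Sum>z\<in>{z\<in>Z. Im z = 0}. real (zmult q chi z) / cmod (?s - z)) \<le> (\<Sum>z\<in>real_zeros q chi. real (zmult q chi z) / cmod (?s - z))"
  proof (intro sum_mono2 fr subsetI)
   fix z assume z: "z \<in> {z \<in> Z. Im z = 0}"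
   have "cmod (Complex 2 t - z) \<le> 15/8" using z by (simp add: Z_def zeros_near_def dist_norm)
   hence "\<bar>Re (Complex 2 t - z)\<bar> \<le> 15/8" using abs_Re_le_cmod order_trans by blast
   thus "z \<in> real_zeros q chi" using z by (auto simp: real_zeros_iff Z_def zeros_near_def abs_minus_commute)
  qed auto
  also have "(\<Sum>z\<in>{z\<in>Z. Im z \<noteq> 0}. real (zmult q chi z) / cmod (?s - z)) \<le> (\<Sum>z\<in>{z\<in>Z. Im z \<noteq> 0}. real (zmult q chi z) * 8)"
  proof (rule sum_mono)
   fix z assume z: "z \<in> {z\<in>Z. Im z \<noteq> 0}"
   have "Re z = 1/2" using GRHR_Lreg_zero(2)[OF assms chi, of z] Zre[of z] z by (auto simp: Z_def zeros_near_def)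
   hence "1/8 \<le> \<bar>Re (?s - z)\<bar>" using c by simp
   hence d: "1/8 \<le> cmod (?s - z)" using abs_Re_le_cmod order_trans by blast
   hence "1 / cmod (?s - z) \<le> 1 / (1/8)" by (intro divide_left_mono mult_pos_pos) auto
   hence "real (zmult q chi z) * (1 / cmod (?s - z)) \<le> real (zmult q chi z) * 8" by (intro mult_left_mono) auto
   thus "real (zmult q chi z) / cmod (?s - z) \<le> real (zmult q chi z) * 8" by simp
  qed
  also have "(\<Sum>z\<in>{z\<in>Z. Im z \<noteq> 0}. real (zmult q chi z) * 8) \<le> (\<Sum>z\<in>Z. real (zmult q chi z) * 8)"
   by (intro sum_mono2 finZ) auto
  also have "\<dots> = 8 * real (\<Sum>z\<in>Z. zmult q chi z)" by (simp add: sum_distrib_left mult.commute)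
  also have "\<dots> \<le> 8 * (C * ?l)" using C(3)[OF chi, of t] by (intro mult_left_mono) (auto simp: Z_def)
  finally have S: "cmod (\<Sum>z\<in>Z. of_nat (zmult q chi z) / (?s - z)) \<le> (\<Sum>z\<in>real_zeros q chi. real (zmult q chi z) / cmod (?s - z)) + 8 * (C * ?l)" by simp
  have D: "cmod (deriv (Lreg q chi) ?s / Lreg q chi ?s - (\<Sum>z\<in>Z. of_nat (zmult q chi z) / (?s - z))) \<le> C * ?l"
   unfolding Z_def by (rule C(4)[OF chi sb nz])
  have P: "cmod (if principal_character q chi then 1 / (?s - 1) else 0) \<le> 4 * ?l"
  proof -
   have "1/2 \<le> \<bar>Re (?s - 1)\<bar>" using c by simp
   hence "1/2 \<le> cmod (?s - 1)" using abs_Re_le_cmod order_trans by blast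
   hence "1 / cmod (?s - 1) \<le> 1 / (1/2)" by (intro divide_left_mono mult_pos_pos) auto
   thus ?thesis using l by (auto simp: norm_divide)
  qed
  have "logderiv_L q chi ?s = (deriv (Lreg q chi) ?s / Lreg q chi ?s - (\<Sum>z\<in>Z. of_nat (zmult q chi z) / (?s - z))) + (\<Sum>z\<in>Z. of_nat (zmult q chi z) / (?s - z))
    - (if principal_character q chi then 1 / (?s - 1) else 0)" by (simp add: logderiv_L_def)
  also have "cmod \<dots> \<le> C * ?l + ((\<Sum>z\<in>real_zeros q chi. real (zmult q chi z) / cmod (?s - z)) + 8 * (C * ?l)) + 4 * ?l"
   by (intro order_trans[OF norm_triangle_ineq4] order_trans[OF norm_triangle_ineq] add_mono D S P)
  finally show ?thesis by (simp add: algebra_simps)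
 qed
 thus ?thesis using C(1) by (intro exI[of _ "9 * C + 4"]) auto
qed

section \<open>A line of integration away from the real zeros\<close>

lemma integral_inverse_sqrt_dist:
 fixes b :: real
 assumes "u \<le> v"
 shows "((\<lambda>x. \<bar>x - b\<bar> powr (-1/2)) has_integral (2 * sgn (v - b) * sqrt \<bar>v - b\<bar> - 2 * sgn (u - b) * sqrt \<bar>u - b\<bar>)) {u..v}"
proof (rule fundamental_theorem_of_calculus_interior_strong[where S = "{b}"])
 have "continuous_on UNIV (\<lambda>x::real. 2 * sgn x * sqrt \<bar>x\<bar>)"
 proof -
  have "2 * sgn x * sqrt \<bar>x\<bar> = 2 * root 2 x" for x by (simp add: sqrt_def sgn_if abs_if real_root_minus)
  hence "(\<lambda>x::real. 2 * sgn x * sqrt \<bar>x\<bar>) = (\<lambda>x. 2 * root 2 x)" by (intro ext)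
  thus ?thesis by (simp only:) (intro continuous_intros)
 qed
 hence "continuous_on {u..v} (\<lambda>x. 2 * sgn (x - b) * sqrt \<bar>x - b\<bar>)"
  by (rule continuous_on_compose2) (auto intro!: continuous_intros)
 thus "continuous_on {u..v} (\<lambda>x. 2 * sgn (x - b) * sqrt \<bar>x - b\<bar>)" .
 fix x assume x: "x \<in> {u<..<v} - {b}"
 show "((\<lambda>x. 2 * sgn (x - b) * sqrt \<bar>x - b\<bar>) has_vector_derivative \<bar>x - b\<bar> powr (-1/2)) (at x)"
 proof (cases "x > b")
  case True
  have "((\<lambda>x. 2 * sqrt (x - b)) has_vector_derivative \<bar>x - b\<bar> powr (-1/2)) (at x)"
   unfolding has_real_derivative_iff_has_vector_derivative[symmetric] using True
   by (auto intro!: derivative_eq_intros simp: powr_minus_divide powr_half_sqrt field_simps)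
  thus ?thesis
   by (rule has_vector_derivative_transform_within_open[of _ _ _ "{b<..}"]) (use True in auto)
 next
  case False
  hence xb: "x < b" using x by auto
  have "((\<lambda>x. - 2 * sqrt (b - x)) has_vector_derivative \<bar>x - b\<bar> powr (-1/2)) (at x)"
   unfolding has_real_derivative_iff_has_vector_derivative[symmetric] using xb
   by (auto intro!: derivative_eq_intros simp: powr_minus_divide powr_half_sqrt field_simps)
  thus ?thesis
   by (rule has_vector_derivative_transform_within_open[of _ _ _ "{..<b}"]) (use xb in auto)
 qed
qed (use assms in auto)

lemma integral_inverse_sqrt_dist_le:
 fixes b :: real
 assumes "u \<le> v"
 shows "integral {u..v} (\<lambda>x. \<bar>x - b\<bar> powr (-1/2)) \<le> 4 * sqrt (v - u)"
proof -
 have "2 * sgn (v - b) * sqrt \<bar>v - b\<bar> - 2 * sgn (u - b) * sqrt \<bar>u - b\<bar> \<le> 4 * sqrt (v - u)"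
 proof -
  consider "b \<le> u" | "u < b" "b < v" | "v \<le> b" by linarith
  thus ?thesis
  proof cases
   case 1
   have "sqrt (v - b) \<le> sqrt ((v - u) + (u - b))" by simp
   also have "\<dots> \<le> sqrt (v - u) + sqrt (u - b)" using 1 assms by (intro sqrt_add_le_add_sqrt) auto
   finally have "sqrt (v - b) \<le> sqrt (v - u) + sqrt (u - b)" .
   moreover have "sqrt (v - u) \<ge> 0" using assms by simp
   moreover have "sqrt (u - b) \<ge> 0" using 1 by simp
   moreover have "2 * sgn (v - b) * sqrt \<bar>v - b\<bar> - 2 * sgn (u - b) * sqrt \<bar>u - b\<bar> = 2 * sqrt (v - b) - 2 * sqrt (u - b)"
    using 1 assms by (cases "u = b"; cases "v = b") (auto simp: sgn_if)
   ultimately show ?thesis by linarith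
  next
   case 2
   have "sqrt (v - b) \<le> sqrt (v - u)" "sqrt (b - u) \<le> sqrt (v - u)" using 2 by auto
   moreover have "2 * sgn (v - b) * sqrt \<bar>v - b\<bar> - 2 * sgn (u - b) * sqrt \<bar>u - b\<bar> = 2 * sqrt (v - b) + 2 * sqrt (b - u)"
    using 2 by (simp add: sgn_if)
   ultimately show ?thesis by linarith
  next
   case 3
   have "sqrt (b - u) \<le> sqrt ((v - u) + (b - v))" by simp
   also have "\<dots> \<le> sqrt (v - u) + sqrt (b - v)" using 3 assms by (intro sqrt_add_le_add_sqrt) auto
   finally have "sqrt (b - u) \<le> sqrt (v - u) + sqrt (b - v)" .
   moreover have "sqrt (v - u) \<ge> 0" using assms by simp
   moreover have "sqrt (b - v) \<ge> 0" using 3 by simp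
   moreover have "2 * sgn (v - b) * sqrt \<bar>v - b\<bar> - 2 * sgn (u - b) * sqrt \<bar>u - b\<bar> = 2 * sqrt (b - u) - 2 * sqrt (b - v)"
    using 3 assms by (cases "u = b"; cases "v = b") (auto simp: sgn_if)
   ultimately show ?thesis by linarith
  qed
 qed
 thus ?thesis using integral_unique[OF integral_inverse_sqrt_dist[OF assms, of b]] by simp
qed

text \<open>Over an interval of length 1/8 the mean of |c - \<beta>|^(-1/2) is at most 4 / (1/8) =
  32 for each \<beta>, so not every c can exceed 33 in the weighted average. The exponent is -1/2
  because |c - \<beta>| |t| \<le> |c + it - \<beta>|^2 splits the singularity of L'/L evenly between
  c and t, and both halves are integrable.\<close>

lemma exists_good_abscissa:
 assumes chi: "dirichlet_character q chi"
 shows "\<exists>c. 1/4 \<le> c \<and> c \<le> 3/8 \<and> (\<forall>z\<in>real_zeros q chi. Re z \<noteq> c) \<and>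
   (\<Sum>z\<in>real_zeros q chi. real (zmult q chi z) * \<bar>c - Re z\<bar> powr (-1/2)) \<le> 33 * (\<Sum>z\<in>real_zeros q chi. real (zmult q chi z))"
proof (rule ccontr)
 define K where "K = (\<Sum>z\<in>real_zeros q chi. real (zmult q chi z))"
 define A where "A = (\<lambda>c. \<Sum>z\<in>real_zeros q chi. real (zmult q chi z) * \<bar>c - Re z\<bar> powr (-1/2))"
 assume "\<not> ?thesis"
 hence big: "A c \<ge> 33 * K" if "c \<in> {1/4..3/8} - Re ` real_zeros q chi" for c
  using that unfolding A_def K_def by force
 have fr: "finite (real_zeros q chi)" using Lreg_local_zeros chi by (auto simp: real_zeros_def)
 have hA: "(A has_integral (\<Sum>z\<in>real_zeros q chi. real (zmult q chi z) * integral {1/4..3/8} (\<lambda>c. \<bar>c - Re z\<bar> powr (-1/2)))) {1/4..3/8}"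
  unfolding A_def by (intro has_integral_sum fr has_integral_mult_right integrable_integral)
   (rule has_integral_integrable[OF integral_inverse_sqrt_dist], simp)
 have sq: "sqrt (3/8 - 1/4) \<le> (1 :: real)" by (simp add: real_sqrt_le_1_iff)
 have sq': "4 * sqrt (3/8 - 1/4) \<le> (4 :: real)" using sq by linarith
 have up: "(\<Sum>z\<in>real_zeros q chi. real (zmult q chi z) * integral {1/4..3/8} (\<lambda>c. \<bar>c - Re z\<bar> powr (-1/2))) \<le> 4 * K"
 proof -
  have "(\<Sum>z\<in>real_zeros q chi. real (zmult q chi z) * integral {1/4..3/8} (\<lambda>c. \<bar>c - Re z\<bar> powr (-1/2))) \<le> (\<Sum>z\<in>real_zeros q chi. real (zmult q chi z) * 4)"
   by (intro sum_mono mult_left_mono order_trans[OF integral_inverse_sqrt_dist_le sq']) auto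
  thus ?thesis by (simp add: K_def sum_distrib_left mult.commute)
 qed
 have "((\<lambda>_::real. 33 * K) has_integral (33 * K) * (3/8 - 1/4)) {1/4..3/8}"
  by (rule has_integral_eq_rhs[OF has_integral_const_real]) simp
 hence "((\<lambda>c. if c \<in> Re ` real_zeros q chi then A c else 33 * K) has_integral (33 * K) * (3/8 - 1/4)) {1/4..3/8}"
  by (rule has_integral_spike_finite[rotated 2, where S = "Re ` real_zeros q chi"]) (use fr in auto)
 have "(33 * K) * (3/8 - 1/4) \<le> 4 * K" proof -
  have "(33 * K) * (3/8 - 1/4) \<le> (\<Sum>z\<in>real_zeros q chi. real (zmult q chi z) * integral {1/4..3/8} (\<lambda>c. \<bar>c - Re z\<bar> powr (-1/2)))"
   by (rule has_integral_le[OF \<open>((\<lambda>c. if c \<in> Re ` real_zeros q chi then A c else 33 * K) has_integral (33 * K) * (3/8 - 1/4)) {1/4..3/8}\<close> hA])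
    (use big in auto)
  thus ?thesis using up by linarith
 qed
 moreover have K0: "K \<ge> 0" unfolding K_def by (intro sum_nonneg) auto
 \<comment> \<open>33 K / 8 \<le> 4 K leaves only K = 0. Then both sides of the inequality vanish
   for every c, and any c outside the finite set of real parts refutes the assumption.\<close>
 ultimately have "K = 0" by simp
 hence zero: "real (zmult q chi z) = 0" if "z \<in> real_zeros q chi" for z
  using that fr unfolding K_def by (subst (asm) sum_nonneg_eq_0_iff) auto
 hence A0: "A c = 0" for c unfolding A_def by (intro sum.neutral) auto
 have "infinite ({1/4..3/8} - Re ` real_zeros q chi)" using fr by (intro Diff_infinite_finite) auto
 then obtain c where "c \<in> {1/4..3/8} - Re ` real_zeros q chi" by (metis finite.emptyI ex_in_conv)
 with \<open>\<not> ?thesis\<close> A0 \<open>K = 0\<close> show False unfolding A_def K_def by force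
qed

section \<open>The explicit formula\<close>

lemma zmult_pos:
 assumes chi: "dirichlet_character q chi" and z: "Lreg q chi z = 0"
 shows "zmult q chi z \<ge> 1"
proof -
 have "Lreg q chi 2 \<noteq> 0" by (rule Lreg_nonzero_gt_1[OF chi]) simp
 hence "\<exists>w\<in>UNIV. Lreg q chi w \<noteq> 0" by blast
 from zorder_exist_zero[OF Lreg_holomorphic[OF chi] open_UNIV connected_UNIV UNIV_I this, of z]
 have "zorder (Lreg q chi) z > 0" using z by presburger
 thus ?thesis by (simp add: zmult_def)
qed

text \<open>Pigeonhole: of \<open>card U + 1\<close> midpoints that are 4 \<delta> apart, each u is
  within \<delta> of at most one, so some midpoint is missed by all u.\<close>

lemma exists_point_away_from_finite_set:
 fixes U :: "real set"
 assumes "finite U"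
 shows "\<exists>T\<in>{a..a+1}. \<forall>u\<in>U. \<bar>T - u\<bar> \<ge> 1 / (4 * (real (card U) + 1))"
proof (rule ccontr)
 define N where "N = card U + 1"
 define \<delta> where "\<delta> = 1 / (4 * (real (card U) + 1))"
 define p where "p = (\<lambda>j::nat. a + (2 * real j + 1) / (2 * real N))"
 have N: "real N > 0" by (simp add: N_def)
 have \<delta>: "\<delta> = 1 / (4 * real N)" by (simp add: \<delta>_def N_def)
 assume neg: "\<not> ?thesis"
 have pin: "p j \<in> {a..a+1}" if "j < N" for j
 proof -
  have "2 * real j + 1 \<le> 2 * real N" using that by linarith
  hence "(2 * real j + 1) / (2 * real N) \<le> 1" using N by simp
  thus ?thesis using N by (simp add: p_def)
 qed
 have ex: "\<exists>u\<in>U. \<bar>p j - u\<bar> < \<delta>" if "j < N" for j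
 proof -
  have "\<not> (\<forall>u\<in>U. \<bar>p j - u\<bar> \<ge> \<delta>)" using neg pin[OF that] unfolding \<delta>_def by blast
  thus ?thesis by (auto simp: not_le)
 qed
 then obtain u where u: "\<And>j. j < N ==> u j \<in> U \<and> \<bar>p j - u j\<bar> < \<delta>" by metis
 have "inj_on u {..<N}"
 proof (rule inj_onI)
  fix i j assume ij: "i \<in> {..<N}" "j \<in> {..<N}" "u i = u j"
  have "\<bar>p i - p j\<bar> < 2 * \<delta>" using u[of i] u[of j] ij by (auto simp: abs_if split: if_splits)
  moreover have "p i - p j = (real i - real j) / real N" using N by (simp add: p_def field_simps)
  ultimately have "\<bar>real i - real j\<bar> / real N < (1 / 2) / real N" using N by (simp add: \<delta>)
  hence "\<bar>real i - real j\<bar> < 1 / 2" using N unfolding divide_less_cancel by auto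
  thus "i = j" by linarith
 qed
 moreover have "u ` {..<N} \<subseteq> U" using u by auto
 ultimately have "N \<le> card U" using card_inj_on_le[of u "{..<N}" U] assms by simp
 thus False by (simp add: N_def)
qed

text \<open>\<open>D\<close> may depend on q and chi, since the heights only serve to let the
  horizontal sides vanish against the exponential decay of the kernel. The square is a product: O(k)
  nearby zeros, each at a distance at least of order 1/k.\<close>

definition good_heights :: "nat => (nat => complex) => real => (nat => real) => bool" where
 "good_heights q chi D T \<longleftrightarrow> (\<forall>k. T k \<in> {real k + 1..real k + 2} \<and> (\<forall>x\<in>{1/4..3/2}. \<forall>\<tau>\<in>{T k, - T k}.
   Lreg q chi (Complex x \<tau>) \<noteq> 0 \<and> cmod (logderiv_L q chi (Complex x \<tau>)) \<le> D * (real k + 4)^2))"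

lemma exists_good_heights:
 assumes GRHR and chi: "dirichlet_character q chi"
 shows "\<exists>D>0. \<exists>T. good_heights q chi D T"
proof -
 obtain C where C: "C > 0" "\<And>t. finite (zeros_near q chi t)"
   "\<And>t. real (\<Sum>z\<in>zeros_near q chi t. zmult q chi z) \<le> C * log_cond q t"
   "\<And>t w. w\<in>cball (Complex 2 t) (7/4) ==> Lreg q chi w \<noteq> 0 ==>
    cmod (deriv (Lreg q chi) w / Lreg q chi w - (\<Sum>z\<in>zeros_near q chi t. of_nat (zmult q chi z) / (w - z))) \<le> C * log_cond q t"
  using Lreg_local_zeros chi by blast
 have q: "q > 0" using chi by (simp add: dirichlet_character_def)
 define K where "K = C * real q"
 have K: "K > 0" using C(1) q by (simp add: K_def)
 have cnt: "real (\<Sum>z\<in>zeros_near q chi t. zmult q chi z) \<le> K * (\<bar>t\<bar> + 2)" and lK: "C * log_cond q t \<le> K * (\<bar>t\<bar> + 2)" for t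
 proof -
  show "C * log_cond q t \<le> K * (\<bar>t\<bar> + 2)" unfolding K_def mult.assoc using log_cond_le[OF q, of t] C(1) by (intro mult_left_mono) auto
  thus "real (\<Sum>z\<in>zeros_near q chi t. zmult q chi z) \<le> K * (\<bar>t\<bar> + 2)" using C(3)[of t] by linarith
 qed
 have card: "real (card (zeros_near q chi t)) \<le> K * (\<bar>t\<bar> + 2)" for t
 proof -
  have "card (zeros_near q chi t) = (\<Sum>z\<in>zeros_near q chi t. 1)" by simp
  also have "\<dots> \<le> (\<Sum>z\<in>zeros_near q chi t. zmult q chi z)"
   by (intro sum_mono zmult_pos[OF chi]) (simp add: zeros_near_def)
  finally show ?thesis using cnt[of t] by linarith
 qed
 define D where "D = K + K * (8 * K + 4) + 1"
 have "\<exists>T. T \<in> {real k + 1..real k + 2} \<and> (\<forall>x\<in>{1/4..3/2}. \<forall>\<tau>\<in>{T, - T}.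
   Lreg q chi (Complex x \<tau>) \<noteq> 0 \<and> cmod (logderiv_L q chi (Complex x \<tau>)) \<le> D * (real k + 4)^2)" for k :: nat
 proof -
  define m where "m = real k + 3/2"
  \<comment> \<open>T must avoid the ordinates near k + 3/2 and, for the height -T, those near -(k +
    3/2). Reflecting the latter lets one T serve both signs. Real zeros are at distance at least T
    \<ge> 1 anyway.\<close>
  define U where "U = Im ` zeros_near q chi m \<union> (\<lambda>z. - Im z) ` zeros_near q chi (- m)"
  have finU: "finite U" using C(2) by (simp add: U_def)
  have "card U \<le> card (zeros_near q chi m) + card (zeros_near q chi (- m))"
   unfolding U_def by (rule order_trans[OF card_Un_le]) (intro add_mono card_image_le C(2))
  hence cU: "real (card U) \<le> 2 * K * (real k + 4)"
   using card[of m] card[of "- m"] K by (simp add: m_def algebra_simps)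
  define \<delta> where "\<delta> = 1 / (4 * (real (card U) + 1))"
  have \<delta>: "\<delta> > 0" "\<delta> \<le> 1/2" by (auto simp: \<delta>_def field_simps)
  obtain T where T: "T \<in> {real k + 1..real k + 1 + 1}" "\<And>u. u \<in> U ==> \<bar>T - u\<bar> \<ge> \<delta>"
   using exists_point_away_from_finite_set[OF finU, of "real k + 1"] unfolding \<delta>_def by blast
  have main: "Lreg q chi (Complex x \<tau>) \<noteq> 0 \<and> cmod (logderiv_L q chi (Complex x \<tau>)) \<le> D * (real k + 4)^2"
   if x: "x \<in> {1/4..3/2}" and \<tau>: "\<tau> \<in> {T, - T}" for x \<tau>
  proof -
   let ?s = "Complex x \<tau>" and ?Z = "zeros_near q chi \<tau>"
   have \<tau>a: "\<bar>\<tau>\<bar> = T" using \<tau> T(1) by auto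
   have sb: "?s \<in> cball (Complex 2 \<tau>) (7/4)" using x by (simp add: dist_norm cmod_def abs_if)
   have dist: "cmod (?s - z) \<ge> \<delta>" if z: "z \<in> ?Z" for z
   proof -
    have Lz: "Lreg q chi z = 0" using z by (simp add: zeros_near_def)
    have "cmod (Complex 2 \<tau> - z) \<le> 15/8" using z by (simp add: zeros_near_def dist_norm)
    hence "\<bar>Re (Complex 2 \<tau> - z)\<bar> \<le> 15/8" using abs_Re_le_cmod order_trans by blast
    hence Rez: "Re z > 0" by (auto simp: abs_if split: if_splits)
    have im: "\<bar>\<tau> - Im z\<bar> \<le> cmod (?s - z)" using abs_Im_le_cmod[of "?s - z"] by simp
    show ?thesis
    proof (cases "Im z = 0")
     case True
     thus ?thesis using im \<tau>a T(1) \<delta>(2) by simp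
    next
     case False
     have Re: "Re z = 1/2" by (rule GRHR_Lreg_zero(2)[OF assms(1) chi Lz Rez False])
     have near: "z \<in> zeros_near q chi v" if "\<bar>v - Im z\<bar> \<le> 1" for v
     proof -
      have "(cmod (Complex 2 v - z))^2 = (3/2)^2 + (v - Im z)^2" by (simp add: cmod_power2 Re)
      also have "(v - Im z)^2 \<le> 1" using that by (simp add: abs_square_le_1)
      also have "(3/2)^2 + 1 \<le> (15/8 :: real)^2" by (simp add: power2_eq_square)
      finally have "cmod (Complex 2 v - z) \<le> 15/8" by (rule power2_le_imp_le) simp_all
      thus ?thesis using Lz by (simp add: zeros_near_def dist_norm)
     qed
     have tm: "\<bar>T - m\<bar> \<le> 1/2" using T(1) by (auto simp: m_def abs_if)
     consider "\<tau> = T" | "\<tau> = - T" using \<tau> by auto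
     hence "\<delta> \<le> \<bar>\<tau> - Im z\<bar>"
     proof cases
      case 1
      show ?thesis
      proof (cases "\<bar>m - Im z\<bar> \<le> 1")
       case True
       hence "Im z \<in> U" using near[of m] by (auto simp: U_def)
       thus ?thesis using T(2) 1 by simp
      next
       case False
       thus ?thesis using tm 1 \<delta>(2) by (auto simp: abs_if split: if_splits)
      qed
     next
      case 2
      show ?thesis
      proof (cases "\<bar>- m - Im z\<bar> \<le> 1")
       case True
       hence "- Im z \<in> U" using near[of "- m"] by (auto simp: U_def)
       from T(2)[OF this] show ?thesis using 2 by (simp add: abs_minus_commute abs_if split: if_splits)
      next
       case False
       thus ?thesis using tm 2 \<delta>(2) by (auto simp: abs_if split: if_splits)
      qed
     qed
     thus ?thesis using im by linarith
    qed
   qed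
   have nz: "Lreg q chi ?s \<noteq> 0"
   proof
    assume "Lreg q chi ?s = 0"
    moreover have "cmod (Complex 2 \<tau> - ?s) \<le> 15/8" using sb by (simp add: dist_norm)
    ultimately have "?s \<in> ?Z" by (simp add: zeros_near_def dist_norm)
    from dist[OF this] \<delta> show False by simp
   qed
   have \<tau>b: "\<bar>\<tau>\<bar> + 2 \<le> real k + 4" using \<tau>a T(1) by simp
   have "cmod (\<Sum>z\<in>?Z. of_nat (zmult q chi z) / (?s - z)) \<le> (\<Sum>z\<in>?Z. real (zmult q chi z) * (1 / \<delta>))"
   proof (intro order_trans[OF norm_sum] sum_mono)
    fix z assume z: "z \<in> ?Z"
    have "1 / cmod (?s - z) \<le> 1 / \<delta>" using dist[OF z] \<delta> by (intro divide_left_mono mult_pos_pos) auto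
    hence "real (zmult q chi z) * (1 / cmod (?s - z)) \<le> real (zmult q chi z) * (1 / \<delta>)" by (intro mult_left_mono) auto
    thus "cmod (of_nat (zmult q chi z) / (?s - z)) \<le> real (zmult q chi z) * (1 / \<delta>)" by (simp add: norm_divide)
   qed
   also have "\<dots> = real (\<Sum>z\<in>?Z. zmult q chi z) * (1 / \<delta>)" unfolding of_nat_sum by (rule sum_distrib_right[symmetric])
   also have "\<dots> \<le> (K * (real k + 4)) * ((8 * K + 4) * (real k + 4))"
   proof (intro mult_mono)
    have "K * (\<bar>\<tau>\<bar> + 2) \<le> K * (real k + 4)" using \<tau>b K by (intro mult_left_mono) auto
    thus "real (\<Sum>z\<in>?Z. zmult q chi z) \<le> K * (real k + 4)" using cnt[of \<tau>] by linarith
    have "1 / \<delta> = 4 * real (card U) + 4" by (simp add: \<delta>_def)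
    also have "\<dots> \<le> (8 * K + 4) * (real k + 4)" using cU by (simp add: algebra_simps)
    finally show "1 / \<delta> \<le> (8 * K + 4) * (real k + 4)" .
   qed (use K \<delta> in auto)
   finally have S: "cmod (\<Sum>z\<in>?Z. of_nat (zmult q chi z) / (?s - z)) \<le> K * (8 * K + 4) * (real k + 4)^2"
    by (simp add: power2_eq_square mult_ac)
   have le2: "real k + 4 \<le> (real k + 4)^2" by (simp add: power2_eq_square)
   have Dv: "cmod (deriv (Lreg q chi) ?s / Lreg q chi ?s - (\<Sum>z\<in>?Z. of_nat (zmult q chi z) / (?s - z))) \<le> K * (real k + 4)^2"
   proof -
    have "C * log_cond q \<tau> \<le> K * (\<bar>\<tau>\<bar> + 2)" by (rule lK)
    also have "\<dots> \<le> K * (real k + 4)^2" using \<tau>b le2 K by (intro mult_left_mono) auto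
    finally show ?thesis using C(4)[OF sb nz] by linarith
   qed
   have P: "cmod (if principal_character q chi then 1 / (?s - 1) else 0) \<le> 1 * (real k + 4)^2"
   proof -
    have "1 \<le> \<bar>Im (?s - 1)\<bar>" using \<tau>a T(1) by simp
    hence "1 \<le> cmod (?s - 1)" using abs_Im_le_cmod order_trans by blast
    hence "1 / cmod (?s - 1) \<le> 1" by (simp add: divide_le_eq)
    hence "cmod (if principal_character q chi then 1 / (?s - 1) else 0) \<le> 1" by (auto simp: norm_divide)
    thus ?thesis using le2 by linarith
   qed
   have "logderiv_L q chi ?s = (deriv (Lreg q chi) ?s / Lreg q chi ?s - (\<Sum>z\<in>?Z. of_nat (zmult q chi z) / (?s - z))) + (\<Sum>z\<in>?Z. of_nat (zmult q chi z) / (?s - z))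
     - (if principal_character q chi then 1 / (?s - 1) else 0)" by (simp add: logderiv_L_def)
   also have "cmod \<dots> \<le> K * (real k + 4)^2 + K * (8 * K + 4) * (real k + 4)^2 + 1 * (real k + 4)^2"
    by (intro order_trans[OF norm_triangle_ineq4] order_trans[OF norm_triangle_ineq] add_mono Dv S P)
   also have "\<dots> = D * (real k + 4)^2" by (simp add: D_def algebra_simps)
   finally show ?thesis using nz by blast
  qed
  show ?thesis using T(1) main by (intro exI[of _ T]) auto
 qed
 then obtain T where "\<And>k. T k \<in> {real k + 1..real k + 2} \<and> (\<forall>x\<in>{1/4..3/2}. \<forall>\<tau>\<in>{T k, - T k}.
   Lreg q chi (Complex x \<tau>) \<noteq> 0 \<and> cmod (logderiv_L q chi (Complex x \<tau>)) \<le> D * (real k + 4)^2)" by metis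
 hence "good_heights q chi D T" unfolding good_heights_def by blast
 moreover have "D > 0" using K by (simp add: D_def add_pos_pos)
 ultimately show ?thesis by blast
qed

definition mellin_kernel :: "complex => complex => complex" where
 "mellin_kernel z s = Gamma s * z powr (- s)"

lemma mellin_kernel_bounds:
 "\<exists>C>0. \<forall>z \<sigma> t. Re z > 0 --> 1/4 \<le> \<sigma> -->
   (\<sigma> \<le> 1/2 --> cmod (mellin_kernel z (Complex \<sigma> t)) \<le> C * cmod z powr (- \<sigma>) * exp (- (Re z / cmod z) * \<bar>t\<bar>)) \<and>
   (\<sigma> \<le> 3/2 --> cmod (mellin_kernel z (Complex \<sigma> t)) \<le> C * (1 + \<bar>t\<bar>) * cmod z powr (- \<sigma>) * exp (- (Re z / cmod z) * \<bar>t\<bar>))"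
proof -
 obtain C where C: "C > 0" "\<And>\<sigma> t. 1/4 \<le> \<sigma> ==> \<sigma> \<le> 1/2 ==> cmod (Gamma (Complex \<sigma> t)) \<le> C * exp (- pi * \<bar>t\<bar> / 2)"
  "\<And>\<sigma> t. 1/4 \<le> \<sigma> ==> \<sigma> \<le> 3/2 ==> cmod (Gamma (Complex \<sigma> t)) \<le> C * (1 + \<bar>t\<bar>) * exp (- pi * \<bar>t\<bar> / 2)"
  using Gamma_strip_bounds by blast
 have gen: "cmod (mellin_kernel z (Complex \<sigma> t)) \<le> B * cmod z powr (- \<sigma>) * exp (- (Re z / cmod z) * \<bar>t\<bar>)"
  if z: "Re z > 0" and B: "cmod (Gamma (Complex \<sigma> t)) \<le> B * exp (- pi * \<bar>t\<bar> / 2)" "B \<ge> 0" for z \<sigma> t B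
 proof -
  have "cmod (mellin_kernel z (Complex \<sigma> t)) \<le> B * exp (- pi * \<bar>t\<bar> / 2) * cmod (z powr (- Complex \<sigma> t))"
   unfolding mellin_kernel_def norm_mult using B by (intro mult_right_mono) auto
  also have "\<dots> = B * (cmod (z powr (- Complex \<sigma> t)) * exp (- pi * \<bar>Im (Complex \<sigma> t)\<bar> / 2))" by simp
  also have "\<dots> \<le> B * (cmod z powr (- Re (Complex \<sigma> t)) * exp (- (Re z / cmod z) * \<bar>Im (Complex \<sigma> t)\<bar>))"
   using B(2) by (intro mult_left_mono norm_powr_minus_bound z) auto
  finally show ?thesis by simp
 qed
 show ?thesis using C by (intro exI[of _ C] conjI allI impI gen) auto
qed

lemma mellin_kernel_holomorphic: "Re z > 0 ==> mellin_kernel z holomorphic_on {s. Re s > 0}"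
 unfolding mellin_kernel_def using Mellin_integrand_holomorphic[of z]
 by (rule holomorphic_on_subset) (auto dest: Re_pos_notin_nonpos_Ints)

lemma continuous_on_vertical: "continuous_on A (\<lambda>t. Complex c t)"
 by (simp add: Complex_eq) (intro continuous_intros)

text \<open>\<open>Cahen_Mellin\<close> is applied to w = n z for each n, where (n z)^(-s) = n^(-s)
  z^(-s) because n is positive. Convergence of the sum of n^(-3/2) ln n justifies the exchange with
  the integral.\<close>

lemma Lambda_sum_line_integral:
 fixes z :: complex and chi :: "nat => complex"
 assumes chi: "dirichlet_character q chi" and z: "Re z > 0"
 shows "integrable lborel (\<lambda>t. logderiv_L q chi (Complex (3/2) t) * mellin_kernel z (Complex (3/2) t))"
  and "integral\<^sup>L lborel (\<lambda>t. logderiv_L q chi (Complex (3/2) t) * mellin_kernel z (Complex (3/2) t)) =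
    - (2 * pi * (\<Sum>n. chi (Suc n) * mangoldt (Suc n) * exp (- (of_nat (Suc n) * z))))"
proof -
 let ?s = "\<lambda>t. Complex (3/2) t"
 define F where "F = (\<lambda>n t. Lambda_term chi (?s t) (Suc n) * mellin_kernel z (?s t))"
 have z0: "z \<noteq> 0" using z by auto
 have eq: "logderiv_L q chi (?s t) = - Lambda_series chi (?s t)" for t
 proof -
  have Re: "Re (?s t) > 1" by simp
  have "?s t \<noteq> 1" by (simp add: complex_eq_iff)
  hence "deriv (Lreg q chi) (?s t) / Lreg q chi (?s t) = deriv (dirichlet_L q chi) (?s t) / dirichlet_L q chi (?s t) + (if principal_character q chi then 1 / (?s t - 1) else 0)"
   using dirichlet_L_nonzero_gt_1[OF chi Re] by (intro logderiv_Lreg[OF chi]) auto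
  thus ?thesis unfolding logderiv_L_def Lambda_series_eq_logderiv[OF chi Re] by simp
 qed
 have Ki: "integrable lborel (\<lambda>t. mellin_kernel z (?s t))" using Cahen_Mellin(1)[OF z] by (simp add: mellin_kernel_def)
 have Feq: "F n t = (chi (Suc n) * mangoldt (Suc n)) * mellin_kernel (of_nat (Suc n) * z) (?s t)" for n t
 proof -
  have "(of_real (real (Suc n)) * z) powr (- ?s t) = of_real (real (Suc n)) powr (- ?s t) * z powr (- ?s t)"
  proof -
   have "Ln (of_real (real (Suc n)) * z) = Ln (of_real (real (Suc n))) + Ln z"
    by (rule Ln_times_of_real) (use z0 in auto)
   moreover have "complex_of_real (real (Suc n)) \<noteq> 0" unfolding of_real_eq_0_iff by simp
   ultimately show ?thesis using z0 by (simp only: powr_def mult_eq_0_iff simp_thms if_False distrib_left exp_add)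
  qed
  thus ?thesis unfolding F_def Lambda_term_def mellin_kernel_def by (simp add: powr_minus_divide del: of_nat_Suc)
 qed
 have nz: "Re (of_nat (Suc n) * z) > 0" for n using z by (simp add: add_pos_nonneg distrib_right)
 have Fi: "integrable lborel (F n)" for n
  unfolding Feq[abs_def] using Cahen_Mellin(1)[OF nz[of n]] by (simp add: mellin_kernel_def)
 have FI: "integral\<^sup>L lborel (F n) = 2 * pi * (chi (Suc n) * mangoldt (Suc n) * exp (- (of_nat (Suc n) * z)))" for n
  unfolding Feq[abs_def] using Cahen_Mellin[OF nz[of n]] by (simp add: mellin_kernel_def)
 have nF: "norm (F n t) \<le> ln (real (Suc n)) * real (Suc n) powr - (3/2) * norm (mellin_kernel z (?s t))" for n t
  unfolding F_def norm_mult using Lambda_term_norm_le[OF chi, of "?s t" n] by (intro mult_right_mono) auto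
 have sl: "summable (\<lambda>n. ln (real (Suc n)) * real (Suc n) powr - (3/2))" by (rule summable_ln_powr) simp
 have S1: "AE t in lborel. summable (\<lambda>n. norm (F n t))"
 proof (rule AE_I2)
  fix t show "summable (\<lambda>n. norm (F n t))"
   by (rule summable_comparison_test'[OF summable_mult2[OF sl]]) (use nF in auto)
 qed
 have S2: "summable (\<lambda>n. \<integral>t. norm (F n t) \<partial>lborel)"
 proof (rule summable_comparison_test'[OF summable_mult2[OF sl, of "\<integral>t. norm (mellin_kernel z (?s t)) \<partial>lborel"]])
  fix n
  have "(\<integral>t. norm (F n t) \<partial>lborel) \<le> (\<integral>t. ln (real (Suc n)) * real (Suc n) powr - (3/2) * norm (mellin_kernel z (?s t)) \<partial>lborel)"
   using Fi Ki nF by (intro integral_mono) auto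
  thus "norm (\<integral>t. norm (F n t) \<partial>lborel) \<le> ln (real (Suc n)) * real (Suc n) powr - (3/2) * (\<integral>t. norm (mellin_kernel z (?s t)) \<partial>lborel)"
   by simp
 qed
 have suminf: "(\<Sum>n. F n t) = - (logderiv_L q chi (?s t) * mellin_kernel z (?s t))" for t
 proof -
  have "summable (\<lambda>n. Lambda_term chi (?s t) (Suc n))"
   by (rule summable_norm_cancel[OF Lambda_series_abs_summable[OF chi]]) simp
  thus ?thesis unfolding F_def eq Lambda_series_def by (simp add: suminf_mult2)
 qed
 have "integrable lborel (\<lambda>t. \<Sum>n. F n t)" by (rule integrable_suminf[OF Fi S1 S2])
 thus "integrable lborel (\<lambda>t. logderiv_L q chi (?s t) * mellin_kernel z (?s t))" unfolding suminf by simp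
 have "integral\<^sup>L lborel (\<lambda>t. \<Sum>n. F n t) = (\<Sum>n. integral\<^sup>L lborel (F n))" by (rule integral_suminf[OF Fi S1 S2])
 also have "\<dots> = 2 * pi * (\<Sum>n. chi (Suc n) * mangoldt (Suc n) * exp (- (of_nat (Suc n) * z)))"
 proof -
  have "summable (\<lambda>n. integral\<^sup>L lborel (F n))"
   by (rule summable_comparison_test'[OF S2]) (rule integral_norm_bound)
  hence "summable (\<lambda>n. (1 / (2 * pi)) * integral\<^sup>L lborel (F n))" by (rule summable_mult)
  hence "summable (\<lambda>n. chi (Suc n) * mangoldt (Suc n) * exp (- (of_nat (Suc n) * z)))" unfolding FI by simp
  thus ?thesis unfolding FI by (rule suminf_mult)
 qed
 finally show "integral\<^sup>L lborel (\<lambda>t. logderiv_L q chi (?s t) * mellin_kernel z (?s t)) =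
    - (2 * pi * (\<Sum>n. chi (Suc n) * mangoldt (Suc n) * exp (- (of_nat (Suc n) * z))))"
  unfolding suminf by (simp add: minus_equation_iff)
qed

definition zeros_in_box :: "nat => (nat => complex) => real => real => complex set" where
 "zeros_in_box q chi c T = {z \<in> box (Complex c (- T)) (Complex (3/2) T). Lreg q chi z = 0}"

lemma finite_Lreg_zeros:
 assumes chi: "dirichlet_character q chi" and K: "bounded K"
 shows "finite {z \<in> K. Lreg q chi z = 0}"
proof -
 have nz: "Lreg q chi 2 \<noteq> 0" by (rule Lreg_nonzero_gt_1[OF chi]) simp
 have nc: "\<not> Lreg q chi constant_on UNIV \<or> (\<forall>z. Lreg q chi z \<noteq> 0)"
  using nz unfolding constant_on_def by (metis UNIV_I)
 show ?thesis
 proof (cases "\<forall>z. Lreg q chi z \<noteq> 0")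
  case False
  hence "\<not> Lreg q chi constant_on UNIV" using nc by blast
  moreover have "compact (closure K)" using K by (rule compact_closure[THEN iffD2])
  ultimately have "finite {z \<in> closure K. Lreg q chi z = 0}"
   by (intro holomorphic_compact_finite_zeros[OF Lreg_holomorphic[OF chi] open_UNIV connected_UNIV]) auto
  thus ?thesis by (rule finite_subset[rotated]) (use closure_subset in blast)
 qed auto
qed

lemma Lreg_left_line_nonzero:
 assumes GRHR "dirichlet_character q chi" "1/4 \<le> c" "c \<le> 3/8" "\<forall>p\<in>real_zeros q chi. Re p \<noteq> c"
 shows "Lreg q chi (Complex c t) \<noteq> 0"
proof
 assume L: "Lreg q chi (Complex c t) = 0"
 show False
 proof (cases "t = 0")
  case True
  hence "Complex c t \<in> real_zeros q chi" using L assms(3,4) by (auto simp: real_zeros_iff abs_if)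
  thus False using assms(5) by force
 next
  case False
  thus False using GRHR_Lreg_zero(2)[OF assms(1,2) L] assms(3,4) by simp
 qed
qed

text \<open>Between the lines c and 3/2 the function L'/L Gamma(s) z^(-s) has poles only at the
  zeros and, for principal characters, at s = 1. The sum over zeros and the integral on the left
  stay together in a single limit along \<open>T\<close>, since the later passage to the limit by
  Fatou's lemma uses just the total.\<close>

lemma explicit_formula:
 fixes z :: complex and chi :: "nat => complex"
 assumes GRHR and chi: "dirichlet_character q chi" and z: "Re z > 0"
  and c: "1/4 \<le> c" "c \<le> 3/8" "\<forall>p\<in>real_zeros q chi. Re p \<noteq> c" and T: "good_heights q chi D T"
 shows "(\<lambda>k. (\<Sum>n. chi (Suc n) * mangoldt (Suc n) * exp (- (of_nat (Suc n) * z))) - E_char q chi / z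
   + (\<Sum>p\<in>zeros_in_box q chi c (T k). of_nat (zmult q chi p) * mellin_kernel z p)
   + integral {-T k..T k} (\<lambda>t. logderiv_L q chi (Complex c t) * mellin_kernel z (Complex c t)) / (2 * pi)) \<longlonglongrightarrow> 0"
proof -
 let ?h = "mellin_kernel z" and ?R = "Lreg q chi"
 define S where "S = (\<Sum>n. chi (Suc n) * mangoldt (Suc n) * exp (- (of_nat (Suc n) * z)))"
 define f where "f = (\<lambda>s. logderiv_L q chi s * ?h s)"
 define V where "V = (\<lambda>b k. integral {-T k..T k} (\<lambda>t. f (Complex b t)))"
 have z0: "z \<noteq> 0" using z by auto
 have Tk: "T k \<ge> real k + 1" "T k \<le> real k + 2" for k using T by (auto simp: good_heights_def)
 have Tpos: "T k > 0" for k using Tk(1)[of k] by linarith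
 have hh: "?h holomorphic_on {s. Re s > 0}" by (rule mellin_kernel_holomorphic[OF z])
 have Rh: "?R holomorphic_on UNIV" by (rule Lreg_holomorphic[OF chi])
 have Rc: "?R (Complex c t) \<noteq> 0" for t by (rule Lreg_left_line_nonzero[OF assms(1) chi c])
 have Rb: "?R (Complex (3/2) t) \<noteq> 0" for t by (rule Lreg_nonzero_gt_1[OF chi]) simp
 define g where "g = (\<lambda>k. rectpath (Complex c (- T k)) (Complex (3/2) (T k)))"
 have cb: "c < 3/2" using c by simp
 have img: "Re w \<ge> c" "Re w \<le> 3/2" "\<bar>Im w\<bar> \<le> T k" "?R w \<noteq> 0" "w \<noteq> 1" if "w \<in> path_image (g k)" for w k
 proof -
  note L = line_in_rectpath[OF cb Tpos[of k] that[unfolded g_def]]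
  show "Re w \<ge> c" "Re w \<le> 3/2" "\<bar>Im w\<bar> \<le> T k" by (fact L)+
  consider "Re w = c" | "Re w = 3/2" | "\<bar>Im w\<bar> = T k" using L(4) by blast
  thus "?R w \<noteq> 0"
  proof cases
   case 1 thus ?thesis using Rc[of "Im w"] by (metis complex.exhaust_sel)
  next
   case 2 thus ?thesis using Rb[of "Im w"] by (metis complex.exhaust_sel)
  next
   case 3
   hence "Im w \<in> {T k, - T k}" by (auto simp: abs_if split: if_splits)
   moreover have "Re w \<in> {1/4..3/2}" using L c by auto
   ultimately have "?R (Complex (Re w) (Im w)) \<noteq> 0" using T unfolding good_heights_def by blast
   thus ?thesis by simp
  qed
  show "w \<noteq> 1" using L(4) Tpos[of k] c by auto
 qed
 have "continuous_on (path_image (g k)) f" for k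
 proof -
  have "continuous_on (path_image (g k)) ?R" "continuous_on (path_image (g k)) (deriv ?R)"
   using holomorphic_on_imp_continuous_on[OF Rh] holomorphic_on_imp_continuous_on[OF holomorphic_deriv[OF Rh open_UNIV]]
     by (auto elim: continuous_on_subset)
  moreover have "continuous_on (path_image (g k)) ?h"
   by (rule continuous_on_subset[OF holomorphic_on_imp_continuous_on[OF hh]]) (use img(1) c in force)
  ultimately show ?thesis unfolding f_def logderiv_L_def
   using img(4,5) by (cases "principal_character q chi") (auto intro!: continuous_intros)
 qed
 note fcont = this
 obtain W where W: "W > 0" "\<And>\<sigma> t. 1/4 \<le> \<sigma> ==> \<sigma> \<le> 3/2 ==> cmod (?h (Complex \<sigma> t)) \<le> W * (1 + \<bar>t\<bar>) * exp (- (Re z / cmod z) * \<bar>t\<bar>)"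
 proof -
  obtain C where C: "C > 0" "\<And>\<sigma> t. 1/4 \<le> \<sigma> ==> \<sigma> \<le> 3/2 ==> cmod (?h (Complex \<sigma> t)) \<le> C * (1 + \<bar>t\<bar>) * cmod z powr (- \<sigma>) * exp (- (Re z / cmod z) * \<bar>t\<bar>)"
   using mellin_kernel_bounds z by meson
  define P where "P = cmod z powr (-1/4) + cmod z powr (-3/2)"
  have P: "cmod z powr (- \<sigma>) \<le> P" if "1/4 \<le> \<sigma>" "\<sigma> \<le> 3/2" for \<sigma>
  proof (cases "cmod z \<ge> 1")
   case True
   hence "cmod z powr (- \<sigma>) \<le> cmod z powr (-1/4)" using that by (intro powr_mono) auto
   thus ?thesis by (simp add: P_def add_increasing2)
  next
   case False
   hence "cmod z powr (- \<sigma>) \<le> cmod z powr (-3/2)" using that z0 by (intro powr_mono') auto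
   thus ?thesis by (simp add: P_def add_increasing)
  qed
  have P0: "P > 0" using z0 by (simp add: P_def add_pos_pos)
  show ?thesis
  proof (rule that[of "C * P"])
   show "C * P > 0" using C(1) P0 by simp
   fix \<sigma> t :: real assume s: "1/4 \<le> \<sigma>" "\<sigma> \<le> 3/2"
   have "C * (1 + \<bar>t\<bar>) * cmod z powr (- \<sigma>) * exp (- (Re z / cmod z) * \<bar>t\<bar>) \<le> C * (1 + \<bar>t\<bar>) * P * exp (- (Re z / cmod z) * \<bar>t\<bar>)"
    using C(1) by (intro mult_right_mono mult_left_mono P s) auto
   thus "cmod (?h (Complex \<sigma> t)) \<le> C * P * (1 + \<bar>t\<bar>) * exp (- (Re z / cmod z) * \<bar>t\<bar>)"
    using C(2)[OF s, of t] by (simp add: mult_ac)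
  qed
 qed
 define \<eta> where "\<eta> = Re z / cmod z"
 have \<eta>: "\<eta> > 0" using z z0 by (simp add: \<eta>_def)
 have D0: "D \<ge> 0"
 proof -
  have "(1/4::real) \<in> {1/4..3/2}" by simp
  hence "cmod (logderiv_L q chi (Complex (1/4) (T 0))) \<le> D * (real 0 + 4)^2"
   using T unfolding good_heights_def by blast
  hence "0 \<le> D * (real 0 + 4)^2" by (rule order_trans[OF norm_ge_zero])
  thus ?thesis by (simp add: zero_le_mult_iff)
 qed
 define B where "B = (\<lambda>k::nat. D * (real k + 4)^2 * (W * (real k + 3) * exp (- \<eta> * (real k + 1))))"
 have Blim: "B \<longlonglongrightarrow> 0"
 proof -
  have "(\<lambda>k::nat. (real k + 4)^2 * ((real k + 3) * exp (- \<eta> * (real k + 1)))) \<longlonglongrightarrow> 0" using \<eta> by real_asymp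
  hence "(\<lambda>k::nat. D * W * ((real k + 4)^2 * ((real k + 3) * exp (- \<eta> * (real k + 1))))) \<longlonglongrightarrow> 0" by (rule tendsto_mult_right_zero)
  moreover have "B = (\<lambda>k::nat. D * W * ((real k + 4)^2 * ((real k + 3) * exp (- \<eta> * (real k + 1)))))"
   unfolding B_def by (intro ext) (simp only: mult_ac)
  ultimately show ?thesis by simp
 qed
 have hb: "cmod (f (Complex x \<tau>)) \<le> B k" if x: "x \<in> {c..3/2}" and \<tau>: "\<tau> \<in> {T k, - T k}" for x \<tau> k
 proof -
  have xx: "x \<in> {1/4..3/2}" using x c by auto
  have a: "\<bar>\<tau>\<bar> = T k" using \<tau> Tpos[of k] by auto
  have "cmod (logderiv_L q chi (Complex x \<tau>)) \<le> D * (real k + 4)^2" using T xx \<tau> unfolding good_heights_def by blast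
  moreover have "cmod (?h (Complex x \<tau>)) \<le> W * (real k + 3) * exp (- \<eta> * (real k + 1))"
  proof -
   have "cmod (?h (Complex x \<tau>)) \<le> W * (1 + \<bar>\<tau>\<bar>) * exp (- \<eta> * \<bar>\<tau>\<bar>)" unfolding \<eta>_def using xx by (intro W(2)) auto
   also have "\<dots> \<le> W * (real k + 3) * exp (- \<eta> * (real k + 1))"
    using a Tk[of k] W(1) \<eta> by (intro mult_mono mult_left_mono) auto
   finally show ?thesis .
  qed
  ultimately show ?thesis unfolding f_def norm_mult B_def using D0 by (intro mult_mono) auto
 qed
 have rect: "cmod (contour_integral (g k) f - \<i> * (V (3/2) k - V c k)) \<le> 2 * (3/2 - c) * B k" for k
  unfolding g_def V_def
  by (rule rectpath_contour_integral_bound[OF cb Tpos]) (use fcont[of k] hb in \<open>auto simp: g_def\<close>)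
 have ci: "contour_integral (g k) f = 2 * pi * \<i> * ((\<Sum>p\<in>zeros_in_box q chi c (T k). of_nat (zmult q chi p) * ?h p) - E_char q chi / z)" for k
 proof -
  \<comment> \<open>A neighbourhood of the rectangle in which the kernel is holomorphic. The zeros
    in it that lie outside the rectangle have winding number 0.\<close>
  define U where "U = box (Complex (1/10) (- T k - 1)) (Complex 2 (T k + 1))"
  have U: "open U" "connected U" by (auto simp: U_def open_box convex_connected convex_box)
  have Uh: "?h holomorphic_on U" by (rule holomorphic_on_subset[OF hh]) (auto simp: U_def in_box_complex_iff)
  have gU: "path_image (g k) \<subseteq> U"
  proof
   fix w assume "w \<in> path_image (g k)"
   from img(1-3)[OF this] show "w \<in> U" using c by (auto simp: U_def in_box_complex_iff)
  qed
  have vp: "valid_path (g k)" "pathfinish (g k) = pathstart (g k)" by (auto simp: g_def)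
  have sub: "zeros_in_box q chi c (T k) \<subseteq> {w \<in> U. ?R w = 0}" using c by (auto simp: zeros_in_box_def U_def in_box_complex_iff)
  have wo: "winding_number (g k) w = 0" if "w \<notin> cbox (Complex c (- T k)) (Complex (3/2) (T k))" for w
   unfolding g_def by (rule winding_number_rectpath_outside) (use c Tpos[of k] that in auto)
  have cs: "cbox (Complex c (- T k)) (Complex (3/2) (T k)) \<subseteq> U" using c by (auto simp: U_def in_box_complex_iff in_cbox_complex_iff)
  have "bounded U" unfolding U_def by simp
  hence fin: "finite {w \<in> U. ?R w = 0}" by (rule finite_Lreg_zeros[OF chi])
  have "contour_integral (g k) (\<lambda>x. deriv ?R x * ?h x / ?R x) = 2 * pi * \<i> * (\<Sum>p\<in>{w \<in> U. ?R w = 0 \<or> w \<in> {}}. winding_number (g k) p * ?h p * zorder ?R p)"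
  proof (rule argument_principle[OF U _ Uh vp])
   show "?R holomorphic_on U - {}" using Rh by (rule holomorphic_on_subset) auto
   show "path_image (g k) \<subseteq> U - {w \<in> U. ?R w = 0 \<or> w \<in> {}}" using gU img(4) by auto
   show "\<forall>w. w \<notin> U --> winding_number (g k) w = 0" using wo cs by blast
  qed (use fin in auto)
  also have "(\<Sum>p\<in>{w \<in> U. ?R w = 0 \<or> w \<in> {}}. winding_number (g k) p * ?h p * zorder ?R p) =
    (\<Sum>p\<in>zeros_in_box q chi c (T k). of_nat (zmult q chi p) * ?h p)"
  proof (rule sum.mono_neutral_cong_right)
   show "zeros_in_box q chi c (T k) \<subseteq> {w \<in> U. ?R w = 0 \<or> w \<in> {}}" using sub by auto
   show "\<forall>i\<in>{w \<in> U. ?R w = 0 \<or> w \<in> {}} - zeros_in_box q chi c (T k). winding_number (g k) i * ?h i * of_int (zorder ?R i) = 0"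
   proof
    fix p assume p: "p \<in> {w \<in> U. ?R w = 0 \<or> w \<in> {}} - zeros_in_box q chi c (T k)"
    hence "p \<notin> box (Complex c (- T k)) (Complex (3/2) (T k))" by (auto simp: zeros_in_box_def)
    moreover have "p \<notin> path_image (g k)" using img(4) p by auto
    moreover have "path_image (g k) = cbox (Complex c (- T k)) (Complex (3/2) (T k)) - box (Complex c (- T k)) (Complex (3/2) (T k))"
     unfolding g_def by (rule path_image_rectpath_cbox_minus_box) (use c Tpos[of k] in auto)
    ultimately have "p \<notin> cbox (Complex c (- T k)) (Complex (3/2) (T k))" by blast
    thus "winding_number (g k) p * ?h p * of_int (zorder ?R p) = 0" using wo by simp
   qed
   fix p assume p: "p \<in> zeros_in_box q chi c (T k)"
   have "winding_number (g k) p = 1" unfolding g_def by (rule winding_number_rectpath) (use p in \<open>simp add: zeros_in_box_def\<close>)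
   moreover have "zorder ?R p = int (zmult q chi p)"
    using zmult_pos[OF chi, of p] p by (simp add: zeros_in_box_def zmult_def)
   ultimately show "winding_number (g k) p * ?h p * of_int (zorder ?R p) = of_nat (zmult q chi p) * ?h p" by simp
  qed (use fin in auto)
  finally have c1: "contour_integral (g k) (\<lambda>x. deriv ?R x * ?h x / ?R x) = 2 * pi * \<i> * (\<Sum>p\<in>zeros_in_box q chi c (T k). of_nat (zmult q chi p) * ?h p)" .
  \<comment> \<open>\<open>Lreg\<close> does not see the pole at 1. It enters through the term 1 /
    (s - 1) of \<open>logderiv_L\<close>, and Gamma(1) z^(-1) = 1 / z produces the term
    \<open>E_char q chi / z\<close>.\<close>
  have ih: "((\<lambda>s. ?h s / (s - 1)) has_contour_integral (2 * pi * \<i> * winding_number (g k) 1 * ?h 1)) (g k)"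
  proof (rule Cauchy_integral_formula_convex_simple[OF _ Uh])
   show "convex U" by (simp add: U_def convex_box)
   show "1 \<in> interior U" using U(1) Tpos[of k] by (simp add: interior_open) (simp add: U_def in_box_complex_iff)
   show "path_image (g k) \<subseteq> U - {1}" using gU img(5) by auto
  qed (use vp in auto)
  moreover have "winding_number (g k) 1 = 1"
   unfolding g_def by (rule winding_number_rectpath) (use c Tpos[of k] in \<open>auto simp: in_box_complex_iff\<close>)
  moreover have "?h 1 = 1 / z" using z0 by (simp add: mellin_kernel_def powr_minus_divide)
  ultimately have i2: "((\<lambda>s. ?h s / (s - 1)) has_contour_integral (2 * pi * \<i> * (1 / z))) (g k)" by simp
  have i1: "((\<lambda>x. deriv ?R x * ?h x / ?R x) has_contour_integral (2 * pi * \<i> * (\<Sum>p\<in>zeros_in_box q chi c (T k). of_nat (zmult q chi p) * ?h p))) (g k)"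
  proof -
   have "continuous_on (path_image (g k)) (\<lambda>x. deriv ?R x * ?h x / ?R x)"
   proof -
    have "continuous_on (path_image (g k)) ?R" "continuous_on (path_image (g k)) (deriv ?R)"
     using holomorphic_on_imp_continuous_on[OF Rh] holomorphic_on_imp_continuous_on[OF holomorphic_deriv[OF Rh open_UNIV]]
     by (auto elim: continuous_on_subset)
    moreover have "continuous_on (path_image (g k)) ?h"
     by (rule continuous_on_subset[OF holomorphic_on_imp_continuous_on[OF Uh] gU])
    ultimately show ?thesis using img(4) by (intro continuous_intros) auto
   qed
   moreover have "(\<lambda>x. deriv ?R x * ?h x / ?R x) contour_integrable_on g k"
   proof -
    define pz where "pz = {w \<in> U. ?R w = 0}"
    have "open (U - pz)" using U(1) fin by (intro open_Diff finite_imp_closed) (auto simp: pz_def)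
    moreover have "(\<lambda>x. deriv ?R x * ?h x / ?R x) holomorphic_on U - pz"
     by (intro holomorphic_intros holomorphic_on_subset[OF Rh] holomorphic_on_subset[OF Uh] holomorphic_on_subset[OF holomorphic_deriv[OF Rh open_UNIV]]) (auto simp: pz_def)
    moreover have "path_image (g k) \<subseteq> U - pz" using gU img(4) by (auto simp: pz_def)
    ultimately show ?thesis using vp(1) contour_integrable_holomorphic_simple by blast
   qed
   ultimately show ?thesis using c1 has_contour_integral_integral by metis
  qed
  have "((\<lambda>s. deriv ?R s * ?h s / ?R s - E_char q chi * (?h s / (s - 1))) has_contour_integral
    (2 * pi * \<i> * (\<Sum>p\<in>zeros_in_box q chi c (T k). of_nat (zmult q chi p) * ?h p) - E_char q chi * (2 * pi * \<i> * (1 / z)))) (g k)"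
   by (intro has_contour_integral_diff has_contour_integral_lmul i1 i2)
  moreover have "(\<lambda>s. deriv ?R s * ?h s / ?R s - E_char q chi * (?h s / (s - 1))) = f"
   by (auto simp: fun_eq_iff f_def logderiv_L_def E_char_def algebra_simps)
  ultimately have "contour_integral (g k) f = 2 * pi * \<i> * (\<Sum>p\<in>zeros_in_box q chi c (T k). of_nat (zmult q chi p) * ?h p) - E_char q chi * (2 * pi * \<i> * (1 / z))"
   using contour_integral_unique by metis
  thus ?thesis by (simp add: algebra_simps)
 qed
 note SI = Lambda_sum_line_integral[OF chi z, folded S_def f_def]
 have "filterlim T at_top sequentially"
 proof (rule filterlim_at_top_mono)
  show "filterlim (\<lambda>k. real k + 1) at_top sequentially" by real_asymp
 qed (use Tk in auto)
 hence Vb: "V (3/2) \<longlonglongrightarrow> - (2 * pi * S)"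
  unfolding V_def using symmetric_integral_tendsto[of "\<lambda>t. f (Complex (3/2) t)" T] SI[unfolded S_def[symmetric]] by (simp add: f_def)
 define X where "X = (\<lambda>k. \<Sum>p\<in>zeros_in_box q chi c (T k). of_nat (zmult q chi p) * ?h p)"
 have "(\<lambda>k. 2 * pi * \<i> * (X k - E_char q chi / z) - \<i> * (V (3/2) k - V c k)) \<longlonglongrightarrow> 0"
 proof (rule Lim_null_comparison)
  show "\<forall>\<^sub>F k in sequentially. norm (2 * pi * \<i> * (X k - E_char q chi / z) - \<i> * (V (3/2) k - V c k)) \<le> 2 * (3/2 - c) * B k"
   using rect unfolding ci X_def by (intro always_eventually allI)
  show "(\<lambda>k. 2 * (3/2 - c) * B k) \<longlonglongrightarrow> 0" by (rule tendsto_mult_right_zero[OF Blim])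
 qed
 moreover have "(\<lambda>k. V (3/2) k - - (2 * pi * S)) \<longlonglongrightarrow> 0" using Vb by (rule LIM_zero)
 ultimately have "(\<lambda>k. (2 * pi * \<i> * (X k - E_char q chi / z) - \<i> * (V (3/2) k - V c k)) + \<i> * (V (3/2) k - - (2 * pi * S))) \<longlonglongrightarrow> 0 + \<i> * 0"
  by (intro tendsto_add tendsto_mult tendsto_const)
 hence "(\<lambda>k. ((2 * pi * \<i> * (X k - E_char q chi / z) - \<i> * (V (3/2) k - V c k)) + \<i> * (V (3/2) k - - (2 * pi * S))) / (2 * pi * \<i>)) \<longlonglongrightarrow> (0 + \<i> * 0) / (2 * pi * \<i>)"
  by (rule tendsto_divide[OF _ tendsto_const]) simp
 moreover have "((2 * pi * \<i> * (X k - E_char q chi / z) - \<i> * (V (3/2) k - V c k)) + \<i> * (V (3/2) k - - (2 * pi * S))) / (2 * pi * \<i>)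
   = S - E_char q chi / z + X k + V c k / (2 * pi)" for k
  by (simp add: field_simps)
 ultimately have "(\<lambda>k. S - E_char q chi / z + X k + V c k / (2 * pi)) \<longlonglongrightarrow> (0 + \<i> * 0) / (2 * pi * \<i>)" by (simp only:)
 hence "(\<lambda>k. S - E_char q chi / z + X k + V c k / (2 * pi)) \<longlonglongrightarrow> 0" by simp
 thus ?thesis unfolding X_def V_def S_def f_def .
qed

section \<open>Mean squares of Mellin-type sums\<close>

lemma nn_integral_exp_abs:
 fixes a :: real
 assumes "a > 0"
 shows "(\<integral>\<^sup>+t. ennreal (exp (- a * \<bar>t\<bar>)) \<partial>lborel) = ennreal (2 / a)"
 using integrable_exp_abs[OF assms] by (subst nn_integral_eq_integral) auto

lemma nn_integral_inverse_power_decay: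
 "(\<integral>\<^sup>+v. ennreal ((1 + \<bar>v\<bar>) powr (-3/2)) \<partial>lborel) \<le> ennreal 4"
proof -
 let ?f = "\<lambda>v::real. (1 + \<bar>v\<bar>) powr (-3/2)"
 have half: "(\<integral>\<^sup>+v. ennreal (?f v) * indicator {0..} v \<partial>lborel) = ennreal (0 - (- 2 * (1 + \<bar>0::real\<bar>) powr (-1/2)))"
 proof -
  have "(\<integral>\<^sup>+v. ennreal (?f v) * indicator {0..} v \<partial>lborel) = (\<integral>\<^sup>+v. ennreal ((1 + v) powr (-3/2)) * indicator {0..} v \<partial>lborel)"
   by (intro nn_integral_cong) (auto simp: indicator_def)
  also have "\<dots> = ennreal (0 - (- 2 * (1 + 0) powr (-1/2)))"
  proof (rule nn_integral_FTC_atLeast)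
   show "DERIV (\<lambda>v. - 2 * (1 + v) powr (-1/2)) x :> (1 + x) powr (-3/2)" if "0 \<le> x" for x :: real
    using that by (auto intro!: derivative_eq_intros)
   show "((\<lambda>v::real. - 2 * (1 + v) powr (-1/2)) \<longlongrightarrow> 0) at_top" by real_asymp
  qed auto
  finally show ?thesis by simp
 qed
 have "(\<integral>\<^sup>+v. ennreal (?f v) \<partial>lborel) \<le> (\<integral>\<^sup>+v. ennreal (?f v) * indicator {0..} v + ennreal (?f v) * indicator {..0} v \<partial>lborel)"
  by (intro nn_integral_mono) (auto simp: indicator_def)
 also have "\<dots> = (\<integral>\<^sup>+v. ennreal (?f v) * indicator {0..} v \<partial>lborel) + (\<integral>\<^sup>+v. ennreal (?f v) * indicator {..0} v \<partial>lborel)"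
  by (rule nn_integral_add) auto
 also have "(\<integral>\<^sup>+v. ennreal (?f v) * indicator {..0} v \<partial>lborel) = (\<integral>\<^sup>+v. ennreal (?f v) * indicator {0..} v \<partial>lborel)"
  by (subst nn_integral_real_affine[where c = "-1" and t = 0]) (auto simp: indicator_def intro!: nn_integral_cong)
 finally show ?thesis unfolding half by (simp flip: ennreal_plus)
qed

text \<open>The weight vanishes at both ends, so the first integration by parts leaves no boundary
  term and the decay is 1 / \<delta>^2 instead of the 1 / |\<delta>| of a sharp cutoff. Such an
  integrable kernel is what makes Schur's test work.\<close>

lemma weighted_oscillatory_integral:
 fixes A B \<delta> :: real
 assumes AB: "0 < A" "A < B"
 shows "cmod (integral\<^sup>L lborel (\<lambda>x. indicator {A..B} x *\<^sub>R (complex_of_real ((x - A) * (B - x)) * exp (- (\<i> * \<delta> * complex_of_real (ln x))))))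
   \<le> 5 * B ^ 3 / (1 + \<delta>^2)"
proof -
 define a where "a = (\<lambda>k::nat. of_nat k - \<i> * complex_of_real \<delta>)"
 define q where "q = (\<lambda>w. exp (- (\<i> * complex_of_real \<delta> * Ln w)))"
 define p where "p = (\<lambda>(k::nat) w. w ^ k * q w)"
 \<comment> \<open>The primitive obtained by repeated integration by parts; differentiating x^(k - i
   \<delta>) produces the factor k - i \<delta>, which is \<open>a k\<close>. At the endpoints only
   the terms with at least two such denominators survive, and each of these is at least sqrt (1 +
   \<delta>^2) in modulus.\<close>
 define P where "P = (\<lambda>w::complex. (w - A) * (B - w) * p (Suc 0) w / a (Suc 0) - (A + B - 2 * w) * p 2 w / (a (Suc 0) * a 2) - 2 * p 3 w / (a (Suc 0) * a 2 * a 3))"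
 have anz: "a (Suc 0) \<noteq> 0" "a 2 \<noteq> 0" "a 3 \<noteq> 0" by (auto simp: a_def complex_eq_iff)
 have pd: "(p (Suc k) has_field_derivative a (Suc k) * p k w) (at w)" if "w \<notin> \<real>\<^sub>\<le>\<^sub>0" for k w
 proof -
  have w0: "w \<noteq> 0" using that by auto
  have "(q has_field_derivative - (\<i> * \<delta> / w) * q w) (at w)"
   unfolding q_def using that w0 by (auto intro!: derivative_eq_intros simp: field_simps)
  moreover have "((\<lambda>w. w ^ Suc k) has_field_derivative of_nat (Suc k) * w ^ k) (at w)"
   by (rule DERIV_cong[OF DERIV_power_Suc[OF DERIV_ident, where n = k]]) simp
  ultimately have "((\<lambda>w. w ^ Suc k * q w) has_field_derivative of_nat (Suc k) * w ^ k * q w + (- (\<i> * \<delta> / w) * q w) * w ^ Suc k) (at w)"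
   by (intro DERIV_mult)
  moreover have "of_nat (Suc k) * w ^ k * q w + (- (\<i> * \<delta> / w) * q w) * w ^ Suc k = a (Suc k) * p k w"
   unfolding a_def p_def using w0 by (simp add: field_simps)
  ultimately show ?thesis unfolding p_def by simp
 qed
 have pd': "(p (Suc 0) has_field_derivative a (Suc 0) * p 0 w) (at w)" "(p 2 has_field_derivative a 2 * p (Suc 0) w) (at w)"
   "(p 3 has_field_derivative a 3 * p 2 w) (at w)" if "w \<notin> \<real>\<^sub>\<le>\<^sub>0" for w
  using pd[OF that, of 0] pd[OF that, of 1] pd[OF that, of 2] by (simp_all add: numeral_2_eq_2 numeral_3_eq_3)
 have Pd: "(P has_field_derivative (w - A) * (B - w) * q w) (at w)" if w: "w \<notin> \<real>\<^sub>\<le>\<^sub>0" for w :: complex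
 proof -
  have "(P has_field_derivative (((w - A) * (B - w) * (a (Suc 0) * p 0 w) + ((w - A) * (-1) + (B - w)) * p (Suc 0) w) / a (Suc 0)
    - ((A + B - 2 * w) * (a 2 * p (Suc 0) w) + (- 2) * p 2 w) / (a (Suc 0) * a 2) - 2 * (a 3 * p 2 w) / (a (Suc 0) * a 2 * a 3))) (at w)"
   unfolding P_def using anz
   by (auto intro!: derivative_eq_intros pd'[OF w]) (auto simp: algebra_simps)?
  moreover have "((w - A) * (B - w) * (a (Suc 0) * p 0 w) + ((w - A) * (-1) + (B - w)) * p (Suc 0) w) / a (Suc 0)
    - ((A + B - 2 * w) * (a 2 * p (Suc 0) w) + (- 2) * p 2 w) / (a (Suc 0) * a 2) - 2 * (a 3 * p 2 w) / (a (Suc 0) * a 2 * a 3) = (w - A) * (B - w) * q w"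
   using anz unfolding p_def by (simp add: field_simps)
  ultimately show ?thesis by simp
 qed
 have nr: "complex_of_real x \<notin> \<real>\<^sub>\<le>\<^sub>0" if "x \<in> {A..B}" for x using that AB by (auto simp: complex_nonpos_Reals_iff)
 have qx: "q (complex_of_real x) = exp (- (\<i> * \<delta> * complex_of_real (ln x)))" if "x \<in> {A..B}" for x
  using that AB by (simp add: q_def Ln_of_real)
 have vd: "((\<lambda>x. P (complex_of_real x)) has_vector_derivative (x - A) * (B - x) * q x) (at x within S)" if "x \<in> {A..B}" for x :: real and S
  using has_vector_derivative_real_field[OF Pd[OF nr[OF that]]] by simp
 have cq: "continuous_on {A..B} (\<lambda>x. q (complex_of_real x))"
  unfolding q_def using nr by (intro continuous_intros continuous_on_Ln) auto
 have "integral\<^sup>L lborel (\<lambda>x. indicator {A..B} x *\<^sub>R (complex_of_real ((x - A) * (B - x)) * exp (- (\<i> * \<delta> * complex_of_real (ln x)))))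
   = integral\<^sup>L lborel (\<lambda>x::real. indicator {A..B} x *\<^sub>R ((x - A) * (B - x) * q x))"
  by (intro Bochner_Integration.integral_cong refl) (auto simp: indicator_def qx)
 also have "\<dots> = P B - P A"
  by (intro integral_FTC_atLeastAtMost vd continuous_intros cq) (use AB in auto)
 finally have eq: "integral\<^sup>L lborel (\<lambda>x. indicator {A..B} x *\<^sub>R (complex_of_real ((x - A) * (B - x)) * exp (- (\<i> * \<delta> * complex_of_real (ln x))))) = P B - P A" .
 have np: "cmod (p k (complex_of_real x)) = x ^ k" if "x \<in> {A..B}" for k x
  using that AB by (simp add: p_def norm_mult norm_power qx)
 have na: "cmod (a k) \<ge> sqrt (1 + \<delta>^2)" if "k \<ge> 1" for k
  using that unfolding a_def cmod_def by (auto intro!: real_sqrt_le_mono)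
 define Y where "Y = sqrt (1 + \<delta>^2)"
 have Y: "Y \<ge> 1" "Y * Y = 1 + \<delta>^2" by (auto simp: Y_def)
 have n12: "cmod (a (Suc 0) * a 2) \<ge> 1 + \<delta>^2"
  using mult_mono[OF na[of "Suc 0"] na[of 2]] Y unfolding Y_def by (simp add: norm_mult)
 have n3: "cmod (a 3) \<ge> 1" using na[of 3] Y(1) unfolding Y_def by linarith
 have n123: "cmod (a (Suc 0) * a 2 * a 3) \<ge> 1 + \<delta>^2"
  using mult_mono[OF n12 n3] by (simp add: norm_mult add_pos_nonneg)
 have d0: "1 + \<delta>^2 > 0" by (simp add: add_pos_nonneg)
 have PB: "P B = (B - A) * p 2 B / (a (Suc 0) * a 2) - 2 * p 3 B / (a (Suc 0) * a 2 * a 3)" unfolding P_def by (simp add: diff_divide_distrib add_divide_distrib algebra_simps)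
 have PA: "P A = - (B - A) * p 2 A / (a (Suc 0) * a 2) - 2 * p 3 A / (a (Suc 0) * a 2 * a 3)" unfolding P_def by (simp add: diff_divide_distrib add_divide_distrib algebra_simps)
 have f2: "cmod ((B - A) * p 2 x / (a (Suc 0) * a 2)) \<le> (B - A) * x^2 / (1 + \<delta>^2)" if "x \<in> {A..B}" for x :: real
 proof -
  have "cmod (complex_of_real (B - A)) = B - A" using AB by (simp only: norm_of_real)
  hence "cmod ((B - A) * p 2 x / (a (Suc 0) * a 2)) = (B - A) * x^2 / cmod (a (Suc 0) * a 2)" unfolding norm_divide norm_mult np[OF that] by simp
  thus ?thesis using n12 AB d0 by (auto intro!: divide_left_mono mult_pos_pos)
 qed
 have f3: "cmod (2 * p 3 x / (a (Suc 0) * a 2 * a 3)) \<le> 2 * x ^ 3 / (1 + \<delta>^2)" if "x \<in> {A..B}" for x :: real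
 proof -
  have "cmod (2 * p 3 x / (a (Suc 0) * a 2 * a 3)) = 2 * x ^ 3 / cmod (a (Suc 0) * a 2 * a 3)" using np[OF that, of 3] by (simp add: norm_divide norm_mult)
  thus ?thesis using n123 that AB d0 by (auto intro!: divide_left_mono mult_pos_pos)
 qed
 have AA: "A \<in> {A..B}" "B \<in> {A..B}" using AB by auto
 have t4: "norm ((u - v) - (- u' - v')) \<le> norm u + norm v + norm u' + norm v'" for u v u' v' :: complex
  by (smt (verit) norm_triangle_ineq norm_triangle_ineq4 norm_minus_cancel)
 have "cmod (P B - P A) \<le> (B - A) * B^2 / (1 + \<delta>^2) + 2 * B ^ 3 / (1 + \<delta>^2) + (B - A) * A^2 / (1 + \<delta>^2) + 2 * A ^ 3 / (1 + \<delta>^2)"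
  unfolding PA PB mult_minus_left minus_divide_left[symmetric] of_real_minus
  using t4[of "(B - A) * p 2 B / (a (Suc 0) * a 2)" "2 * p 3 B / (a (Suc 0) * a 2 * a 3)" "(B - A) * p 2 A / (a (Suc 0) * a 2)" "2 * p 3 A / (a (Suc 0) * a 2 * a 3)"]
   f2[OF AA(2)] f3[OF AA(2)] f2[OF AA(1)] f3[OF AA(1)] by linarith
 also have "\<dots> = ((B - A) * B^2 + 2 * B ^ 3 + (B - A) * A^2 + 2 * A ^ 3) / (1 + \<delta>^2)" by (simp add: add_divide_distrib)
 also have "\<dots> \<le> 5 * B ^ 3 / (1 + \<delta>^2)"
 proof (intro divide_right_mono)
  have "A ^ 3 \<le> B ^ 3" "A^2 * B \<le> B^2 * B" "0 \<le> A * B^2"using AB by (auto intro!: power_mono mult_right_mono)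
  moreover have "0 \<le> A ^ 3" using AB by simp
  moreover have "A * B^2 \<ge> A^2 * B" using AB by (simp add: power2_eq_square mult_left_mono mult_right_mono)
  ultimately show "(B - A) * B^2 + 2 * B ^ 3 + (B - A) * A^2 + 2 * A ^ 3 \<le> 5 * B ^ 3"
   by (simp add: algebra_simps power2_eq_square power3_eq_cube)
 qed (use d0 in simp)
 finally show ?thesis unfolding eq .
qed

lemma divide_le_self_nonneg: "0 \<le> x ==> 1 \<le> y ==> x / y \<le> x" for x y :: real
 by (simp add: divide_le_eq mult_le_cancel_left1)

text \<open>Expanding the square and integrating over x first leaves the kernel of
  \<open>weighted_oscillatory_integral\<close> at \<delta> = \<tau> t - \<tau> s. The measure is
  general so that the counting measure on zeros and Lebesgue measure on the line Re s = c are
  treated alike.\<close>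

lemma mellin_mean_square:
 fixes a :: "'b => complex" and \<tau> :: "'b => real"
 assumes M: "sigma_finite_measure M" and a: "integrable M a" and \<tau>[measurable]: "\<tau> \<in> borel_measurable M" and AB: "0 < A" "A < B"
 shows "(\<integral>\<^sup>+x. ennreal (indicator {A..B} x * ((x - A) * (B - x)) * (cmod (\<integral>t. a t * exp (- (\<i> * \<tau> t * complex_of_real (ln x))) \<partial>M))^2) \<partial>lborel)
   \<le> (\<integral>\<^sup>+t. \<integral>\<^sup>+s. ennreal (5 * B ^ 3 * (cmod (a t) * cmod (a s)) / (1 + (\<tau> t - \<tau> s)^2)) \<partial>M \<partial>M)"
proof -
 interpret M: sigma_finite_measure M by (rule M)
 interpret P: pair_sigma_finite M M ..
 interpret Q: pair_sigma_finite "M \<Otimes>\<^sub>M M" lborel ..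
 have am[measurable]: "a \<in> borel_measurable M" using a by simp
 define k where "k = (\<lambda>x::real. indicator {A..B} x * ((x - A) * (B - x)))"
 define g where "g = (\<lambda>p. a (fst p) * cnj (a (snd p)))"
 define F where "F = (\<lambda>x::real. \<integral>t. a t * exp (- (\<i> * \<tau> t * complex_of_real (ln x))) \<partial>M)"
 define E where "E = (\<lambda>p x. exp (- (\<i> * complex_of_real (\<tau> (fst p) - \<tau> (snd p)) * complex_of_real (ln x))))"
 define f where "f = (\<lambda>p x. g p * (complex_of_real (k x) * E p x))"
 have k0: "k x \<ge> 0" for x by (auto simp: k_def indicator_def)
 have km[measurable]: "k \<in> borel_measurable borel" unfolding k_def by measurable
 have "continuous_on {A..B} (\<lambda>x. (x - A) * (B - x))" by (intro continuous_intros)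
 hence ki: "integrable lborel k"
  unfolding k_def using borel_integrable_compact[of "{A..B}" "\<lambda>x. (x - A) * (B - x)"] by simp
 have [measurable]: "cnj \<in> borel_measurable borel"
  by (intro borel_measurable_continuous_onI continuous_intros)
 have gm[measurable]: "g \<in> borel_measurable (M \<Otimes>\<^sub>M M)" unfolding g_def by measurable
 have gi: "integrable (M \<Otimes>\<^sub>M M) g"
  by (rule P.Fubini_integrable) (use a in \<open>auto simp: g_def norm_mult\<close>)
 have nE: "cmod (E p x) = 1" for p x by (simp add: E_def)
 have fm[measurable]: "case_prod f \<in> borel_measurable ((M \<Otimes>\<^sub>M M) \<Otimes>\<^sub>M lborel)"
  unfolding f_def E_def by measurable
 have fi: "integrable ((M \<Otimes>\<^sub>M M) \<Otimes>\<^sub>M lborel) (case_prod f)"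
 proof (rule Q.Fubini_integrable[OF fm])
  show "integrable (M \<Otimes>\<^sub>M M) (\<lambda>p. \<integral>x. norm (case (p, x) of (p, x) => f p x) \<partial>lborel)"
   using gi ki by (simp add: f_def norm_mult nE k0)
  show "AE p in M \<Otimes>\<^sub>M M. integrable lborel (\<lambda>x. case (p, x) of (p, x) => f p x)"
  proof (rule AE_I2)
   fix p assume p: "p \<in> space (M \<Otimes>\<^sub>M M)"
   have [measurable]: "E p \<in> borel_measurable lborel" unfolding E_def by measurable
   show "integrable lborel (\<lambda>x. case (p, x) of (p, x) => f p x)"
    by (rule Bochner_Integration.integrable_bound[of _ "\<lambda>x. cmod (g p) * k x"]) (use ki k0 in \<open>auto simp: f_def norm_mult nE abs_mult\<close>)
  qed
 qed
 have FF: "complex_of_real (k x * (cmod (F x))^2) = (\<integral>p. f p x \<partial>(M \<Otimes>\<^sub>M M))" for x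
 proof -
  define h where "h = (\<lambda>p. g p * E p x)"
  have hm[measurable]: "h \<in> borel_measurable (M \<Otimes>\<^sub>M M)" unfolding h_def E_def by measurable
  have hi: "integrable (M \<Otimes>\<^sub>M M) h"
   by (rule Bochner_Integration.integrable_bound[OF gi hm]) (auto simp: h_def norm_mult nE)
  have he: "h (t, s) = (a t * exp (- (\<i> * \<tau> t * complex_of_real (ln x)))) * cnj (a s * exp (- (\<i> * \<tau> s * complex_of_real (ln x))))" for t s
   by (simp add: h_def g_def E_def exp_cnj algebra_simps flip: exp_add)
  have "(\<integral>p. h p \<partial>(M \<Otimes>\<^sub>M M)) = (\<integral>t. (\<integral>s. h (t, s) \<partial>M) \<partial>M)" by (rule P.integral_fst'[OF hi, symmetric])
  also have "\<dots> = F x * cnj (F x)" unfolding he F_def by (simp del: complex_cnj_mult)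
  also have "\<dots> = complex_of_real ((cmod (F x))^2)" by (rule complex_norm_square[symmetric])
  finally have "(\<integral>p. h p \<partial>(M \<Otimes>\<^sub>M M)) = complex_of_real ((cmod (F x))^2)" .
  moreover have "f p x = complex_of_real (k x) * h p" for p by (simp add: f_def h_def)
  ultimately show ?thesis by simp
 qed
 have ii: "integrable lborel (\<lambda>x. complex_of_real (k x * (cmod (F x))^2))"
  unfolding FF by (rule Q.integrable_snd[OF fi])
 hence ir: "integrable lborel (\<lambda>x. k x * (cmod (F x))^2)" by (simp only: complex_of_real_integrable_eq)
 have ip: "integrable (M \<Otimes>\<^sub>M M) (\<lambda>p. \<integral>x. f p x \<partial>lborel)" by (rule Q.integrable_fst[OF fi])
 define G where "G = (\<lambda>p. 5 * B ^ 3 * (cmod (a (fst p)) * cmod (a (snd p))) / (1 + (\<tau> (fst p) - \<tau> (snd p))^2))"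
 have Gm[measurable]: "G \<in> borel_measurable (M \<Otimes>\<^sub>M M)" unfolding G_def by measurable
 have d1: "1 + d^2 \<ge> 1" for d :: real by simp
 have G0: "G p \<ge> 0" for p unfolding G_def using AB by (auto intro!: divide_nonneg_nonneg add_nonneg_nonneg)
 have Gi: "integrable (M \<Otimes>\<^sub>M M) G"
 proof (rule Bochner_Integration.integrable_bound[of _ "\<lambda>p. 5 * B ^ 3 * cmod (g p)"])
  show "AE p in M \<Otimes>\<^sub>M M. norm (G p) \<le> norm (5 * B ^ 3 * cmod (g p))"
  proof (rule AE_I2)
   fix p
   have "G p \<le> 5 * B ^ 3 * cmod (g p)"
    unfolding G_def g_def norm_mult complex_mod_cnj using AB d1[of "\<tau> (fst p) - \<tau> (snd p)"]
    by (intro divide_le_self_nonneg) auto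
   thus "norm (G p) \<le> norm (5 * B ^ 3 * cmod (g p))" using G0[of p] AB by simp
  qed
 qed (use gi in auto)
 have bd: "cmod (\<integral>x. f p x \<partial>lborel) \<le> G p" for p
 proof -
  have "(\<integral>x. f p x \<partial>lborel) = g p * (\<integral>x. complex_of_real (k x) * E p x \<partial>lborel)" unfolding f_def by simp
  also have "(\<lambda>x. complex_of_real (k x) * E p x) = (\<lambda>x. indicator {A..B} x *\<^sub>R (complex_of_real ((x - A) * (B - x)) * exp (- (\<i> * (\<tau> (fst p) - \<tau> (snd p)) * complex_of_real (ln x)))))"
   by (auto simp: k_def E_def indicator_def)
  also have "cmod (g p * integral\<^sup>L lborel (\<lambda>x. indicator {A..B} x *\<^sub>R (complex_of_real ((x - A) * (B - x)) * exp (- (\<i> * (\<tau> (fst p) - \<tau> (snd p)) * complex_of_real (ln x))))))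
    \<le> cmod (g p) * (5 * B ^ 3 / (1 + (\<tau> (fst p) - \<tau> (snd p))^2))"
   unfolding norm_mult[of "g p"] by (intro mult_left_mono weighted_oscillatory_integral AB) auto
  also have "\<dots> = G p" by (simp add: G_def g_def norm_mult mult_ac)
  finally show ?thesis .
 qed
 have "complex_of_real (\<integral>x. k x * (cmod (F x))^2 \<partial>lborel) = (\<integral>x. (\<integral>p. f p x \<partial>(M \<Otimes>\<^sub>M M)) \<partial>lborel)"
  unfolding FF[symmetric] by (rule integral_complex_of_real[symmetric])
 also have "\<dots> = (\<integral>p. (\<integral>x. f p x \<partial>lborel) \<partial>(M \<Otimes>\<^sub>M M))" by (rule Q.Fubini_integral[OF fi])
 finally have eq: "complex_of_real (\<integral>x. k x * (cmod (F x))^2 \<partial>lborel) = (\<integral>p. (\<integral>x. f p x \<partial>lborel) \<partial>(M \<Otimes>\<^sub>M M))" .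
 have "(\<integral>x. k x * (cmod (F x))^2 \<partial>lborel) \<le> cmod (complex_of_real (\<integral>x. k x * (cmod (F x))^2 \<partial>lborel))" by simp
 also have "\<dots> \<le> (\<integral>p. G p \<partial>(M \<Otimes>\<^sub>M M))"
  unfolding eq by (rule order_trans[OF integral_norm_bound], intro integral_mono integrable_norm ip Gi bd)
 finally have le: "(\<integral>x. k x * (cmod (F x))^2 \<partial>lborel) \<le> (\<integral>p. G p \<partial>(M \<Otimes>\<^sub>M M))" .
 have "(\<integral>\<^sup>+x. ennreal (k x * (cmod (F x))^2) \<partial>lborel) = ennreal (\<integral>x. k x * (cmod (F x))^2 \<partial>lborel)"
  by (rule nn_integral_eq_integral[OF ir]) (use k0 in auto)
 also have "\<dots> \<le> ennreal (\<integral>p. G p \<partial>(M \<Otimes>\<^sub>M M))" by (rule ennreal_leI[OF le])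
 also have "\<dots> = (\<integral>\<^sup>+p. ennreal (G p) \<partial>(M \<Otimes>\<^sub>M M))"
  by (rule nn_integral_eq_integral[OF Gi, symmetric]) (use G0 in auto)
 also have "\<dots> = (\<integral>\<^sup>+t. \<integral>\<^sup>+s. ennreal (G (t, s)) \<partial>M \<partial>M)" by (rule M.nn_integral_fst[symmetric]) simp
 finally show ?thesis by (simp add: k_def F_def G_def)
qed

text \<open>Since 2 b(t) b(s) \<le> b(t)^2 + b(s)^2 and the kernel is symmetric, one of the two
  integrations runs over the kernel against m alone, and this is the row sum \<open>K\<close>. In
  the applications m is the multiplicity of a zero or \<open>log_cond\<close>, while b carries the
  exponential decay.\<close>

lemma mellin_Schur:
 fixes a :: "'b => complex" and \<tau> m b K :: "'b => real"
 assumes M: "sigma_finite_measure M" and a: "integrable M a" and [measurable]: "\<tau> \<in> borel_measurable M" and AB: "0 < A" "A < B"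
  and [measurable]: "m \<in> borel_measurable M" "b \<in> borel_measurable M" "K \<in> borel_measurable M"
  and m: "\<And>t. m t \<ge> 0" and ab: "\<And>t. t \<in> space M ==> cmod (a t) \<le> m t * b t"
  and K: "\<And>t. t \<in> space M ==> (\<integral>\<^sup>+s. ennreal (m s / (1 + (\<tau> t - \<tau> s)^2)) \<partial>M) \<le> ennreal (K t)" "\<And>t. K t \<ge> 0"
 shows "(\<integral>\<^sup>+x. ennreal (indicator {A..B} x * ((x - A) * (B - x)) * (cmod (\<integral>t. a t * exp (- (\<i> * \<tau> t * complex_of_real (ln x))) \<partial>M))^2) \<partial>lborel)
   \<le> (\<integral>\<^sup>+t. ennreal (5 * B ^ 3 * (m t * (b t)^2 * K t)) \<partial>M)"
proof -
 interpret M: sigma_finite_measure M by (rule M)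
 interpret P: pair_sigma_finite M M ..
 have [measurable]: "a \<in> borel_measurable M" using a by simp
 define c where "c = 5 * B ^ 3 / 2"
 have c: "c \<ge> 0" using AB by (simp add: c_def)
 define U where "U = (\<lambda>t s. ennreal (c * (m t * (b t)^2)) * ennreal (m s / (1 + (\<tau> t - \<tau> s)^2)))"
 have Um[measurable]: "case_prod U \<in> borel_measurable (M \<Otimes>\<^sub>M M)" unfolding U_def by measurable
 have d1: "1 + d^2 > 0" for d :: real by (simp add: add_pos_nonneg)
 have pt: "ennreal (5 * B ^ 3 * (cmod (a t) * cmod (a s)) / (1 + (\<tau> t - \<tau> s)^2)) \<le> U t s + U s t" if ts: "t \<in> space M" "s \<in> space M" for t s
 proof -
  have "cmod (a t) * cmod (a s) \<le> (m t * b t) * (m s * b s)"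
   using ab[OF ts(1)] ab[OF ts(2)] order_trans[OF norm_ge_zero ab[OF ts(1)]] by (intro mult_mono) auto
  also have "\<dots> = (m t * m s) * (b t * b s)" by simp
  also have "\<dots> \<le> (m t * m s) * (((b t)^2 + (b s)^2) / 2)"
   using m[of t] m[of s] sum_squares_bound[of "b t" "b s"] by (intro mult_left_mono) auto
  finally have "5 * B ^ 3 * (cmod (a t) * cmod (a s)) / (1 + (\<tau> t - \<tau> s)^2) \<le> 5 * B ^ 3 * ((m t * m s) * (((b t)^2 + (b s)^2) / 2)) / (1 + (\<tau> t - \<tau> s)^2)"
   using AB d1[of "\<tau> t - \<tau> s"] by (intro divide_right_mono mult_left_mono) auto
  also have "\<dots> = (c * (m t * (b t)^2)) * (m s / (1 + (\<tau> t - \<tau> s)^2)) + (c * (m s * (b s)^2)) * (m t / (1 + (\<tau> s - \<tau> t)^2))"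
   unfolding c_def power2_commute[of "\<tau> s" "\<tau> t"] by (simp add: algebra_simps add_divide_distrib)
  finally have "ennreal (5 * B ^ 3 * (cmod (a t) * cmod (a s)) / (1 + (\<tau> t - \<tau> s)^2)) \<le> ennreal \<dots>" by (rule ennreal_leI)
  also have "\<dots> = ennreal ((c * (m t * (b t)^2)) * (m s / (1 + (\<tau> t - \<tau> s)^2))) + ennreal ((c * (m s * (b s)^2)) * (m t / (1 + (\<tau> s - \<tau> t)^2)))"
   using c m d1 by (intro ennreal_plus mult_nonneg_nonneg divide_nonneg_nonneg) (auto intro: less_imp_le)
  also have "\<dots> = U t s + U s t" unfolding U_def using c m d1
   by (intro arg_cong2[where f = "(+)"] ennreal_mult mult_nonneg_nonneg divide_nonneg_nonneg) (auto intro: less_imp_le)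
  finally show ?thesis .
 qed
 have Ub: "(\<integral>\<^sup>+t. \<integral>\<^sup>+s. U t s \<partial>M \<partial>M) \<le> (\<integral>\<^sup>+t. ennreal (c * (m t * (b t)^2) * K t) \<partial>M)"
 proof (intro nn_integral_mono)
  fix t assume t: "t \<in> space M"
  have "(\<integral>\<^sup>+s. U t s \<partial>M) = ennreal (c * (m t * (b t)^2)) * (\<integral>\<^sup>+s. ennreal (m s / (1 + (\<tau> t - \<tau> s)^2)) \<partial>M)"
   unfolding U_def by (rule nn_integral_cmult) simp
  also have "\<dots> \<le> ennreal (c * (m t * (b t)^2)) * ennreal (K t)" by (intro mult_left_mono K(1) t) auto
  also have "\<dots> = ennreal (c * (m t * (b t)^2) * K t)" using c m[of t] K(2) by (simp add: ennreal_mult)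
  finally show "(\<integral>\<^sup>+s. U t s \<partial>M) \<le> ennreal (c * (m t * (b t)^2) * K t)" .
 qed
 have "(\<integral>\<^sup>+t. \<integral>\<^sup>+s. ennreal (5 * B ^ 3 * (cmod (a t) * cmod (a s)) / (1 + (\<tau> t - \<tau> s)^2)) \<partial>M \<partial>M)
   \<le> (\<integral>\<^sup>+t. \<integral>\<^sup>+s. U t s + U s t \<partial>M \<partial>M)" by (intro nn_integral_mono pt)
 also have "\<dots> = (\<integral>\<^sup>+t. (\<integral>\<^sup>+s. U t s \<partial>M) + (\<integral>\<^sup>+s. U s t \<partial>M) \<partial>M)"
  by (intro nn_integral_cong nn_integral_add) (auto simp: U_def)
 also have "\<dots> = (\<integral>\<^sup>+t. \<integral>\<^sup>+s. U t s \<partial>M \<partial>M) + (\<integral>\<^sup>+t. \<integral>\<^sup>+s. U s t \<partial>M \<partial>M)"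
  by (intro nn_integral_add) (auto simp: U_def)
 also have "(\<integral>\<^sup>+t. \<integral>\<^sup>+s. U s t \<partial>M \<partial>M) = (\<integral>\<^sup>+t. \<integral>\<^sup>+s. U t s \<partial>M \<partial>M)"
  by (rule P.Fubini'[OF Um])
 finally have "(\<integral>\<^sup>+t. \<integral>\<^sup>+s. ennreal (5 * B ^ 3 * (cmod (a t) * cmod (a s)) / (1 + (\<tau> t - \<tau> s)^2)) \<partial>M \<partial>M)
   \<le> 2 * (\<integral>\<^sup>+t. \<integral>\<^sup>+s. U t s \<partial>M \<partial>M)" by (simp add: mult_2)
 also have "\<dots> \<le> 2 * (\<integral>\<^sup>+t. ennreal (c * (m t * (b t)^2) * K t) \<partial>M)" by (intro mult_left_mono Ub) simp
 also have "\<dots> = (\<integral>\<^sup>+t. ennreal (5 * B ^ 3 * (m t * (b t)^2 * K t)) \<partial>M)"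
  using c m K(2) unfolding c_def
  by (subst nn_integral_cmult[symmetric]) (auto intro!: nn_integral_cong simp: mult_ac simp flip: ennreal_mult' ennreal_numeral)
 finally show ?thesis using mellin_mean_square[OF M a _ AB, of \<tau>] by simp
qed

section \<open>Sums over the critical zeros\<close>

definition critical_zeros :: "nat => (nat => complex) => complex set" where
 "critical_zeros q chi = {z. Re z = 1/2 \<and> Lreg q chi z = 0}"

text \<open>Written with indicators in t so that it can be integrated over t for a fixed finite set
  of zeros.\<close>

lemma critical_zeros_unit_count:
 "\<exists>C>0. \<forall>q chi t Z. dirichlet_character q chi --> finite Z --> Z \<subseteq> critical_zeros q chi -->
   (\<Sum>z\<in>Z. real (zmult q chi z) * indicator {Im z - 1..Im z + 1} t) \<le> C * log_cond q t"
proof -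
 obtain C where C: "C > 0" "\<And>q chi t. dirichlet_character q chi ==> finite (zeros_near q chi t)"
   "\<And>q chi t. dirichlet_character q chi ==> real (\<Sum>z\<in>zeros_near q chi t. zmult q chi z) \<le> C * log_cond q t"
  using Lreg_local_zeros by blast
 have "(\<Sum>z\<in>Z. real (zmult q chi z) * indicator {Im z - 1..Im z + 1} t) \<le> C * log_cond q t"
  if chi: "dirichlet_character q chi" and Z: "finite Z" "Z \<subseteq> critical_zeros q chi" for q chi t Z
 proof -
  have near: "z \<in> zeros_near q chi t" if z: "z \<in> Z" "t \<in> {Im z - 1..Im z + 1}" for z
  proof -
   have "(Im z - t)^2 \<le> 1" using z(2) by (auto simp: abs_le_iff intro!: abs_square_le_1[THEN iffD2])
   moreover have z': "Re z = 1/2" "Lreg q chi z = 0" using z(1) Z(2) by (auto simp: critical_zeros_def)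
   ultimately have "(2 - Re z)^2 + (t - Im z)^2 \<le> (15/8)^2" unfolding z'(1) power2_commute[of t] by (simp add: power2_eq_square)
   hence "cmod (Complex 2 t - z) \<le> 15/8" unfolding cmod_def by (intro real_le_lsqrt) auto
   thus ?thesis using z'(2) by (simp add: zeros_near_def dist_norm)
  qed
  have "(\<Sum>z\<in>Z. real (zmult q chi z) * indicator {Im z - 1..Im z + 1} t) = (\<Sum>z\<in>{z\<in>Z. t \<in> {Im z - 1..Im z + 1}}. real (zmult q chi z))"
   using Z(1) by (intro sum.mono_neutral_cong_right) (auto simp: indicator_def)
  also have "\<dots> \<le> (\<Sum>z\<in>zeros_near q chi t. real (zmult q chi z))"
   using near by (intro sum_mono2 C(2)[OF chi]) auto
  also have "\<dots> \<le> C * log_cond q t" using C(3)[OF chi, of t] by simp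
  finally show ?thesis .
 qed
 thus ?thesis using C(1) by blast
qed

text \<open>Each zero is spread over the interval of radius 1 about its ordinate, on which f changes
  at most by the factor D. At a point t only O(\<open>log_cond q t\<close>) of these intervals
  overlap, counted with multiplicity. This takes the place of partial summation with a counting
  function.\<close>

lemma critical_zero_sum_le_integral:
 "\<exists>C>0. \<forall>q chi Z f D. dirichlet_character q chi --> finite Z --> Z \<subseteq> critical_zeros q chi -->
   f \<in> borel_measurable borel --> (\<forall>t. f t \<ge> 0) --> D \<ge> 0 --> (\<forall>u v. \<bar>u - v\<bar> \<le> 1 --> f u \<le> D * f v) -->
   ennreal (\<Sum>z\<in>Z. real (zmult q chi z) * f (Im z)) \<le> ennreal (C * D) * (\<integral>\<^sup>+t. ennreal (f t * log_cond q t) \<partial>lborel)"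
proof -
 obtain C where C: "C > 0" and count: "\<And>q chi t Z. dirichlet_character q chi ==> finite Z ==> Z \<subseteq> critical_zeros q chi ==>
   (\<Sum>z\<in>Z. real (zmult q chi z) * indicator {Im z - 1..Im z + 1} t) \<le> C * log_cond q t"
  using critical_zeros_unit_count by blast
 have "ennreal (\<Sum>z\<in>Z. real (zmult q chi z) * f (Im z)) \<le> ennreal (C * D) * (\<integral>\<^sup>+t. ennreal (f t * log_cond q t) \<partial>lborel)"
  if chi: "dirichlet_character q chi" and Z: "finite Z" "Z \<subseteq> critical_zeros q chi"
   and fm[measurable]: "f \<in> borel_measurable borel" and f0: "\<forall>t. f t \<ge> 0" and D: "D \<ge> 0" and fD: "\<forall>u v. \<bar>u - v\<bar> \<le> 1 --> f u \<le> D * f v"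
  for q chi Z f D
 proof -
  have q: "q > 0" using chi by (simp add: dirichlet_character_def)
  have [measurable]: "log_cond q \<in> borel_measurable borel" unfolding log_cond_def[abs_def] by measurable
  have one: "ennreal (real (zmult q chi z) * f (Im z)) \<le> (\<integral>\<^sup>+t. ennreal (D * f t * (real (zmult q chi z) * indicator {Im z - 1..Im z + 1} t)) \<partial>lborel)" (is "_ \<le> ?I") for z
  proof -
   let ?c = "real (zmult q chi z) * f (Im z)"
   have "ennreal ?c \<le> ennreal ?c * emeasure lborel {Im z - 1..Im z + 1}"
    using mult_left_mono[of 1 "2 :: ennreal" "ennreal ?c"] by simp
   also have "\<dots> = (\<integral>\<^sup>+t. ennreal ?c * indicator {Im z - 1..Im z + 1} t \<partial>lborel)" by (rule nn_integral_cmult_indicator[symmetric]) simp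
   also have "\<dots> \<le> ?I"
   proof (intro nn_integral_mono)
    fix t :: real
    have "?c \<le> D * f t * (real (zmult q chi z) * indicator {Im z - 1..Im z + 1} t)" if "t \<in> {Im z - 1..Im z + 1}"
    proof -
     have "f (Im z) \<le> D * f t" using fD that by (auto simp: abs_le_iff)
     thus ?thesis using that by (simp add: mult.commute mult_right_mono)
    qed
    thus "ennreal ?c * indicator {Im z - 1..Im z + 1} t \<le> ennreal (D * f t * (real (zmult q chi z) * indicator {Im z - 1..Im z + 1} t))"
     by (cases "t \<in> {Im z - 1..Im z + 1}") (simp_all add: ennreal_leI)
   qed
   finally show ?thesis .
  qed
  have "ennreal (\<Sum>z\<in>Z. real (zmult q chi z) * f (Im z)) = (\<Sum>z\<in>Z. ennreal (real (zmult q chi z) * f (Im z)))"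
   using f0 by (intro sum_ennreal[symmetric]) auto
  also have "\<dots> \<le> (\<Sum>z\<in>Z. \<integral>\<^sup>+t. ennreal (D * f t * (real (zmult q chi z) * indicator {Im z - 1..Im z + 1} t)) \<partial>lborel)"
   by (intro sum_mono one)
  also have "\<dots> = (\<integral>\<^sup>+t. (\<Sum>z\<in>Z. ennreal (D * f t * (real (zmult q chi z) * indicator {Im z - 1..Im z + 1} t))) \<partial>lborel)"
   by (rule nn_integral_sum[symmetric]) measurable
  also have "\<dots> \<le> (\<integral>\<^sup>+t. ennreal (C * D) * ennreal (f t * log_cond q t) \<partial>lborel)"
  proof (intro nn_integral_mono)
   fix t :: real
   have l0: "0 \<le> log_cond q t" using log_cond_ge[OF q, of t] by linarith
   have "(\<Sum>z\<in>Z. ennreal (D * f t * (real (zmult q chi z) * indicator {Im z - 1..Im z + 1} t)))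
     = ennreal (D * f t * (\<Sum>z\<in>Z. real (zmult q chi z) * indicator {Im z - 1..Im z + 1} t))"
    using f0 D by (subst sum_ennreal) (auto simp: sum_distrib_left)
   also have "\<dots> \<le> ennreal (D * f t * (C * log_cond q t))"
    using f0 D count[OF chi Z, of t] by (intro ennreal_leI mult_left_mono) auto
   also have "\<dots> = ennreal (C * D) * ennreal (f t * log_cond q t)"
    using f0 D C l0 by (subst ennreal_mult[symmetric]) (auto simp: mult_ac)
   finally show "(\<Sum>z\<in>Z. ennreal (D * f t * (real (zmult q chi z) * indicator {Im z - 1..Im z + 1} t))) \<le> ennreal (C * D) * ennreal (f t * log_cond q t)" .
  qed
  also have "\<dots> = ennreal (C * D) * (\<integral>\<^sup>+t. ennreal (f t * log_cond q t) \<partial>lborel)" by (rule nn_integral_cmult) measurable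
  finally show ?thesis .
 qed
 thus ?thesis using C by blast
qed

text \<open>The logarithm turns a ratio of arguments into an additive term, and
  \<open>log_cond\<close> \<ge> 1/2 turns that into a factor. The first factor grows like a square
  root, slowly enough to be integrated against 1 / (1 + v^2); the third measures t on the scale X of
  an exponential weight.\<close>

lemma log_cond_shift_le:
 assumes "q > 0"
 shows "log_cond q t \<le> log_cond q u * (1 + 4 * sqrt \<bar>t - u\<bar>)"
  and "\<bar>t - u\<bar> \<le> 1 ==> log_cond q t \<le> 2 * log_cond q u"
  and "X > 0 ==> log_cond q t \<le> log_cond q X * (1 + 2 * (\<bar>t\<bar> / X))"
proof -
 have q1: "real q \<ge> 1" using assms by linarith
 have split: "log_cond q t \<le> log_cond q s + ln y" if "\<bar>t\<bar> + 2 \<le> (\<bar>s\<bar> + 2) * y" "y > 0" for s y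
 proof -
  have "real q * (\<bar>t\<bar> + 2) \<le> (real q * (\<bar>s\<bar> + 2)) * y" using mult_left_mono[OF that(1), of "real q"] by (simp add: mult_ac)
  hence "ln (real q * (\<bar>t\<bar> + 2)) \<le> ln ((real q * (\<bar>s\<bar> + 2)) * y)" using q1 by (intro ln_mono) (auto intro!: mult_pos_pos)
  also have "\<dots> = ln (real q * (\<bar>s\<bar> + 2)) + ln y" using q1 that(2) by (intro ln_mult_pos) (auto intro!: mult_pos_pos)
  finally show ?thesis by (simp add: log_cond_def)
 qed
 have l: "log_cond q s \<ge> 1/2" for s by (rule log_cond_ge[OF assms])
 {
  have "\<bar>t\<bar> + 2 \<le> (\<bar>u\<bar> + 2) * (1 + \<bar>t - u\<bar>)"
  proof -
   have "0 \<le> \<bar>u\<bar> * \<bar>t - u\<bar>" by simp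
   thus ?thesis using abs_triangle_ineq2[of t u] abs_ge_zero[of "t - u"] unfolding distrib_left distrib_right by linarith
  qed
  hence "log_cond q t \<le> log_cond q u + ln (1 + \<bar>t - u\<bar>)" by (rule split) simp
  also have "ln (1 + \<bar>t - u\<bar>) \<le> ln ((1 + sqrt \<bar>t - u\<bar>)^2)"
   by (intro ln_mono) (auto simp: power2_eq_square algebra_simps add_pos_nonneg)
  also have "\<dots> = 2 * ln (1 + sqrt \<bar>t - u\<bar>)" by (subst ln_realpow) (auto simp: add_pos_nonneg)
  also have "ln (1 + sqrt \<bar>t - u\<bar>) \<le> sqrt \<bar>t - u\<bar>" by (intro ln_add_one_self_le_self) simp
  finally have "log_cond q t \<le> log_cond q u + 2 * sqrt \<bar>t - u\<bar>" by simp
  also have "\<dots> \<le> log_cond q u * (1 + 4 * sqrt \<bar>t - u\<bar>)"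
   using mult_right_mono[OF l[of u], of "4 * sqrt \<bar>t - u\<bar>"] by (simp add: algebra_simps)
  finally show "log_cond q t \<le> log_cond q u * (1 + 4 * sqrt \<bar>t - u\<bar>)" .
 }
 {
  assume "\<bar>t - u\<bar> \<le> 1"
  hence "\<bar>t\<bar> + 2 \<le> (\<bar>u\<bar> + 2) * (3/2)" by (simp add: algebra_simps)
  hence "log_cond q t \<le> log_cond q u + ln (3/2)" by (rule split) simp
  also have "ln (3/2) \<le> (1/2::real)" using ln_add_one_self_le_self[of "1/2"] by simp
  finally show "log_cond q t \<le> 2 * log_cond q u" using l[of u] by simp
 }
 {
  assume X: "X > 0"
  hence "\<bar>t\<bar> + 2 \<le> (\<bar>X\<bar> + 2) * (1 + \<bar>t\<bar> / X)" by (simp add: field_simps)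
  hence "log_cond q t \<le> log_cond q X + ln (1 + \<bar>t\<bar> / X)" using X by (intro split) (auto simp: add_pos_nonneg)
  also have "ln (1 + \<bar>t\<bar> / X) \<le> \<bar>t\<bar> / X" using X by (intro ln_add_one_self_le_self) simp
  finally have "log_cond q t \<le> log_cond q X + \<bar>t\<bar> / X" by simp
  also have "\<dots> \<le> log_cond q X * (1 + 2 * (\<bar>t\<bar> / X))"
   using mult_right_mono[OF l[of X], of "2 * (\<bar>t\<bar> / X)"] X by (simp add: algebra_simps)
  finally show "log_cond q t \<le> log_cond q X * (1 + 2 * (\<bar>t\<bar> / X))" .
 }
qed

lemma nn_integral_log_cond_kernel:
 assumes "q > 0"
 shows "(\<integral>\<^sup>+t. ennreal (1 / (1 + (u - t)^2) * log_cond q t) \<partial>lborel) \<le> ennreal (40 * log_cond q u)"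
proof -
 have l: "log_cond q s \<ge> 1/2" for s by (rule log_cond_ge[OF assms])
 \<comment> \<open>1 / (1 + v^2) is of the order of (1 + |v|)^(-2), so a factor of order |v|^(1/2)
   leaves the exponent -3/2. The factor 10 is 5 from 1 + 4 y \<le> 5 y times 2 from (1 + |v|)^2
   \<le> 2 (1 + v^2).\<close>
 have pt: "1 / (1 + v^2) * (1 + 4 * sqrt \<bar>v\<bar>) \<le> 10 * (1 + \<bar>v\<bar>) powr (-3/2)" for v :: real
 proof -
  define y where "y = sqrt (1 + \<bar>v\<bar>)"
  have y: "y \<ge> 1" "y * y = 1 + \<bar>v\<bar>" by (auto simp: y_def)
  have sy: "sqrt \<bar>v\<bar> \<le> y" by (simp add: y_def)
  have pw: "(1 + \<bar>v\<bar>) powr (-3/2) = 1 / y ^ 3"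
  proof -
   have "y ^ 3 = ((1 + \<bar>v\<bar>) powr (1/2)) ^ 3" by (simp add: y_def powr_half_sqrt)
   also have "\<dots> = (1 + \<bar>v\<bar>) powr (3/2)" by (subst powr_power) auto
   finally show ?thesis by (simp add: powr_minus_divide)
  qed
  have "(1 + 4 * sqrt \<bar>v\<bar>) * y ^ 3 \<le> 5 * y * y ^ 3" using sy y(1) by (intro mult_right_mono) auto
  also have "\<dots> = 5 * (1 + \<bar>v\<bar>)^2" unfolding y(2)[symmetric] by (simp add: power2_eq_square power3_eq_cube)
  also have "\<dots> \<le> 10 * (1 + v^2)" using sum_squares_bound[of 1 "\<bar>v\<bar>"] by (simp add: power2_eq_square algebra_simps)
  finally have "(1 + 4 * sqrt \<bar>v\<bar>) * y ^ 3 \<le> 10 * (1 + v^2)" .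
  moreover have "1 + v^2 > 0" "y ^ 3 > 0" using y(1) by (auto simp: add_pos_nonneg)
  ultimately show ?thesis unfolding pw by (simp add: divide_simps mult.commute)
 qed
 have "(\<integral>\<^sup>+t. ennreal (1 / (1 + (u - t)^2) * log_cond q t) \<partial>lborel)
   \<le> (\<integral>\<^sup>+t. ennreal (10 * log_cond q u) * ennreal ((1 + \<bar>- u + t\<bar>) powr (-3/2)) \<partial>lborel)"
 proof (intro nn_integral_mono)
  fix t :: real
  have "1 / (1 + (u - t)^2) * log_cond q t \<le> 1 / (1 + (u - t)^2) * (log_cond q u * (1 + 4 * sqrt \<bar>t - u\<bar>))"
   by (intro mult_left_mono log_cond_shift_le[OF assms]) (simp add: add_nonneg_nonneg)
  also have "\<dots> = log_cond q u * (1 / (1 + (t - u)^2) * (1 + 4 * sqrt \<bar>t - u\<bar>))" by (simp add: power2_commute[of u])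
  also have "\<dots> \<le> log_cond q u * (10 * (1 + \<bar>t - u\<bar>) powr (-3/2))" using l[of u] by (intro mult_left_mono pt) linarith
  finally have "ennreal (1 / (1 + (u - t)^2) * log_cond q t) \<le> ennreal ((10 * log_cond q u) * (1 + \<bar>- u + t\<bar>) powr (-3/2))"
   by (intro ennreal_leI) (simp add: mult_ac)
  also have "\<dots> = ennreal (10 * log_cond q u) * ennreal ((1 + \<bar>- u + t\<bar>) powr (-3/2))" by (rule ennreal_mult'') simp
  finally show "ennreal (1 / (1 + (u - t)^2) * log_cond q t) \<le> ennreal (10 * log_cond q u) * ennreal ((1 + \<bar>- u + t\<bar>) powr (-3/2))" .
 qed
 also have "\<dots> = ennreal (10 * log_cond q u) * (\<integral>\<^sup>+t. ennreal ((1 + \<bar>- u + t\<bar>) powr (-3/2)) \<partial>lborel)"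
  by (rule nn_integral_cmult) measurable
 also have "(\<integral>\<^sup>+t. ennreal ((1 + \<bar>- u + t\<bar>) powr (-3/2)) \<partial>lborel) = (\<integral>\<^sup>+t. ennreal ((1 + \<bar>t\<bar>) powr (-3/2)) \<partial>lborel)"
  using nn_integral_real_affine[of "\<lambda>t. ennreal ((1 + \<bar>t\<bar>) powr (-3/2))" 1 "- u"] by simp
 also have "ennreal (10 * log_cond q u) * \<dots> \<le> ennreal (10 * log_cond q u) * ennreal 4"
  by (intro mult_left_mono nn_integral_inverse_power_decay) simp
 also have "\<dots> = ennreal (40 * log_cond q u)" using l[of u] by (subst ennreal_mult''[symmetric]) auto
 finally show ?thesis .
qed

text \<open>Half of the exponential decay absorbs the growth of the squared logarithm, by 1 + 2 y
  \<le> 4 exp (y/2) at y = |t| / X. The other half has integral 2 X, and 32 = 16 * 2.\<close>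

lemma nn_integral_exp_log_cond:
 assumes "q > 0" "X > 0"
 shows "(\<integral>\<^sup>+t. ennreal (exp (- (2 / X) * \<bar>t\<bar>) * (log_cond q t)^2) \<partial>lborel) \<le> ennreal (32 * X * (log_cond q X)^2)"
proof -
 have l: "log_cond q s \<ge> 1/2" for s by (rule log_cond_ge[OF assms(1)])
 have "(\<integral>\<^sup>+t. ennreal (exp (- (2 / X) * \<bar>t\<bar>) * (log_cond q t)^2) \<partial>lborel)
   \<le> (\<integral>\<^sup>+t. ennreal (16 * (log_cond q X)^2) * ennreal (exp (- (1 / X) * \<bar>t\<bar>)) \<partial>lborel)"
 proof (intro nn_integral_mono)
  fix t :: real
  define y where "y = \<bar>t\<bar> / X"
  have y0: "y \<ge> 0" using assms by (simp add: y_def)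
  have "log_cond q t \<le> log_cond q X * (1 + 2 * y)" unfolding y_def by (rule log_cond_shift_le(3)[OF assms])
  also have "\<dots> \<le> log_cond q X * (4 * exp (y / 2))"
   using exp_ge_add_one_self[of "y/2"] y0 l[of X] by (intro mult_left_mono) linarith+
  finally have "(log_cond q t)^2 \<le> (log_cond q X * (4 * exp (y / 2)))^2" using l[of t] by (intro power_mono) linarith+
  also have "\<dots> = 16 * (log_cond q X)^2 * exp y" by (simp add: power_mult_distrib flip: exp_double)
  finally have "exp (- 2 * y) * (log_cond q t)^2 \<le> exp (- 2 * y) * (16 * (log_cond q X)^2 * exp y)" by (rule mult_left_mono) simp
  also have "\<dots> = 16 * (log_cond q X)^2 * exp (- y)" by (simp add: mult_ac flip: exp_add)
  finally have "exp (- (2 / X) * \<bar>t\<bar>) * (log_cond q t)^2 \<le> 16 * (log_cond q X)^2 * exp (- (1 / X) * \<bar>t\<bar>)" by (simp add: y_def)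
  hence "ennreal (exp (- (2 / X) * \<bar>t\<bar>) * (log_cond q t)^2) \<le> ennreal (16 * (log_cond q X)^2 * exp (- (1 / X) * \<bar>t\<bar>))"
   by (rule ennreal_leI)
  also have "\<dots> = ennreal (16 * (log_cond q X)^2) * ennreal (exp (- (1 / X) * \<bar>t\<bar>))" by (rule ennreal_mult'') simp
  finally show "ennreal (exp (- (2 / X) * \<bar>t\<bar>) * (log_cond q t)^2) \<le> ennreal (16 * (log_cond q X)^2) * ennreal (exp (- (1 / X) * \<bar>t\<bar>))" .
 qed
 also have "\<dots> = ennreal (16 * (log_cond q X)^2) * (\<integral>\<^sup>+t. ennreal (exp (- (1 / X) * \<bar>t\<bar>)) \<partial>lborel)"
  by (rule nn_integral_cmult) measurable
 also have "(\<integral>\<^sup>+t. ennreal (exp (- (1 / X) * \<bar>t\<bar>)) \<partial>lborel) = ennreal (2 / (1 / X))"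
  by (rule nn_integral_exp_abs) (use assms in simp)
 also have "ennreal (16 * (log_cond q X)^2) * \<dots> = ennreal (32 * X * (log_cond q X)^2)"
  using assms by (subst ennreal_mult''[symmetric]) (auto simp: mult_ac)
 finally show ?thesis .
qed

text \<open>These are the two inputs of Schur's test on zeros. The row sums of the kernel cost one
  logarithm; the zeros up to height about X, weighted with that row bound, then amount to X times
  two logarithms.\<close>

lemma critical_zero_sums:
 "\<exists>C>0. \<forall>q chi Z. dirichlet_character q chi --> finite Z --> Z \<subseteq> critical_zeros q chi -->
   (\<forall>u. (\<Sum>z\<in>Z. real (zmult q chi z) * (1 / (1 + (u - Im z)^2))) \<le> C * log_cond q u) \<and>
   (\<forall>X\<ge>1. (\<Sum>z\<in>Z. real (zmult q chi z) * (exp (- (2 / X) * \<bar>Im z\<bar>) * log_cond q (Im z))) \<le> C * X * (log_cond q X)^2)"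
proof -
 obtain C where C: "C > 0" and main: "\<And>q chi Z f D. dirichlet_character q chi ==> finite Z ==> Z \<subseteq> critical_zeros q chi ==>
   f \<in> borel_measurable borel ==> (\<forall>t. f t \<ge> 0) ==> D \<ge> 0 ==> (\<forall>u v. \<bar>u - v\<bar> \<le> 1 --> f u \<le> D * f v) ==>
   ennreal (\<Sum>z\<in>Z. real (zmult q chi z) * f (Im z)) \<le> ennreal (C * D) * (\<integral>\<^sup>+t. ennreal (f t * log_cond q t) \<partial>lborel)"
  using critical_zero_sum_le_integral by blast
 \<comment> \<open>2000 exceeds both 3 * 40 and 18 * 32, the products of the variation factors and
   the integral bounds. In the second sum the factor 18 is 9 \<ge> e^2 for the exponential times 2
   for the logarithm.\<close>
 define C' where "C' = C * 2000"
 have e2: "exp 2 \<le> (9::real)"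
 proof -
  have "exp 2 = exp 1 * exp (1::real)" by (simp flip: exp_add)
  also have "\<dots> \<le> 3 * 3" using exp_le by (intro mult_mono) auto
  finally show ?thesis by simp
 qed
 have "(\<Sum>z\<in>Z. real (zmult q chi z) * (1 / (1 + (u - Im z)^2))) \<le> C' * log_cond q u"
  if chi: "dirichlet_character q chi" and Z: "finite Z" "Z \<subseteq> critical_zeros q chi" for q chi Z u
 proof -
  have q: "q > 0" using chi by (simp add: dirichlet_character_def)
  have l: "log_cond q u \<ge> 1/2" by (rule log_cond_ge[OF q])
  have "ennreal (\<Sum>z\<in>Z. real (zmult q chi z) * (1 / (1 + (u - Im z)^2))) \<le> ennreal (C * 3) * (\<integral>\<^sup>+t. ennreal (1 / (1 + (u - t)^2) * log_cond q t) \<partial>lborel)"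
  proof (rule main[OF chi Z])
   show "\<forall>v w. \<bar>v - w\<bar> \<le> 1 --> 1 / (1 + (u - v)^2) \<le> 3 * (1 / (1 + (u - w)^2))"
   proof (intro allI impI)
    fix v w :: real assume vw: "\<bar>v - w\<bar> \<le> 1"
    have "(u - w)^2 = ((u - v) + (v - w))^2" by simp
    also have "\<dots> \<le> 2 * (u - v)^2 + 2 * (v - w)^2"
     using sum_squares_bound[of "u - v" "v - w"] by (simp add: power2_eq_square algebra_simps)
    finally have "(u - w)^2 \<le> 2 * (u - v)^2 + 2 * (v - w)^2" .
    moreover have "(v - w)^2 \<le> 1" using vw by (simp add: abs_square_le_1)
    moreover have "1 + a \<le> 3 * (1 + b)" if "a \<le> 2 * b + 2 * d" "d \<le> 1" "0 \<le> b" for a b d :: real using that by simp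
    ultimately have "1 + (u - w)^2 \<le> 3 * (1 + (u - v)^2)" by (metis zero_le_power2)
    moreover have "1 + (u - w)^2 > 0" "1 + (u - v)^2 > 0" by (auto simp: add_pos_nonneg)
    ultimately show "1 / (1 + (u - v)^2) \<le> 3 * (1 / (1 + (u - w)^2))" by (simp add: divide_simps)
   qed
  qed (auto intro!: divide_nonneg_nonneg add_nonneg_nonneg)
  also have "\<dots> \<le> ennreal (C * 3) * ennreal (40 * log_cond q u)"
   by (intro mult_left_mono nn_integral_log_cond_kernel[OF q]) simp
  also have "\<dots> = ennreal (C * 3 * (40 * log_cond q u))" using C l by (intro ennreal_mult[symmetric]) auto
  finally have "(\<Sum>z\<in>Z. real (zmult q chi z) * (1 / (1 + (u - Im z)^2))) \<le> C * 3 * (40 * log_cond q u)"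
   using C l by (subst (asm) ennreal_le_iff) auto
  also have "\<dots> \<le> C' * log_cond q u" using C l by (simp add: C'_def)
  finally show ?thesis .
 qed
 moreover have "(\<Sum>z\<in>Z. real (zmult q chi z) * (exp (- (2 / X) * \<bar>Im z\<bar>) * log_cond q (Im z))) \<le> C' * X * (log_cond q X)^2"
  if chi: "dirichlet_character q chi" and Z: "finite Z" "Z \<subseteq> critical_zeros q chi" and X: "X \<ge> 1" for q chi Z X
 proof -
  have q: "q > 0" using chi by (simp add: dirichlet_character_def)
  have l: "log_cond q s \<ge> 1/2" for s by (rule log_cond_ge[OF q])
  have l0: "log_cond q s \<ge> 0" for s using l[of s] by linarith
  have "ennreal (\<Sum>z\<in>Z. real (zmult q chi z) * (exp (- (2 / X) * \<bar>Im z\<bar>) * log_cond q (Im z)))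
    \<le> ennreal (C * 18) * (\<integral>\<^sup>+t. ennreal (exp (- (2 / X) * \<bar>t\<bar>) * log_cond q t * log_cond q t) \<partial>lborel)"
  proof (rule main[OF chi Z])
   show "(\<lambda>t. exp (- (2 / X) * \<bar>t\<bar>) * log_cond q t) \<in> borel_measurable borel" unfolding log_cond_def by measurable
   show "\<forall>v w. \<bar>v - w\<bar> \<le> 1 --> exp (- (2 / X) * \<bar>v\<bar>) * log_cond q v \<le> 18 * (exp (- (2 / X) * \<bar>w\<bar>) * log_cond q w)"
   proof (intro allI impI)
    fix v w :: real assume vw: "\<bar>v - w\<bar> \<le> 1"
    have "(2 / X) * \<bar>w\<bar> - (2 / X) * \<bar>v\<bar> = (2 / X) * (\<bar>w\<bar> - \<bar>v\<bar>)" by (rule right_diff_distrib[symmetric])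
    also have "\<dots> \<le> 2 * 1"
    proof (cases "\<bar>w\<bar> \<ge> \<bar>v\<bar>")
     case True
     thus ?thesis using vw X by (intro mult_mono) (auto simp: field_simps)
    next
     case False
     hence "(2 / X) * (\<bar>w\<bar> - \<bar>v\<bar>) \<le> 0" using X by (intro mult_nonneg_nonpos) auto
     thus ?thesis by linarith
    qed
    finally have "exp (- (2 / X) * \<bar>v\<bar>) \<le> exp (2 + - (2 / X) * \<bar>w\<bar>)" by simp
    also have "\<dots> \<le> 9 * exp (- (2 / X) * \<bar>w\<bar>)" unfolding exp_add using e2 by (intro mult_right_mono) auto
    finally have "exp (- (2 / X) * \<bar>v\<bar>) * log_cond q v \<le> 9 * exp (- (2 / X) * \<bar>w\<bar>) * (2 * log_cond q w)"
     by (intro mult_mono log_cond_shift_le(2)[OF q vw] l0) auto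
    thus "exp (- (2 / X) * \<bar>v\<bar>) * log_cond q v \<le> 18 * (exp (- (2 / X) * \<bar>w\<bar>) * log_cond q w)" by simp
   qed
  qed (use l0 in auto)
  also have "(\<integral>\<^sup>+t. ennreal (exp (- (2 / X) * \<bar>t\<bar>) * log_cond q t * log_cond q t) \<partial>lborel)
    = (\<integral>\<^sup>+t. ennreal (exp (- (2 / X) * \<bar>t\<bar>) * (log_cond q t)^2) \<partial>lborel)" by (simp add: power2_eq_square mult.assoc)
  also have "ennreal (C * 18) * \<dots> \<le> ennreal (C * 18) * ennreal (32 * X * (log_cond q X)^2)"
   using X by (intro mult_left_mono nn_integral_exp_log_cond[OF q]) auto
  also have "\<dots> = ennreal (C * 18 * (32 * X * (log_cond q X)^2))" using C X by (intro ennreal_mult[symmetric]) auto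
  finally have "(\<Sum>z\<in>Z. real (zmult q chi z) * (exp (- (2 / X) * \<bar>Im z\<bar>) * log_cond q (Im z))) \<le> C * 18 * (32 * X * (log_cond q X)^2)"
   using C X by (subst (asm) ennreal_le_iff) auto
  also have "\<dots> \<le> C' * X * (log_cond q X)^2" using C X by (simp add: C'_def)
  finally show ?thesis .
 qed
 moreover have "C' > 0" using C by (simp add: C'_def)
 ultimately show ?thesis by blast
qed

section \<open>Mean squares on rays\<close>

definition Phi :: "nat => (nat => complex) => complex => complex" where
 "Phi q chi z = (\<Sum>n. chi (Suc n) * mangoldt (Suc n) * exp (- (of_nat (Suc n) * z))) - E_char q chi / z + real_zero_sum q chi z"

lemma real_zeros_finite_mult:
 "\<exists>C>0. \<forall>q chi. dirichlet_character q chi --> finite (real_zeros q chi) \<and>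
   (\<Sum>p\<in>real_zeros q chi. real (zmult q chi p)) \<le> C * log_cond q 0"
proof -
 obtain C where C: "C > 0" "\<And>q chi t. dirichlet_character q chi ==> finite (zeros_near q chi t)"
   "\<And>q chi t. dirichlet_character q chi ==> real (\<Sum>z\<in>zeros_near q chi t. zmult q chi z) \<le> C * log_cond q t"
  using Lreg_local_zeros by blast
 have "finite (real_zeros q chi) \<and> (\<Sum>p\<in>real_zeros q chi. real (zmult q chi p)) \<le> C * log_cond q 0"
  if chi: "dirichlet_character q chi" for q chi
 proof -
  have sub: "real_zeros q chi \<subseteq> zeros_near q chi 0"
  proof
   fix p assume "p \<in> real_zeros q chi"
   hence p: "Im p = 0" "\<bar>Re p - 2\<bar> \<le> 15/8" "Lreg q chi p = 0" by (auto simp: real_zeros_iff)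
   have "cmod (Complex 2 0 - p) = \<bar>Re p - 2\<bar>" using p(1) by (simp add: cmod_def abs_minus_commute)
   thus "p \<in> zeros_near q chi 0" using p by (simp add: zeros_near_def dist_norm)
  qed
  have "(\<Sum>p\<in>real_zeros q chi. real (zmult q chi p)) \<le> (\<Sum>p\<in>zeros_near q chi 0. real (zmult q chi p))"
   by (rule sum_mono2[OF C(2)[OF chi] sub]) simp
  thus ?thesis using C(3)[OF chi, of 0] finite_subset[OF sub C(2)[OF chi]] by simp
 qed
 thus ?thesis using C(1) by blast
qed

lemma real_zero_sum_eq:
 assumes GRHR and chi: "dirichlet_character q chi"
 shows "real_zero_sum q chi z = (\<Sum>p\<in>{p\<in>real_zeros q chi. 1/2 \<le> Re p}. of_nat (zmult q chi p) * mellin_kernel z p)"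
proof -
 define B where "B = {\<beta>. nontrivial_zero q chi (complex_of_real \<beta>) \<and> \<beta> \<ge> 1/2}"
 have im: "{p\<in>real_zeros q chi. 1/2 \<le> Re p} = complex_of_real ` B"
 proof (intro equalityI subsetI)
  fix p assume "p \<in> {p\<in>real_zeros q chi. 1/2 \<le> Re p}"
  hence p: "Im p = 0" "Lreg q chi p = 0" "1/2 \<le> Re p" by (auto simp: real_zeros_iff)
  hence "nontrivial_zero q chi p" by (intro GRHR_Lreg_zero(3)[OF assms]) auto
  moreover have "p = complex_of_real (Re p)" using p(1) by (simp add: complex_eq_iff)
  ultimately show "p \<in> complex_of_real ` B" using p(3) unfolding B_def by (metis (mono_tags, lifting) imageI mem_Collect_eq)
 next
  fix p assume "p \<in> complex_of_real ` B"
  thus "p \<in> {p\<in>real_zeros q chi. 1/2 \<le> Re p}" by (auto simp: B_def real_zeros_iff nontrivial_zero_iff[OF chi] abs_if)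
 qed
 have "real_zero_sum q chi z = (\<Sum>\<beta>\<in>B. of_int (zorder (dirichlet_L q chi) (of_real \<beta>)) * (Gamma (of_real \<beta>) / z powr of_real \<beta>))"
  unfolding real_zero_sum_def B_def ..
 also have "\<dots> = (\<Sum>\<beta>\<in>B. of_nat (zmult q chi (of_real \<beta>)) * mellin_kernel z (of_real \<beta>))"
 proof (intro sum.cong refl)
  fix \<beta> assume "\<beta> \<in> B"
  hence "zorder (dirichlet_L q chi) (of_real \<beta>) = int (zmult q chi (of_real \<beta>))" by (intro zorder_dirichlet_L[OF chi]) (simp add: B_def)
  thus "of_int (zorder (dirichlet_L q chi) (of_real \<beta>)) * (Gamma (of_real \<beta>) / z powr of_real \<beta>) = of_nat (zmult q chi (of_real \<beta>)) * mellin_kernel z (of_real \<beta>)"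
   by (simp add: mellin_kernel_def powr_minus_divide)
 qed
 also have "\<dots> = (\<Sum>p\<in>complex_of_real ` B. of_nat (zmult q chi p) * mellin_kernel z p)"
  by (subst sum.reindex) (auto simp: inj_on_def)
 finally show ?thesis unfolding im .
qed

text \<open>The rectangle contains three kinds of zeros. The real ones from 1/2 on make up
  \<open>real_zero_sum\<close> and have been moved into \<open>Phi\<close>; the real ones between c
  and 1/2 remain as an error with few terms; the nonreal ones are left for the mean square.\<close>

lemma explicit_formula_Phi:
 fixes z :: complex and chi :: "nat => complex"
 assumes G: GRHR and chi: "dirichlet_character q chi" and z: "Re z > 0"
  and c: "1/4 \<le> c" "c \<le> 3/8" "\<forall>p\<in>real_zeros q chi. Re p \<noteq> c" and T: "good_heights q chi D T"
 shows "(\<lambda>k. Phi q chi z + (\<Sum>p\<in>{p\<in>real_zeros q chi. c < Re p \<and> Re p < 1/2}. of_nat (zmult q chi p) * mellin_kernel z p)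
   + (\<Sum>p\<in>{p\<in>zeros_in_box q chi c (T k). Im p \<noteq> 0}. of_nat (zmult q chi p) * mellin_kernel z p)
   + integral {-T k..T k} (\<lambda>t. logderiv_L q chi (Complex c t) * mellin_kernel z (Complex c t)) / (2 * pi)) \<longlonglongrightarrow> 0"
proof -
 let ?m = "\<lambda>p. of_nat (zmult q chi p) * mellin_kernel z p"
 let ?R1 = "{p\<in>real_zeros q chi. c < Re p \<and> Re p < 1/2}" and ?R2 = "{p\<in>real_zeros q chi. 1/2 \<le> Re p}"
 have fr: "finite (real_zeros q chi)" using real_zeros_finite_mult chi by blast
 have eq: "(\<Sum>p\<in>zeros_in_box q chi c (T k). ?m p) = sum ?m {p\<in>zeros_in_box q chi c (T k). Im p \<noteq> 0} + sum ?m ?R1 + real_zero_sum q chi z" for k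
 proof -
  have "T k \<ge> real k + 1" using T by (auto simp: good_heights_def)
  hence "T k > 0" by linarith
  have un: "zeros_in_box q chi c (T k) = {p\<in>zeros_in_box q chi c (T k). Im p \<noteq> 0} \<union> (?R1 \<union> ?R2)"
  proof (intro equalityI subsetI)
   fix p assume p: "p \<in> zeros_in_box q chi c (T k)"
   thus "p \<in> {p\<in>zeros_in_box q chi c (T k). Im p \<noteq> 0} \<union> (?R1 \<union> ?R2)"
    using c(1) by (auto simp: zeros_in_box_def in_box_complex_iff real_zeros_iff abs_if)
  next
   fix p assume "p \<in> {p\<in>zeros_in_box q chi c (T k). Im p \<noteq> 0} \<union> (?R1 \<union> ?R2)"
   then consider "p \<in> zeros_in_box q chi c (T k)" | "p \<in> real_zeros q chi" "c < Re p" using c(2) by auto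
   thus "p \<in> zeros_in_box q chi c (T k)"
   proof cases
    case 2
    hence "Re p < 1" using GRHR_Lreg_zero(1)[OF G chi, of p] c by (auto simp: real_zeros_iff)
    thus ?thesis using 2 \<open>T k > 0\<close> by (auto simp: zeros_in_box_def in_box_complex_iff real_zeros_iff)
   qed
  qed
  have fin: "finite (zeros_in_box q chi c (T k))"
   using finite_Lreg_zeros[OF chi bounded_box] by (simp add: zeros_in_box_def)
  have "(\<Sum>p\<in>zeros_in_box q chi c (T k). ?m p) = sum ?m {p\<in>zeros_in_box q chi c (T k). Im p \<noteq> 0} + sum ?m (?R1 \<union> ?R2)"
  proof (subst un, rule sum.union_disjoint)
   show "{p\<in>zeros_in_box q chi c (T k). Im p \<noteq> 0} \<inter> (?R1 \<union> ?R2) = {}" by (auto simp: real_zeros_iff)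
  qed (use fin fr in auto)
  also have "sum ?m (?R1 \<union> ?R2) = sum ?m ?R1 + sum ?m ?R2" by (rule sum.union_disjoint) (use fr in auto)
  finally show ?thesis unfolding real_zero_sum_eq[OF G chi] by (simp add: add.assoc)
 qed
 show ?thesis using explicit_formula[OF assms] unfolding eq Phi_def by (simp add: algebra_simps)
qed

lemma powr_minus_le_inverse_sqrt:
 fixes r \<sigma> :: real
 assumes "0 < r" "r \<le> 16" "1/4 \<le> \<sigma>" "\<sigma> \<le> 1/2"
 shows "r powr (- \<sigma>) \<le> 2 * r powr (-1/2)"
proof -
 have "r powr (1/2 - \<sigma>) \<le> 2"
 proof (cases "r \<le> 1")
  case True
  hence "r powr (1/2 - \<sigma>) \<le> 1 powr (1/2 - \<sigma>)" using assms by (intro powr_mono2) auto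
  thus ?thesis by simp
 next
  case False
  hence "r powr (1/2 - \<sigma>) \<le> r powr (1/4)" using assms by (intro powr_mono) auto
  also have "\<dots> \<le> 16 powr (1/4)" using assms by (intro powr_mono2) auto
  also have "16 powr (1/4) = (2 powr 4) powr (1/4 :: real)" by (simp add: powr_numeral)
  also have "\<dots> = 2" by (subst powr_powr) simp
  finally show ?thesis .
 qed
 hence "r powr (1/2 - \<sigma>) * r powr (-1/2) \<le> 2 * r powr (-1/2)" by (intro mult_right_mono) auto
 thus ?thesis by (simp flip: powr_add)
qed

text \<open>On a ray the argument is constant, so x separates: an amplitude independent of x, a
  power of x that depends only on Re s, and a pure oscillation in ln x. This is the shape that
  \<open>mellin_mean_square\<close> asks for.\<close>

lemma mellin_kernel_scale:
 assumes "x > 0" "w \<noteq> 0"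
 shows "mellin_kernel (complex_of_real x * w) s = of_real (x powr (- Re s)) * (mellin_kernel w s * exp (- (\<i> * of_real (Im s) * of_real (ln x))))"
proof -
 have "Ln (complex_of_real x * w) = of_real (ln x) + Ln w"
  using Ln_times_of_real[of x w] assms by (simp add: Ln_of_real)
 hence "(complex_of_real x * w) powr (- s) = exp (- s * of_real (ln x)) * w powr (- s)"
  using assms by (simp add: powr_def distrib_left exp_add exp_diff exp_minus field_simps)
 also have "- s * of_real (ln x) = of_real (- Re s * ln x) + - (\<i> * of_real (Im s) * of_real (ln x))"
  by (simp add: complex_eq_iff)
 also have "exp \<dots> = of_real (x powr (- Re s)) * exp (- (\<i> * of_real (Im s) * of_real (ln x)))"
  unfolding exp_add exp_of_real using assms by (simp add: powr_def)
 finally show ?thesis by (simp add: mellin_kernel_def mult_ac)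
qed

text \<open>Near the real axis L'/L may be large, but |c + it - \<beta>| \<ge> sqrt (|c - \<beta>|
  |t|) bounds it by an integrable function of t whose coefficient is controlled by the choice of c.
  Absolute values suffice on this piece: a pointwise bound of this size is already within what the
  mean square on a ray allows.\<close>

lemma left_line_near_real_axis:
 assumes GRHR
 shows "\<exists>C>0. \<forall>q chi c z. dirichlet_character q chi --> 1/4 \<le> c --> c \<le> 3/8 --> (\<forall>p\<in>real_zeros q chi. Re p \<noteq> c) -->
   (\<Sum>p\<in>real_zeros q chi. real (zmult q chi p) * \<bar>c - Re p\<bar> powr (-1/2)) \<le> 33 * (\<Sum>p\<in>real_zeros q chi. real (zmult q chi p)) -->
   Re z > 0 --> cmod z \<le> 16 -->
   cmod ((\<Sum>p\<in>{p\<in>real_zeros q chi. c < Re p \<and> Re p < 1/2}. of_nat (zmult q chi p) * mellin_kernel z p)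
    + integral {-1..1} (\<lambda>t. logderiv_L q chi (Complex c t) * mellin_kernel z (Complex c t)) / (2 * pi)) \<le> C * log_cond q 0 * cmod z powr (-1/2)"
  (is "\<exists>C>0. \<forall>q chi c z. ?chi q chi --> ?c1 c --> ?c2 c --> ?nz q chi c --> ?good q chi c --> ?z1 z --> ?z2 z --> ?P C q chi c z")
proof -
 obtain C1 where C1: "C1 > 0" "\<And>q chi. dirichlet_character q chi ==> finite (real_zeros q chi)"
   "\<And>q chi. dirichlet_character q chi ==> (\<Sum>p\<in>real_zeros q chi. real (zmult q chi p)) \<le> C1 * log_cond q 0"
  using real_zeros_finite_mult by blast
 obtain C2 where C2: "C2 > 0" "\<And>z \<sigma> t. Re z > 0 ==> 1/4 \<le> \<sigma> ==> \<sigma> \<le> 1/2 ==> cmod (mellin_kernel z (Complex \<sigma> t)) \<le> C2 * cmod z powr (- \<sigma>) * exp (- (Re z / cmod z) * \<bar>t\<bar>)"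
  using mellin_kernel_bounds by blast
 obtain C3 where C3: "C3 > 0" "\<And>q chi c t. dirichlet_character q chi ==> 1/4 \<le> c ==> c \<le> 3/8 ==> Lreg q chi (Complex c t) \<noteq> 0 ==>
  cmod (logderiv_L q chi (Complex c t)) \<le> C3 * log_cond q t + (\<Sum>z\<in>real_zeros q chi. real (zmult q chi z) / cmod (Complex c t - z))"
  using logderiv_L_bound[OF assms] by blast
 have K: "cmod (mellin_kernel z (Complex \<sigma> t)) \<le> 2 * C2 * cmod z powr (-1/2)" if "Re z > 0" "cmod z \<le> 16" "1/4 \<le> \<sigma>" "\<sigma> \<le> 1/2" for z \<sigma> t
 proof -
  have z0: "cmod z > 0" using that(1) by auto
  have "cmod (mellin_kernel z (Complex \<sigma> t)) \<le> C2 * cmod z powr (- \<sigma>) * exp (- (Re z / cmod z) * \<bar>t\<bar>)" by (rule C2(2)[OF that(1,3,4)])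
  also have "\<dots> \<le> C2 * (2 * cmod z powr (-1/2)) * 1"
   using C2(1) that z0 by (intro mult_mono powr_minus_le_inverse_sqrt) auto
  finally show ?thesis by (simp add: mult_ac)
 qed
 define C where "C = 2 * C1 * C2 + 2 * C2 * (4 * C3 + 198 * C1)"
 have "?P C q chi c z"
  if chi: "dirichlet_character q chi" and c: "1/4 \<le> c" "c \<le> 3/8" "\<forall>p\<in>real_zeros q chi. Re p \<noteq> c"
   and good: "?good q chi c"
   and z: "Re z > 0" "cmod z \<le> 16" for q chi c z
 proof -
  let ?l = "log_cond q 0" and ?r = "cmod z powr (-1/2)"
  define M where "M = (\<Sum>p\<in>real_zeros q chi. real (zmult q chi p))"
  have M: "M \<le> C1 * ?l" "M \<ge> 0" using C1(3)[OF chi] by (auto simp: M_def intro: sum_nonneg)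
  have q: "q > 0" using chi by (simp add: dirichlet_character_def)
  have l: "log_cond q s \<ge> 1/2" for s by (rule log_cond_ge[OF q])
  have "cmod (\<Sum>p\<in>{p\<in>real_zeros q chi. c < Re p \<and> Re p < 1/2}. of_nat (zmult q chi p) * mellin_kernel z p)
    \<le> (\<Sum>p\<in>{p\<in>real_zeros q chi. c < Re p \<and> Re p < 1/2}. real (zmult q chi p) * (2 * C2 * ?r))"
  proof (rule sum_norm_le)
   fix p assume "p \<in> {p\<in>real_zeros q chi. c < Re p \<and> Re p < 1/2}"
   hence "cmod (mellin_kernel z (Complex (Re p) (Im p))) \<le> 2 * C2 * ?r" using c by (intro K z) auto
   thus "cmod (of_nat (zmult q chi p) * mellin_kernel z p) \<le> real (zmult q chi p) * (2 * C2 * ?r)"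
    by (simp add: norm_mult mult_left_mono)
  qed
  also have "\<dots> \<le> M * (2 * C2 * ?r)" unfolding M_def sum_distrib_right
   using C2(1) C1(2)[OF chi] by (intro sum_mono2) auto
  also have "\<dots> \<le> (C1 * ?l) * (2 * C2 * ?r)" using M C2(1) by (intro mult_right_mono) auto
  finally have S: "cmod (\<Sum>p\<in>{p\<in>real_zeros q chi. c < Re p \<and> Re p < 1/2}. of_nat (zmult q chi p) * mellin_kernel z p) \<le> (C1 * ?l) * (2 * C2 * ?r)" .
  let ?f = "\<lambda>t. logderiv_L q chi (Complex c t) * mellin_kernel z (Complex c t)"
  define h where "h = (\<lambda>t::real. 2 * C3 * ?l + (33 * M) * \<bar>t\<bar> powr (-1/2))"
  have si: "(\<lambda>t::real. \<bar>t\<bar> powr (-1/2)) integrable_on {-1..1}" using has_integral_integrable[OF integral_inverse_sqrt_dist[of "-1" 1 0]] by simp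
  have hi: "h integrable_on {-1..1}" unfolding h_def
   by (intro integrable_add integrable_const_ivl integrable_on_mult_right si)
  \<comment> \<open>The exact value is 4; the 6 enters the constant 198 = 33 * 6.\<close>
  have i6: "integral {-1..1} (\<lambda>t::real. \<bar>t\<bar> powr (-1/2)) \<le> 6"
   using integral_unique[OF integral_inverse_sqrt_dist[of "-1" 1 0]] by simp
  have "integral {-1..1} h = 4 * C3 * ?l + (33 * M) * integral {-1..1} (\<lambda>t::real. \<bar>t\<bar> powr (-1/2))"
   unfolding h_def using si by (subst integral_add) (auto intro!: integrable_on_mult_right)
  also have "\<dots> \<le> 4 * C3 * ?l + (33 * (C1 * ?l)) * 6"
   using M i6 integral_nonneg[OF si] by (intro add_left_mono mult_mono) auto
  finally have hI: "integral {-1..1} h \<le> (4 * C3 + 198 * C1) * ?l" by (simp add: algebra_simps)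
  have fb: "cmod (?f t) \<le> 2 * C2 * ?r * h t" if t: "t \<in> {-1..1}" "t \<noteq> 0" for t
  proof -
   have L: "Lreg q chi (Complex c t) \<noteq> 0"
    using GRHR_Lreg_zero(2)[OF assms chi, of "Complex c t"] t c by auto
   have "(\<Sum>p\<in>real_zeros q chi. real (zmult q chi p) / cmod (Complex c t - p)) \<le> (\<Sum>p\<in>real_zeros q chi. real (zmult q chi p) * \<bar>c - Re p\<bar> powr (-1/2) * \<bar>t\<bar> powr (-1/2))"
   proof (rule sum_mono)
    fix p assume p: "p \<in> real_zeros q chi"
    define u where "u = \<bar>c - Re p\<bar>"
    have u: "u > 0" using c(3) p by (auto simp: u_def)
    have "sqrt (u * \<bar>t\<bar>) \<le> sqrt (u^2 + t^2)"
    proof (rule real_sqrt_le_mono)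
     have "2 * u * \<bar>t\<bar> \<le> u^2 + \<bar>t\<bar>^2" by (rule sum_squares_bound)
     moreover have "0 \<le> u * \<bar>t\<bar>" using u by simp
     ultimately show "u * \<bar>t\<bar> \<le> u^2 + t^2" by simp
    qed
    also have "\<dots> = cmod (Complex c t - p)" using p by (simp add: cmod_def u_def real_zeros_iff)
    finally have "1 / cmod (Complex c t - p) \<le> 1 / sqrt (u * \<bar>t\<bar>)" using u t by (intro frac_le) auto
    also have "\<dots> = u powr (-1/2) * \<bar>t\<bar> powr (-1/2)" using u t by (simp add: powr_minus_divide powr_half_sqrt real_sqrt_mult)
    finally have "real (zmult q chi p) * (1 / cmod (Complex c t - p)) \<le> real (zmult q chi p) * (u powr (-1/2) * \<bar>t\<bar> powr (-1/2))" by (intro mult_left_mono) auto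
    thus "real (zmult q chi p) / cmod (Complex c t - p) \<le> real (zmult q chi p) * \<bar>c - Re p\<bar> powr (-1/2) * \<bar>t\<bar> powr (-1/2)"
     by (simp add: u_def mult.assoc)
   qed
   also have "\<dots> \<le> (33 * M) * \<bar>t\<bar> powr (-1/2)" unfolding sum_distrib_right[symmetric] M_def using good by (intro mult_right_mono) auto
   finally have 1: "(\<Sum>p\<in>real_zeros q chi. real (zmult q chi p) / cmod (Complex c t - p)) \<le> (33 * M) * \<bar>t\<bar> powr (-1/2)" .
   have "C3 * log_cond q t \<le> C3 * (2 * ?l)" using C3(1) log_cond_shift_le(2)[OF q, of t 0] t by (intro mult_left_mono) auto
   hence "cmod (logderiv_L q chi (Complex c t)) \<le> h t" using C3(2)[OF chi c(1,2) L] 1 unfolding h_def by linarith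
   hence "cmod (?f t) \<le> h t * (2 * C2 * ?r)" unfolding norm_mult
    using K[OF z c(1), of t] c(2) by (intro mult_mono) (auto intro: order_trans[OF norm_ge_zero])
   thus ?thesis by (simp add: mult_ac)
  qed
  \<comment> \<open>At t = 0 the majorant fails, because \<open>0 powr (-1/2) = 0\<close>; this one
    point is removed. Should \<open>f0\<close> not be integrable, its integral is 0 by convention
    and the bound is trivial.\<close>
  define f0 where "f0 = (\<lambda>t. if t = 0 then 0 else ?f t)"
  have h0: "h t \<ge> 0" for t unfolding h_def using C3(1) l[of 0] M(2) by auto
  have "integral {-1..1} ?f = integral {-1..1} f0"
   by (rule integral_spike[of "{0}"]) (auto simp: f0_def)
  also have "cmod \<dots> \<le> 2 * C2 * ?r * integral {-1..1} h"
  proof (cases "f0 integrable_on {-1..1}")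
   case True
   have "cmod (integral {-1..1} f0) \<le> integral {-1..1} (\<lambda>t. 2 * C2 * ?r * h t)"
    using fb C2(1) h0 by (intro integral_norm_bound_integral True integrable_on_mult_right hi) (auto simp: f0_def)
   thus ?thesis by simp
  next
   case False
   hence "integral {-1..1} f0 = 0" by (rule not_integrable_integral)
   thus ?thesis using C2(1) h0 integral_nonneg[OF hi] by auto
  qed
  also have "\<dots> \<le> 2 * C2 * ?r * ((4 * C3 + 198 * C1) * ?l)" using C2(1) by (intro mult_left_mono hI) auto
  finally have I: "cmod (integral {-1..1} ?f) \<le> 2 * C2 * ?r * ((4 * C3 + 198 * C1) * ?l)" .
  have "cmod (integral {-1..1} ?f / (2 * pi)) = cmod (integral {-1..1} ?f) / (2 * pi)" by (simp add: norm_divide)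
  also have "\<dots> \<le> cmod (integral {-1..1} ?f)" using pi_gt3 by (intro divide_le_self_nonneg) auto
  finally have "cmod (integral {-1..1} ?f / (2 * pi)) \<le> 2 * C2 * ?r * ((4 * C3 + 198 * C1) * ?l)" using I by linarith
  from norm_triangle_le[OF add_mono[OF S this]] show ?thesis by (simp add: C_def algebra_simps)
 qed
 moreover have "C > 0" using C1(1) C2(1) C3(1) by (simp add: C_def add_pos_pos)
 ultimately show ?thesis by blast
qed

text \<open>
 The sums over \<open>Z k\<close> and the integrals of \<open>a w k\<close> are the contributions of the nonreal zeros and of the part
 \<open>\<bar>t\<bar> \<ge> 1\<close> of the line \<open>Re s = c\<close> up to the \<open>k\<close>-th truncation height, on the ray through \<open>w\<close>;
 \<open>V\<close> collects what stems from the real zeros and from \<open>\<bar>t\<bar> \<le> 1\<close>.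
\<close>

definition Phi_approximation ::
 "nat => (nat => complex) => real => real => (nat => complex set) => (complex => nat => real => complex) => bool" where
 "Phi_approximation q chi C c Z a \<longleftrightarrow> 1/4 \<le> c \<and> c \<le> 3/8 \<and> (\<forall>k. finite (Z k) \<and> Z k \<subseteq> critical_zeros q chi) \<and>
   (\<forall>w k. Re w = 1 --> integrable lborel (a w k) \<and>
     (\<forall>t. cmod (a w k t) \<le> C * log_cond q t * (cmod w powr (- c) * exp (- (1 / cmod w) * \<bar>t\<bar>)))) \<and>
   (\<forall>w x. Re w = 1 --> x > 0 --> x * cmod w \<le> 16 -->
    (\<exists>V. cmod V \<le> C * log_cond q 0 * (x * cmod w) powr (-1/2) \<and>
      (\<lambda>k. Phi q chi (of_real x * w) + V
       + of_real (x powr (-1/2)) * (\<Sum>p\<in>Z k. (of_nat (zmult q chi p) * mellin_kernel w p) * exp (- (\<i> * of_real (Im p) * of_real (ln x))))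
       + of_real (x powr (- c)) * (\<integral>t. a w k t * exp (- (\<i> * of_real t * of_real (ln x))) \<partial>lborel)) \<longlonglongrightarrow> 0))"

lemma Phi_decomposition:
 assumes G: GRHR
 shows "\<exists>C>0. \<forall>q chi. dirichlet_character q chi --> (\<exists>c Z a. Phi_approximation q chi C c Z a)"
proof -
 obtain C1 where C1: "C1 > 0" "\<And>q chi. dirichlet_character q chi ==> finite (real_zeros q chi)"
   "\<And>q chi. dirichlet_character q chi ==> (\<Sum>p\<in>real_zeros q chi. real (zmult q chi p)) \<le> C1 * log_cond q 0"
  using real_zeros_finite_mult by blast
 obtain C2 where C2: "C2 > 0" "\<And>z \<sigma> t. Re z > 0 ==> 1/4 \<le> \<sigma> ==> \<sigma> \<le> 1/2 ==> cmod (mellin_kernel z (Complex \<sigma> t)) \<le> C2 * cmod z powr (- \<sigma>) * exp (- (Re z / cmod z) * \<bar>t\<bar>)"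
  using mellin_kernel_bounds by blast
 obtain C3 where C3: "C3 > 0" "\<And>q chi c t. dirichlet_character q chi ==> 1/4 \<le> c ==> c \<le> 3/8 ==> Lreg q chi (Complex c t) \<noteq> 0 ==>
  cmod (logderiv_L q chi (Complex c t)) \<le> C3 * log_cond q t + (\<Sum>z\<in>real_zeros q chi. real (zmult q chi z) / cmod (Complex c t - z))"
  using logderiv_L_bound[OF G] by blast
 obtain C4 where C4: "C4 > 0" "\<And>q chi c z. dirichlet_character q chi ==> 1/4 \<le> c ==> c \<le> 3/8 ==> (\<forall>p\<in>real_zeros q chi. Re p \<noteq> c) ==>
   (\<Sum>p\<in>real_zeros q chi. real (zmult q chi p) * \<bar>c - Re p\<bar> powr (-1/2)) \<le> 33 * (\<Sum>p\<in>real_zeros q chi. real (zmult q chi p)) ==>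
   Re z > 0 ==> cmod z \<le> 16 ==>
   cmod ((\<Sum>p\<in>{p\<in>real_zeros q chi. c < Re p \<and> Re p < 1/2}. of_nat (zmult q chi p) * mellin_kernel z p)
    + integral {-1..1} (\<lambda>t. logderiv_L q chi (Complex c t) * mellin_kernel z (Complex c t)) / (2 * pi)) \<le> C4 * log_cond q 0 * cmod z powr (-1/2)"
  using left_line_near_real_axis[OF G] by blast
 define C where "C = (C3 + C1) * C2 + C4"
 have Cpos: "C > 0" using C1(1) C2(1) C3(1) C4(1) by (auto simp: C_def intro!: add_pos_pos mult_pos_pos)
 have Cge: "C4 \<le> C" "(C3 + C1) * C2 \<le> C" using C1(1) C2(1) C3(1) C4(1) by (auto simp: C_def)
 have "\<exists>c Z a. Phi_approximation q chi C c Z a"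
  if chi: "dirichlet_character q chi" for q chi
 proof -
  obtain c where c: "1/4 \<le> c" "c \<le> 3/8" "\<forall>p\<in>real_zeros q chi. Re p \<noteq> c"
   and good: "(\<Sum>p\<in>real_zeros q chi. real (zmult q chi p) * \<bar>c - Re p\<bar> powr (-1/2)) \<le> 33 * (\<Sum>p\<in>real_zeros q chi. real (zmult q chi p))"
   using exists_good_abscissa[OF chi] by blast
  obtain D T where T: "good_heights q chi D T" using exists_good_heights[OF G chi] by blast
  have T1: "T k \<ge> real k + 1" for k using T by (auto simp: good_heights_def)
  have T1': "T k \<ge> 1" for k using T1[of k] by linarith
  have q: "q > 0" using chi by (simp add: dirichlet_character_def)
  have l: "log_cond q s \<ge> 1/2" for s by (rule log_cond_ge[OF q])
  have Rc: "Lreg q chi (Complex c t) \<noteq> 0" for t by (rule Lreg_left_line_nonzero[OF G chi c])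
  define Z where "Z = (\<lambda>k. {p\<in>zeros_in_box q chi c (T k). Im p \<noteq> 0})"
  define g where "g = (\<lambda>w t. logderiv_L q chi (Complex c t) * mellin_kernel w (Complex c t) / (2 * pi))"
  \<comment> \<open>On this range every real zero has distance at least 1 from the line, so L'/L is
    O(log) without any smoothing in c.\<close>
  define a where "a = (\<lambda>w k t. (indicator {-T k..-1} t + indicator {1..T k} t) *\<^sub>R g w t)"
  have Z: "finite (Z k)" "Z k \<subseteq> critical_zeros q chi" for k
  proof -
   have "finite (zeros_in_box q chi c (T k))" using finite_Lreg_zeros[OF chi bounded_box] by (simp add: zeros_in_box_def)
   thus "finite (Z k)" by (simp add: Z_def)
   show "Z k \<subseteq> critical_zeros q chi"
    using GRHR_Lreg_zero(2)[OF G chi] c(1) by (auto simp: Z_def critical_zeros_def zeros_in_box_def in_box_complex_iff)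
  qed
  have gc: "continuous_on UNIV (g w)" if w: "Re w > 0" for w
  proof -
   have Rh: "Lreg q chi holomorphic_on UNIV" by (rule Lreg_holomorphic[OF chi])
   have "continuous_on UNIV (\<lambda>t. Lreg q chi (Complex c t))" "continuous_on UNIV (\<lambda>t. deriv (Lreg q chi) (Complex c t))"
    by (rule continuous_on_compose2[OF holomorphic_on_imp_continuous_on[OF Rh] continuous_on_vertical],
      simp, rule continuous_on_compose2[OF holomorphic_on_imp_continuous_on[OF holomorphic_deriv[OF Rh open_UNIV]] continuous_on_vertical], simp)
   moreover have "continuous_on UNIV (\<lambda>t. mellin_kernel w (Complex c t))"
    by (rule continuous_on_compose2[OF holomorphic_on_imp_continuous_on[OF mellin_kernel_holomorphic[OF w]] continuous_on_vertical]) (use c in auto)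
   moreover have "continuous_on UNIV (\<lambda>t. if principal_character q chi then 1 / (Complex c t - 1) else 0)"
    by (cases "principal_character q chi") (use c in \<open>auto intro!: continuous_intros continuous_on_vertical simp: complex_eq_iff\<close>)
   ultimately show ?thesis unfolding g_def logderiv_L_def using Rc by (intro continuous_intros) auto
  qed
  have ai: "integrable lborel (a w k)" if "Re w = 1" for w k
  proof -
   have "integrable lborel (\<lambda>t. indicator {u..v} t *\<^sub>R g w t)" for u v
    using gc[of w] that by (intro borel_integrable_compact) (auto elim: continuous_on_subset)
   thus ?thesis unfolding a_def scaleR_add_left by (intro Bochner_Integration.integrable_add)
  qed
  have ab: "cmod (a w k t) \<le> C * log_cond q t * (cmod w powr (- c) * exp (- (1 / cmod w) * \<bar>t\<bar>))" (is "_ \<le> ?b") if w: "Re w = 1" for w k t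
  proof (cases "\<bar>t\<bar> \<ge> 1")
   case False
   hence "a w k t = 0" by (auto simp: a_def indicator_def)
   thus ?thesis using Cpos l[of t] by simp
  next
   case True
   have "(\<Sum>p\<in>real_zeros q chi. real (zmult q chi p) / cmod (Complex c t - p)) \<le> (\<Sum>p\<in>real_zeros q chi. real (zmult q chi p))"
   proof (rule sum_mono)
    fix p assume "p \<in> real_zeros q chi"
    hence "Im (Complex c t - p) = t" by (simp add: real_zeros_iff)
    hence "cmod (Complex c t - p) \<ge> 1" using abs_Im_le_cmod[of "Complex c t - p"] True by simp
    thus "real (zmult q chi p) / cmod (Complex c t - p) \<le> real (zmult q chi p)" by (intro divide_le_self_nonneg) auto
   qed
   also have "\<dots> \<le> C1 * log_cond q t"
    using C1(3)[OF chi] log_cond_mono[OF q, of 0 t] C1(1) by (smt (verit) mult_left_mono abs_ge_zero abs_zero)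
   finally have L: "cmod (logderiv_L q chi (Complex c t)) \<le> (C3 + C1) * log_cond q t"
    using C3(2)[OF chi c(1,2) Rc, of t] by (simp add: algebra_simps)
   have K: "cmod (mellin_kernel w (Complex c t)) \<le> C2 * (cmod w powr (- c) * exp (- (1 / cmod w) * \<bar>t\<bar>))"
    using C2(2)[of w c t] w c by (simp add: mult.assoc)
   have "cmod (a w k t) \<le> cmod (g w t)" by (auto simp: a_def indicator_def)
   also have "\<dots> \<le> cmod (logderiv_L q chi (Complex c t) * mellin_kernel w (Complex c t))"
    unfolding g_def norm_divide using pi_gt3 by (intro divide_le_self_nonneg) auto
   also have "\<dots> \<le> ((C3 + C1) * log_cond q t) * (C2 * (cmod w powr (- c) * exp (- (1 / cmod w) * \<bar>t\<bar>)))"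
    unfolding norm_mult by (intro mult_mono L K order_trans[OF norm_ge_zero L]) auto
   also have "\<dots> = ((C3 + C1) * C2) * (log_cond q t * (cmod w powr (- c) * exp (- (1 / cmod w) * \<bar>t\<bar>)))" by (simp add: mult_ac)
   also have "\<dots> \<le> C * (log_cond q t * (cmod w powr (- c) * exp (- (1 / cmod w) * \<bar>t\<bar>)))"
    using Cge(2) l[of t] by (intro mult_right_mono) auto
   finally show ?thesis by (simp add: mult.assoc)
  qed
  have lim: "\<exists>V. cmod V \<le> C * log_cond q 0 * (x * cmod w) powr (-1/2) \<and>
      (\<lambda>k. Phi q chi (of_real x * w) + V
       + of_real (x powr (-1/2)) * (\<Sum>p\<in>Z k. (of_nat (zmult q chi p) * mellin_kernel w p) * exp (- (\<i> * of_real (Im p) * of_real (ln x))))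
       + of_real (x powr (- c)) * (\<integral>t. a w k t * exp (- (\<i> * of_real t * of_real (ln x))) \<partial>lborel)) \<longlonglongrightarrow> 0"
   if w: "Re w = 1" and x: "x > 0" "x * cmod w \<le> 16" for w x
  proof -
   define z where "z = of_real x * w"
   have w0: "w \<noteq> 0" using w by auto
   have z: "Re z > 0" "cmod z = x * cmod w" using w x by (auto simp: z_def norm_mult)
   define F where "F = (\<lambda>t. logderiv_L q chi (Complex c t) * mellin_kernel z (Complex c t))"
   define E where "E = (\<lambda>t::real. exp (- (\<i> * of_real t * of_real (ln x))))"
   define V where "V = (\<Sum>p\<in>{p\<in>real_zeros q chi. c < Re p \<and> Re p < 1/2}. of_nat (zmult q chi p) * mellin_kernel z p) + integral {-1..1} F / (2 * pi)"
   have Vb: "cmod V \<le> C * log_cond q 0 * (x * cmod w) powr (-1/2)"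
   proof -
    have "cmod V \<le> C4 * log_cond q 0 * cmod z powr (-1/2)"
     unfolding V_def F_def by (rule C4(2)[OF chi c good]) (use z x in auto)
    also have "\<dots> \<le> C * log_cond q 0 * cmod z powr (-1/2)" using Cge(1) l[of 0] by (intro mult_right_mono) auto
    finally show ?thesis by (simp add: z)
   qed
   have S: "(\<Sum>p\<in>{p\<in>zeros_in_box q chi c (T k). Im p \<noteq> 0}. of_nat (zmult q chi p) * mellin_kernel z p)
     = of_real (x powr (-1/2)) * (\<Sum>p\<in>Z k. (of_nat (zmult q chi p) * mellin_kernel w p) * E (Im p))" for k
    unfolding sum_distrib_left
   proof (intro sum.cong)
    show "{p\<in>zeros_in_box q chi c (T k). Im p \<noteq> 0} = Z k" by (simp add: Z_def)
    fix p assume "p \<in> Z k"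
    hence Rp: "- Re p = -1/2" using Z(2)[of k] by (auto simp: critical_zeros_def)
    have "mellin_kernel z p = of_real (x powr (-1/2)) * (mellin_kernel w p * E (Im p))"
     using mellin_kernel_scale[OF x(1) w0, of p] unfolding Rp z_def E_def .
    thus "of_nat (zmult q chi p) * mellin_kernel z p = of_real (x powr (-1/2)) * ((of_nat (zmult q chi p) * mellin_kernel w p) * E (Im p))"
     by (simp only: mult_ac)
   qed
   have Fg: "F t / (2 * pi) = of_real (x powr (- c)) * (g w t * E t)" for t
    using mellin_kernel_scale[OF x(1) w0, of "Complex c t"] by (simp add: F_def g_def z_def E_def)
   have Ec: "continuous_on UNIV E" unfolding E_def by (intro continuous_intros)
   have gE: "continuous_on UNIV (\<lambda>t. g w t * E t)" using gc[of w] w by (intro continuous_intros Ec) auto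
   have Fc: "continuous_on UNIV F"
   proof -
    have "F = (\<lambda>t. 2 * pi * (of_real (x powr (- c)) * (g w t * E t)))" using Fg by (auto simp: fun_eq_iff field_simps)
    thus ?thesis by (simp only:) (intro continuous_intros gE)
   qed
   have Fi: "F integrable_on {u..v}" for u v by (rule integrable_continuous_interval[OF continuous_on_subset[OF Fc]]) simp
   have seg: "integral {u..v} F / (2 * pi) = of_real (x powr (- c)) * (\<integral>t. indicator {u..v} t *\<^sub>R (g w t * E t) \<partial>lborel)"
    and segi: "integrable lborel (\<lambda>t. indicator {u..v} t *\<^sub>R (g w t * E t))" for u v
   proof -
    show si: "integrable lborel (\<lambda>t. indicator {u..v} t *\<^sub>R (g w t * E t))"
     by (intro borel_integrable_compact continuous_on_subset[OF gE]) auto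
    have "integral {u..v} F / (2 * pi) = integral {u..v} (\<lambda>t. F t / (2 * pi))" by simp
    also have "\<dots> = of_real (x powr (- c)) * integral {u..v} (\<lambda>t. g w t * E t)" unfolding Fg by simp
    also have "integral {u..v} (\<lambda>t. g w t * E t) = (\<integral>t. indicator {u..v} t *\<^sub>R (g w t * E t) \<partial>lborel)"
     using set_borel_integral_eq_integral(2)[of "{u..v}" "\<lambda>t. g w t * E t"] si unfolding set_integrable_def set_lebesgue_integral_def by simp
    finally show "integral {u..v} F / (2 * pi) = of_real (x powr (- c)) * (\<integral>t. indicator {u..v} t *\<^sub>R (g w t * E t) \<partial>lborel)" .
   qed
   have I: "integral {-T k..T k} F / (2 * pi) = integral {-1..1} F / (2 * pi) + of_real (x powr (- c)) * (\<integral>t. a w k t * E t \<partial>lborel)" for k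
   proof -
    have "integral {-T k..T k} F = integral {-T k..-1} F + integral {-1..T k} F"
     using T1'[of k] by (intro Henstock_Kurzweil_Integration.integral_combine[symmetric] Fi) auto
    also have "integral {-1..T k} F = integral {-1..1} F + integral {1..T k} F"
     using T1'[of k] by (intro Henstock_Kurzweil_Integration.integral_combine[symmetric] Fi) auto
    finally have "integral {-T k..T k} F / (2 * pi) = integral {-1..1} F / (2 * pi) + (integral {-T k..-1} F / (2 * pi) + integral {1..T k} F / (2 * pi))"
     by (simp add: add_divide_distrib)
    also have "integral {-T k..-1} F / (2 * pi) + integral {1..T k} F / (2 * pi) =
      of_real (x powr (- c)) * ((\<integral>t. indicator {-T k..-1} t *\<^sub>R (g w t * E t) \<partial>lborel) + (\<integral>t. indicator {1..T k} t *\<^sub>R (g w t * E t) \<partial>lborel))"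
     unfolding seg by (rule distrib_left[symmetric])
    also have "(\<integral>t. indicator {-T k..-1} t *\<^sub>R (g w t * E t) \<partial>lborel) + (\<integral>t. indicator {1..T k} t *\<^sub>R (g w t * E t) \<partial>lborel)
      = (\<integral>t. indicator {-T k..-1} t *\<^sub>R (g w t * E t) + indicator {1..T k} t *\<^sub>R (g w t * E t) \<partial>lborel)"
     by (rule Bochner_Integration.integral_add[OF segi segi, symmetric])
    also have "\<dots> = (\<integral>t. a w k t * E t \<partial>lborel)" by (simp add: a_def scaleR_add_left distrib_right)
    finally show ?thesis .
   qed
   have "(\<lambda>k. Phi q chi z + V + of_real (x powr (-1/2)) * (\<Sum>p\<in>Z k. (of_nat (zmult q chi p) * mellin_kernel w p) * E (Im p))
       + of_real (x powr (- c)) * (\<integral>t. a w k t * E t \<partial>lborel)) \<longlonglongrightarrow> 0"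
    using explicit_formula_Phi[OF G chi z(1) c T] unfolding S F_def[symmetric] I V_def by (simp add: add_ac)
   thus ?thesis using Vb unfolding z_def E_def by blast
  qed
  show ?thesis unfolding Phi_approximation_def using c Z ai ab lim by (intro exI[of _ c] exI[of _ Z] exI[of _ a] conjI allI impI) blast+
 qed
 thus ?thesis using Cpos by blast
qed

lemma nn_integral_parabola_le:
 fixes A B k :: real
 assumes "0 < A" "A < B" "k \<ge> 0"
 shows "(\<integral>\<^sup>+x. ennreal (indicator {A..B} x * ((x - A) * (B - x)) * k) \<partial>lborel) \<le> ennreal (B ^ 3 * k)"
proof -
 have "(\<integral>\<^sup>+x. ennreal (indicator {A..B} x * ((x - A) * (B - x)) * k) \<partial>lborel) \<le> (\<integral>\<^sup>+x. ennreal (B * B * k) * indicator {A..B} x \<partial>lborel)"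
 proof (intro nn_integral_mono)
  fix x :: real
  show "ennreal (indicator {A..B} x * ((x - A) * (B - x)) * k) \<le> ennreal (B * B * k) * indicator {A..B} x"
   using assms by (cases "x \<in> {A..B}") (auto intro!: ennreal_leI mult_right_mono mult_mono)
 qed
 also have "\<dots> = ennreal (B * B * k) * emeasure lborel {A..B}" by (rule nn_integral_cmult_indicator) simp
 also have "\<dots> = ennreal (B * B * k * (B - A))" using assms by (simp add: ennreal_mult'')
 also have "\<dots> \<le> ennreal (B ^ 3 * k)"
 proof (rule ennreal_leI)
  have "B * B * k * (B - A) \<le> B * B * k * B" using assms by (intro mult_left_mono) auto
  thus "B * B * k * (B - A) \<le> B ^ 3 * k" by (simp add: power3_eq_cube mult_ac)
 qed
 finally show ?thesis .
qed

lemma norm_sum3_squared_le: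
 fixes u v w :: complex
 shows "(cmod (u + v + w))^2 \<le> 3 * ((cmod u)^2 + (cmod v)^2 + (cmod w)^2)"
proof -
 have "cmod (u + v + w) \<le> cmod u + cmod v + cmod w" by (meson add_mono norm_triangle_le order_refl norm_triangle_ineq)
 hence "(cmod (u + v + w))^2 \<le> (cmod u + cmod v + cmod w)^2" by (intro power_mono) auto
 also have "\<dots> \<le> 3 * ((cmod u)^2 + (cmod v)^2 + (cmod w)^2)"
  using sum_squares_bound[of "cmod u" "cmod v"] sum_squares_bound[of "cmod u" "cmod w"] sum_squares_bound[of "cmod v" "cmod w"]
  by (simp add: power2_eq_square algebra_simps)
 finally show ?thesis .
qed

text \<open>The factor x undoes the square of x^(-1/2). With X = |1 + iv|, the squared kernel
  carries 1 / X and the weighted number of zeros carries X, so the bound depends on v through the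
  logarithm only. This makes a later integral over v linear in its range, up to logarithms.\<close>

lemma ray_mean_square:
 assumes G: GRHR
 shows "\<exists>C>0. \<forall>q chi A B v. dirichlet_character q chi --> 0 < A --> A < B --> B * cmod (Complex 1 v) \<le> 16 -->
  (\<integral>\<^sup>+x. ennreal (indicator {A..B} x * ((x - A) * (B - x)) * (x * (cmod (Phi q chi (of_real x * Complex 1 v)))^2)) \<partial>lborel)
   \<le> ennreal (C * B ^ 3 * (log_cond q (cmod (Complex 1 v)))^2)"
  (is "\<exists>C>0. \<forall>q chi A B v. ?chi q chi --> ?A A --> ?AB A B --> ?Bv B v --> ?P C q chi A B v")
proof -
 obtain C1 where C1: "C1 > 0" and dec: "\<And>q chi. dirichlet_character q chi ==> \<exists>c Z a. Phi_approximation q chi C1 c Z a"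
  using Phi_decomposition[OF G] by blast
 obtain C2 where C2: "C2 > 0" "\<And>z \<sigma> t. Re z > 0 ==> 1/4 \<le> \<sigma> ==> \<sigma> \<le> 1/2 ==> cmod (mellin_kernel z (Complex \<sigma> t)) \<le> C2 * cmod z powr (- \<sigma>) * exp (- (Re z / cmod z) * \<bar>t\<bar>)"
  using mellin_kernel_bounds by blast
 obtain C5 where C5: "C5 > 0" and sums: "\<And>q chi Z. dirichlet_character q chi ==> finite Z ==> Z \<subseteq> critical_zeros q chi ==>
   (\<forall>u. (\<Sum>z\<in>Z. real (zmult q chi z) * (1 / (1 + (u - Im z)^2))) \<le> C5 * log_cond q u) \<and>
   (\<forall>X\<ge>1. (\<Sum>z\<in>Z. real (zmult q chi z) * (exp (- (2 / X) * \<bar>Im z\<bar>) * log_cond q (Im z))) \<le> C5 * X * (log_cond q X)^2)"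
  using critical_zero_sums by blast
 define DV where "DV = 3 * C1^2"
 define DG where "DG = 5 * C2^2 * C5 * C5"
 define DH where "DH = 16 * 6400 * C1^2"
 define C where "C = DV + 3 * DG + 3 * DH"
 have pos: "DV > 0" "DG > 0" "DH > 0" using C1 C2(1) C5 by (auto simp: DV_def DG_def DH_def)
 have "?P C q chi A B v"
  if chi: "dirichlet_character q chi" and A: "0 < A" "A < B" and B: "B * cmod (Complex 1 v) \<le> 16" for q chi A B v
 proof -
  define w where "w = Complex 1 v"
  define X where "X = cmod w"
  have w: "Re w = 1" by (simp add: w_def)
  have X: "X \<ge> 1" using complex_Re_le_cmod[of w] w by (simp add: X_def)
  have BX: "B * X \<le> 16" using B by (simp add: X_def w_def)
  have q: "q > 0" using chi by (simp add: dirichlet_character_def)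
  have l: "log_cond q s \<ge> 1/2" for s by (rule log_cond_ge[OF q])
  have l0: "log_cond q s \<ge> 0" for s using l[of s] by linarith
  have [measurable]: "log_cond q \<in> borel_measurable borel" unfolding log_cond_def[abs_def] by measurable
  define L where "L = log_cond q X"
  have L: "L \<ge> 1/2" "log_cond q 0 \<le> L" using l log_cond_mono[OF q, of 0 X] by (auto simp: L_def)
  obtain c Z a where c: "1/4 \<le> c" "c \<le> 3/8" and Z: "\<And>k::nat. finite (Z k)" "\<And>k. Z k \<subseteq> critical_zeros q chi"
   and a: "\<And>k. integrable lborel (a w k)" "\<And>k t. cmod (a w k t) \<le> C1 * log_cond q t * (X powr (- c) * exp (- (1 / X) * \<bar>t\<bar>))"
   and lim: "\<And>x. x > 0 ==> x * X \<le> 16 ==> \<exists>V. cmod V \<le> C1 * log_cond q 0 * (x * X) powr (-1/2) \<and>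
      (\<lambda>k. Phi q chi (of_real x * w) + V
       + of_real (x powr (-1/2)) * (\<Sum>p\<in>Z k. (of_nat (zmult q chi p) * mellin_kernel w p) * exp (- (\<i> * of_real (Im p) * of_real (ln x))))
       + of_real (x powr (- c)) * (\<integral>t. a w k t * exp (- (\<i> * of_real t * of_real (ln x))) \<partial>lborel)) \<longlonglongrightarrow> 0"
  proof -
   obtain c Z a where h: "Phi_approximation q chi C1 c Z a" using dec[OF chi] by blast
   show ?thesis
    by (rule that[of c Z a]) (use h w in \<open>simp_all add: X_def Phi_approximation_def\<close>)
  qed
  define W where "W = (\<lambda>x. indicator {A..B} x * ((x - A) * (B - x)))"
  have W0: "W x \<ge> 0" for x by (auto simp: W_def indicator_def)
  have Wm[measurable]: "W \<in> borel_measurable borel" unfolding W_def by measurable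
  define Gs where "Gs = (\<lambda>k x. \<Sum>p\<in>Z k. (of_nat (zmult q chi p) * mellin_kernel w p) * exp (- (\<i> * of_real (Im p) * complex_of_real (ln x))))"
  define Hs where "Hs = (\<lambda>k x. \<integral>t. a w k t * exp (- (\<i> * of_real t * complex_of_real (ln x))) \<partial>lborel)"
  have [measurable]: "Gs k \<in> borel_measurable borel" for k unfolding Gs_def by measurable
  have [measurable]: "a w k \<in> borel_measurable borel" for k using borel_measurable_integrable[OF a(1)[of k]] by simp
  have [measurable]: "Hs k \<in> borel_measurable borel" for k
   unfolding Hs_def by (rule lborel.borel_measurable_lebesgue_integral) measurable
  have GI: "(\<integral>\<^sup>+x. ennreal (W x * (cmod (Gs k x))^2) \<partial>lborel) \<le> ennreal (B ^ 3 * (DG * L^2))" for k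
  proof -
   let ?M = "count_space (Z k)" and ?b = "\<lambda>p. C2 * X powr (-1/2) * exp (- (1 / X) * \<bar>Im p\<bar>)"
   have Gs_eq: "Gs k x = (\<integral>p. (of_nat (zmult q chi p) * mellin_kernel w p) * exp (- (\<i> * of_real (Im p) * complex_of_real (ln x))) \<partial>?M)" for x
    unfolding Gs_def by (rule lebesgue_integral_count_space_finite[OF Z(1), symmetric])
   have "(\<integral>\<^sup>+x. ennreal (W x * (cmod (Gs k x))^2) \<partial>lborel) \<le> (\<integral>\<^sup>+p. ennreal (5 * B ^ 3 * (real (zmult q chi p) * (?b p)^2 * (C5 * log_cond q (Im p)))) \<partial>?M)"
    unfolding W_def Gs_eq
   proof (rule mellin_Schur[OF _ _ _ A])
    show "sigma_finite_measure ?M" by (rule sigma_finite_measure_count_space_finite[OF Z(1)])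
    show "integrable ?M (\<lambda>p. of_nat (zmult q chi p) * mellin_kernel w p)" by (rule integrable_count_space[OF Z(1)])
    fix p assume "p \<in> space ?M"
    hence p: "p \<in> Z k" by simp
    hence Rp: "Re p = 1/2" using Z(2) by (auto simp: critical_zeros_def)
    have pe: "Complex (1/2) (Im p) = p" using Rp by (simp add: complex_eq_iff)
    have "cmod (mellin_kernel w (Complex (1/2) (Im p))) \<le> ?b p"
     using C2(2)[of w "1/2" "Im p"] w by (simp add: X_def)
    thus "cmod (of_nat (zmult q chi p) * mellin_kernel w p) \<le> real (zmult q chi p) * ?b p"
     unfolding pe norm_mult norm_of_nat by (intro mult_left_mono) auto
    have "(\<integral>\<^sup>+s. ennreal (real (zmult q chi s) / (1 + (Im p - Im s)^2)) \<partial>?M) = (\<Sum>s\<in>Z k. ennreal (real (zmult q chi s) / (1 + (Im p - Im s)^2)))"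
     by (rule nn_integral_count_space_finite[OF Z(1)])
    also have "\<dots> = ennreal (\<Sum>s\<in>Z k. real (zmult q chi s) * (1 / (1 + (Im p - Im s)^2)))"
     by (subst sum_ennreal) (auto intro!: divide_nonneg_nonneg add_nonneg_nonneg)
    also have "\<dots> \<le> ennreal (C5 * log_cond q (Im p))" using sums[OF chi Z(1) Z(2)] by (intro ennreal_leI) blast
    finally show "(\<integral>\<^sup>+s. ennreal (real (zmult q chi s) / (1 + (Im p - Im s)^2)) \<partial>?M) \<le> ennreal (C5 * log_cond q (Im p))" .
   qed (use C5 l0 in auto)
   also have "\<dots> = (\<Sum>p\<in>Z k. ennreal (5 * B ^ 3 * (real (zmult q chi p) * (?b p)^2 * (C5 * log_cond q (Im p)))))"
    by (rule nn_integral_count_space_finite[OF Z(1)])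
   also have "\<dots> = ennreal (\<Sum>p\<in>Z k. 5 * B ^ 3 * (real (zmult q chi p) * (?b p)^2 * (C5 * log_cond q (Im p))))"
    using A C5 l0 by (intro sum_ennreal) auto
   also have "(\<Sum>p\<in>Z k. 5 * B ^ 3 * (real (zmult q chi p) * (?b p)^2 * (C5 * log_cond q (Im p))))
     = (5 * B ^ 3 * C2^2 * C5 / X) * (\<Sum>p\<in>Z k. real (zmult q chi p) * (exp (- (2 / X) * \<bar>Im p\<bar>) * log_cond q (Im p)))"
    unfolding sum_distrib_left
   proof (intro sum.cong refl)
    fix p
    have "(X powr (-1/2))^2 = 1 / X" using X by (subst powr_power) (auto simp: powr_minus_divide)
    moreover have "(exp (- (1 / X) * \<bar>Im p\<bar>))^2 = exp (- (2 / X) * \<bar>Im p\<bar>)" by (simp flip: exp_double)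
    ultimately have "(?b p)^2 = C2^2 * (1 / X) * exp (- (2 / X) * \<bar>Im p\<bar>)" by (simp only: power_mult_distrib)
    thus "5 * B ^ 3 * (real (zmult q chi p) * (?b p)^2 * (C5 * log_cond q (Im p))) =
      5 * B ^ 3 * C2^2 * C5 / X * (real (zmult q chi p) * (exp (- (2 / X) * \<bar>Im p\<bar>) * log_cond q (Im p)))" by (simp add: mult_ac)
   qed
   also have "\<dots> \<le> (5 * B ^ 3 * C2^2 * C5 / X) * (C5 * X * L^2)"
    using sums[OF chi Z(1) Z(2)] X A C5 unfolding L_def by (intro mult_left_mono) auto
   also have "\<dots> = B ^ 3 * (DG * L^2)" using X by (simp add: DG_def)
   finally show ?thesis by (simp add: ennreal_leI)
  qed
  have HI: "(\<integral>\<^sup>+x. ennreal (W x * (cmod (Hs k x))^2) \<partial>lborel) \<le> ennreal (6400 * B ^ 3 * C1^2 * X powr (1 - 2 * c) * L^2)" for k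
  proof -
   let ?b = "\<lambda>t. C1 * (X powr (- c) * exp (- (1 / X) * \<bar>t\<bar>))"
   have "(\<integral>\<^sup>+x. ennreal (W x * (cmod (Hs k x))^2) \<partial>lborel) \<le> (\<integral>\<^sup>+t. ennreal (5 * B ^ 3 * (log_cond q t * (?b t)^2 * (40 * log_cond q t))) \<partial>lborel)"
    unfolding W_def Hs_def
   proof (rule mellin_Schur[where \<tau> = "\<lambda>t. t", OF _ a(1) _ A])
    fix t :: real
    show "cmod (a w k t) \<le> log_cond q t * ?b t" using a(2)[of k t] by (simp add: mult_ac)
    show "(\<integral>\<^sup>+s. ennreal (log_cond q s / (1 + (t - s)^2)) \<partial>lborel) \<le> ennreal (40 * log_cond q t)"
     using nn_integral_log_cond_kernel[OF q, of t] by simp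
   qed (use l0 in \<open>auto simp: sigma_finite_lborel\<close>)
   also have "\<dots> = (\<integral>\<^sup>+t. ennreal (200 * B ^ 3 * C1^2 * X powr (- 2 * c)) * ennreal (exp (- (2 / X) * \<bar>t\<bar>) * (log_cond q t)^2) \<partial>lborel)"
   proof (intro nn_integral_cong)
    fix t :: real
    have "(X powr (- c))^2 = X powr (- 2 * c)" using X by (subst powr_power) auto
    moreover have "(exp (- (1 / X) * \<bar>t\<bar>))^2 = exp (- (2 / X) * \<bar>t\<bar>)" by (simp flip: exp_double)
    ultimately have bt: "(?b t)^2 = C1^2 * (X powr (- 2 * c) * exp (- (2 / X) * \<bar>t\<bar>))" by (simp only: power_mult_distrib)
    have "5 * B ^ 3 * (log_cond q t * (?b t)^2 * (40 * log_cond q t)) = (200 * B ^ 3 * C1^2 * X powr (- 2 * c)) * (exp (- (2 / X) * \<bar>t\<bar>) * (log_cond q t)^2)"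
     unfolding bt by (simp add: power2_eq_square mult_ac)
    thus "ennreal (5 * B ^ 3 * (log_cond q t * (?b t)^2 * (40 * log_cond q t))) = ennreal (200 * B ^ 3 * C1^2 * X powr (- 2 * c)) * ennreal (exp (- (2 / X) * \<bar>t\<bar>) * (log_cond q t)^2)"
     by (simp only: ennreal_mult'' zero_le_mult_iff exp_ge_zero zero_le_power2 simp_thms)
   qed
   also have "\<dots> = ennreal (200 * B ^ 3 * C1^2 * X powr (- 2 * c)) * (\<integral>\<^sup>+t. ennreal (exp (- (2 / X) * \<bar>t\<bar>) * (log_cond q t)^2) \<partial>lborel)"
    by (rule nn_integral_cmult) measurable
   also have "\<dots> \<le> ennreal (200 * B ^ 3 * C1^2 * X powr (- 2 * c)) * ennreal (32 * X * (log_cond q X)^2)"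
    using X by (intro mult_left_mono nn_integral_exp_log_cond[OF q]) auto
   also have "\<dots> = ennreal (200 * B ^ 3 * C1^2 * X powr (- 2 * c) * (32 * X * (log_cond q X)^2))"
    using X by (intro ennreal_mult''[symmetric]) auto
   also have "200 * B ^ 3 * C1^2 * X powr (- 2 * c) * (32 * X * (log_cond q X)^2) = 6400 * B ^ 3 * C1^2 * X powr (1 - 2 * c) * L^2"
    using X by (simp add: L_def powr_diff powr_minus_divide)
   finally show ?thesis .
  qed
  \<comment> \<open>On the line Re s = c < 1/2 the powers of x and of X do not cancel separately.
    Together they are at most (B X)^(1 - 2 c), which is bounded because B X \<le> 16.\<close>
  define Q where "Q = B powr (1 - 2 * c)"
  define U where "U = (\<lambda>k x. ennreal (W x * (DV * L^2)) + (ennreal 3 * ennreal (W x * (cmod (Gs k x))^2) + ennreal (3 * Q) * ennreal (W x * (cmod (Hs k x))^2)))"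
  have Um: "U k \<in> borel_measurable lborel" for k unfolding U_def by measurable
  have QX: "Q * X powr (1 - 2 * c) \<le> 16"
  proof -
   have "Q * X powr (1 - 2 * c) = (B * X) powr (1 - 2 * c)" using A X by (simp add: Q_def powr_mult)
   also have "\<dots> \<le> 16 powr (1 - 2 * c)" using BX A X c by (intro powr_mono2) auto
   also have "\<dots> \<le> 16 powr 1" using c by (intro powr_mono) auto
   finally show ?thesis by simp
  qed
  have UI: "integral\<^sup>N lborel (U k) \<le> ennreal (C * B ^ 3 * L^2)" for k
  proof -
   have "integral\<^sup>N lborel (U k) = (\<integral>\<^sup>+x. ennreal (W x * (DV * L^2)) \<partial>lborel) +
     (ennreal 3 * (\<integral>\<^sup>+x. ennreal (W x * (cmod (Gs k x))^2) \<partial>lborel) + ennreal (3 * Q) * (\<integral>\<^sup>+x. ennreal (W x * (cmod (Hs k x))^2) \<partial>lborel))"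
    unfolding U_def by (subst nn_integral_add, measurable, subst nn_integral_add, measurable, subst nn_integral_cmult, measurable, subst nn_integral_cmult, measurable)
   also have "\<dots> \<le> ennreal (B ^ 3 * (DV * L^2)) + (ennreal 3 * ennreal (B ^ 3 * (DG * L^2)) + ennreal (3 * Q) * ennreal (6400 * B ^ 3 * C1^2 * X powr (1 - 2 * c) * L^2))"
    using pos(1) unfolding W_def by (intro add_mono mult_left_mono GI[unfolded W_def] HI[unfolded W_def] nn_integral_parabola_le A) auto
   also have "\<dots> = ennreal (B ^ 3 * (DV * L^2) + (3 * (B ^ 3 * (DG * L^2)) + 3 * Q * (6400 * B ^ 3 * C1^2 * X powr (1 - 2 * c) * L^2)))"
   proof -
    have B0: "B > 0" "Q \<ge> 0" using A by (auto simp: Q_def)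
    have e1: "ennreal 3 * ennreal (B ^ 3 * (DG * L^2)) = ennreal (3 * (B ^ 3 * (DG * L^2)))"
     by (rule ennreal_mult''[symmetric]) (use pos B0 in auto)
    have e2: "ennreal (3 * Q) * ennreal (6400 * B ^ 3 * C1^2 * X powr (1 - 2 * c) * L^2) = ennreal (3 * Q * (6400 * B ^ 3 * C1^2 * X powr (1 - 2 * c) * L^2))"
     by (rule ennreal_mult''[symmetric]) (use B0 in auto)
    show ?thesis unfolding e1 e2 using pos B0 by simp
   qed
   also have "\<dots> \<le> ennreal (C * B ^ 3 * L^2)"
   proof (rule ennreal_leI)
    have "3 * Q * (6400 * B ^ 3 * C1^2 * X powr (1 - 2 * c) * L^2) = (3 * 6400 * B ^ 3 * C1^2 * L^2) * (Q * X powr (1 - 2 * c))" by (simp only: mult_ac)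
    also have "\<dots> \<le> (3 * 6400 * B ^ 3 * C1^2 * L^2) * 16" using A by (intro mult_left_mono QX) auto
    finally show "B ^ 3 * (DV * L^2) + (3 * (B ^ 3 * (DG * L^2)) + 3 * Q * (6400 * B ^ 3 * C1^2 * X powr (1 - 2 * c) * L^2)) \<le> C * B ^ 3 * L^2"
     by (simp add: C_def DH_def algebra_simps)
   qed
   finally show ?thesis .
  qed
  have pt: "ennreal (W x * (x * (cmod (Phi q chi (of_real x * w)))^2)) \<le> liminf (\<lambda>k. U k x)" for x
  proof (cases "x \<in> {A..B}")
   case False
   thus ?thesis by (simp add: W_def)
  next
   case True
   hence x: "x > 0" "x \<le> B" using A by auto
   have xX: "x * X \<le> 16" using BX mult_right_mono[OF x(2), of X] X by linarith
   obtain V where V: "cmod V \<le> C1 * log_cond q 0 * (x * X) powr (-1/2)"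
    and Vlim: "(\<lambda>k. Phi q chi (of_real x * w) + V + of_real (x powr (-1/2)) * Gs k x + of_real (x powr (- c)) * Hs k x) \<longlonglongrightarrow> 0"
    using lim[OF x(1) xX] unfolding Gs_def Hs_def by blast
   define Y where "Y = (\<lambda>k. V + of_real (x powr (-1/2)) * Gs k x + of_real (x powr (- c)) * Hs k x)"
   have "(\<lambda>k. (Phi q chi (of_real x * w) + V + of_real (x powr (-1/2)) * Gs k x + of_real (x powr (- c)) * Hs k x) - Phi q chi (of_real x * w)) \<longlonglongrightarrow> 0 - Phi q chi (of_real x * w)"
    by (intro tendsto_diff Vlim tendsto_const)
   hence "Y \<longlonglongrightarrow> - Phi q chi (of_real x * w)" by (simp add: Y_def add_ac)
   hence "(\<lambda>k. W x * (x * (cmod (Y k))^2)) \<longlonglongrightarrow> W x * (x * (cmod (- Phi q chi (of_real x * w)))^2)" by (intro tendsto_intros)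
   hence "(\<lambda>k. ennreal (W x * (x * (cmod (Y k))^2))) \<longlonglongrightarrow> ennreal (W x * (x * (cmod (Phi q chi (of_real x * w)))^2))" by (intro tendsto_ennrealI) simp
   hence "ennreal (W x * (x * (cmod (Phi q chi (of_real x * w)))^2)) = liminf (\<lambda>k. ennreal (W x * (x * (cmod (Y k))^2)))"
    by (intro lim_imp_Liminf[symmetric]) auto
   also have "\<dots> \<le> liminf (\<lambda>k. U k x)"
   proof (intro Liminf_mono always_eventually allI)
    fix k
    have "x * (cmod V)^2 \<le> C1^2 * L^2"
    proof -
     have "(cmod V)^2 \<le> (C1 * log_cond q 0 * (x * X) powr (-1/2))^2" using V by (intro power_mono) auto
     also have "\<dots> = C1^2 * (log_cond q 0)^2 * (1 / (x * X))"
      unfolding power_mult_distrib using x X by (subst powr_power) (auto simp: powr_minus_divide)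
     finally have "x * (cmod V)^2 \<le> x * (C1^2 * (log_cond q 0)^2 * (1 / (x * X)))" using x by (intro mult_left_mono) auto
     also have "\<dots> = (C1^2 * (log_cond q 0)^2) / X" using x by simp
     also have "\<dots> \<le> C1^2 * (log_cond q 0)^2" using X by (intro divide_le_self_nonneg) auto
     also have "\<dots> \<le> C1^2 * L^2" using L(2) l0 by (intro mult_left_mono power_mono) auto
     finally show ?thesis .
    qed
    moreover have "x * (cmod (of_real (x powr (-1/2)) * Gs k x))^2 = (cmod (Gs k x))^2"
    proof -
     have "(x powr (-1/2))^2 = 1 / x" using x by (subst powr_power) (auto simp: powr_minus_divide)
     thus ?thesis unfolding norm_mult power_mult_distrib norm_of_real power2_abs using x by simp
    qed
    moreover have "x * (cmod (of_real (x powr (- c)) * Hs k x))^2 \<le> Q * (cmod (Hs k x))^2"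
    proof -
     have "(x powr (- c))^2 = x powr (- 2 * c)" using x by (subst powr_power) auto
     hence "x * (x powr (- c))^2 = x powr (1 - 2 * c)" using x by (simp add: powr_mult_base)
     also have "\<dots> \<le> Q" unfolding Q_def using x c by (intro powr_mono2) auto
     finally have "x * (x powr (- c))^2 * (cmod (Hs k x))^2 \<le> Q * (cmod (Hs k x))^2" by (intro mult_right_mono) auto
     thus ?thesis using x by (simp add: norm_mult power_mult_distrib mult.assoc)
    qed
    moreover have "DV * L^2 = 3 * (C1^2 * L^2)" "3 * Q * (cmod (Hs k x))^2 = 3 * (Q * (cmod (Hs k x))^2)" by (simp_all add: DV_def)
    ultimately have s: "3 * (x * (cmod V)^2 + x * (cmod (of_real (x powr (-1/2)) * Gs k x))^2 + x * (cmod (of_real (x powr (- c)) * Hs k x))^2)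
      \<le> DV * L^2 + (3 * (cmod (Gs k x))^2 + 3 * Q * (cmod (Hs k x))^2)" unfolding distrib_left by linarith
    have "x * (cmod (Y k))^2 \<le> x * (3 * ((cmod V)^2 + (cmod (of_real (x powr (-1/2)) * Gs k x))^2 + (cmod (of_real (x powr (- c)) * Hs k x))^2))"
     unfolding Y_def using x by (intro mult_left_mono norm_sum3_squared_le) auto
    also have "\<dots> = 3 * (x * (cmod V)^2 + x * (cmod (of_real (x powr (-1/2)) * Gs k x))^2 + x * (cmod (of_real (x powr (- c)) * Hs k x))^2)"
     by (simp only: distrib_left mult_ac)
    also note s
    finally have "W x * (x * (cmod (Y k))^2) \<le> W x * (DV * L^2 + (3 * (cmod (Gs k x))^2 + 3 * Q * (cmod (Hs k x))^2))"
     by (intro mult_left_mono W0)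
    also have "\<dots> = W x * (DV * L^2) + (3 * (W x * (cmod (Gs k x))^2) + 3 * Q * (W x * (cmod (Hs k x))^2))" by (simp add: algebra_simps)
    finally have "ennreal (W x * (x * (cmod (Y k))^2)) \<le> ennreal \<dots>" by (rule ennreal_leI)
    also have "\<dots> = U k x" unfolding U_def using W0[of x] pos(1)
     by (subst ennreal_plus, simp, simp add: Q_def, subst ennreal_plus) (auto simp: ennreal_mult Q_def intro!: mult_nonneg_nonneg)
    finally show "ennreal (W x * (x * (cmod (Y k))^2)) \<le> U k x" .
   qed
   finally show ?thesis .
  qed
  have "(\<integral>\<^sup>+x. ennreal (W x * (x * (cmod (Phi q chi (of_real x * w)))^2)) \<partial>lborel) \<le> (\<integral>\<^sup>+x. liminf (\<lambda>k. U k x) \<partial>lborel)"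
   by (intro nn_integral_mono pt)
  \<comment> \<open>Fatou's lemma: the bounds for the truncations are uniform in k, and pointwise
    convergence of the total to 0 is what the explicit formula provides.\<close>
  also have "\<dots> \<le> liminf (\<lambda>k. integral\<^sup>N lborel (U k))" by (rule nn_integral_liminf[OF Um])
  also have "\<dots> \<le> liminf (\<lambda>k::nat. ennreal (C * B ^ 3 * L^2))" by (intro Liminf_mono always_eventually allI UI)
  also have "\<dots> = ennreal (C * B ^ 3 * L^2)" by (simp add: Liminf_const)
  finally show ?thesis unfolding W_def L_def X_def w_def .
 qed
 moreover have "C > 0" using pos by (simp add: C_def add_pos_pos)
 ultimately show ?thesis by blast
qed

section \<open>From rays to vertical segments\<close>

lemma unit_interval_Cauchy_Schwarz:
 fixes f :: "real => real"
 assumes "continuous_on {0..1} f"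
 shows "(integral {0..1} f)^2 \<le> integral {0..1} (\<lambda>x. (f x)^2)"
proof -
 define m where "m = integral {0..1} f"
 have f: "f integrable_on {0..1}" "(\<lambda>x. (f x)^2) integrable_on {0..1}"
  using assms by (auto intro!: integrable_continuous_interval continuous_intros)
 have "0 \<le> integral {0..1} (\<lambda>x. (f x - m)^2)"
  by (rule integral_nonneg) (use assms in \<open>auto intro!: integrable_continuous_interval continuous_intros\<close>)
 also have "(\<lambda>x. (f x - m)^2) = (\<lambda>x. ((f x)^2 - (2 * m) * f x) + m^2)" by (auto simp: power2_eq_square algebra_simps)
 also have "integral {0..1} \<dots> = (integral {0..1} (\<lambda>x. (f x)^2) - (2 * m) * integral {0..1} f) + m^2"
  using f by (subst integral_add, auto intro!: integrable_diff integrable_on_mult_right, subst integral_diff, auto intro!: integrable_on_mult_right)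
 finally show ?thesis by (simp add: m_def power2_eq_square)
qed

text \<open>The length 2 r of the side and the distance r from z0 combine to the factor 2;
  Cauchy-Schwarz on the unit interval does the rest.\<close>

lemma linepath_mean_square:
 fixes f :: "complex => complex"
 assumes f: "continuous_on (closed_segment a b) f" and r: "r > 0" "\<And>w. w \<in> closed_segment a b ==> cmod (w - z0) \<ge> r" and ab: "cmod (b - a) = 2 * r"
 shows "(cmod (contour_integral (linepath a b) (\<lambda>w. f w / (w - z0))))^2 \<le> 4 * integral {0..1} (\<lambda>x. (cmod (f (linepath a b x)))^2)"
proof -
 let ?p = "linepath a b" and ?F = "\<lambda>w. f w / (w - z0)"
 have p: "?p x \<in> closed_segment a b" if "x \<in> {0..1}" for x using that linepath_in_path by blast
 have nz: "w - z0 \<noteq> 0" if "w \<in> closed_segment a b" for w using r(2)[OF that] r(1) by auto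
 have Fc: "continuous_on (closed_segment a b) ?F" using nz by (intro continuous_intros f) auto
 have fp: "continuous_on {0..1} (\<lambda>x. f (?p x))"
  by (rule continuous_on_compose2[OF f]) (use p in \<open>auto intro: continuous_on_linepath\<close>)
 have I: "((\<lambda>x. ?F (?p x) * (b - a)) has_integral contour_integral ?p ?F) {0..1}"
  using has_contour_integral_integral[OF contour_integrable_continuous_linepath[OF Fc]] by (simp add: has_contour_integral_linepath)
 have "cmod (contour_integral ?p ?F) = cmod (integral {0..1} (\<lambda>x. ?F (?p x) * (b - a)))" using I by (simp add: integral_unique)
 also have "\<dots> \<le> integral {0..1} (\<lambda>x. 2 * cmod (f (?p x)))"
 proof (rule integral_norm_bound_integral)
  show "(\<lambda>x. ?F (?p x) * (b - a)) integrable_on {0..1}" using I by blast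
  show "(\<lambda>x. 2 * cmod (f (?p x))) integrable_on {0..1}" by (intro integrable_continuous_interval continuous_intros fp)
  fix x :: real assume x: "x \<in> {0..1}"
  have "cmod (?F (?p x) * (b - a)) = cmod (f (?p x)) * (2 * r) / cmod (?p x - z0)" by (simp add: norm_mult norm_divide ab)
  also have "\<dots> \<le> cmod (f (?p x)) * (2 * r) / r" using r(1) r(2)[OF p[OF x]] by (intro divide_left_mono mult_pos_pos) auto
  finally show "cmod (?F (?p x) * (b - a)) \<le> 2 * cmod (f (?p x))" using r(1) by simp
 qed
 also have "\<dots> = 2 * integral {0..1} (\<lambda>x. cmod (f (?p x)))" by simp
 finally have "(cmod (contour_integral ?p ?F))^2 \<le> (2 * integral {0..1} (\<lambda>x. cmod (f (?p x))))^2" by (intro power_mono) auto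
 also have "\<dots> = 4 * (integral {0..1} (\<lambda>x. cmod (f (?p x))))^2" by (simp add: power_mult_distrib)
 also have "\<dots> \<le> 4 * integral {0..1} (\<lambda>x. (cmod (f (?p x)))^2)"
  by (intro mult_left_mono unit_interval_Cauchy_Schwarz continuous_intros fp) auto
 finally show ?thesis .
qed

text \<open>The sign of d is the orientation of a side; both signs occur when the boundary of a
  square is traversed.\<close>

lemma nn_integral_unit_interval_affine:
 fixes H :: "real => real"
 assumes [measurable]: "H \<in> borel_measurable borel" and H: "continuous_on {-r..r} H" "\<And>u. H u \<ge> 0" and r: "r > 0" "d = 2 * r \<or> d = - 2 * r"
 shows "ennreal (2 * r * integral {0..1} (\<lambda>x. H (- d / 2 + d * x))) = (\<integral>\<^sup>+u. ennreal (indicator {-r..r} u * H u) \<partial>lborel)"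
proof -
 have c: "continuous_on {0..1} (\<lambda>x. H (- d / 2 + d * x))"
 proof (rule continuous_on_compose2[OF H(1)])
  show "(\<lambda>x. - d / 2 + d * x) ` {0..1} \<subseteq> {-r..r}"
  proof clarsimp
   fix x :: real assume x: "0 \<le> x" "x \<le> 1"
   have "0 \<le> r * x" "r * x \<le> r" using x r(1) by (auto simp: mult_left_le)
   thus "- r \<le> d * x - d / 2 \<and> d * x - d / 2 \<le> r" using r(2) by auto
  qed
 qed (auto intro!: continuous_intros)
 have i0: "integral {0..1} (\<lambda>x. H (- d / 2 + d * x)) \<ge> 0" using c H(2) by (intro integral_nonneg integrable_continuous_interval)
 have eq: "indicator {-r..r} (- d / 2 + d * x) = (indicator {0..1} x :: real)" for x
 proof -
  have "- r \<le> - d / 2 + d * x \<and> - d / 2 + d * x \<le> r \<longleftrightarrow> 0 \<le> x \<and> x \<le> 1"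
   using r(2)
  proof
   assume "d = 2 * r"
   hence e: "- d / 2 + d * x = 2 * r * x - r" by simp
   have "r * x \<ge> 0 \<longleftrightarrow> x \<ge> 0" "r * x \<le> r \<longleftrightarrow> x \<le> 1" using r(1) by (simp_all add: zero_le_mult_iff)
   thus ?thesis unfolding e by linarith
  next
   assume "d = - 2 * r"
   hence e: "- d / 2 + d * x = r - 2 * r * x" by simp
   have "r * x \<ge> 0 \<longleftrightarrow> x \<ge> 0" "r * x \<le> r \<longleftrightarrow> x \<le> 1" using r(1) by (simp_all add: zero_le_mult_iff)
   thus ?thesis unfolding e by linarith
  qed
  thus ?thesis by (auto simp: indicator_def)
 qed
 have "(\<integral>\<^sup>+u. ennreal (indicator {-r..r} u * H u) \<partial>lborel) = ennreal \<bar>d\<bar> * (\<integral>\<^sup>+x. ennreal (indicator {-r..r} (- d / 2 + d * x) * H (- d / 2 + d * x)) \<partial>lborel)"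
  using r by (intro nn_integral_real_affine) auto
 also have "(\<integral>\<^sup>+x. ennreal (indicator {-r..r} (- d / 2 + d * x) * H (- d / 2 + d * x)) \<partial>lborel) = (\<integral>\<^sup>+x. ennreal (H (- d / 2 + d * x)) * indicator {0..1} x \<partial>lborel)"
  unfolding eq by (intro nn_integral_cong) (simp add: indicator_def)
 also have "\<dots> = ennreal (integral {0..1} (\<lambda>x. H (- d / 2 + d * x)))"
  by (rule nn_integral_has_integral_lebesgue') (use c H(2) in \<open>auto intro!: integrable_integral integrable_continuous_interval\<close>)
 also have "ennreal \<bar>d\<bar> * \<dots> = ennreal (2 * r * integral {0..1} (\<lambda>x. H (- d / 2 + d * x)))"
  using r i0 by (subst ennreal_mult''[symmetric]) (auto simp: abs_if)
 finally show ?thesis by simp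
qed

lemma norm_sum4_squared_le:
 fixes a b c d :: complex
 shows "(cmod (a + b + c + d))^2 \<le> 4 * ((cmod a)^2 + (cmod b)^2 + (cmod c)^2 + (cmod d)^2)"
proof -
 have "cmod (a + b + c + d) \<le> cmod a + cmod b + cmod c + cmod d" by (meson add_mono norm_triangle_le order_refl norm_triangle_ineq)
 hence "(cmod (a + b + c + d))^2 \<le> (cmod a + cmod b + cmod c + cmod d)^2" by (intro power_mono) auto
 also have "\<dots> \<le> 4 * ((cmod a)^2 + (cmod b)^2 + (cmod c)^2 + (cmod d)^2)"
  using sum_squares_bound[of "cmod a" "cmod b"] sum_squares_bound[of "cmod a" "cmod c"] sum_squares_bound[of "cmod a" "cmod d"]
   sum_squares_bound[of "cmod b" "cmod c"] sum_squares_bound[of "cmod b" "cmod d"] sum_squares_bound[of "cmod c" "cmod d"]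
  by (simp add: power2_eq_square algebra_simps)
 finally show ?thesis .
qed

text \<open>Cauchy's integral formula on the boundary, Cauchy-Schwarz on each side, and pi^2 \<ge>
  8. A square in place of a circle keeps the later average a product of two Lebesgue integrals, so
  that Fubini applies without polar coordinates.\<close>

lemma square_boundary_bound:
 fixes g :: "complex => complex"
 assumes gm[measurable]: "g \<in> borel_measurable borel" and g: "g holomorphic_on S" "open S" and sub: "cbox (z0 - Complex r r) (z0 + Complex r r) \<subseteq> S" and r: "r > 0"
 shows "ennreal (4 * r * (cmod (g z0))^2) \<le>
   (\<integral>\<^sup>+v. ennreal (indicator {-r..r} v * (cmod (g (z0 + Complex r v)))^2) \<partial>lborel) +
   (\<integral>\<^sup>+v. ennreal (indicator {-r..r} v * (cmod (g (z0 + Complex (-r) v)))^2) \<partial>lborel) +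
   (\<integral>\<^sup>+s. ennreal (indicator {-r..r} s * (cmod (g (z0 + Complex s r)))^2) \<partial>lborel) +
   (\<integral>\<^sup>+s. ennreal (indicator {-r..r} s * (cmod (g (z0 + Complex s (-r))))^2) \<partial>lborel)"
proof -
 let ?a1 = "z0 + Complex (-r) (-r)" and ?a2 = "z0 + Complex r (-r)" and ?a3 = "z0 + Complex r r" and ?a4 = "z0 + Complex (-r) r"
 let ?K = "cbox (z0 - Complex r r) (z0 + Complex r r)" and ?F = "\<lambda>w. g w / (w - z0)"
 have a1: "z0 - Complex r r = ?a1" by (simp add: complex_eq_iff)
 have rp: "rectpath ?a1 ?a3 = linepath ?a1 ?a2 +++ linepath ?a2 ?a3 +++ linepath ?a3 ?a4 +++ linepath ?a4 ?a1"
 proof -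
  have "Complex (Re ?a3) (Im ?a1) = ?a2" "Complex (Re ?a1) (Im ?a3) = ?a4" by (simp_all add: complex_eq_iff)
  thus ?thesis by (simp add: rectpath_def Let_def)
 qed
 have gc: "continuous_on ?K g" using holomorphic_on_imp_continuous_on[OF g(1)] sub by (rule continuous_on_subset)
 have cv: "convex ?K" by (rule convex_box)
 have inK: "?a1 \<in> ?K" "?a2 \<in> ?K" "?a3 \<in> ?K" "?a4 \<in> ?K" using r by (auto simp: in_cbox_complex_iff)
 have seg: "closed_segment u v \<subseteq> ?K" if "u \<in> ?K" "v \<in> ?K" for u v using cv that by (rule closed_segment_subset[rotated 2])
 have far1: "cmod (w - z0) \<ge> r" if w: "w \<in> closed_segment (z0 + Complex s u) (z0 + Complex s v)" and s: "\<bar>s\<bar> = r" for w s u v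
 proof -
  obtain t where t: "w = (1 - t) *\<^sub>R (z0 + Complex s u) + t *\<^sub>R (z0 + Complex s v)" using w unfolding closed_segment_def by blast
  have "Re w = Re z0 + s" unfolding t by (simp add: algebra_simps)
  thus ?thesis using abs_Re_le_cmod[of "w - z0"] s by simp
 qed
 have far2: "cmod (w - z0) \<ge> r" if w: "w \<in> closed_segment (z0 + Complex u s) (z0 + Complex v s)" and s: "\<bar>s\<bar> = r" for w s u v
 proof -
  obtain t where t: "w = (1 - t) *\<^sub>R (z0 + Complex u s) + t *\<^sub>R (z0 + Complex v s)" using w unfolding closed_segment_def by blast
  have "Im w = Im z0 + s" unfolding t by (simp add: algebra_simps)
  thus ?thesis using abs_Im_le_cmod[of "w - z0"] s by simp
 qed
 have d: "cmod (?a2 - ?a1) = 2 * r" "cmod (?a3 - ?a2) = 2 * r" "cmod (?a4 - ?a3) = 2 * r" "cmod (?a1 - ?a4) = 2 * r"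
  using r by (auto simp: cmod_def real_sqrt_mult)
 have far: "\<And>w. w \<in> closed_segment ?a1 ?a2 ==> cmod (w - z0) \<ge> r" "\<And>w. w \<in> closed_segment ?a2 ?a3 ==> cmod (w - z0) \<ge> r"
  "\<And>w. w \<in> closed_segment ?a3 ?a4 ==> cmod (w - z0) \<ge> r" "\<And>w. w \<in> closed_segment ?a4 ?a1 ==> cmod (w - z0) \<ge> r"
  using far1 far2 r by auto
 have ci: "?F contour_integrable_on linepath u v" if "u \<in> ?K" "v \<in> ?K" "\<And>w. w \<in> closed_segment u v ==> cmod (w - z0) \<ge> r" for u v
 proof (intro contour_integrable_continuous_linepath continuous_intros)
  show "continuous_on (closed_segment u v) g" by (rule continuous_on_subset[OF gc seg[OF that(1,2)]])
  show "\<forall>w\<in>closed_segment u v. w - z0 \<noteq> 0" using that(3) r by fastforce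
 qed
 note cis = ci[OF inK(1,2) far(1)] ci[OF inK(2,3) far(2)] ci[OF inK(3,4) far(3)] ci[OF inK(4,1) far(4)]
 have "(?F has_contour_integral (2 * pi * \<i> * winding_number (rectpath ?a1 ?a3) z0 * g z0)) (rectpath ?a1 ?a3)"
 proof (rule Cauchy_integral_formula_convex_simple[OF cv])
  show "g holomorphic_on ?K" using g(1) sub by (rule holomorphic_on_subset)
  show "z0 \<in> interior ?K" using r unfolding interior_cbox by (auto simp: in_box_complex_iff)
  show "path_image (rectpath ?a1 ?a3) \<subseteq> ?K - {z0}"
  proof -
   have im: "path_image (rectpath ?a1 ?a3) = closed_segment ?a1 ?a2 \<union> closed_segment ?a2 ?a3 \<union> closed_segment ?a3 ?a4 \<union> closed_segment ?a4 ?a1"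
    unfolding rp by (simp add: path_image_join Un_assoc)
   have sz: "closed_segment u v \<subseteq> ?K - {z0}" if "u \<in> ?K" "v \<in> ?K" "\<And>w. w \<in> closed_segment u v ==> cmod (w - z0) \<ge> r" for u v
   proof -
    have "z0 \<notin> closed_segment u v" using that(3)[of z0] r by auto
    thus ?thesis using seg[OF that(1,2)] by blast
   qed
   show ?thesis unfolding im by (intro Un_least sz inK far)
  qed
 qed auto
 moreover have "winding_number (rectpath ?a1 ?a3) z0 = 1"
  using r by (intro winding_number_rectpath) (auto simp: in_box_complex_iff)
 ultimately have C: "contour_integral (rectpath ?a1 ?a3) ?F = 2 * pi * \<i> * g z0" by (simp add: contour_integral_unique)
 have tot: "contour_integral (rectpath ?a1 ?a3) ?F = contour_integral (linepath ?a1 ?a2) ?F + contour_integral (linepath ?a2 ?a3) ?F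
   + contour_integral (linepath ?a3 ?a4) ?F + contour_integral (linepath ?a4 ?a1) ?F"
  unfolding rp using cis by (simp add: contour_integrable_joinI add.assoc)
 define J where "J = (\<lambda>u v. integral {0..1} (\<lambda>x. (cmod (g (linepath u v x)))^2))"
 have J: "(cmod (contour_integral (linepath u v) ?F))^2 \<le> 4 * J u v"
  if "u \<in> ?K" "v \<in> ?K" "\<And>w. w \<in> closed_segment u v ==> cmod (w - z0) \<ge> r" "cmod (v - u) = 2 * r" for u v
  unfolding J_def by (rule linepath_mean_square[OF continuous_on_subset[OF gc seg[OF that(1,2)]] r that(3,4)])
 have "4 * pi^2 * (cmod (g z0))^2 = (cmod (contour_integral (rectpath ?a1 ?a3) ?F))^2"
  unfolding C by (simp add: norm_mult power_mult_distrib)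
 also have "\<dots> \<le> 4 * (4 * J ?a1 ?a2 + 4 * J ?a2 ?a3 + 4 * J ?a3 ?a4 + 4 * J ?a4 ?a1)"
  unfolding tot by (rule order_trans[OF norm_sum4_squared_le], intro mult_left_mono add_mono J inK far d) auto
 finally have le: "4 * pi^2 * (cmod (g z0))^2 \<le> 16 * (J ?a1 ?a2 + J ?a2 ?a3 + J ?a3 ?a4 + J ?a4 ?a1)" by simp
 have "3 * 3 \<le> pi * pi" using pi_gt3 by (intro mult_mono) auto
 hence "8 * (cmod (g z0))^2 \<le> pi^2 * (cmod (g z0))^2" by (intro mult_right_mono) (auto simp: power2_eq_square)
 with le have "2 * (cmod (g z0))^2 \<le> J ?a1 ?a2 + J ?a2 ?a3 + J ?a3 ?a4 + J ?a4 ?a1" by simp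
 from mult_left_mono[OF this, of "2 * r"] r
 have le2: "4 * r * (cmod (g z0))^2 \<le> 2 * r * J ?a2 ?a3 + 2 * r * J ?a4 ?a1 + 2 * r * J ?a3 ?a4 + 2 * r * J ?a1 ?a2" by (simp add: algebra_simps)
 have J0: "J u v \<ge> 0" if "u \<in> ?K" "v \<in> ?K" for u v
  unfolding J_def
  by (intro integral_nonneg integrable_continuous_interval continuous_intros continuous_on_compose2[OF continuous_on_subset[OF gc seg[OF that]]])
    (auto intro: continuous_on_linepath linepath_in_path)
 have [measurable]: "(\<lambda>v. Complex s v) \<in> borel_measurable borel" "(\<lambda>v. Complex v s) \<in> borel_measurable borel" for s
  by (simp_all add: Complex_eq)
 have Kin: "z0 + Complex s v \<in> ?K" if "\<bar>s\<bar> \<le> r" "\<bar>v\<bar> \<le> r" for s v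
  using that by (auto simp: in_cbox_complex_iff)
 have ver: "ennreal (2 * r * J (z0 + Complex s (- d / 2)) (z0 + Complex s (d / 2))) = (\<integral>\<^sup>+v. ennreal (indicator {-r..r} v * (cmod (g (z0 + Complex s v)))^2) \<partial>lborel)"
  if "d = 2 * r \<or> d = - 2 * r" "\<bar>s\<bar> = r" for d s
 proof -
  have "linepath (z0 + Complex s (- d / 2)) (z0 + Complex s (d / 2)) x = z0 + Complex s (- d / 2 + d * x)" for x
   by (simp add: linepath_def complex_eq_iff algebra_simps)
  moreover have "continuous_on {-r..r} (\<lambda>v. (cmod (g (z0 + Complex s v)))^2)"
   by (intro continuous_intros continuous_on_compose2[OF gc] continuous_on_vertical) (use Kin that(2) in auto)
  ultimately show ?thesis unfolding J_def using that(1) r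
   by (simp only:) (rule nn_integral_unit_interval_affine[where H = "\<lambda>v. (cmod (g (z0 + Complex s v)))^2"], auto)
 qed
 have hor: "ennreal (2 * r * J (z0 + Complex (- d / 2) s) (z0 + Complex (d / 2) s)) = (\<integral>\<^sup>+v. ennreal (indicator {-r..r} v * (cmod (g (z0 + Complex v s)))^2) \<partial>lborel)"
  if "d = 2 * r \<or> d = - 2 * r" "\<bar>s\<bar> = r" for d s
 proof -
  have "linepath (z0 + Complex (- d / 2) s) (z0 + Complex (d / 2) s) x = z0 + Complex (- d / 2 + d * x) s" for x
   by (simp add: linepath_def complex_eq_iff algebra_simps)
  moreover have "continuous_on A (\<lambda>v. Complex v s)" for A by (simp add: Complex_eq) (intro continuous_intros)
  hence "continuous_on {-r..r} (\<lambda>v. (cmod (g (z0 + Complex v s)))^2)"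
   by (intro continuous_intros continuous_on_compose2[OF gc]) (use Kin that(2) in auto)
  ultimately show ?thesis unfolding J_def using that(1) r
   by (simp only:) (rule nn_integral_unit_interval_affine[where H = "\<lambda>v. (cmod (g (z0 + Complex v s)))^2"], auto)
 qed
 have "ennreal (4 * r * (cmod (g z0))^2) \<le> ennreal (2 * r * J ?a2 ?a3 + 2 * r * J ?a4 ?a1 + 2 * r * J ?a3 ?a4 + 2 * r * J ?a1 ?a2)"
  by (rule ennreal_leI[OF le2])
 also have "\<dots> = ennreal (2 * r * J ?a2 ?a3) + ennreal (2 * r * J ?a4 ?a1) + ennreal (2 * r * J ?a3 ?a4) + ennreal (2 * r * J ?a1 ?a2)"
  using r J0[OF inK(1,2)] J0[OF inK(2,3)] J0[OF inK(3,4)] J0[OF inK(4,1)] by simp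
 also have "ennreal (2 * r * J ?a2 ?a3) = (\<integral>\<^sup>+v. ennreal (indicator {-r..r} v * (cmod (g (z0 + Complex r v)))^2) \<partial>lborel)"
  using ver[of "2 * r" r] r by simp
 also have "ennreal (2 * r * J ?a4 ?a1) = (\<integral>\<^sup>+v. ennreal (indicator {-r..r} v * (cmod (g (z0 + Complex (-r) v)))^2) \<partial>lborel)"
  using ver[of "- 2 * r" "-r"] r by simp
 also have "ennreal (2 * r * J ?a3 ?a4) = (\<integral>\<^sup>+s. ennreal (indicator {-r..r} s * (cmod (g (z0 + Complex s r)))^2) \<partial>lborel)"
  using hor[of "- 2 * r" r] r by simp
 also have "ennreal (2 * r * J ?a1 ?a2) = (\<integral>\<^sup>+s. ennreal (indicator {-r..r} s * (cmod (g (z0 + Complex s (-r))))^2) \<partial>lborel)"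
  using hor[of "2 * r" "-r"] r by simp
 finally show ?thesis .
qed

lemma measurable_Complex [measurable]: "(\<lambda>(x, y). Complex x y) \<in> borel_measurable (borel \<Otimes>\<^sub>M borel)"
 by (simp add: Complex_eq case_prod_unfold)

text \<open>The boundary bound is integrated over half-sides r from \<rho>/2 to \<rho>. Each of the
  four sides sweeps out a part of the full square at most once, so together they give at most four
  times the integral over it.\<close>

lemma square_mean_value:
 fixes g :: "complex => complex"
 assumes gm[measurable]: "g \<in> borel_measurable borel" and g: "g holomorphic_on S" "open S"
  and sub: "cbox (z0 - Complex \<rho> \<rho>) (z0 + Complex \<rho> \<rho>) \<subseteq> S" and r: "\<rho> > 0"
 shows "ennreal (\<rho>^2 / 4 * (cmod (g z0))^2) \<le>
   (\<integral>\<^sup>+s. \<integral>\<^sup>+v. ennreal (indicator {-\<rho>..\<rho>} s * indicator {-\<rho>..\<rho>} v * (cmod (g (z0 + Complex s v)))^2) \<partial>lborel \<partial>lborel)"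
proof -
 define h where "h = (\<lambda>s v. ennreal (indicator {-\<rho>..\<rho>} s * indicator {-\<rho>..\<rho>} v * (cmod (g (z0 + Complex s v)))^2))"
 have hm[measurable]: "case_prod h \<in> borel_measurable (borel \<Otimes>\<^sub>M borel)" unfolding h_def by measurable
 define I where "I = (\<integral>\<^sup>+s. \<integral>\<^sup>+v. h s v \<partial>lborel \<partial>lborel)"
 have Is: "(\<integral>\<^sup>+v. \<integral>\<^sup>+s. h s v \<partial>lborel \<partial>lborel) = I"
  unfolding I_def by (rule lborel_pair.Fubini') simp
 have refl: "(\<integral>\<^sup>+r. f (- r) \<partial>lborel) = (\<integral>\<^sup>+r. f r \<partial>lborel)" if "f \<in> borel_measurable borel" for f :: "real => ennreal"
  using nn_integral_real_affine[OF that, of "-1" 0] by simp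
 have m1: "(\<lambda>r. \<integral>\<^sup>+v. h r v \<partial>lborel) \<in> borel_measurable borel" "(\<lambda>r. \<integral>\<^sup>+v. h v r \<partial>lborel) \<in> borel_measurable borel"
  by measurable
 have m2: "(\<lambda>r. \<integral>\<^sup>+v. h (- r) v \<partial>lborel) \<in> borel_measurable borel" "(\<lambda>r. \<integral>\<^sup>+v. h v (- r) \<partial>lborel) \<in> borel_measurable borel"
  by measurable
 have pt: "ennreal (2 * \<rho> * (cmod (g z0))^2) * indicator {\<rho>/2..\<rho>} r \<le>
   (\<integral>\<^sup>+v. h r v \<partial>lborel) + (\<integral>\<^sup>+v. h (- r) v \<partial>lborel) + (\<integral>\<^sup>+s. h s r \<partial>lborel) + (\<integral>\<^sup>+s. h s (- r) \<partial>lborel)" for r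
 proof (cases "r \<in> {\<rho>/2..\<rho>}")
  case False
  thus ?thesis by simp
 next
  case True
  hence rr: "r > 0" "\<rho> / 2 \<le> r" "r \<le> \<rho>" using r by auto
  have sub': "cbox (z0 - Complex r r) (z0 + Complex r r) \<subseteq> S"
   using sub rr by (intro order_trans[OF _ sub]) (auto simp: subset_box_complex)
  have "ennreal (2 * \<rho> * (cmod (g z0))^2) \<le> ennreal (4 * r * (cmod (g z0))^2)"
   using rr by (intro ennreal_leI mult_right_mono) auto
  also have "\<dots> \<le> (\<integral>\<^sup>+v. ennreal (indicator {-r..r} v * (cmod (g (z0 + Complex r v)))^2) \<partial>lborel) +
    (\<integral>\<^sup>+v. ennreal (indicator {-r..r} v * (cmod (g (z0 + Complex (-r) v)))^2) \<partial>lborel) +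
    (\<integral>\<^sup>+s. ennreal (indicator {-r..r} s * (cmod (g (z0 + Complex s r)))^2) \<partial>lborel) +
    (\<integral>\<^sup>+s. ennreal (indicator {-r..r} s * (cmod (g (z0 + Complex s (-r))))^2) \<partial>lborel)"
   by (rule square_boundary_bound[OF gm g sub' rr(1)])
  also have "\<dots> \<le> (\<integral>\<^sup>+v. h r v \<partial>lborel) + (\<integral>\<^sup>+v. h (- r) v \<partial>lborel) + (\<integral>\<^sup>+s. h s r \<partial>lborel) + (\<integral>\<^sup>+s. h s (- r) \<partial>lborel)"
   using rr unfolding h_def by (intro add_mono nn_integral_mono ennreal_leI) (auto simp: indicator_def)
  finally show ?thesis using True by simp
 qed
 have "ennreal (\<rho>^2 * (cmod (g z0))^2) = ennreal (2 * \<rho> * (cmod (g z0))^2) * emeasure lborel {\<rho>/2..\<rho>}"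
  using r by (simp add: ennreal_mult''[symmetric] power2_eq_square)
 also have "\<dots> = (\<integral>\<^sup>+r. ennreal (2 * \<rho> * (cmod (g z0))^2) * indicator {\<rho>/2..\<rho>} r \<partial>lborel)"
  by (rule nn_integral_cmult_indicator[symmetric]) simp
 also have "\<dots> \<le> (\<integral>\<^sup>+r. (\<integral>\<^sup>+v. h r v \<partial>lborel) + (\<integral>\<^sup>+v. h (- r) v \<partial>lborel) + (\<integral>\<^sup>+s. h s r \<partial>lborel) + (\<integral>\<^sup>+s. h s (- r) \<partial>lborel) \<partial>lborel)"
  by (intro nn_integral_mono pt)
 also have "\<dots> = (\<integral>\<^sup>+r. (\<integral>\<^sup>+v. h r v \<partial>lborel) \<partial>lborel) + (\<integral>\<^sup>+r. (\<integral>\<^sup>+v. h (- r) v \<partial>lborel) \<partial>lborel)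
   + (\<integral>\<^sup>+r. (\<integral>\<^sup>+s. h s r \<partial>lborel) \<partial>lborel) + (\<integral>\<^sup>+r. (\<integral>\<^sup>+s. h s (- r) \<partial>lborel) \<partial>lborel)"
  using m1 m2 by (simp add: nn_integral_add)
 also have "\<dots> = I + I + I + I"
  unfolding refl[OF m1(1)] refl[OF m1(2)] Is unfolding I_def ..
 finally have "ennreal (\<rho>^2 * (cmod (g z0))^2) \<le> I + I + I + I" .
 also have "\<dots> = 4 * I"
 proof -
  have "(4::ennreal) = 1 + 1 + 1 + 1" by simp
  thus ?thesis by (simp only: distrib_right mult_1)
 qed
 finally have "ennreal (1/4) * ennreal (\<rho>^2 * (cmod (g z0))^2) \<le> ennreal (1/4) * (4 * I)" by (rule mult_left_mono) simp
 also have "\<dots> = ennreal (1/4) * ennreal 4 * I" by (simp add: mult.assoc)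
 also have "ennreal (1/4) * ennreal 4 = 1" by (subst ennreal_mult[symmetric]) auto
 finally show ?thesis unfolding I_def h_def by (simp add: ennreal_mult'[symmetric])
qed

text \<open>The series over n is a power series in exp (- z) whose coefficients grow at most
  linearly, hence holomorphic as long as |exp (- z)| < 1.\<close>

lemma Phi_holomorphic:
 assumes chi: "dirichlet_character q chi"
 shows "Phi q chi holomorphic_on {z. Re z > 0}"
proof -
 define b where "b = (\<lambda>n. chi (Suc n) * mangoldt (Suc n) :: complex)"
 define P where "P = (\<lambda>w. \<Sum>n. b n * w ^ n)"
 have bn: "cmod (b n) \<le> real (Suc n)" for n
 proof -
  have "cmod (b n) \<le> 1 * mangoldt (Suc n)"
   unfolding b_def norm_mult using dirichlet_character_norm_le[OF chi, of "Suc n"] by (intro mult_mono) (auto simp: mangoldt_nonneg)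
  also have "\<dots> \<le> ln (real (Suc n))" using mangoldt_le_ln[of "Suc n"] by simp
  also have "\<dots> \<le> real (Suc n)" using ln_le_minus_one[of "real (Suc n)"] by simp
  finally show ?thesis .
 qed
 have sm: "summable (\<lambda>n. b n * w ^ n)" if "w \<in> ball 0 1" for w
 proof (rule summable_comparison_test')
  show "summable (\<lambda>n. real (Suc n) * cmod w ^ n)"
   using geometric_deriv_sums[of "cmod w"] that by (auto simp: sums_iff)
  show "norm (b n * w ^ n) \<le> real (Suc n) * cmod w ^ n" if "n \<ge> 0" for n
   unfolding norm_mult norm_power by (intro mult_right_mono bn) auto
 qed
 have "P holomorphic_on ball 0 1"
 proof (rule power_series_holomorphic)
  fix w :: complex assume "w \<in> ball 0 1"
  thus "(\<lambda>n. b n * (w - 0) ^ n) sums P w" unfolding P_def using sm by (simp add: summable_sums)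
 qed
 hence "P \<circ> (\<lambda>z. exp (- z)) holomorphic_on {z. Re z > 0}"
  by (rule holomorphic_on_compose_gen[rotated]) (auto intro!: holomorphic_intros)
 hence "(\<lambda>z. exp (- z) * P (exp (- z))) holomorphic_on {z. Re z > 0}"
  by (intro holomorphic_intros) (simp add: o_def)
 moreover have "exp (- z) * P (exp (- z)) = (\<Sum>n. chi (Suc n) * mangoldt (Suc n) * exp (- (of_nat (Suc n) * z)))" if "z \<in> {z. Re z > 0}" for z
 proof -
  have "exp (- z) \<in> ball 0 1" using that by simp
  hence "exp (- z) * P (exp (- z)) = (\<Sum>n. exp (- z) * (b n * exp (- z) ^ n))" unfolding P_def by (intro suminf_mult[symmetric] sm)
  moreover have "exp (- z) * (b n * exp (- z) ^ n) = chi (Suc n) * mangoldt (Suc n) * exp (- (of_nat (Suc n) * z))" for n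
  proof -
   have "exp (- z) ^ Suc n = exp (of_nat (Suc n) * (- z))" by (rule exp_of_nat_mult[symmetric])
   thus ?thesis by (simp add: b_def mult_ac)
  qed
  ultimately show ?thesis by (simp only:)
 qed
 ultimately have 1: "(\<lambda>z. \<Sum>n. chi (Suc n) * mangoldt (Suc n) * exp (- (of_nat (Suc n) * z))) holomorphic_on {z. Re z > 0}"
  by (rule holomorphic_transform)
 have 2: "(\<lambda>z. E_char q chi / z) holomorphic_on {z. Re z > 0}" by (intro holomorphic_intros) auto
 have 3: "real_zero_sum q chi holomorphic_on {z. Re z > 0}"
  unfolding real_zero_sum_def[abs_def] by (intro holomorphic_intros) (auto simp: complex_nonpos_Reals_iff)
 show ?thesis unfolding Phi_def[abs_def] by (intro holomorphic_intros 1 2 3)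
qed

lemma S_tilde_eq:
 "S_tilde N chi \<alpha> - E_char q chi / z_of N \<alpha> + real_zero_sum q chi (z_of N \<alpha>) = Phi q chi (z_of N \<alpha>)"
proof -
 have "of_real (exp (- real (Suc n) / N)) * exp (2 * of_real pi * \<i> * of_real (real (Suc n) * \<alpha>)) = exp (- (of_nat (Suc n) * z_of N \<alpha>))" for n
  unfolding exp_of_real[symmetric] exp_add[symmetric] z_of_def by (rule arg_cong[where f = exp]) (simp add: algebra_simps add_divide_distrib diff_divide_distrib)
 thus ?thesis unfolding S_tilde_def Phi_def by (simp only: mult.assoc)
qed

text \<open>Extension by 0 gives a Borel function on the whole plane, which can stand under iterated
  Lebesgue integrals.\<close>

definition Phi0 :: "nat => (nat => complex) => complex => complex" where
 "Phi0 q chi z = (if Re z > 0 then Phi q chi z else 0)"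

lemma Phi0_measurable [measurable (raw)]:
 assumes "dirichlet_character q chi" "f \<in> borel_measurable M"
 shows "(\<lambda>x. Phi0 q chi (f x)) \<in> borel_measurable M"
proof -
 have "open {z. Re z > 0}" by (rule open_halfspace_Re_gt)
 hence "(\<lambda>z. indicator {z. Re z > 0} z *\<^sub>R Phi q chi z) \<in> borel_measurable borel"
  using holomorphic_on_imp_continuous_on[OF Phi_holomorphic[OF assms(1)]]
  by (intro borel_measurable_continuous_on_indicator) auto
 moreover have "(\<lambda>z. indicator {z. Re z > 0} z *\<^sub>R Phi q chi z) = Phi0 q chi" by (auto simp: Phi0_def indicator_def)
 ultimately have "Phi0 q chi \<in> borel_measurable borel" by simp
 from measurable_compose[OF assms(2) this] show ?thesis .
qed

lemma Phi0_holomorphic: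
 assumes "dirichlet_character q chi"
 shows "Phi0 q chi holomorphic_on {z. Re z > 0}"
 by (rule holomorphic_transform[OF Phi_holomorphic[OF assms]]) (simp add: Phi0_def)

text \<open>The substitution y = x v on each vertical line turns the rectangle into a bundle of rays
  from the origin, and its Jacobian is the factor x in \<open>ray_mean_square\<close>. The slopes v
  fill an interval of length 4 N Y. Each ray contributes O(1 / N) times the squared logarithm, from
  N^2 for removing the weight and N^(-3) for the cube of the right endpoint, so N cancels.\<close>

lemma rectangle_mean_square:
 assumes G: GRHR
 shows "\<exists>C>0. \<forall>q chi N Y. dirichlet_character q chi --> N \<ge> 2 --> 0 < Y --> Y \<le> 17/4 -->
   (\<integral>\<^sup>+x. \<integral>\<^sup>+y. ennreal (indicator {1/(2*N)..3/(2*N)} x * indicator {-Y..Y} y * (cmod (Phi0 q chi (Complex x y)))^2) \<partial>lborel \<partial>lborel)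
    \<le> ennreal (C * Y * (log_cond q (1 + 2 * N * Y))^2)"
  (is "\<exists>C>0. \<forall>q chi N Y. ?chi q chi --> ?N N --> ?Y1 Y --> ?Y2 Y --> ?P C q chi N Y")
proof -
 obtain C where C: "C > 0" and ray: "\<And>q chi A B v. dirichlet_character q chi ==> 0 < A ==> A < B ==> B * cmod (Complex 1 v) \<le> 16 ==>
  (\<integral>\<^sup>+x. ennreal (indicator {A..B} x * ((x - A) * (B - x)) * (x * (cmod (Phi q chi (of_real x * Complex 1 v)))^2)) \<partial>lborel)
   \<le> ennreal (C * B ^ 3 * (log_cond q (cmod (Complex 1 v)))^2)"
  using ray_mean_square[OF G] by blast
 have "?P (384 * C) q chi N Y"
  if chi: "dirichlet_character q chi" and N: "N \<ge> 2" and Y: "0 < Y" "Y \<le> 17/4" for q chi N Y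
 proof -
  have q: "q > 0" using chi by (simp add: dirichlet_character_def)
  have l: "log_cond q s \<ge> 1/2" for s by (rule log_cond_ge[OF q])
  note [measurable] = Phi0_measurable[OF chi]
  \<comment> \<open>The weighted interval exceeds \<open>?J\<close> by 1 / (4 N) on both sides, so
    the weight is at least 1 / (16 N^2) on \<open>?J\<close>.\<close>
  let ?A = "1/(4*N)" and ?B = "7/(4*N)" and ?J = "{1/(2*N)..3/(2*N)}"
  define \<Lambda> where "\<Lambda> = 2 * N * Y"
  define L where "L = log_cond q (1 + \<Lambda>)"
  have \<Lambda>: "\<Lambda> > 0" using N Y by (simp add: \<Lambda>_def)
  define k where "k = (\<lambda>x v. ennreal (indicator ?J x * indicator {-\<Lambda>..\<Lambda>} v * (x * (cmod (Phi0 q chi (of_real x * Complex 1 v)))^2)))"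
  have km[measurable]: "case_prod k \<in> borel_measurable (borel \<Otimes>\<^sub>M borel)" unfolding k_def by measurable
  have step1: "(\<integral>\<^sup>+y. ennreal (indicator ?J x * indicator {-Y..Y} y * (cmod (Phi0 q chi (Complex x y)))^2) \<partial>lborel) \<le> (\<integral>\<^sup>+v. k x v \<partial>lborel)" for x
  proof (cases "x \<in> ?J")
   case False
   thus ?thesis by simp
  next
   case True
   hence x: "x > 0" "1 \<le> 2 * N * x" using N by (auto simp: field_simps intro: order_less_le_trans[of _ "1/(2*N)"])
   have "(\<integral>\<^sup>+y. ennreal (indicator ?J x * indicator {-Y..Y} y * (cmod (Phi0 q chi (Complex x y)))^2) \<partial>lborel)
     = ennreal \<bar>x\<bar> * (\<integral>\<^sup>+v. ennreal (indicator ?J x * indicator {-Y..Y} (0 + x * v) * (cmod (Phi0 q chi (Complex x (0 + x * v))))^2) \<partial>lborel)"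
    using x by (intro nn_integral_real_affine) auto
   also have "\<dots> = (\<integral>\<^sup>+v. ennreal \<bar>x\<bar> * ennreal (indicator ?J x * indicator {-Y..Y} (0 + x * v) * (cmod (Phi0 q chi (Complex x (0 + x * v))))^2) \<partial>lborel)"
    by (rule nn_integral_cmult[symmetric]) measurable
   also have "\<dots> \<le> (\<integral>\<^sup>+v. k x v \<partial>lborel)"
   proof (intro nn_integral_mono)
    fix v :: real
    have e: "Complex x (0 + x * v) = of_real x * Complex 1 v" by (simp add: complex_eq_iff)
    have "indicator {-Y..Y} (0 + x * v) \<le> (indicator {-\<Lambda>..\<Lambda>} v :: real)"
    proof -
     have "\<bar>v\<bar> \<le> \<Lambda>" if "\<bar>x * v\<bar> \<le> Y"
     proof -
      have "\<bar>v\<bar> * 1 \<le> \<bar>v\<bar> * (2 * N * x)" using x(2) by (intro mult_left_mono) auto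
      also have "\<dots> = 2 * N * \<bar>x * v\<bar>" using x(1) by (simp add: abs_mult)
      also have "\<dots> \<le> 2 * N * Y" using N that by (intro mult_left_mono) auto
      finally show ?thesis by (simp add: \<Lambda>_def)
     qed
     thus ?thesis by (auto simp: indicator_def abs_le_iff)
    qed
    hence "indicator ?J x * indicator {-Y..Y} (0 + x * v) * (x * (cmod (Phi0 q chi (of_real x * Complex 1 v)))^2) \<le> indicator ?J x * indicator {-\<Lambda>..\<Lambda>} v * (x * (cmod (Phi0 q chi (of_real x * Complex 1 v)))^2)"
     using x by (intro mult_right_mono mult_left_mono) auto
    hence "ennreal (x * (indicator ?J x * indicator {-Y..Y} (0 + x * v) * (cmod (Phi0 q chi (of_real x * Complex 1 v)))^2)) \<le> k x v"
     unfolding k_def by (intro ennreal_leI) (simp add: mult_ac)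
    thus "ennreal \<bar>x\<bar> * ennreal (indicator ?J x * indicator {-Y..Y} (0 + x * v) * (cmod (Phi0 q chi (Complex x (0 + x * v))))^2) \<le> k x v"
     unfolding e using x by (simp add: ennreal_mult'' )
   qed
   finally show ?thesis .
  qed
  have step2: "(\<integral>\<^sup>+x. k x v \<partial>lborel) \<le> ennreal (96 * C / N * L^2) * indicator {-\<Lambda>..\<Lambda>} v" for v
  proof (cases "v \<in> {-\<Lambda>..\<Lambda>}")
   case False
   thus ?thesis by (simp add: k_def)
  next
   case True
   have cv: "cmod (Complex 1 v) \<le> 1 + \<Lambda>"
    using cmod_le[of "Complex 1 v"] True by auto
   have AB: "0 < ?A" "?A < ?B" using N by (auto simp: field_simps)
   \<comment> \<open>At worst this is 7/8 + (7/2)(17/4) = 63/4, which explains the bound 16 for |z|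
     in the estimates on rays.\<close>
   have "?B * cmod (Complex 1 v) \<le> ?B * (1 + \<Lambda>)" using N cv by (intro mult_left_mono) auto
   also have "\<dots> = 7/(4*N) + 7/2 * Y" using N by (simp add: \<Lambda>_def field_simps)
   finally have "?B * cmod (Complex 1 v) \<le> 7/(4*N) + 7/2 * Y" .
   moreover have "7/(4*N) \<le> 7/8" using N by (simp add: field_simps)
   ultimately have B16: "?B * cmod (Complex 1 v) \<le> 16" using Y(2) by linarith
   have "(\<integral>\<^sup>+x. k x v \<partial>lborel) \<le> (\<integral>\<^sup>+x. ennreal (16 * N^2) * ennreal (indicator {?A..?B} x * ((x - ?A) * (?B - x)) * (x * (cmod (Phi0 q chi (of_real x * Complex 1 v)))^2)) \<partial>lborel)"
   proof (intro nn_integral_mono)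
    fix x :: real
    show "k x v \<le> ennreal (16 * N^2) * ennreal (indicator {?A..?B} x * ((x - ?A) * (?B - x)) * (x * (cmod (Phi0 q chi (of_real x * Complex 1 v)))^2))"
    proof (cases "x \<in> ?J")
     case False
     thus ?thesis by (simp add: k_def)
    next
     case True
     have "?A \<le> 1/(2*N)" "3/(2*N) \<le> ?B" "1/(2*N) > 0" using N by (auto simp: field_simps)
     hence x: "x \<in> {?A..?B}" "x > 0" using True unfolding atLeastAtMost_iff by linarith+
     have "1/(2*N) - ?A = ?A" "?B - 3/(2*N) = ?A" using N by (auto simp: field_simps)
     hence "?A * ?A \<le> (x - ?A) * (?B - x)" using True AB(1) by (intro mult_mono) auto
     hence "16 * N^2 * (?A * ?A) \<le> 16 * N^2 * ((x - ?A) * (?B - x))" by (intro mult_left_mono) auto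
     hence "1 \<le> 16 * N^2 * ((x - ?A) * (?B - x))" using N by (simp add: power2_eq_square)
     hence "1 * (x * (cmod (Phi0 q chi (of_real x * Complex 1 v)))^2) \<le> 16 * N^2 * ((x - ?A) * (?B - x)) * (x * (cmod (Phi0 q chi (of_real x * Complex 1 v)))^2)"
      using x(2) by (intro mult_right_mono) auto
     hence "k x v \<le> ennreal (16 * N^2 * (((x - ?A) * (?B - x)) * (x * (cmod (Phi0 q chi (of_real x * Complex 1 v)))^2)))"
      unfolding k_def using True \<open>v \<in> {-\<Lambda>..\<Lambda>}\<close> by (intro ennreal_leI) (simp add: mult.assoc)
     also have "\<dots> = ennreal (16 * N^2) * ennreal (((x - ?A) * (?B - x)) * (x * (cmod (Phi0 q chi (of_real x * Complex 1 v)))^2))"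
      by (rule ennreal_mult') simp
     finally show ?thesis using x(1) by simp
    qed
   qed
   also have "\<dots> = ennreal (16 * N^2) * (\<integral>\<^sup>+x. ennreal (indicator {?A..?B} x * ((x - ?A) * (?B - x)) * (x * (cmod (Phi0 q chi (of_real x * Complex 1 v)))^2)) \<partial>lborel)"
    by (rule nn_integral_cmult) measurable
   also have "(\<integral>\<^sup>+x. ennreal (indicator {?A..?B} x * ((x - ?A) * (?B - x)) * (x * (cmod (Phi0 q chi (of_real x * Complex 1 v)))^2)) \<partial>lborel)
     = (\<integral>\<^sup>+x. ennreal (indicator {?A..?B} x * ((x - ?A) * (?B - x)) * (x * (cmod (Phi q chi (of_real x * Complex 1 v)))^2)) \<partial>lborel)"
   proof (intro nn_integral_cong)
    fix x :: real
    show "ennreal (indicator {?A..?B} x * ((x - ?A) * (?B - x)) * (x * (cmod (Phi0 q chi (of_real x * Complex 1 v)))^2))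
      = ennreal (indicator {?A..?B} x * ((x - ?A) * (?B - x)) * (x * (cmod (Phi q chi (of_real x * Complex 1 v)))^2))"
    proof (cases "x \<in> {?A..?B}")
     case True
     hence "x > 0" using AB(1) unfolding atLeastAtMost_iff by linarith
     thus ?thesis by (simp add: Phi0_def)
    qed simp
   qed
   also have "ennreal (16 * N^2) * \<dots> \<le> ennreal (16 * N^2) * ennreal (C * ?B ^ 3 * (log_cond q (cmod (Complex 1 v)))^2)"
    by (intro mult_left_mono ray[OF chi AB B16]) simp
   also have "\<dots> = ennreal (16 * N^2 * (C * ?B ^ 3 * (log_cond q (cmod (Complex 1 v)))^2))" by (rule ennreal_mult'[symmetric]) simp
   also have "\<dots> \<le> ennreal (96 * C / N * L^2)"
   proof (rule ennreal_leI)
    have "log_cond q (cmod (Complex 1 v)) \<le> L" unfolding L_def using cv \<Lambda> by (intro log_cond_mono[OF q]) auto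
    hence "(log_cond q (cmod (Complex 1 v)))^2 \<le> L^2" using l[of "cmod (Complex 1 v)"] by (intro power_mono) linarith+
    hence "16 * N^2 * (C * ?B ^ 3 * (log_cond q (cmod (Complex 1 v)))^2) \<le> 16 * N^2 * (C * ?B ^ 3 * L^2)"
     using C N by (intro mult_left_mono) auto
    \<comment> \<open>16 * 7^3 / 4^3 = 343/4, rounded up to 96; multiplied by the interval length 4
      N Y this becomes the constant 384.\<close>
    also have "\<dots> = 343/4 * C / N * L^2" using N by (simp add: field_simps power2_eq_square power3_eq_cube)
    also have "\<dots> \<le> 96 * C / N * L^2" using C N by (intro mult_right_mono divide_right_mono) auto
    finally show "16 * N^2 * (C * ?B ^ 3 * (log_cond q (cmod (Complex 1 v)))^2) \<le> 96 * C / N * L^2" .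
   qed
   finally show ?thesis using True by simp
  qed
  have "(\<integral>\<^sup>+x. \<integral>\<^sup>+y. ennreal (indicator ?J x * indicator {-Y..Y} y * (cmod (Phi0 q chi (Complex x y)))^2) \<partial>lborel \<partial>lborel)
    \<le> (\<integral>\<^sup>+x. \<integral>\<^sup>+v. k x v \<partial>lborel \<partial>lborel)" by (intro nn_integral_mono step1)
  also have "\<dots> = (\<integral>\<^sup>+v. \<integral>\<^sup>+x. k x v \<partial>lborel \<partial>lborel)" by (rule lborel_pair.Fubini'[symmetric]) simp
  also have "\<dots> \<le> (\<integral>\<^sup>+v. ennreal (96 * C / N * L^2) * indicator {-\<Lambda>..\<Lambda>} v \<partial>lborel)" by (intro nn_integral_mono step2)
  also have "\<dots> = ennreal (96 * C / N * L^2) * emeasure lborel {-\<Lambda>..\<Lambda>}" by (rule nn_integral_cmult_indicator) simp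
  also have "emeasure lborel {-\<Lambda>..\<Lambda>} = ennreal (\<Lambda> - - \<Lambda>)" using \<Lambda> by (intro emeasure_lborel_Icc) simp
  also have "ennreal (96 * C / N * L^2) * \<dots> = ennreal (96 * C / N * L^2 * (\<Lambda> - - \<Lambda>))" using \<Lambda> by (intro ennreal_mult''[symmetric]) simp
  also have "96 * C / N * L^2 * (\<Lambda> - - \<Lambda>) = 384 * C * Y * L^2" using N by (simp add: \<Lambda>_def)
  finally show ?thesis by (simp add: L_def \<Lambda>_def)
 qed
 thus ?thesis using C by (intro exI[of _ "384 * C"]) auto
qed

text \<open>Since N \<ge> 2, constants can be traded for powers of N: 3 + 2 N Y \<le> 16 N \<le>
  N^5.\<close>

lemma log_cond_le_ln_qN:
 assumes "q > 0" "N \<ge> 2" "0 < Y" "Y \<le> 17/4"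
 shows "log_cond q (1 + 2 * N * Y) \<le> 5 * ln (real q * N)"
proof -
 have q: "real q \<ge> 1" using assms(1) by linarith
 have NY: "0 \<le> N * Y" "N * Y \<le> N * (17/4)" using assms by (auto intro: mult_left_mono)
 have n4: "(2::real) ^ 4 \<le> N ^ 4" using assms by (intro power_mono) auto
 have "\<bar>1 + 2 * N * Y\<bar> + 2 \<le> 16 * N" using NY assms(2) by linarith
 also have "\<dots> \<le> N ^ 4 * N" using n4 assms(2) by (intro mult_right_mono) auto
 finally have "\<bar>1 + 2 * N * Y\<bar> + 2 \<le> N ^ 5" by (simp add: power_Suc2[symmetric] eval_nat_numeral mult_ac)
 moreover have "real q ^ 1 \<le> real q ^ 5" using q by (intro power_increasing) auto
 ultimately have "real q * (\<bar>1 + 2 * N * Y\<bar> + 2) \<le> real q ^ 5 * N ^ 5" using q by (intro mult_mono) auto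
 hence "ln (real q * (\<bar>1 + 2 * N * Y\<bar> + 2)) \<le> ln ((real q * N) ^ 5)"
  using q by (intro ln_mono) (auto simp: power_mult_distrib intro!: mult_pos_pos)
 also have "\<dots> = 5 * ln (real q * N)" using q assms(2) by (subst ln_realpow) auto
 finally show ?thesis by (simp add: log_cond_def)
qed

theorem theorem3:
  assumes GRHR
  shows "\<exists>C>0. \<forall>(N::real) (\<xi>::real) (q::nat) (chi::nat \<Rightarrow> complex).
           N \<ge> 2 \<longrightarrow> 0 < \<xi> \<longrightarrow> \<xi> \<le> 1 / 2 \<longrightarrow> dirichlet_character q chi \<longrightarrow>
           integral {-\<xi>..\<xi>} (\<lambda>\<alpha>.
             (norm (S_tilde N chi \<alpha> - E_char q chi / z_of N \<alpha>
                    + real_zero_sum q chi (z_of N \<alpha>)))\<^sup>2)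
           \<le> C * N * \<xi> * (ln (real q * N))\<^sup>2"
proof -
 obtain C where C: "C > 0" and rect: "\<And>q chi N Y. dirichlet_character q chi ==> N \<ge> 2 ==> 0 < Y ==> Y \<le> 17/4 ==>
   (\<integral>\<^sup>+x. \<integral>\<^sup>+y. ennreal (indicator {1/(2*N)..3/(2*N)} x * indicator {-Y..Y} y * (cmod (Phi0 q chi (Complex x y)))^2) \<partial>lborel \<partial>lborel)
    \<le> ennreal (C * Y * (log_cond q (1 + 2 * N * Y))^2)"
  using rectangle_mean_square[OF assms] by blast
 define D where "D = 3600 * C"
 have "integral {-\<xi>..\<xi>} (\<lambda>\<alpha>. (norm (S_tilde N chi \<alpha> - E_char q chi / z_of N \<alpha> + real_zero_sum q chi (z_of N \<alpha>)))^2)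
      \<le> D * N * \<xi> * (ln (real q * N))^2"
  if N: "N \<ge> 2" and \<xi>: "0 < \<xi>" "\<xi> \<le> 1/2" and chi: "dirichlet_character q chi" for N \<xi> q chi
 proof -
  note [measurable] = Phi0_measurable[OF chi]
  have q: "q > 0" using chi by (simp add: dirichlet_character_def)
  \<comment> \<open>Half the side of the squares. The segment lies on Re z = 1/N = 2 \<rho>, so the
    squares stay between \<rho> and 3 \<rho>, inside the half-plane of holomorphy. \<open>Y\<close>
    adds this margin to the half-length 2 pi \<xi> of the segment; by pi < 4 and \<xi> \<le> 1/2 it
    is at most 4 + 1/4 = 17/4.\<close>
  define \<rho> where "\<rho> = 1/(2*N)"
  define Y where "Y = 2 * pi * \<xi> + \<rho>"
  define M where "M = ln (real q * N)"
  have \<rho>: "\<rho> > 0" "\<rho> \<le> 1/4" "1/N = 2 * \<rho>" "1/(2*N) = \<rho>" "3/(2*N) = 3 * \<rho>" "N * \<rho> = 1/2" using N by (auto simp: \<rho>_def field_simps)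
  have pi4: "2 * pi * \<xi> \<le> 8 * \<xi>" "2 * pi * \<xi> \<ge> 0" using pi_less_4 \<xi> by auto
  have Y: "Y > 0" "Y \<le> 17/4" "Y \<le> 8 * \<xi> + \<rho>" using pi4 \<rho> \<xi> unfolding Y_def by linarith+
  define R where "R = C * Y * (5 * M)^2"
  have R0: "R \<ge> 0" using C Y by (simp add: R_def)
  define F where "F = (\<lambda>x y. ennreal (indicator {\<rho>..3*\<rho>} x * indicator {-Y..Y} y * (cmod (Phi0 q chi (Complex x y)))^2))"
  have Fm[measurable]: "case_prod F \<in> borel_measurable (borel \<Otimes>\<^sub>M borel)" unfolding F_def by measurable
  have FI: "(\<integral>\<^sup>+x. \<integral>\<^sup>+y. F x y \<partial>lborel \<partial>lborel) \<le> ennreal R"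
  proof -
   have "(\<integral>\<^sup>+x. \<integral>\<^sup>+y. F x y \<partial>lborel \<partial>lborel) \<le> ennreal (C * Y * (log_cond q (1 + 2 * N * Y))^2)"
    using rect[OF chi N Y(1,2)] unfolding F_def \<rho> .
   also have "\<dots> \<le> ennreal R"
    unfolding R_def M_def using C Y log_cond_le_ln_qN[OF q N Y(1,2)] log_cond_ge[OF q, of "1 + 2 * N * Y"]
    by (intro ennreal_leI mult_left_mono power_mono) auto
   finally show ?thesis .
  qed
  define Q where "Q = (\<lambda>\<alpha> x v. ennreal (indicator {\<rho>..3*\<rho>} x * indicator {-\<rho>..\<rho>} v * (cmod (Phi0 q chi (Complex x (v - 2 * pi * \<alpha>))))^2))"
  have zof: "z_of N \<alpha> = Complex (2 * \<rho>) (- 2 * pi * \<alpha>)" for \<alpha>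
   unfolding z_of_def \<rho>(3)[symmetric] by (simp add: complex_eq_iff)
  have local: "ennreal (\<rho>^2 / 4 * (cmod (Phi q chi (z_of N \<alpha>)))^2) \<le> (\<integral>\<^sup>+x. \<integral>\<^sup>+v. Q \<alpha> x v \<partial>lborel \<partial>lborel)" for \<alpha>
  proof -
   have "ennreal (\<rho>^2 / 4 * (cmod (Phi0 q chi (z_of N \<alpha>)))^2) \<le>
     (\<integral>\<^sup>+s. \<integral>\<^sup>+v. ennreal (indicator {-\<rho>..\<rho>} s * indicator {-\<rho>..\<rho>} v * (cmod (Phi0 q chi (z_of N \<alpha> + Complex s v)))^2) \<partial>lborel \<partial>lborel)"
   proof (rule square_mean_value[OF _ Phi0_holomorphic[OF chi] open_halfspace_Re_gt _ \<rho>(1)])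
    show "cbox (z_of N \<alpha> - Complex \<rho> \<rho>) (z_of N \<alpha> + Complex \<rho> \<rho>) \<subseteq> {z. 0 < Re z}"
     using \<rho>(1) by (auto simp: zof in_cbox_complex_iff)
   qed measurable
   also have "\<dots> = (\<integral>\<^sup>+s. (\<integral>\<^sup>+v. Q \<alpha> (2 * \<rho> + 1 * s) v \<partial>lborel) \<partial>lborel)"
   proof (intro nn_integral_cong)
    fix s v :: real
    have "z_of N \<alpha> + Complex s v = Complex (2 * \<rho> + 1 * s) (v - 2 * pi * \<alpha>)" by (simp add: zof complex_eq_iff)
    moreover have "indicator {-\<rho>..\<rho>} s = (indicator {\<rho>..3*\<rho>} (2 * \<rho> + 1 * s) :: real)" by (auto simp: indicator_def)
    ultimately show "ennreal (indicator {-\<rho>..\<rho>} s * indicator {-\<rho>..\<rho>} v * (cmod (Phi0 q chi (z_of N \<alpha> + Complex s v)))^2) = Q \<alpha> (2 * \<rho> + 1 * s) v"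
     unfolding Q_def by (simp only:)
   qed
   also have "\<dots> = (\<integral>\<^sup>+x. (\<integral>\<^sup>+v. Q \<alpha> x v \<partial>lborel) \<partial>lborel)"
   proof -
    have "case_prod (Q \<alpha>) \<in> borel_measurable (borel \<Otimes>\<^sub>M borel)" unfolding Q_def by measurable
    hence "(\<lambda>x. \<integral>\<^sup>+v. Q \<alpha> x v \<partial>lborel) \<in> borel_measurable borel" by measurable
    from nn_integral_real_affine[OF this, of 1 "2 * \<rho>"] show ?thesis by simp
   qed
   finally show ?thesis by (simp add: Phi0_def zof \<rho>(1))
  qed
  let ?I = "\<integral>\<^sup>+\<alpha>. ennreal (\<rho>^2 / 4 * (cmod (Phi q chi (z_of N \<alpha>)))^2) * indicator {-\<xi>..\<xi>} \<alpha> \<partial>lborel"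
  \<comment> \<open>Every square lies in the rectangle, so each local mean is at most
    \<open>R\<close>, and integration over \<alpha> contributes the length 2 \<xi>. This is the
    better bound for \<xi> \<le> \<rho>, when the squares overlap almost completely.\<close>
  have small: "?I \<le> ennreal (2 * \<xi> * R)"
  proof -
   have inner: "(\<integral>\<^sup>+x. \<integral>\<^sup>+v. Q \<alpha> x v \<partial>lborel \<partial>lborel) \<le> ennreal R" if \<alpha>: "\<alpha> \<in> {-\<xi>..\<xi>}" for \<alpha>
   proof -
    have "\<bar>2 * pi * \<alpha>\<bar> = 2 * pi * \<bar>\<alpha>\<bar>" by (simp add: abs_mult)
    also have "\<dots> \<le> 2 * pi * \<xi>" using \<alpha> by (intro mult_left_mono) auto
    finally have a: "\<bar>2 * pi * \<alpha>\<bar> \<le> 2 * pi * \<xi>" .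
    have "(\<integral>\<^sup>+v. Q \<alpha> x v \<partial>lborel) \<le> (\<integral>\<^sup>+y. F x y \<partial>lborel)" for x
    proof -
     have "(\<lambda>v. Q \<alpha> x v) \<in> borel_measurable borel" unfolding Q_def by measurable
     from nn_integral_real_affine[OF this, of 1 "2 * pi * \<alpha>"]
     have "(\<integral>\<^sup>+v. Q \<alpha> x v \<partial>lborel) = (\<integral>\<^sup>+y. Q \<alpha> x (2 * pi * \<alpha> + y) \<partial>lborel)" by simp
     also have "\<dots> \<le> (\<integral>\<^sup>+y. F x y \<partial>lborel)"
     proof (intro nn_integral_mono)
      fix y :: real
      have le: "indicator {-\<rho>..\<rho>} (2 * pi * \<alpha> + y) \<le> (indicator {-Y..Y} y :: real)"
       using a by (auto simp: indicator_def Y_def)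
      have e: "2 * pi * \<alpha> + y - 2 * pi * \<alpha> = y" by simp
      show "Q \<alpha> x (2 * pi * \<alpha> + y) \<le> F x y" unfolding Q_def F_def e
       by (rule ennreal_leI, rule mult_right_mono[OF mult_left_mono[OF le]]) auto
     qed
     finally show ?thesis .
    qed
    hence "(\<integral>\<^sup>+x. \<integral>\<^sup>+v. Q \<alpha> x v \<partial>lborel \<partial>lborel) \<le> (\<integral>\<^sup>+x. \<integral>\<^sup>+y. F x y \<partial>lborel \<partial>lborel)" by (rule nn_integral_mono)
    thus ?thesis using FI by (rule order_trans)
   qed
   have "?I \<le> (\<integral>\<^sup>+\<alpha>. ennreal R * indicator {-\<xi>..\<xi>} \<alpha> \<partial>lborel)"
   proof (intro nn_integral_mono)
    fix \<alpha> :: real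
    show "ennreal (\<rho>^2 / 4 * (cmod (Phi q chi (z_of N \<alpha>)))^2) * indicator {-\<xi>..\<xi>} \<alpha> \<le> ennreal R * indicator {-\<xi>..\<xi>} \<alpha>"
     by (cases "\<alpha> \<in> {-\<xi>..\<xi>}") (use order_trans[OF local inner] in simp_all)
   qed
   also have "\<dots> = ennreal R * emeasure lborel {-\<xi>..\<xi>}" by (rule nn_integral_cmult_indicator) simp
   also have "\<dots> = ennreal (2 * \<xi> * R)" using \<xi> R0 by (simp add: ennreal_mult'' mult.commute)
   finally show ?thesis .
  qed
  \<comment> \<open>After exchanging the integrals, a point of the rectangle is counted only for
    those \<alpha> whose square contains it, so the factor is 2 \<rho> instead of 2 \<xi>. The
    Jacobian 1 / (2 pi) of \<alpha> is estimated by 1.\<close>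
  have large: "?I \<le> ennreal (2 * \<rho> * R)"
  proof -
   define T where "T = (\<lambda>\<alpha> x v. ennreal (indicator {-\<xi>..\<xi>} \<alpha> * (indicator {\<rho>..3*\<rho>} x * indicator {-\<rho>..\<rho>} v * (cmod (Phi0 q chi (Complex x (v - 2 * pi * \<alpha>))))^2)))"
   have "?I \<le> (\<integral>\<^sup>+\<alpha>. \<integral>\<^sup>+x. \<integral>\<^sup>+v. T \<alpha> x v \<partial>lborel \<partial>lborel \<partial>lborel)"
   proof (intro nn_integral_mono)
    fix \<alpha> :: real
    show "ennreal (\<rho>^2 / 4 * (cmod (Phi q chi (z_of N \<alpha>)))^2) * indicator {-\<xi>..\<xi>} \<alpha> \<le> (\<integral>\<^sup>+x. \<integral>\<^sup>+v. T \<alpha> x v \<partial>lborel \<partial>lborel)"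
     by (cases "\<alpha> \<in> {-\<xi>..\<xi>}") (use local[of \<alpha>] in \<open>simp_all add: T_def Q_def\<close>)
   qed
   also have "\<dots> = (\<integral>\<^sup>+x. \<integral>\<^sup>+\<alpha>. \<integral>\<^sup>+v. T \<alpha> x v \<partial>lborel \<partial>lborel \<partial>lborel)"
    by (rule lborel_pair.Fubini'[symmetric]) (unfold T_def, measurable)
   also have "\<dots> = (\<integral>\<^sup>+x. \<integral>\<^sup>+v. \<integral>\<^sup>+\<alpha>. T \<alpha> x v \<partial>lborel \<partial>lborel \<partial>lborel)"
   proof (rule nn_integral_cong)
    fix x :: real
    show "(\<integral>\<^sup>+\<alpha>. \<integral>\<^sup>+v. T \<alpha> x v \<partial>lborel \<partial>lborel) = (\<integral>\<^sup>+v. \<integral>\<^sup>+\<alpha>. T \<alpha> x v \<partial>lborel \<partial>lborel)"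
     by (rule lborel_pair.Fubini'[symmetric]) (unfold T_def, measurable)
   qed
   also have "\<dots> \<le> (\<integral>\<^sup>+x. \<integral>\<^sup>+v. (\<integral>\<^sup>+y. F x y \<partial>lborel) * indicator {-\<rho>..\<rho>} v \<partial>lborel \<partial>lborel)"
   proof (intro nn_integral_mono)
    fix x v :: real
    show "(\<integral>\<^sup>+\<alpha>. T \<alpha> x v \<partial>lborel) \<le> (\<integral>\<^sup>+y. F x y \<partial>lborel) * indicator {-\<rho>..\<rho>} v"
    proof (cases "v \<in> {-\<rho>..\<rho>}")
     case False
     thus ?thesis by (simp add: T_def)
    next
     case True
     have "(\<integral>\<^sup>+\<alpha>. T \<alpha> x v \<partial>lborel) \<le> (\<integral>\<^sup>+\<alpha>. F x (v + - (2 * pi) * \<alpha>) \<partial>lborel)"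
     proof (intro nn_integral_mono)
      fix \<alpha> :: real
      show "T \<alpha> x v \<le> F x (v + - (2 * pi) * \<alpha>)"
      proof (cases "\<alpha> \<in> {-\<xi>..\<xi>}")
       case \<alpha>: True
       have "\<bar>2 * pi * \<alpha>\<bar> = 2 * pi * \<bar>\<alpha>\<bar>" by (simp add: abs_mult)
       also have "\<dots> \<le> 2 * pi * \<xi>" using \<alpha> by (intro mult_left_mono) auto
       finally have "v - 2 * pi * \<alpha> \<in> {-Y..Y}" using True unfolding Y_def atLeastAtMost_iff by linarith
       thus ?thesis using True \<alpha> by (simp add: T_def F_def)
      qed (simp add: T_def)
     qed
     also have "\<dots> = 1 * \<dots>" by simp
     also have "\<dots> \<le> ennreal \<bar>- (2 * pi)\<bar> * (\<integral>\<^sup>+\<alpha>. F x (v + - (2 * pi) * \<alpha>) \<partial>lborel)"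
      using pi_gt3 by (intro mult_right_mono) (auto simp flip: ennreal_1 intro!: ennreal_leI)
     also have "\<dots> = (\<integral>\<^sup>+y. F x y \<partial>lborel)"
     proof (rule nn_integral_real_affine[symmetric])
      show "F x \<in> borel_measurable borel" unfolding F_def by measurable
     qed simp
     finally show ?thesis using True by simp
    qed
   qed
   also have "\<dots> = (\<integral>\<^sup>+x. (\<integral>\<^sup>+y. F x y \<partial>lborel) * ennreal (2 * \<rho>) \<partial>lborel)"
    using \<rho>(1) by (simp add: nn_integral_cmult_indicator)
   also have "\<dots> = (\<integral>\<^sup>+x. (\<integral>\<^sup>+y. F x y \<partial>lborel) \<partial>lborel) * ennreal (2 * \<rho>)"
    by (rule nn_integral_multc) measurable
   also have "\<dots> \<le> ennreal R * ennreal (2 * \<rho>)" by (intro mult_right_mono FI) simp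
   also have "\<dots> = ennreal (2 * \<rho> * R)" using \<rho>(1) R0 by (simp add: ennreal_mult'' mult.commute)
   finally show ?thesis .
  qed
  define f where "f = (\<lambda>\<alpha>. (cmod (Phi q chi (z_of N \<alpha>)))^2)"
  have "continuous_on {-\<xi>..\<xi>} (\<lambda>\<alpha>. Phi q chi (z_of N \<alpha>))"
   unfolding zof by (rule continuous_on_compose2[OF holomorphic_on_imp_continuous_on[OF Phi_holomorphic[OF chi]]])
    (use \<rho>(1) in \<open>auto simp: Complex_eq intro!: continuous_intros\<close>)
  hence fc: "continuous_on {-\<xi>..\<xi>} f" unfolding f_def by (intro continuous_intros)
  have "?I = ennreal (\<rho>^2 / 4 * integral {-\<xi>..\<xi>} f)"
  proof (rule nn_integral_has_integral_lebesgue')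
   show "((\<lambda>\<alpha>. \<rho>^2 / 4 * (cmod (Phi q chi (z_of N \<alpha>)))^2) has_integral \<rho>^2 / 4 * integral {-\<xi>..\<xi>} f) {-\<xi>..\<xi>}"
    unfolding f_def[symmetric] using fc
    by (intro has_integral_mult_right) (auto simp: f_def intro!: integrable_integral integrable_continuous_interval)
  qed auto
  hence b: "\<rho>^2 / 4 * integral {-\<xi>..\<xi>} f \<le> 2 * \<xi> * R" "\<rho>^2 / 4 * integral {-\<xi>..\<xi>} f \<le> 2 * \<rho> * R"
   using small large \<xi> \<rho>(1) R0 by (simp_all add: ennreal_le_iff)
  \<comment> \<open>\<open>Y\<close> \<le> 8 \<xi> + \<rho> is at most 9 times the larger of \<xi>
    and \<rho>, and the better of the two bounds has the smaller one as a factor; the product is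
    \<rho> \<xi>. Here 450 = 2 * 25 * 9, and \<open>D\<close> collects 4 * 450 * 2 from 4 / \<rho>^2
    and 1 / \<rho> = 2 N.\<close>
  have "\<rho>^2 / 4 * integral {-\<xi>..\<xi>} f \<le> 450 * C * M^2 * (\<rho> * \<xi>)"
  proof (cases "\<xi> \<le> \<rho>")
   case True
   have "2 * \<xi> * R = 50 * C * M^2 * \<xi> * Y" by (simp add: R_def power_mult_distrib)
   also have "\<dots> \<le> 50 * C * M^2 * \<xi> * (9 * \<rho>)" using C \<xi> Y True by (intro mult_left_mono) auto
   finally show ?thesis using b(1) by (simp add: mult_ac)
  next
   case False
   have "2 * \<rho> * R = 50 * C * M^2 * \<rho> * Y" by (simp add: R_def power_mult_distrib)
   also have "\<dots> \<le> 50 * C * M^2 * \<rho> * (9 * \<xi>)" using C \<rho>(1) Y False by (intro mult_left_mono) auto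
   finally show ?thesis using b(2) by (simp add: mult_ac)
  qed
  hence "(4 / \<rho>^2) * (\<rho>^2 / 4 * integral {-\<xi>..\<xi>} f) \<le> (4 / \<rho>^2) * (450 * C * M^2 * (\<rho> * \<xi>))" by (rule mult_left_mono) simp
  hence "integral {-\<xi>..\<xi>} f \<le> (4 / \<rho>^2) * (450 * C * M^2 * (\<rho> * \<xi>))" using \<rho>(1) by simp
  also have "\<dots> = D * N * \<xi> * M^2" using N by (simp add: D_def \<rho>_def power2_eq_square field_simps)
  finally show ?thesis unfolding S_tilde_eq f_def M_def .
 qed
 moreover have "D > 0" using C by (simp add: D_def)
 ultimately show ?thesis by blast
qed

end
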